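(* (Sewing Lemma) Let $T\in(0,\infty)$, $m\in\mathbb N$, $\varXi\in L^{0;2}([0,T];\mathbb R^m)$. Let $\alpha\in(0,1)$, $\gamma\in(1,\infty)$, $\beta_1,\beta_2\in(0,\infty)$, $q_1,q_2\in(0,\infty]$ be such that $$\varXi\in B^{\alpha;2}_{\Phi_{\beta_1},q_1}([0,T];\mathbb R^m)\quad\text{and}\quad\delta\varXi\in B^{\gamma;3}_{\Phi_{\beta_2},q_2}([0,T];\mathbb R^m).$$ Then there exists $\mathscr I=\mathscr I(\varXi)\in L^0([0,T];\mathbb R^m)$ such that the map $\varXi\mapsto\mathscr I(\varXi)$ is linear, $$\lim_{N\to\infty}\|\delta\mathscr I-I^{\pi_N}\varXi\|_{B^{\gamma;2}_{\Phi_{\beta_2},r}}=0$$ for an arbitrary sequence $\{\pi_N\}_{N\ge1}$ of partitions of $[0,1]$ with vanishing norms and any $r$ with $r\ge q_2$ and $r>\frac1\gamma$, and $$\|\delta\mathscr I-\varXi\|_{B^{\gamma;2}_{\Phi_{\beta_2},q_2}}\le C\,\|\delta\varXi\|_{B^{\gamma;3}_{\Phi_{\beta_2},q_2}}\qquad(1)$$ with $C$ depending only on $\gamma,q_2$. Moreover, if there exist $\rho\in(0,\frac12]$ and $M\in(0,\infty)$ such that $$|\delta\varXi_{s,u,t}|\le M\Big(((u-s)\wedge(t-u))^{\rho}((u-s)\vee(t-u))^{1-\rho}\Big)^{\gamma-\frac1p}\qquad(2)$$ holds for any $(s,u,t)\in\triangle^3[0,T]$ and some $p\in(\frac1\gamma,\infty)$,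 then $\mathscr I$ is continuous on $[0,T]$, the bound $$[\mathscr I]_{B^{\alpha}_{\Phi_{\beta_1\wedge\beta_2},q_1\vee q_2}}\le C\big(\|\varXi\|_{B^{\alpha;2}_{\Phi_{\beta_1},q_1}}+\|\delta\varXi\|_{B^{\gamma;3}_{\Phi_{\beta_2},q_2}}+M\big)$$ holds with $C$ depending only on $\alpha,\gamma,\beta_1,\beta_2,p,q_1,q_2,T$, and $\mathscr I$ is uniquely determined by prescribing $\mathscr I_0=\Theta$ for some $\Theta\in\mathbb R^m$. If, in addition, $\beta_2<\beta_1$, then, for any $p\in(\frac1\alpha\vee\frac1{\gamma-\alpha},\infty)$, we have $$\|\delta\mathscr I-\varXi\|_{C^{\gamma-1/p;2}}\le C\big(\|\delta\varXi\|_{B^{\gamma;3}_{\Phi_{\beta_2},q_2}}+M\big)$$ with $C$ depending only on $\gamma,p,q_2,\rho$ and $T$, and $$[\mathscr I]_{B^\alpha_{\Phi_{\beta_1},q_1\vee q_2}}\le C\Big(\|\varXi\|_{B^{\alpha;2}_{\Phi_{\beta_1},q_1}}+T^{\gamma-\frac1p-\alpha+\frac{\beta_2}{p\beta_1}}\big(\|\delta\varXi\|_{B^{\gamma;3}_{\Phi_{\beta_2},q_2}}+M\big)+T^{-\frac1p}M\Big)$$ with $C$ depending only on $\alpha,\gamma,\beta_1,\beta_2,p,q_1,q_2,\rho$ and $T$; in both of these last two bounds $C$ is nondecreasing in $T$.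
   Context: **Orlicz norm.** For $\beta\in(0,\infty)$ put $x_\beta=((1-\beta)/\beta)^{1/\beta}$ if $\beta<1$, $x_\beta=0$ if $\beta\ge1$; $\Psi_\beta(x)=e^{x^\beta}-1$; $E_\beta(x)=\Psi_\beta(x)$ for $x\ge x_\beta$, $E_\beta(x)=\Psi_\beta(x_\beta)+\Psi_\beta'(x_\beta)(x-x_\beta)$ for $0\le x<x_\beta$; $\Phi_\beta(x)=E_\beta(x)-E_\beta(0)$. For a bounded interval $D$ and measurable $g$ on $D$ with values in a normed space, $\|g\|_{L^{\Phi_\beta}(D)}=\inf\{\lambda>0:\int_D\Phi_\beta(|g_r|/\lambda)\,\mathrm dr\le1\}$. **Notation.** $\triangle^d[0,T]=\{(u_1,\dots,u_d)\in[0,T]^d:u_1\le\dots\le u_d\}$, $d\in\{2,3\}$. For $f$ on $[0,T]$: $\delta f_{s,t}=f_t-f_s$. For $\varXi$ on $\triangle^2[0,T]$: $\delta\varXi_{s,u,t}=\varXi_{s,t}-\varXi_{s,u}-\varXi_{u,t}$. $L^0([0,T];\mathbb R^m)$ is the space of a.e.-classes of measurable functions. $L^{0;d}([0,T];\mathbb R^m)$ is the space of measurable maps $\triangle^d[0,T]\to\mathbb R^m$, where for $d=2$ two maps are identified if for all $h\in[0,T]$ they agree at $(r,r+h)$ for a.a. $r\in[0,T-h]$, and for $d=3$ if for all $h\in[0,T]$, $\theta\in[0,1]$ they agree at $(r,r+\theta h,r+h)$ for a.a. $r\in[0,T-h]$. **Spaces.** For $\varXi\in L^{0;d}$ let $\omega^2_{\Phi_\beta}(\varXi,\tau)=\sup_{h\in[0,\tau]}\|\varXi_{\cdot,\cdot+h}\|_{L^{\Phi_\beta}([0,T-h])}$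 for $d=2$ and $\omega^3_{\Phi_\beta}(\varXi,\tau)=\sup_{\theta\in[0,1]}\sup_{h\in[0,\tau]}\|\varXi_{\cdot,\cdot+\theta h,\cdot+h}\|_{L^{\Phi_\beta}([0,T-h])}$ for $d=3$. For $\alpha\in(0,\infty)$, $q\in(0,\infty]$: $\|\varXi\|_{B^{\alpha;d}_{\Phi_\beta,q}}=\|\tau^{-\alpha}\omega^d_{\Phi_\beta}(\varXi,\tau)\|_{L^q([0,T],\mathrm d\tau/\tau)}$, and $B^{\alpha;d}_{\Phi_\beta,q}([0,T];\mathbb R^m)$ is the set of $\varXi\in L^{0;d}$ where this is finite. For $f$ on $[0,T]$ and $\alpha\in(0,1)$: $[f]_{B^\alpha_{\Phi_\beta,q}}=\|\delta f\|_{B^{\alpha;2}_{\Phi_\beta,q}}$. $\|\varXi\|_{C^{\kappa;2}}=\sup_{0<h\le T,\,0\le r\le T-h}|\varXi_{r,r+h}|h^{-\kappa}$ (evaluated on continuous versions). **Partitions.** A partition of $[0,1]$ is $\pi=\{t_i\}_{i=0}^N$ with $0=t_0<t_1<\dots<t_N=1$; its norm is $\max_i(t_{i+1}-t_i)$; a sequence has vanishing norms if the norms tend to $0$. $(I^\pi\varXi)_{s,t}=\sum_{i=0}^{N-1}\varXi_{s+t_i(t-s),\,s+t_{i+1}(t-s)}$.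
   Formalization: In the bound of δI−Ξ in C^{γ−1/p;2} the constant C may also depend on β_2 (independence of β_2 is false), and in the last two bounds p is the same p as in (2), restricted to p>1/α∨1/(γ−α); with an unrelated p the bounds fail. *)

theory Defs
  imports "HOL-Analysis.Analysis" "HOL-Probability.Essential_Supremum"
begin

text \<open>
  The dimension \<open>m\<close> has to be an ordinary variable, because the constants in the theorem do not
  depend on it. A vector of \<open>\<real>\<^sup>m\<close> is therefore a function \<open>nat \<Rightarrow> real\<close> of which only the
  coordinates below \<open>m\<close> are ever inspected.
\<close>

definition vec_norm :: "nat \<Rightarrow> (nat \<Rightarrow> real) \<Rightarrow> real" where
  "vec_norm m x = L2_set x {..<m}"

definition vec_eq :: "nat \<Rightarrow> (nat \<Rightarrow> real) \<Rightarrow> (nat \<Rightarrow> real) \<Rightarrow> bool" where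
  "vec_eq m x y \<longleftrightarrow> (\<forall>i<m. x i = y i)"

definition vec_continuous_on :: "nat \<Rightarrow> 'a::topological_space set \<Rightarrow> ('a \<Rightarrow> nat \<Rightarrow> real) \<Rightarrow> bool" where
  "vec_continuous_on m S f \<longleftrightarrow> (\<forall>i<m. continuous_on S (\<lambda>x. f x i))"

definition vec_measurable_on :: "nat \<Rightarrow> 'a::topological_space set \<Rightarrow> ('a \<Rightarrow> nat \<Rightarrow> real) \<Rightarrow> bool" where
  "vec_measurable_on m S f \<longleftrightarrow> (\<forall>i<m. (\<lambda>x. f x i) \<in> borel_measurable (restrict_space borel S))"


section \<open>Orlicz norms\<close>

definition orlicz_threshold :: "real \<Rightarrow> real" where
  "orlicz_threshold \<beta> = (if \<beta> < 1 then ((1 - \<beta>) / \<beta>) powr (1 / \<beta>) else 0)"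

definition orlicz_Psi :: "real \<Rightarrow> real \<Rightarrow> real" where
  "orlicz_Psi \<beta> x = exp (x powr \<beta>) - 1"

definition orlicz_E :: "real \<Rightarrow> real \<Rightarrow> real" where
  "orlicz_E \<beta> x =
     (if orlicz_threshold \<beta> \<le> x then orlicz_Psi \<beta> x
      else orlicz_Psi \<beta> (orlicz_threshold \<beta>)
           + deriv (orlicz_Psi \<beta>) (orlicz_threshold \<beta>) * (x - orlicz_threshold \<beta>))"

definition orlicz_Phi :: "real \<Rightarrow> real \<Rightarrow> real" where
  "orlicz_Phi \<beta> x = orlicz_E \<beta> x - orlicz_E \<beta> 0"

text \<open>
  The Luxemburg norm takes the pointwise modulus \<open>g \<ge> 0\<close> of the function as its argument. It is
  \<open>\<infinity>\<close> if no \<open>l\<close> is admissible.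
\<close>

definition orlicz_norm :: "real \<Rightarrow> real set \<Rightarrow> (real \<Rightarrow> real) \<Rightarrow> ennreal" where
  "orlicz_norm \<beta> D g =
     Inf {ennreal l | l. 0 < l \<and> (\<integral>\<^sup>+r\<in>D. ennreal (orlicz_Phi \<beta> (g r / l)) \<partial>lborel) \<le> 1}"


section \<open>Functions of one, two and three time variables\<close>

definition delta1 :: "(real \<Rightarrow> nat \<Rightarrow> real) \<Rightarrow> real \<Rightarrow> real \<Rightarrow> nat \<Rightarrow> real" where
  "delta1 f s t = (\<lambda>i. f t i - f s i)"

definition delta2 :: "(real \<Rightarrow> real \<Rightarrow> nat \<Rightarrow> real) \<Rightarrow> real \<Rightarrow> real \<Rightarrow> real \<Rightarrow> nat \<Rightarrow> real" where
  "delta2 X s u t = (\<lambda>i. X s t i - X s u i - X u t i)"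

definition sub2 ::
    "(real \<Rightarrow> real \<Rightarrow> nat \<Rightarrow> real) \<Rightarrow> (real \<Rightarrow> real \<Rightarrow> nat \<Rightarrow> real) \<Rightarrow> real \<Rightarrow> real \<Rightarrow> nat \<Rightarrow> real" where
  "sub2 X Y s t = (\<lambda>i. X s t i - Y s t i)"

definition lincomb1 ::
    "real \<Rightarrow> (real \<Rightarrow> nat \<Rightarrow> real) \<Rightarrow> real \<Rightarrow> (real \<Rightarrow> nat \<Rightarrow> real) \<Rightarrow> real \<Rightarrow> nat \<Rightarrow> real" where
  "lincomb1 a f b g t = (\<lambda>i. a * f t i + b * g t i)"

definition lincomb2 ::
    "real \<Rightarrow> (real \<Rightarrow> real \<Rightarrow> nat \<Rightarrow> real) \<Rightarrow> real \<Rightarrow> (real \<Rightarrow> real \<Rightarrow> nat \<Rightarrow> real)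
      \<Rightarrow> real \<Rightarrow> real \<Rightarrow> nat \<Rightarrow> real" where
  "lincomb2 a X b Y s t = (\<lambda>i. a * X s t i + b * Y s t i)"

definition triangle2 :: "real \<Rightarrow> (real \<times> real) set" where
  "triangle2 T = {(s, t). 0 \<le> s \<and> s \<le> t \<and> t \<le> T}"

definition triangle3 :: "real \<Rightarrow> (real \<times> real \<times> real) set" where
  "triangle3 T = {(s, u, t). 0 \<le> s \<and> s \<le> u \<and> u \<le> t \<and> t \<le> T}"

text \<open>
  The spaces of classes \<open>L\<^sup>0\<close>, \<open>L\<^sup>0\<^sup>;\<^sup>2\<close>, \<open>L\<^sup>0\<^sup>;\<^sup>3\<close> are represented by their sets of
  representatives, together with the relations that identify representatives. Measurability is
  Borel measurability, so that the restrictions to the lines \<open>(r, r + h)\<close> and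
  \<open>(r, r + \<theta>h, r + h)\<close> are measurable.
\<close>

definition L0_1 :: "real \<Rightarrow> nat \<Rightarrow> (real \<Rightarrow> nat \<Rightarrow> real) set" where
  "L0_1 T m = {f. vec_measurable_on m {0..T} f}"

definition L0_2 :: "real \<Rightarrow> nat \<Rightarrow> (real \<Rightarrow> real \<Rightarrow> nat \<Rightarrow> real) set" where
  "L0_2 T m = {X. vec_measurable_on m (triangle2 T) (\<lambda>(s, t). X s t)}"

definition L0_3 :: "real \<Rightarrow> nat \<Rightarrow> (real \<Rightarrow> real \<Rightarrow> real \<Rightarrow> nat \<Rightarrow> real) set" where
  "L0_3 T m = {X. vec_measurable_on m (triangle3 T) (\<lambda>(s, u, t). X s u t)}"

definition L0_1_eq :: "real \<Rightarrow> nat \<Rightarrow> (real \<Rightarrow> nat \<Rightarrow> real) \<Rightarrow> (real \<Rightarrow> nat \<Rightarrow> real) \<Rightarrow> bool" where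
  "L0_1_eq T m f g \<longleftrightarrow> (AE t in lborel. t \<in> {0..T} \<longrightarrow> vec_eq m (f t) (g t))"

definition L0_2_eq ::
    "real \<Rightarrow> nat \<Rightarrow> (real \<Rightarrow> real \<Rightarrow> nat \<Rightarrow> real) \<Rightarrow> (real \<Rightarrow> real \<Rightarrow> nat \<Rightarrow> real) \<Rightarrow> bool" where
  "L0_2_eq T m X Y \<longleftrightarrow>
     (\<forall>h\<in>{0..T}. AE r in lborel. r \<in> {0..T - h} \<longrightarrow> vec_eq m (X r (r + h)) (Y r (r + h)))"


section \<open>Besov-Orlicz spaces\<close>

definition modulus2 ::
    "real \<Rightarrow> nat \<Rightarrow> real \<Rightarrow> (real \<Rightarrow> real \<Rightarrow> nat \<Rightarrow> real) \<Rightarrow> real \<Rightarrow> ennreal" where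
  "modulus2 T m \<beta> X \<tau> =
     (SUP h\<in>{0..\<tau>}. orlicz_norm \<beta> {0..T - h} (\<lambda>r. vec_norm m (X r (r + h))))"

definition modulus3 ::
    "real \<Rightarrow> nat \<Rightarrow> real \<Rightarrow> (real \<Rightarrow> real \<Rightarrow> real \<Rightarrow> nat \<Rightarrow> real) \<Rightarrow> real \<Rightarrow> ennreal" where
  "modulus3 T m \<beta> X \<tau> =
     (SUP \<theta>\<in>{0..1}. SUP h\<in>{0..\<tau>}.
        orlicz_norm \<beta> {0..T - h} (\<lambda>r. vec_norm m (X r (r + \<theta> * h) (r + h))))"

text \<open>Powers \<open>x\<^sup>a\<close> in \<open>[0,\<infinity>]\<close>; used for \<open>a > 0\<close> only.\<close>

definition ennreal_powr :: "ennreal \<Rightarrow> real \<Rightarrow> ennreal" where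
  "ennreal_powr x a = (if x = \<infinity> then \<infinity> else ennreal (enn2real x powr a))"

text \<open>The (quasi-)norm of \<open>L\<^sup>q([0,T], d\<tau>/\<tau>)\<close> for \<open>q \<in> (0,\<infinity>]\<close>.\<close>

definition log_measure :: "real \<Rightarrow> real measure" where
  "log_measure T = density (restrict_space lborel {0..T}) (\<lambda>\<tau>. ennreal (1 / \<tau>))"

definition Lq_log_norm :: "real \<Rightarrow> ennreal \<Rightarrow> (real \<Rightarrow> ennreal) \<Rightarrow> ennreal" where
  "Lq_log_norm T q F =
     (if q = \<infinity> then esssup (log_measure T) F
      else ennreal_powr (\<integral>\<^sup>+\<tau>. ennreal_powr (F \<tau>) (enn2real q) \<partial>log_measure T) (1 / enn2real q))"

definition besov2_norm ::
    "real \<Rightarrow> nat \<Rightarrow> real \<Rightarrow> real \<Rightarrow> ennreal \<Rightarrow> (real \<Rightarrow> real \<Rightarrow> nat \<Rightarrow> real) \<Rightarrow> ennreal" where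
  "besov2_norm T m \<alpha> \<beta> q X =
     Lq_log_norm T q (\<lambda>\<tau>. ennreal (\<tau> powr (- \<alpha>)) * modulus2 T m \<beta> X \<tau>)"

definition besov3_norm ::
    "real \<Rightarrow> nat \<Rightarrow> real \<Rightarrow> real \<Rightarrow> ennreal \<Rightarrow> (real \<Rightarrow> real \<Rightarrow> real \<Rightarrow> nat \<Rightarrow> real) \<Rightarrow> ennreal" where
  "besov3_norm T m \<alpha> \<beta> q X =
     Lq_log_norm T q (\<lambda>\<tau>. ennreal (\<tau> powr (- \<alpha>)) * modulus3 T m \<beta> X \<tau>)"

definition besov2 ::
    "real \<Rightarrow> nat \<Rightarrow> real \<Rightarrow> real \<Rightarrow> ennreal \<Rightarrow> (real \<Rightarrow> real \<Rightarrow> nat \<Rightarrow> real) set" where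
  "besov2 T m \<alpha> \<beta> q = {X \<in> L0_2 T m. besov2_norm T m \<alpha> \<beta> q X < \<infinity>}"

definition besov3 ::
    "real \<Rightarrow> nat \<Rightarrow> real \<Rightarrow> real \<Rightarrow> ennreal \<Rightarrow> (real \<Rightarrow> real \<Rightarrow> real \<Rightarrow> nat \<Rightarrow> real) set" where
  "besov3 T m \<alpha> \<beta> q = {X \<in> L0_3 T m. besov3_norm T m \<alpha> \<beta> q X < \<infinity>}"

definition besov_seminorm ::
    "real \<Rightarrow> nat \<Rightarrow> real \<Rightarrow> real \<Rightarrow> ennreal \<Rightarrow> (real \<Rightarrow> nat \<Rightarrow> real) \<Rightarrow> ennreal" where
  "besov_seminorm T m \<alpha> \<beta> q f = besov2_norm T m \<alpha> \<beta> q (delta1 f)"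

definition hoelder2_norm ::
    "real \<Rightarrow> nat \<Rightarrow> real \<Rightarrow> (real \<Rightarrow> real \<Rightarrow> nat \<Rightarrow> real) \<Rightarrow> ennreal" where
  "hoelder2_norm T m \<kappa> X =
     (SUP h\<in>{0<..T}. SUP r\<in>{0..T - h}. ennreal (vec_norm m (X r (r + h)) * h powr (- \<kappa>)))"


section \<open>Partitions and Riemann sums\<close>

text \<open>A partition of \<open>[0,1]\<close> is given by the number \<open>K\<close> of its intervals and its points
  \<open>p 0 < \<dots> < p K\<close>.\<close>

definition unit_partition :: "nat \<Rightarrow> (nat \<Rightarrow> real) \<Rightarrow> bool" where
  "unit_partition K p \<longleftrightarrow> 0 < K \<and> p 0 = 0 \<and> p K = 1 \<and> (\<forall>i<K. p i < p (Suc i))"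

definition partition_mesh :: "nat \<Rightarrow> (nat \<Rightarrow> real) \<Rightarrow> real" where
  "partition_mesh K p = Max ((\<lambda>i. p (Suc i) - p i) ` {..<K})"

definition riemann_sum ::
    "nat \<Rightarrow> (nat \<Rightarrow> real) \<Rightarrow> (real \<Rightarrow> real \<Rightarrow> nat \<Rightarrow> real) \<Rightarrow> real \<Rightarrow> real \<Rightarrow> nat \<Rightarrow> real" where
  "riemann_sum K p X s t =
     (\<lambda>j. \<Sum>i<K. X (s + p i * (t - s)) (s + p (Suc i) * (t - s)) j)"


section \<open>Sewing\<close>

definition sewing_domain ::
    "real \<Rightarrow> nat \<Rightarrow> real \<Rightarrow> real \<Rightarrow> real \<Rightarrow> real \<Rightarrow> ennreal \<Rightarrow> ennreal
      \<Rightarrow> (real \<Rightarrow> real \<Rightarrow> nat \<Rightarrow> real) set" where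
  "sewing_domain T m \<alpha> \<gamma> \<beta>1 \<beta>2 q1 q2 =
     {X \<in> besov2 T m \<alpha> \<beta>1 q1. delta2 X \<in> besov3 T m \<gamma> \<beta>2 q2}"

text \<open>A linear map from the classes of \<open>V \<subseteq> L\<^sup>0\<^sup>;\<^sup>2\<close> to the classes of \<open>L\<^sup>0\<close>, acting on
  representatives.\<close>

definition linear_on_classes ::
    "real \<Rightarrow> nat \<Rightarrow> (real \<Rightarrow> real \<Rightarrow> nat \<Rightarrow> real) set
      \<Rightarrow> ((real \<Rightarrow> real \<Rightarrow> nat \<Rightarrow> real) \<Rightarrow> real \<Rightarrow> nat \<Rightarrow> real) \<Rightarrow> bool" where
  "linear_on_classes T m V J \<longleftrightarrow>
     (\<forall>X\<in>V. J X \<in> L0_1 T m) \<and>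
     (\<forall>X\<in>V. \<forall>Y\<in>V. L0_2_eq T m X Y \<longrightarrow> L0_1_eq T m (J X) (J Y)) \<and>
     (\<forall>X\<in>V. \<forall>Y\<in>V. \<forall>a b. L0_1_eq T m (J (lincomb2 a X b Y)) (lincomb1 a (J X) b (J Y)))"

definition sewing_limit ::
    "real \<Rightarrow> nat \<Rightarrow> real \<Rightarrow> real \<Rightarrow> ennreal \<Rightarrow> (real \<Rightarrow> real \<Rightarrow> nat \<Rightarrow> real)
      \<Rightarrow> (real \<Rightarrow> nat \<Rightarrow> real) \<Rightarrow> bool" where
  "sewing_limit T m \<gamma> \<beta> q X I \<longleftrightarrow>
     (\<forall>K p r. (\<forall>N. unit_partition (K N) (p N)) \<longrightarrow>
        (\<lambda>N. partition_mesh (K N) (p N)) \<longlonglongrightarrow> 0 \<longrightarrow>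
        q \<le> r \<longrightarrow> ennreal (1 / \<gamma>) < r \<longrightarrow>
        (\<lambda>N. besov2_norm T m \<gamma> \<beta> r (sub2 (delta1 I) (riemann_sum (K N) (p N) X))) \<longlonglongrightarrow> 0)"

text \<open>The pointwise bound on \<open>\<delta>\<Xi>\<close> with exponent \<open>\<kappa>\<close>.\<close>

definition pointwise_bound ::
    "real \<Rightarrow> nat \<Rightarrow> real \<Rightarrow> real \<Rightarrow> real \<Rightarrow> (real \<Rightarrow> real \<Rightarrow> nat \<Rightarrow> real) \<Rightarrow> bool" where
  "pointwise_bound T m \<rho> M \<kappa> X \<longleftrightarrow>
     (\<forall>s u t. (s, u, t) \<in> triangle3 T \<longrightarrow>
        vec_norm m (delta2 X s u t)
          \<le> M * (min (u - s) (t - u) powr \<rho> * max (u - s) (t - u) powr (1 - \<rho>)) powr \<kappa>)"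

end

theory Submission
  imports Defs "HOL-Library.Function_Algebras"
begin

text \<open>
  Along dyadic partitions the Riemann sums of \<open>X\<close> form a Cauchy sequence in every Luxemburg norm
  over a line \<open>(r, r + h)\<close>: halving all intervals changes the sum by at most
  \<open>2 ^ n * \<omega> (h / 2 ^ n)\<close>, where \<open>\<omega>\<close> is the modulus of \<open>\<delta> X\<close>, and this is summable because
  \<open>\<gamma> > 1\<close>. Comparing finite partitions by common refinement shows that the limit is additive almost
  everywhere, hence the increment of a path, and that its distance from \<open>X\<close> is at most
  \<open>S h = (\<Sum>n. 2 ^ n * \<omega> (h / 2 ^ n))\<close>. Hardy's inequality bounds \<open>S\<close> by \<open>\<omega>\<close> in the weighted
  \<open>L\<^sup>q\<close> norm. For a partition \<open>p\<close> of mesh \<open>\<epsilon>\<close> the error is bounded by the sum of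
  \<open>S ((p (Suc i) - p i) * h)\<close>, whose norm carries a positive power of \<open>\<epsilon>\<close>.

  For the pointwise statements, the exponential integrability turns the Luxemburg bounds into bounds
  of averages over short windows at the cost of \<open>1 / p\<close> in the exponent. An almost subadditive
  function of pairs with small averages is Hoelder at all Lebesgue-type points, by telescoping over
  dyadic scales, and extends continuously from there. The last bound interpolates the
  \<open>\<Phi>\<^sub>\<beta>\<^sub>2\<close> bound of the remainder with its supremum.
\<close>

subsection \<open>The Young functions\<close>

text \<open>The obstacle that shapes the estimates is the right end of the scale axis. A weighted
  norm with \<open>q < \<infinity>\<close> controls a monotone modulus pointwise only at scales
  \<open>\<tau>\<close> for which a fixed enlargement still lies below \<open>T\<close>; the
  enlargement \<open>4 / 3 * \<tau>\<close> gives the bound \<open>3 * T / 4\<close> that recurs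
  throughout. Larger increments are reached by halving them or by splitting at an intermediate
  point. A second obstacle is that identities hold along each line \<open>(r, r + h)\<close> only
  outside a null set that depends on \<open>h\<close>; a shear followed by Fubini turns them into
  statements about almost every pair of times, which the construction of the path requires. Finally,
  the constants have to be functions of the parameters alone and not of the data. Therefore
  existential constants are obtained before the set and the function are fixed, and are later
  selected by choice.\<close>

lemma orlicz_threshold_nonneg: "0 \<le> orlicz_threshold \<beta>"
  by (simp add: orlicz_threshold_def)

text \<open>For \<open>\<beta> < 1\<close> the threshold is the inflection point of
  \<open>orlicz_Psi\<close>: at \<open>x > 0\<close> the second derivative has the sign of
  \<open>\<beta> * x powr \<beta> - (1 - \<beta>)\<close>. For \<open>\<beta> \<ge> 1\<close> this
  is nonnegative everywhere.\<close>

lemma orlicz_threshold_powr: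
  assumes "0 < \<beta>" "orlicz_threshold \<beta> \<le> x" "0 < x"
  shows "1 - \<beta> \<le> \<beta> * x powr \<beta>"
proof (cases "\<beta> < 1")
  case True
  have "(1 - \<beta>) / \<beta> = (((1 - \<beta>) / \<beta>) powr (1 / \<beta>)) powr \<beta>"
    using True assms by (simp add: powr_powr)
  also have "\<dots> \<le> x powr \<beta>"
    using True assms by (intro powr_mono2) (auto simp: orlicz_threshold_def)
  finally show ?thesis
    using assms by (simp add: field_simps)
next
  case False
  then show ?thesis
    using assms mult_nonneg_nonneg[of \<beta> "x powr \<beta>"] powr_ge_zero[of x \<beta>] by linarith
qed

definition orlicz_dPsi :: "real \<Rightarrow> real \<Rightarrow> real" where
  "orlicz_dPsi \<beta> x = exp (x powr \<beta>) * (\<beta> * x powr (\<beta> - 1))"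

lemma orlicz_Psi_deriv:
  assumes "0 < x"
  shows "(orlicz_Psi \<beta> has_real_derivative orlicz_dPsi \<beta> x) (at x)"
  unfolding orlicz_Psi_def orlicz_dPsi_def
  using assms by (auto intro!: derivative_eq_intros)

lemma orlicz_dPsi_nonneg: "0 < \<beta> \<Longrightarrow> 0 \<le> orlicz_dPsi \<beta> x"
  by (simp add: orlicz_dPsi_def)

lemma orlicz_dPsi_mono:
  assumes "0 < \<beta>" "orlicz_threshold \<beta> \<le> x" "0 < x" "x \<le> y"
  shows "orlicz_dPsi \<beta> x \<le> orlicz_dPsi \<beta> y"
proof -
  have "\<exists>D. (orlicz_dPsi \<beta> has_real_derivative D) (at z) \<and> 0 \<le> D" if "x \<le> z" for z
  proof -
    have z: "0 < z" "orlicz_threshold \<beta> \<le> z"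
      using that assms by auto
    have "((\<lambda>x. exp (x powr \<beta>) * (\<beta> * x powr (\<beta> - 1))) has_real_derivative
        exp (z powr \<beta>) * \<beta> * z powr (\<beta> - 2) * (\<beta> * z powr \<beta> - (1 - \<beta>))) (at z)"
    proof -
      \<comment> \<open>Expressing every power through \<open>z powr (\<beta> - 2)\<close> turns the
        derivative into a nonnegative factor times the expression whose sign the threshold
        controls.\<close>
      have "z powr (\<beta> - 1) = z powr (\<beta> - 2) * z" "z powr \<beta> = z powr (\<beta> - 2) * z * z"
        using z by (simp_all add: powr_diff power2_eq_square)
      then show ?thesis
        using z by (auto intro!: derivative_eq_intros simp: field_simps)
    qed
    moreover have "0 \<le> exp (z powr \<beta>) * \<beta> * z powr (\<beta> - 2) * (\<beta> * z powr \<beta> - (1 - \<beta>))"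
      using orlicz_threshold_powr[OF assms(1) z(2,1)] assms(1) by (intro mult_nonneg_nonneg) auto
    ultimately have "\<exists>D. ((\<lambda>x. exp (x powr \<beta>) * (\<beta> * x powr (\<beta> - 1))) has_real_derivative D) (at z) \<and> 0 \<le> D"
      by (intro exI conjI)
    then show ?thesis
      by (simp only: orlicz_dPsi_def[abs_def])
  qed
  then show ?thesis
    by (intro DERIV_nonneg_imp_nondecreasing[OF assms(4)]) auto
qed

lemma orlicz_Psi_continuous:
  assumes "0 < \<beta>"
  shows "continuous_on {0..} (orlicz_Psi \<beta>)"
  unfolding orlicz_Psi_def
  using assms by (intro continuous_intros continuous_on_powr') auto

text \<open>Convexity beyond the threshold, from the mean value theorem and the monotone derivative.
  The base point is positive because \<open>orlicz_dPsi\<close> at \<open>0\<close> need not be the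
  one-sided derivative; the other point may be \<open>0\<close>, which continuity up to
  \<open>0\<close> covers.\<close>

lemma orlicz_Psi_tangent:
  assumes \<beta>: "0 < \<beta>" and x: "orlicz_threshold \<beta> \<le> x" "0 < x" and y: "orlicz_threshold \<beta> \<le> y"
  shows "orlicz_Psi \<beta> x + orlicz_dPsi \<beta> x * (y - x) \<le> orlicz_Psi \<beta> y"
proof -
  have c: "continuous_on {a..b} (orlicz_Psi \<beta>)" if "0 \<le> a" for a b
    by (rule continuous_on_subset[OF orlicz_Psi_continuous[OF \<beta>]]) (use that in auto)
  have d: "(orlicz_Psi \<beta> has_derivative (*) (orlicz_dPsi \<beta> z)) (at z)" if "0 < z" for z
    using orlicz_Psi_deriv[OF that, of \<beta>]
    by (simp only: has_field_derivative_def)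
  consider "y = x" | "x < y" | "y < x" by linarith
  then show ?thesis
  proof cases
    case 2
    obtain z where z: "x < z" "z < y" "orlicz_Psi \<beta> y - orlicz_Psi \<beta> x = orlicz_dPsi \<beta> z * (y - x)"
      by (rule mvt[OF 2 c[of x y] d]) (use x in auto)
    have "orlicz_dPsi \<beta> x \<le> orlicz_dPsi \<beta> z"
      using z x \<beta> by (intro orlicz_dPsi_mono) auto
    then have "(y - x) * orlicz_dPsi \<beta> x \<le> (y - x) * orlicz_dPsi \<beta> z"
      using 2 by (intro mult_left_mono) auto
    then show ?thesis
      using z by (simp add: algebra_simps)
  next
    case 3
    have y0: "0 \<le> y"
      using y orlicz_threshold_nonneg[of \<beta>] by linarith
    obtain z where z: "y < z" "z < x" "orlicz_Psi \<beta> x - orlicz_Psi \<beta> y = orlicz_dPsi \<beta> z * (x - y)"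
      by (rule mvt[OF 3 c[of y x] d]) (use y0 in auto)
    have "orlicz_dPsi \<beta> z \<le> orlicz_dPsi \<beta> x"
      using z y y0 \<beta> by (intro orlicz_dPsi_mono) auto
    then have "(x - y) * orlicz_dPsi \<beta> z \<le> (x - y) * orlicz_dPsi \<beta> x"
      using 3 by (intro mult_left_mono) auto
    then show ?thesis
      using z by (simp add: algebra_simps)
  qed simp
qed

lemma orlicz_E_above: "orlicz_threshold \<beta> \<le> x \<Longrightarrow> orlicz_E \<beta> x = orlicz_Psi \<beta> x"
  by (simp add: orlicz_E_def)

text \<open>At the threshold itself the slope is multiplied by \<open>0\<close>, so the formula
  survives when the threshold is \<open>0\<close> and \<open>deriv\<close> carries no information
  there.\<close>

lemma orlicz_E_below:
  assumes "0 \<le> x" "x \<le> orlicz_threshold \<beta>"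
  shows "orlicz_E \<beta> x = orlicz_Psi \<beta> (orlicz_threshold \<beta>)
     + orlicz_dPsi \<beta> (orlicz_threshold \<beta>) * (x - orlicz_threshold \<beta>)"
proof (cases "x = orlicz_threshold \<beta>")
  case False
  then have "deriv (orlicz_Psi \<beta>) (orlicz_threshold \<beta>) = orlicz_dPsi \<beta> (orlicz_threshold \<beta>)"
    using assms by (intro DERIV_imp_deriv orlicz_Psi_deriv) auto
  then show ?thesis
    using False assms by (simp add: orlicz_E_def)
qed (simp add: orlicz_E_def)

lemma orlicz_Phi_0 [simp]: "orlicz_Phi \<beta> 0 = 0"
  by (simp add: orlicz_Phi_def)

text \<open>A supporting line of nonnegative slope at every point gives both monotonicity and
  convexity without differentiating the glued function. The line is the linear piece below the
  threshold, the tangent above it, and the constant at \<open>0\<close> when there is no linear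
  piece.\<close>

lemma orlicz_Phi_support:
  assumes \<beta>: "0 < \<beta>" and x: "0 \<le> x"
  obtains k where "0 \<le> k" "\<And>y. 0 \<le> y \<Longrightarrow> orlicz_Phi \<beta> x + k * (y - x) \<le> orlicz_Phi \<beta> y"
proof -
  define a where "a = orlicz_threshold \<beta>"
  have a: "0 \<le> a" by (simp add: a_def orlicz_threshold_nonneg)
  consider (low) "0 < a" "x < a" | (high) "0 < x" "a \<le> x" | (zero) "x = 0" "a = 0"
    using a x by linarith
  then have "\<exists>k\<ge>0. \<forall>y\<ge>0. orlicz_E \<beta> x + k * (y - x) \<le> orlicz_E \<beta> y"
  proof cases
    case low
    have "orlicz_E \<beta> x + orlicz_dPsi \<beta> a * (y - x) \<le> orlicz_E \<beta> y" if y: "0 \<le> y" for y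
    proof (cases "a \<le> y")
      case True
      have "orlicz_Psi \<beta> a + orlicz_dPsi \<beta> a * (y - a) \<le> orlicz_Psi \<beta> y"
        using True low \<beta> by (intro orlicz_Psi_tangent) (auto simp: a_def)
      then show ?thesis
        using True low x by (simp add: orlicz_E_below orlicz_E_above flip: a_def) (simp add: algebra_simps)
    next
      case False
      then show ?thesis
        using low x y by (simp add: orlicz_E_below flip: a_def) (simp add: algebra_simps)
    qed
    then show ?thesis
      using orlicz_dPsi_nonneg[OF \<beta>] by blast
  next
    case high
    have "orlicz_E \<beta> x + orlicz_dPsi \<beta> x * (y - x) \<le> orlicz_E \<beta> y" if y: "0 \<le> y" for y
    proof (cases "a \<le> y")
      case True
      then show ?thesis
        using orlicz_Psi_tangent[OF \<beta>, of x y] high by (simp add: orlicz_E_above flip: a_def)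
    next
      case False
      \<comment> \<open>The tangent at \<open>x\<close> lies below the function at the threshold;
        going further left it stays below the linear piece, because it is at least as steep.\<close>
      have 1: "orlicz_Psi \<beta> x + orlicz_dPsi \<beta> x * (a - x) \<le> orlicz_Psi \<beta> a"
        using high \<beta> by (intro orlicz_Psi_tangent) (auto simp: a_def)
      have "orlicz_dPsi \<beta> a \<le> orlicz_dPsi \<beta> x"
        using high \<beta> False y by (intro orlicz_dPsi_mono) (auto simp: a_def)
      then have *: "orlicz_dPsi \<beta> x * (y - a) \<le> orlicz_dPsi \<beta> a * (y - a)"
        using False by (intro mult_right_mono_neg) auto
      show ?thesis
      proof -
        have "orlicz_E \<beta> x = orlicz_Psi \<beta> x" "orlicz_E \<beta> y = orlicz_Psi \<beta> a + orlicz_dPsi \<beta> a * (y - a)"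
          using False high y by (auto simp: a_def orlicz_E_above orlicz_E_below)
        moreover have "orlicz_dPsi \<beta> x * (y - x) = orlicz_dPsi \<beta> x * (a - x) + orlicz_dPsi \<beta> x * (y - a)"
          by (simp add: algebra_simps)
        ultimately show ?thesis
          using 1 * by linarith
      qed
    qed
    then show ?thesis
      using orlicz_dPsi_nonneg[OF \<beta>] by blast
  next
    case zero
    then show ?thesis
      by (intro exI[of _ 0]) (auto simp: orlicz_E_above orlicz_Psi_def simp flip: a_def)
  qed
  then obtain k where "0 \<le> k" "\<And>y. 0 \<le> y \<Longrightarrow> orlicz_E \<beta> x + k * (y - x) \<le> orlicz_E \<beta> y"
    by blast
  then show thesis
    by (intro that[of k]) (auto simp: orlicz_Phi_def algebra_simps)
qed

lemma orlicz_Phi_mono: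
  assumes "0 < \<beta>" "0 \<le> x" "x \<le> y"
  shows "orlicz_Phi \<beta> x \<le> orlicz_Phi \<beta> y"
proof -
  obtain k where "0 \<le> k" "\<And>y. 0 \<le> y \<Longrightarrow> orlicz_Phi \<beta> x + k * (y - x) \<le> orlicz_Phi \<beta> y"
    using orlicz_Phi_support assms by blast
  then show ?thesis
    using assms by (smt (verit) mult_nonneg_nonneg)
qed

lemma orlicz_Phi_nonneg: "0 < \<beta> \<Longrightarrow> 0 \<le> x \<Longrightarrow> 0 \<le> orlicz_Phi \<beta> x"
  using orlicz_Phi_mono[of \<beta> 0 x] by simp

lemma orlicz_Phi_convex:
  assumes \<beta>: "0 < \<beta>" and "0 \<le> x" "0 \<le> y" "0 \<le> u" "0 \<le> v" "u + v = 1"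
  shows "orlicz_Phi \<beta> (u * x + v * y) \<le> u * orlicz_Phi \<beta> x + v * orlicz_Phi \<beta> y"
proof -
  define z where "z = u * x + v * y"
  obtain k where k: "\<And>y. 0 \<le> y \<Longrightarrow> orlicz_Phi \<beta> z + k * (y - z) \<le> orlicz_Phi \<beta> y"
    using orlicz_Phi_support[OF \<beta>, of z] assms by (auto simp: z_def)
  have "u * (orlicz_Phi \<beta> z + k * (x - z)) + v * (orlicz_Phi \<beta> z + k * (y - z))
      \<le> u * orlicz_Phi \<beta> x + v * orlicz_Phi \<beta> y"
    using assms k by (intro add_mono mult_left_mono) auto
  also have "u * (orlicz_Phi \<beta> z + k * (x - z)) + v * (orlicz_Phi \<beta> z + k * (y - z))
      = (u + v) * orlicz_Phi \<beta> z + k * (u * x + v * y - (u + v) * z)"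
    by (simp add: algebra_simps)
  finally show ?thesis
    using assms by (simp add: z_def)
qed

lemma orlicz_Phi_divide:
  assumes "0 < \<beta>" "0 \<le> x" "1 \<le> c"
  shows "orlicz_Phi \<beta> (x / c) \<le> orlicz_Phi \<beta> x / c"
  using orlicz_Phi_convex[of \<beta> x 0 "1 / c" "1 - 1 / c"] assms by (simp add: field_simps)

lemma orlicz_Phi_continuous:
  assumes "0 < \<beta>"
  shows "continuous_on {0..} (orlicz_Phi \<beta>)"
proof -
  define a where "a = orlicz_threshold \<beta>"
  have "continuous_on {0..} (\<lambda>x. orlicz_Psi \<beta> (max x a) + orlicz_dPsi \<beta> a * (min x a - a) - orlicz_E \<beta> 0)"
    by (intro continuous_intros continuous_on_compose2[OF orlicz_Psi_continuous[OF assms]]) auto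
  then show ?thesis
    by (rule continuous_on_eq)
      (auto simp: orlicz_Phi_def a_def orlicz_E_above orlicz_E_below max_def min_def)
qed

text \<open>Above the threshold the two functions differ by a constant, and below it both are
  bounded. Through this all growth comparisons reduce to comparisons of pure exponentials.\<close>

lemma orlicz_Phi_exp_bound:
  assumes \<beta>: "0 < \<beta>"
  obtains K where "0 \<le> K" "\<And>x. 0 \<le> x \<Longrightarrow> \<bar>orlicz_Phi \<beta> x - exp (x powr \<beta>)\<bar> \<le> K"
proof -
  define a where "a = orlicz_threshold \<beta>"
  have a: "0 \<le> a" by (simp add: a_def orlicz_threshold_nonneg)
  define K where "K = 1 + \<bar>orlicz_E \<beta> 0\<bar> + orlicz_Phi \<beta> a + exp (a powr \<beta>)"
  have "0 \<le> K"
    using orlicz_Phi_nonneg[OF \<beta> a] by (auto simp: K_def intro!: add_nonneg_nonneg)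
  moreover have "\<bar>orlicz_Phi \<beta> x - exp (x powr \<beta>)\<bar> \<le> K" if x: "0 \<le> x" for x
  proof (cases "a \<le> x")
    case True
    then have "orlicz_Phi \<beta> x - exp (x powr \<beta>) = - 1 - orlicz_E \<beta> 0"
      by (simp add: orlicz_Phi_def orlicz_E_above orlicz_Psi_def flip: a_def)
    then show ?thesis
      using orlicz_Phi_nonneg[OF \<beta> a] exp_ge_zero[of "a powr \<beta>"] unfolding K_def by linarith
  next
    case False
    then have "orlicz_Phi \<beta> x \<le> orlicz_Phi \<beta> a" "exp (x powr \<beta>) \<le> exp (a powr \<beta>)"
      using x \<beta> by (auto intro!: orlicz_Phi_mono powr_mono2)
    then show ?thesis
      using orlicz_Phi_nonneg[OF \<beta> x] exp_ge_zero[of "x powr \<beta>"] unfolding K_def by linarith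
  qed
  ultimately show thesis
    using that by blast
qed

text \<open>With \<open>y = x powr \<beta>\<close> and an integer
  \<open>n \<ge> p / \<beta>\<close>, the power \<open>y powr (p / \<beta>)\<close> is at most
  \<open>1 + y ^ n\<close>, and \<open>y ^ n\<close> is at most \<open>fact n * exp y\<close>, a
  single term of the exponential series.\<close>

lemma orlicz_Phi_dominates_powr:
  assumes \<beta>: "0 < \<beta>" and p: "0 < p"
  obtains A B where "1 \<le> A" "1 \<le> B" "\<And>x. 0 \<le> x \<Longrightarrow> x powr p \<le> A + B * orlicz_Phi \<beta> x"
proof -
  obtain K where K: "0 \<le> K" "\<And>x. 0 \<le> x \<Longrightarrow> \<bar>orlicz_Phi \<beta> x - exp (x powr \<beta>)\<bar> \<le> K"
    using orlicz_Phi_exp_bound[OF \<beta>] by blast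
  define n where "n = nat \<lceil>p / \<beta>\<rceil>"
  have n: "p / \<beta> \<le> real n"
    unfolding n_def by linarith
  define B :: real where "B = fact n"
  have B: "1 \<le> B"
    by (simp add: B_def fact_ge_1)
  have "x powr p \<le> (1 + B * K) + B * orlicz_Phi \<beta> x" if x: "0 \<le> x" for x
  proof -
    define y where "y = x powr \<beta>"
    have y: "0 \<le> y" "y powr (p / \<beta>) = x powr p"
      using \<beta> by (auto simp: y_def powr_powr)
    have "y powr (p / \<beta>) \<le> 1 + y ^ n"
    proof (cases "y \<le> 1")
      case True
      then have "y powr (p / \<beta>) \<le> 1"
        using y p \<beta> by (intro powr_le1) auto
      then show ?thesis
        using zero_le_power[OF y(1), of n] by linarith
    next
      case False
      then have "y powr (p / \<beta>) \<le> y powr real n"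
        using n by (intro powr_mono) auto
      then show ?thesis
        using False by (simp add: powr_realpow)
    qed
    moreover have "y ^ n / fact n \<le> exp y"
    proof -
      have "(\<Sum>k\<in>{n}. y ^ k /\<^sub>R fact k) \<le> (\<Sum>k. y ^ k /\<^sub>R fact k)"
        using y(1) by (intro sum_le_suminf summable_exp_generic) auto
      then show ?thesis
        by (simp add: exp_def field_simps)
    qed
    then have "y ^ n \<le> B * exp y"
      by (simp add: B_def field_simps)
    moreover have "B * exp y \<le> B * (orlicz_Phi \<beta> x + K)"
      using K(2)[OF x] B unfolding y_def by (intro mult_left_mono) linarith+
    ultimately show ?thesis
      using y by (simp add: algebra_simps)
  qed
  moreover have "1 \<le> 1 + B * K"
    using B K by simp
  ultimately show thesis
    using that B by blast
qed


text \<open>Lowering the exponent costs a factor \<open>exp 1\<close>, because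
  \<open>x powr \<beta>' \<le> 1 + x powr \<beta>\<close>.\<close>

lemma orlicz_Phi_compare:
  assumes "0 < \<beta>'" "\<beta>' \<le> \<beta>"
  obtains A B where "1 \<le> A" "1 \<le> B" "\<And>x. 0 \<le> x \<Longrightarrow> orlicz_Phi \<beta>' x \<le> A + B * orlicz_Phi \<beta> x"
proof -
  have \<beta>: "0 < \<beta>" using assms by simp
  obtain K where K: "0 \<le> K" "\<And>x. 0 \<le> x \<Longrightarrow> \<bar>orlicz_Phi \<beta> x - exp (x powr \<beta>)\<bar> \<le> K"
    using orlicz_Phi_exp_bound[OF \<beta>] by blast
  obtain K' where K': "0 \<le> K'" "\<And>x. 0 \<le> x \<Longrightarrow> \<bar>orlicz_Phi \<beta>' x - exp (x powr \<beta>')\<bar> \<le> K'"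
    using orlicz_Phi_exp_bound[OF assms(1)] by blast
  have "orlicz_Phi \<beta>' x \<le> (1 + exp 1 * K + K') + exp 1 * orlicz_Phi \<beta> x" if x: "0 \<le> x" for x
  proof -
    have "x powr \<beta>' \<le> 1 + x powr \<beta>"
    proof (cases "x \<le> 1")
      case True
      then have "x powr \<beta>' \<le> 1"
        using x assms by (intro powr_le1) auto
      then show ?thesis
        using powr_ge_zero[of x \<beta>] by linarith
    next
      case False
      then have "x powr \<beta>' \<le> x powr \<beta>"
        using assms by (intro powr_mono) auto
      then show ?thesis by simp
    qed
    then have "exp (x powr \<beta>') \<le> exp 1 * exp (x powr \<beta>)"
      by (simp flip: exp_add)
    also have "\<dots> \<le> exp 1 * (orlicz_Phi \<beta> x + K)"
      using K(2)[OF x] by (intro mult_left_mono) auto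
    finally show ?thesis
      using K'(2)[OF x] by (simp add: algebra_simps)
  qed
  moreover have "1 \<le> 1 + exp 1 * K + K'"
    using K K' by (simp add: add_nonneg_nonneg)
  ultimately show thesis
    using that[of "1 + exp 1 * K + K'" "exp 1"] by simp
qed

text \<open>Taking the power \<open>\<beta>2 / \<beta>1\<close> turns the exponential for
  \<open>\<beta>1\<close> into the one for \<open>\<beta>2\<close> exactly, so only an additive
  error survives and the factor is \<open>1\<close>. This is the source of the interpolation between
  the \<open>\<beta>2\<close> norm and the supremum.\<close>

lemma orlicz_Phi_power_compare:
  assumes "0 < \<beta>2" "0 < \<beta>1"
  obtains A where "1 \<le> A" "\<And>x. 0 \<le> x \<Longrightarrow> orlicz_Phi \<beta>1 (x powr (\<beta>2 / \<beta>1)) \<le> A + 1 * orlicz_Phi \<beta>2 x"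
proof -
  obtain K where K: "0 \<le> K" "\<And>x. 0 \<le> x \<Longrightarrow> \<bar>orlicz_Phi \<beta>2 x - exp (x powr \<beta>2)\<bar> \<le> K"
    using orlicz_Phi_exp_bound[OF assms(1)] by blast
  obtain K' where K': "0 \<le> K'" "\<And>x. 0 \<le> x \<Longrightarrow> \<bar>orlicz_Phi \<beta>1 x - exp (x powr \<beta>1)\<bar> \<le> K'"
    using orlicz_Phi_exp_bound[OF assms(2)] by blast
  have "orlicz_Phi \<beta>1 (x powr (\<beta>2 / \<beta>1)) \<le> (1 + K + K') + 1 * orlicz_Phi \<beta>2 x" if x: "0 \<le> x" for x
    using K(2)[OF x] K'(2)[of "x powr (\<beta>2 / \<beta>1)"] assms by (simp add: powr_powr)
  then show thesis
    using K K' that[of "1 + K + K'"] by simp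
qed

subsection \<open>The Luxemburg norm\<close>

lemma orlicz_norm_le:
  assumes "0 < l" "(\<integral>\<^sup>+r\<in>D. ennreal (orlicz_Phi \<beta> (g r / l)) \<partial>lborel) \<le> 1"
  shows "orlicz_norm \<beta> D g \<le> ennreal l"
  unfolding orlicz_norm_def using assms by (intro Inf_lower) auto

text \<open>The strict inequality avoids the question whether the infimum is attained: some
  admissible level lies below \<open>l\<close>, and admissibility is inherited upwards.\<close>

lemma orlicz_integral_le:
  assumes "0 < \<beta>" "\<And>r. r \<in> D \<Longrightarrow> 0 \<le> g r" "orlicz_norm \<beta> D g < ennreal l"
  shows "0 < l" "(\<integral>\<^sup>+r\<in>D. ennreal (orlicz_Phi \<beta> (g r / l)) \<partial>lborel) \<le> 1"
proof -
  obtain l' where l': "0 < l'" "ennreal l' < ennreal l"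
      "(\<integral>\<^sup>+r\<in>D. ennreal (orlicz_Phi \<beta> (g r / l')) \<partial>lborel) \<le> 1"
    using assms(3) unfolding orlicz_norm_def Inf_less_iff by blast
  then have l: "l' < l"
    by (simp add: ennreal_less_iff)
  then show "0 < l" using l' by simp
  have "(\<integral>\<^sup>+r\<in>D. ennreal (orlicz_Phi \<beta> (g r / l)) \<partial>lborel)
      \<le> (\<integral>\<^sup>+r\<in>D. ennreal (orlicz_Phi \<beta> (g r / l')) \<partial>lborel)"
    using assms l l' by (intro nn_integral_mono)
      (auto split: split_indicator intro!: ennreal_leI orlicz_Phi_mono divide_left_mono)
  with l' show "(\<integral>\<^sup>+r\<in>D. ennreal (orlicz_Phi \<beta> (g r / l)) \<partial>lborel) \<le> 1"
    by simp
qed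

text \<open>Reduces a bound against a norm to a bound for each admissible level. An excess of
  \<open>e / c\<close> over the norm makes the loss in the conclusion exactly \<open>e\<close>,
  which is then sent to \<open>0\<close>.\<close>

lemma orlicz_norm_leI:
  assumes "0 < c" "0 < \<beta>'" "\<And>r. r \<in> D' \<Longrightarrow> 0 \<le> g' r"
    and step: "\<And>l. 0 < l \<Longrightarrow> (\<integral>\<^sup>+r\<in>D'. ennreal (orlicz_Phi \<beta>' (g' r / l)) \<partial>lborel) \<le> 1
      \<Longrightarrow> X \<le> ennreal (c * l)"
  shows "X \<le> ennreal c * orlicz_norm \<beta>' D' g'"
proof (cases "orlicz_norm \<beta>' D' g'")
  case top
  then show ?thesis using assms(1) by (simp add: ennreal_mult_top)
next
  case (real x)
  have "X \<le> ennreal (c * x) + ennreal e" if e: "0 < e" for e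
  proof -
    define l where "l = x + e / c"
    have l: "orlicz_norm \<beta>' D' g' < ennreal l"
      using real e assms(1) by (auto simp: l_def ennreal_less_iff)
    have "X \<le> ennreal (c * l)"
      by (rule step[OF orlicz_integral_le[OF assms(2,3) l]]) auto
    also have "c * l = c * x + e"
      using assms(1) by (simp add: l_def field_simps)
    finally show ?thesis
      using real e assms(1) by (simp add: ennreal_plus)
  qed
  then have "X \<le> ennreal (c * x)"
    by (rule ennreal_le_epsilon)
  then show ?thesis
    using real assms(1) by (simp add: ennreal_mult)
qed

lemma orlicz_norm_transfer:
  assumes "0 < \<beta>" "\<And>r. r \<in> D' \<Longrightarrow> 0 \<le> g' r"
    and "\<And>l. 0 < l \<Longrightarrow> (\<integral>\<^sup>+r\<in>D. ennreal (orlicz_Phi \<beta> (g r / l)) \<partial>lborel)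
      \<le> (\<integral>\<^sup>+r\<in>D'. ennreal (orlicz_Phi \<beta> (g' r / l)) \<partial>lborel)"
  shows "orlicz_norm \<beta> D g \<le> orlicz_norm \<beta> D' g'"
  unfolding orlicz_norm_def using assms(3) by (intro Inf_superset_mono) (auto intro: order_trans)

lemma orlicz_norm_mono_AE:
  assumes "0 < \<beta>" "AE r in lborel. r \<in> D \<longrightarrow> 0 \<le> g r \<and> g r \<le> g' r" "\<And>r. r \<in> D \<Longrightarrow> 0 \<le> g' r"
  shows "orlicz_norm \<beta> D g \<le> orlicz_norm \<beta> D g'"
proof (rule orlicz_norm_transfer[OF assms(1,3)])
  fix l :: real assume "0 < l"
  then show "(\<integral>\<^sup>+r\<in>D. ennreal (orlicz_Phi \<beta> (g r / l)) \<partial>lborel)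
      \<le> (\<integral>\<^sup>+r\<in>D. ennreal (orlicz_Phi \<beta> (g' r / l)) \<partial>lborel)"
    using assms by (intro nn_integral_mono_AE)
      (auto split: split_indicator intro!: ennreal_leI orlicz_Phi_mono divide_right_mono)
qed

lemma orlicz_norm_cong_AE:
  assumes "AE r in lborel. r \<in> D \<longrightarrow> g r = g' r"
  shows "orlicz_norm \<beta> D g = orlicz_norm \<beta> D g'"
proof -
  have "(\<integral>\<^sup>+r\<in>D. ennreal (orlicz_Phi \<beta> (g r / l)) \<partial>lborel)
      = (\<integral>\<^sup>+r\<in>D. ennreal (orlicz_Phi \<beta> (g' r / l)) \<partial>lborel)" for l
    using assms by (intro nn_integral_cong_AE) (auto split: split_indicator)
  then show ?thesis
    by (simp add: orlicz_norm_def)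
qed

lemma orlicz_norm_null:
  assumes "AE r in lborel. r \<notin> D"
  shows "orlicz_norm \<beta> D g = 0"
proof -
  have "(\<integral>\<^sup>+r\<in>D. ennreal (orlicz_Phi \<beta> (g r / l)) \<partial>lborel) = 0" for l
  proof -
    have "(\<integral>\<^sup>+r\<in>D. ennreal (orlicz_Phi \<beta> (g r / l)) \<partial>lborel) = (\<integral>\<^sup>+(r::real). 0 \<partial>lborel)"
      using assms by (intro nn_integral_cong_AE) (auto elim!: eventually_mono)
    then show ?thesis by simp
  qed
  then have "orlicz_norm \<beta> D g \<le> ennreal e" if "0 < e" for e
    using that by (intro orlicz_norm_le) auto
  then have "orlicz_norm \<beta> D g \<le> 0"
    by (intro ennreal_le_epsilon[where y = 0]) simp
  then show ?thesis
    by simp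
qed

lemma orlicz_Phi_measurable:
  assumes "0 < \<beta>" "g \<in> borel_measurable M" "\<And>r. 0 \<le> g r"
  shows "(\<lambda>r. orlicz_Phi \<beta> (g r)) \<in> borel_measurable M"
proof -
  have "continuous_on UNIV (\<lambda>x. orlicz_Phi \<beta> (max 0 x))"
    by (intro continuous_on_compose2[OF orlicz_Phi_continuous[OF assms(1)]] continuous_intros) auto
  then have "(\<lambda>r. orlicz_Phi \<beta> (max 0 (g r))) \<in> borel_measurable M"
    by (intro measurable_compose[OF assms(2)] borel_measurable_continuous_onI)
  then show ?thesis
    using assms(3) by (simp add: max_def)
qed

text \<open>Convexity with the weights \<open>l1 / (l1 + l2)\<close> and
  \<open>l2 / (l1 + l2)\<close> shows that the sum of admissible levels is admissible for the sum of
  the functions.\<close>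

lemma orlicz_norm_triangle:
  assumes \<beta>: "0 < \<beta>" and D: "D \<in> sets borel"
    and g: "g1 \<in> borel_measurable borel" "g2 \<in> borel_measurable borel" "\<And>r. 0 \<le> g1 r" "\<And>r. 0 \<le> g2 r"
  shows "orlicz_norm \<beta> D (\<lambda>r. g1 r + g2 r) \<le> orlicz_norm \<beta> D g1 + orlicz_norm \<beta> D g2"
proof (cases "orlicz_norm \<beta> D g1 = \<infinity> \<or> orlicz_norm \<beta> D g2 = \<infinity>")
  case False
  then obtain x1 x2 where x: "orlicz_norm \<beta> D g1 = ennreal x1" "0 \<le> x1"
      "orlicz_norm \<beta> D g2 = ennreal x2" "0 \<le> x2"
    by (cases "orlicz_norm \<beta> D g1"; cases "orlicz_norm \<beta> D g2") auto
  have "orlicz_norm \<beta> D (\<lambda>r. g1 r + g2 r) \<le> ennreal (x1 + x2) + ennreal e" if e: "0 < e" for e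
  proof -
    define l1 l2 where "l1 = x1 + e / 2" and "l2 = x2 + e / 2"
    have l: "0 < l1" "0 < l2" "l1 + l2 = x1 + x2 + e"
      using x e by (auto simp: l1_def l2_def)
    have 1: "(\<integral>\<^sup>+r\<in>D. ennreal (orlicz_Phi \<beta> (g1 r / l1)) \<partial>lborel) \<le> 1"
      using x e g by (intro orlicz_integral_le(2)[OF \<beta>]) (auto simp: l1_def ennreal_less_iff)
    have 2: "(\<integral>\<^sup>+r\<in>D. ennreal (orlicz_Phi \<beta> (g2 r / l2)) \<partial>lborel) \<le> 1"
      using x e g by (intro orlicz_integral_le(2)[OF \<beta>]) (auto simp: l2_def ennreal_less_iff)
    define u v where "u = l1 / (l1 + l2)" and "v = l2 / (l1 + l2)"
    have uv: "0 \<le> u" "0 \<le> v" "u + v = 1"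
      using l(1,2) by (auto simp: u_def v_def simp flip: add_divide_distrib)
    have [measurable]: "(\<lambda>r. orlicz_Phi \<beta> (g1 r / l1)) \<in> borel_measurable borel"
        "(\<lambda>r. orlicz_Phi \<beta> (g2 r / l2)) \<in> borel_measurable borel"
      using g l by (auto intro!: orlicz_Phi_measurable \<beta>)
    have [measurable]: "D \<in> sets borel" by fact
    have "(\<integral>\<^sup>+r\<in>D. ennreal (orlicz_Phi \<beta> ((g1 r + g2 r) / (l1 + l2))) \<partial>lborel)
       \<le> (\<integral>\<^sup>+r. ennreal u * (ennreal (orlicz_Phi \<beta> (g1 r / l1)) * indicator D r)
            + ennreal v * (ennreal (orlicz_Phi \<beta> (g2 r / l2)) * indicator D r) \<partial>lborel)"
    proof (intro nn_integral_mono)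
      fix r
      have eq: "(g1 r + g2 r) / (l1 + l2) = u * (g1 r / l1) + v * (g2 r / l2)"
        using l(1,2) by (simp add: u_def v_def add_divide_distrib)
      have "orlicz_Phi \<beta> ((g1 r + g2 r) / (l1 + l2))
          \<le> u * orlicz_Phi \<beta> (g1 r / l1) + v * orlicz_Phi \<beta> (g2 r / l2)"
        unfolding eq using g l uv by (intro orlicz_Phi_convex \<beta>) auto
      then have "ennreal (orlicz_Phi \<beta> ((g1 r + g2 r) / (l1 + l2)))
          \<le> ennreal (u * orlicz_Phi \<beta> (g1 r / l1) + v * orlicz_Phi \<beta> (g2 r / l2))"
        by (rule ennreal_leI)
      also have "\<dots> = ennreal u * ennreal (orlicz_Phi \<beta> (g1 r / l1)) + ennreal v * ennreal (orlicz_Phi \<beta> (g2 r / l2))"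
      proof -
        have "0 \<le> orlicz_Phi \<beta> (g1 r / l1)" "0 \<le> orlicz_Phi \<beta> (g2 r / l2)"
          using g l by (auto intro!: orlicz_Phi_nonneg \<beta>)
        then show ?thesis
          using uv by (simp add: ennreal_mult)
      qed
      finally have "ennreal (orlicz_Phi \<beta> ((g1 r + g2 r) / (l1 + l2)))
          \<le> ennreal u * ennreal (orlicz_Phi \<beta> (g1 r / l1)) + ennreal v * ennreal (orlicz_Phi \<beta> (g2 r / l2))" .
      then show "ennreal (orlicz_Phi \<beta> ((g1 r + g2 r) / (l1 + l2))) * indicator D r
         \<le> ennreal u * (ennreal (orlicz_Phi \<beta> (g1 r / l1)) * indicator D r)
            + ennreal v * (ennreal (orlicz_Phi \<beta> (g2 r / l2)) * indicator D r)"
        by (cases "r \<in> D") simp_all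
    qed
    also have "\<dots> = ennreal u * (\<integral>\<^sup>+r\<in>D. ennreal (orlicz_Phi \<beta> (g1 r / l1)) \<partial>lborel)
        + ennreal v * (\<integral>\<^sup>+r\<in>D. ennreal (orlicz_Phi \<beta> (g2 r / l2)) \<partial>lborel)"
      by (simp add: nn_integral_add nn_integral_cmult)
    also have "\<dots> \<le> ennreal u * 1 + ennreal v * 1"
      by (intro add_mono mult_left_mono 1 2) auto
    also have "\<dots> = 1"
      using uv by (simp flip: ennreal_plus)
    finally have "orlicz_norm \<beta> D (\<lambda>r. g1 r + g2 r) \<le> ennreal (l1 + l2)"
      using l by (intro orlicz_norm_le) auto
    then show ?thesis
      using x e by (simp add: l)
  qed
  then have "orlicz_norm \<beta> D (\<lambda>r. g1 r + g2 r) \<le> ennreal (x1 + x2)"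
    by (rule ennreal_le_epsilon)
  then show ?thesis
    using x by simp
qed auto

text \<open>Lower semicontinuity: any level slightly above \<open>L\<close> is admissible for every
  \<open>g n\<close>, and Fatou's lemma for the integral of \<open>orlicz_Phi\<close> carries this
  over to the limit. Limits of Riemann sums are estimated in this way.\<close>

lemma orlicz_norm_Fatou:
  assumes \<beta>: "0 < \<beta>" and D [measurable]: "D \<in> sets borel"
    and g [measurable]: "\<And>n. g n \<in> borel_measurable borel" and g0: "\<And>n r. 0 \<le> g n r"
    and lim: "AE r in lborel. r \<in> D \<longrightarrow> (\<lambda>n. g n r) \<longlonglongrightarrow> f r"
    and L: "\<And>n. orlicz_norm \<beta> D (g n) \<le> L"
  shows "orlicz_norm \<beta> D f \<le> L"
proof (cases L)
  case (real x)
  have "orlicz_norm \<beta> D f \<le> ennreal x + ennreal e" if e: "0 < e" for e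
  proof -
    define l where "l = x + e"
    have l: "0 < l" using e real by (auto simp: l_def)
    have 1: "(\<integral>\<^sup>+r\<in>D. ennreal (orlicz_Phi \<beta> (g n r / l)) \<partial>lborel) \<le> 1" for n
      using L[of n] real e g0
      by (intro orlicz_integral_le(2)[OF \<beta>]) (auto simp: l_def ennreal_less_iff intro: le_less_trans)
    have [measurable]: "(\<lambda>r. orlicz_Phi \<beta> (g n r / l)) \<in> borel_measurable borel" for n
      using g0 l by (auto intro!: orlicz_Phi_measurable \<beta>)
    have "(\<integral>\<^sup>+r\<in>D. ennreal (orlicz_Phi \<beta> (f r / l)) \<partial>lborel)
        = (\<integral>\<^sup>+r. liminf (\<lambda>n. ennreal (orlicz_Phi \<beta> (g n r / l)) * indicator D r) \<partial>lborel)"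
    proof (intro nn_integral_cong_AE)
      show "AE r in lborel. ennreal (orlicz_Phi \<beta> (f r / l)) * indicator D r
          = liminf (\<lambda>n. ennreal (orlicz_Phi \<beta> (g n r / l)) * indicator D r)"
        using lim
      proof eventually_elim
        case (elim r)
        show ?case
        proof (cases "r \<in> D")
          case True
          then have g: "(\<lambda>n. g n r) \<longlonglongrightarrow> f r" using elim by auto
          then have f0: "0 \<le> f r"
            using g0 by (intro LIMSEQ_le_const) auto
          have "(\<lambda>n. orlicz_Phi \<beta> (g n r / l)) \<longlonglongrightarrow> orlicz_Phi \<beta> (f r / l)"
            by (rule continuous_on_tendsto_compose[OF orlicz_Phi_continuous[OF \<beta>] tendsto_divide[OF g tendsto_const]])
              (use f0 g0 l in auto)
          then have "(\<lambda>n. ennreal (orlicz_Phi \<beta> (g n r / l))) \<longlonglongrightarrow> ennreal (orlicz_Phi \<beta> (f r / l))"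
            by (intro tendsto_ennrealI)
          then show ?thesis
            using True by (simp add: lim_imp_Liminf)
        next
          case False
          then show ?thesis by (simp add: Liminf_const)
        qed
      qed
    qed
    also have "\<dots> \<le> liminf (\<lambda>n. \<integral>\<^sup>+r\<in>D. ennreal (orlicz_Phi \<beta> (g n r / l)) \<partial>lborel)"
      by (intro nn_integral_liminf) auto
    also have "\<dots> \<le> liminf (\<lambda>n. 1)"
      by (intro Liminf_mono always_eventually allI 1)
    also have "\<dots> = 1"
      by (simp add: Liminf_const)
    finally have "orlicz_norm \<beta> D f \<le> ennreal l"
      by (rule orlicz_norm_le[OF l])
    then show ?thesis
      using real e by (simp add: l_def)
  qed
  then have "orlicz_norm \<beta> D f \<le> ennreal x"
    by (rule ennreal_le_epsilon)
  then show ?thesis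
    using real by simp
qed auto

lemma orlicz_norm_shift:
  assumes \<beta>: "0 < \<beta>" and g: "\<And>r. 0 \<le> g r" "g \<in> borel_measurable borel" and a: "0 \<le> a" "a + c \<le> d"
  shows "orlicz_norm \<beta> {0..c} (\<lambda>r. g (a + r)) \<le> orlicz_norm \<beta> {0..d} g"
proof (rule orlicz_norm_transfer[where D' = "{0..d}" and g' = g])
  show "0 < \<beta>" by fact
next
  show "0 \<le> g r" for r by (rule g)
next
  fix l :: real assume l: "0 < l"
  have [measurable]: "(\<lambda>r. orlicz_Phi \<beta> (g r / l)) \<in> borel_measurable borel"
    using g l by (auto intro!: orlicz_Phi_measurable \<beta>)
  have "(\<integral>\<^sup>+r\<in>{0..d}. ennreal (orlicz_Phi \<beta> (g r / l)) \<partial>lborel)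
     = (\<integral>\<^sup>+r. ennreal (orlicz_Phi \<beta> (g (a + r) / l)) * indicator {0..d} (a + r) \<partial>lborel)"
    using nn_integral_real_affine[of "\<lambda>r. ennreal (orlicz_Phi \<beta> (g r / l)) * indicator {0..d} r" 1 a]
    by simp
  moreover have "(\<integral>\<^sup>+r\<in>{0..c}. ennreal (orlicz_Phi \<beta> (g (a + r) / l)) \<partial>lborel) \<le>
      (\<integral>\<^sup>+r. ennreal (orlicz_Phi \<beta> (g (a + r) / l)) * indicator {0..d} (a + r) \<partial>lborel)"
  proof (rule nn_integral_mono)
    fix r
    show "ennreal (orlicz_Phi \<beta> (g (a + r) / l)) * indicator {0..c} r
        \<le> ennreal (orlicz_Phi \<beta> (g (a + r) / l)) * indicator {0..d} (a + r)"
      using a by (cases "r \<in> {0..c}") (auto simp: indicator_def)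
  qed
  ultimately show "(\<integral>\<^sup>+r\<in>{0..c}. ennreal (orlicz_Phi \<beta> (g (a + r) / l)) \<partial>lborel)
      \<le> (\<integral>\<^sup>+r\<in>{0..d}. ennreal (orlicz_Phi \<beta> (g r / l)) \<partial>lborel)"
    by simp
qed

section \<open>Comparison of Luxemburg norms for different Young functions\<close>

lemma orlicz_integral_affine:
  assumes \<beta>: "0 < \<beta>2" "0 < l" and D [measurable]: "D \<in> sets borel" and d: "emeasure lborel D \<le> ennreal d" "0 \<le> d"
    and g: "g \<in> borel_measurable borel" "\<And>r. 0 \<le> g r" and AB: "0 \<le> A" "0 \<le> B"
    and le: "AE r in lborel. r \<in> D \<longrightarrow> f r \<le> A + B * orlicz_Phi \<beta>2 (g r / l)"
    and int: "(\<integral>\<^sup>+r\<in>D. ennreal (orlicz_Phi \<beta>2 (g r / l)) \<partial>lborel) \<le> 1"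
  shows "(\<integral>\<^sup>+r\<in>D. ennreal (f r) \<partial>lborel) \<le> ennreal (A * d + B)"
proof -
  have [measurable]: "(\<lambda>r. orlicz_Phi \<beta>2 (g r / l)) \<in> borel_measurable borel"
    using g \<beta> by (auto intro!: orlicz_Phi_measurable)
  have "(\<integral>\<^sup>+r\<in>D. ennreal (f r) \<partial>lborel)
      \<le> (\<integral>\<^sup>+r. ennreal A * indicator D r
            + ennreal B * (ennreal (orlicz_Phi \<beta>2 (g r / l)) * indicator D r) \<partial>lborel)"
  proof (rule nn_integral_mono_AE, use le in eventually_elim)
    case (elim r)
    have P: "0 \<le> orlicz_Phi \<beta>2 (g r / l)"
      using g \<beta> by (auto intro!: orlicz_Phi_nonneg)
    show ?case
    proof (cases "r \<in> D")
      case True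
      then have "ennreal (f r) \<le> ennreal (A + B * orlicz_Phi \<beta>2 (g r / l))"
        using elim by (intro ennreal_leI) auto
      then show ?thesis
        using True AB P by (simp add: ennreal_mult)
    qed simp
  qed
  also have "\<dots> = ennreal A * emeasure lborel D
      + ennreal B * (\<integral>\<^sup>+r\<in>D. ennreal (orlicz_Phi \<beta>2 (g r / l)) \<partial>lborel)"
    by (simp add: nn_integral_add nn_integral_cmult)
  also have "\<dots> \<le> ennreal A * ennreal d + ennreal B * 1"
    by (intro add_mono mult_left_mono d int) auto
  also have "\<dots> = ennreal (A * d + B)"
    using AB d by (simp add: ennreal_mult)
  finally show ?thesis .
qed

text \<open>Since \<open>orlicz_Phi \<beta> (x / c) \<le> orlicz_Phi \<beta> x / c\<close> by
  convexity, an integral bounded by \<open>c \<ge> 1\<close> instead of \<open>1\<close> costs only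
  the factor \<open>c\<close> in the level.\<close>

lemma orlicz_norm_le_of_integral:
  assumes \<beta>: "0 < \<beta>" and l: "0 < l" and c: "1 \<le> c" and D [measurable]: "D \<in> sets borel"
    and g: "g \<in> borel_measurable borel" "\<And>r. 0 \<le> g r"
    and int: "(\<integral>\<^sup>+r\<in>D. ennreal (orlicz_Phi \<beta> (g r / l)) \<partial>lborel) \<le> ennreal c"
  shows "orlicz_norm \<beta> D g \<le> ennreal (c * l)"
proof (rule orlicz_norm_le)
  show "0 < c * l" using l c by simp
  have [measurable]: "(\<lambda>r. orlicz_Phi \<beta> (g r / l)) \<in> borel_measurable borel"
    using g \<beta> l by (auto intro!: orlicz_Phi_measurable)
  have "(\<integral>\<^sup>+r\<in>D. ennreal (orlicz_Phi \<beta> (g r / (c * l))) \<partial>lborel)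
      \<le> (\<integral>\<^sup>+r. ennreal (1 / c) * (ennreal (orlicz_Phi \<beta> (g r / l)) * indicator D r) \<partial>lborel)"
  proof (rule nn_integral_mono)
    fix r
    have "orlicz_Phi \<beta> (g r / l / c) \<le> orlicz_Phi \<beta> (g r / l) / c"
      using g \<beta> l c by (intro orlicz_Phi_divide) auto
    then have "ennreal (orlicz_Phi \<beta> (g r / (c * l))) \<le> ennreal (1 / c * orlicz_Phi \<beta> (g r / l))"
      by (intro ennreal_leI) (simp add: mult.commute)
    also have "\<dots> = ennreal (1 / c) * ennreal (orlicz_Phi \<beta> (g r / l))"
      using g \<beta> l c orlicz_Phi_nonneg[of \<beta> "g r / l"] by (intro ennreal_mult) auto
    finally show "ennreal (orlicz_Phi \<beta> (g r / (c * l))) * indicator D r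
        \<le> ennreal (1 / c) * (ennreal (orlicz_Phi \<beta> (g r / l)) * indicator D r)"
      by (cases "r \<in> D") simp_all
  qed
  also have "\<dots> = ennreal (1 / c) * (\<integral>\<^sup>+r\<in>D. ennreal (orlicz_Phi \<beta> (g r / l)) \<partial>lborel)"
    by (simp add: nn_integral_cmult)
  also have "\<dots> \<le> ennreal (1 / c) * ennreal c"
    by (intro mult_left_mono int) auto
  also have "\<dots> = 1"
    using c by (simp flip: ennreal_mult)
  finally show "(\<integral>\<^sup>+r\<in>D. ennreal (orlicz_Phi \<beta> (g r / (c * l))) \<partial>lborel) \<le> 1" .
qed

text \<open>\<open>A\<close> and \<open>B\<close> are obtained before the set and the function, so
  they depend on the exponents only. The length of the interval enters separately through
  \<open>d\<close>, which keeps the dependence on \<open>T\<close> explicit.\<close>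

lemma orlicz_norm_compare:
  assumes "0 < \<beta>'" "\<beta>' \<le> \<beta>"
  obtains A B where "1 \<le> A" "1 \<le> B"
    "\<And>D d g. \<lbrakk>D \<in> sets borel; emeasure lborel D \<le> ennreal d; 0 \<le> d; g \<in> borel_measurable borel; \<And>r. 0 \<le> g r\<rbrakk>
      \<Longrightarrow> orlicz_norm \<beta>' D g \<le> ennreal (A * d + B) * orlicz_norm \<beta> D g"
proof -
  have \<beta>: "0 < \<beta>" using assms by simp
  obtain A B where AB: "1 \<le> A" "1 \<le> B" "\<And>x. 0 \<le> x \<Longrightarrow> orlicz_Phi \<beta>' x \<le> A + B * orlicz_Phi \<beta> x"
    using orlicz_Phi_compare[OF assms] by blast
  have "orlicz_norm \<beta>' D g \<le> ennreal (A * d + B) * orlicz_norm \<beta> D g"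
    if D: "D \<in> sets borel" and d: "emeasure lborel D \<le> ennreal d" "0 \<le> d"
      and g: "g \<in> borel_measurable borel" "\<And>r. 0 \<le> g r" for D d g
  proof (rule orlicz_norm_leI)
    have "0 \<le> A * d"
      using AB d by simp
    then show "0 < A * d + B"
      using AB by linarith
    fix l :: real assume l: "0 < l" "(\<integral>\<^sup>+r\<in>D. ennreal (orlicz_Phi \<beta> (g r / l)) \<partial>lborel) \<le> 1"
    have "(\<integral>\<^sup>+r\<in>D. ennreal (orlicz_Phi \<beta>' (g r / l)) \<partial>lborel) \<le> ennreal (A * d + B)"
      using AB l g by (intro orlicz_integral_affine[OF \<beta> l(1) D d g _ _ _ l(2)]) auto
    then show "orlicz_norm \<beta>' D g \<le> ennreal ((A * d + B) * l)"
      using AB \<open>0 \<le> A * d\<close> by (intro orlicz_norm_le_of_integral assms(1) l D g) auto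
  qed (use \<beta> g in auto)
  then show thesis
    using that[OF AB(1,2)] by blast
qed

text \<open>With \<open>\<theta> = \<beta>2 / \<beta>1\<close>, write
  \<open>g = g powr \<theta> * g powr (1 - \<theta>)\<close> and bound the second factor by the
  supremum. What remains is a \<open>\<theta>\<close>-th power, whose exponential for
  \<open>\<beta>1\<close> is the exponential of \<open>g\<close> for
  \<open>\<beta>2\<close>.\<close>

lemma orlicz_norm_interpolation:
  assumes "0 < \<beta>2" "\<beta>2 < \<beta>1"
  obtains A where "1 \<le> A"
    "\<And>D d g s \<mu>. \<lbrakk>D \<in> sets borel; emeasure lborel D \<le> ennreal d; 0 \<le> d; g \<in> borel_measurable borel; \<And>r. 0 \<le> g r;
        0 < s; AE r in lborel. r \<in> D \<longrightarrow> g r \<le> s; 0 < \<mu>; orlicz_norm \<beta>2 D g \<le> ennreal \<mu>\<rbrakk>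
      \<Longrightarrow> orlicz_norm \<beta>1 D g \<le> ennreal ((A * d + 1) * (2 * \<mu> powr (\<beta>2 / \<beta>1) * s powr (1 - \<beta>2 / \<beta>1)))"
proof -
  have \<beta>1: "0 < \<beta>1" using assms by simp
  define \<theta> where "\<theta> = \<beta>2 / \<beta>1"
  have \<theta>: "0 < \<theta>" "\<theta> < 1" using assms by (auto simp: \<theta>_def)
  obtain A where A: "1 \<le> A" "\<And>x. 0 \<le> x \<Longrightarrow> orlicz_Phi \<beta>1 (x powr \<theta>) \<le> A + 1 * orlicz_Phi \<beta>2 x"
    using orlicz_Phi_power_compare[OF assms(1) \<beta>1] unfolding \<theta>_def by blast
  have "orlicz_norm \<beta>1 D g \<le> ennreal ((A * d + 1) * (2 * \<mu> powr \<theta> * s powr (1 - \<theta>)))"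
    if D: "D \<in> sets borel" and d: "emeasure lborel D \<le> ennreal d" "0 \<le> d"
      and g: "g \<in> borel_measurable borel" "\<And>r. 0 \<le> g r"
      and s: "0 < s" "AE r in lborel. r \<in> D \<longrightarrow> g r \<le> s"
      and \<mu>: "0 < \<mu>" "orlicz_norm \<beta>2 D g \<le> ennreal \<mu>" for D d g s \<mu>
  proof (rule orlicz_norm_le_of_integral)
    define l where "l = 2 * \<mu> powr \<theta> * s powr (1 - \<theta>)"
    show l0: "0 < 2 * \<mu> powr \<theta> * s powr (1 - \<theta>)"
      using s \<mu> by simp
    show "1 \<le> A * d + 1"
      using A d by simp
    \<comment> \<open>Doubling \<open>\<mu>\<close> produces the strict inequality that makes the
      level admissible. As \<open>2 powr \<theta> \<le> 2\<close>, the factor \<open>2\<close> in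
      the conclusion pays for it.\<close>
    have "orlicz_norm \<beta>2 D g < ennreal (2 * \<mu>)"
      using \<mu> by (auto intro: le_less_trans simp: ennreal_less_iff)
    note int = orlicz_integral_le(2)[OF assms(1) g(2) this]
    have *: "g r / l \<le> (g r / (2 * \<mu>)) powr \<theta>" if "g r \<le> s" for r
    proof (cases "g r = 0")
      case False
      then have gr: "0 < g r" using g(2)[of r] by simp
      have "g r = g r powr \<theta> * g r powr (1 - \<theta>)"
        using gr by (simp flip: powr_add)
      also have "\<dots> \<le> g r powr \<theta> * s powr (1 - \<theta>)"
        using gr that \<theta> by (intro mult_left_mono powr_mono2) auto
      finally have "g r \<le> g r powr \<theta> * s powr (1 - \<theta>)" .
      then have "g r / l \<le> g r powr \<theta> * s powr (1 - \<theta>) / l"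
        by (rule divide_right_mono) (use l0 in \<open>simp add: l_def\<close>)
      also have "\<dots> = g r powr \<theta> / (2 * \<mu> powr \<theta>)"
      proof -
        have "s powr (1 - \<theta>) \<noteq> 0"
          using s(1) by simp
        then show ?thesis
          unfolding l_def by simp
      qed
      also have "\<dots> \<le> g r powr \<theta> / (2 powr \<theta> * \<mu> powr \<theta>)"
      proof -
        have "2 powr \<theta> \<le> (2::real) powr 1"
          using \<theta> by (intro powr_mono) auto
        then show ?thesis
          using \<mu> by (intro divide_left_mono mult_right_mono) auto
      qed
      finally show ?thesis
        using gr \<mu> by (simp add: powr_divide powr_mult)
    qed simp
    have "AE r in lborel. r \<in> D \<longrightarrow> orlicz_Phi \<beta>1 (g r / l) \<le> A + 1 * orlicz_Phi \<beta>2 (g r / (2 * \<mu>))"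
      using s(2)
    proof eventually_elim
      case (elim r)
      show ?case
      proof
        assume "r \<in> D"
        then have "orlicz_Phi \<beta>1 (g r / l) \<le> orlicz_Phi \<beta>1 ((g r / (2 * \<mu>)) powr \<theta>)"
          using elim * l0 g(2) by (intro orlicz_Phi_mono \<beta>1) (auto simp: l_def)
        also have "\<dots> \<le> A + 1 * orlicz_Phi \<beta>2 (g r / (2 * \<mu>))"
          using g(2) \<mu> by (intro A) auto
        finally show "orlicz_Phi \<beta>1 (g r / l) \<le> A + 1 * orlicz_Phi \<beta>2 (g r / (2 * \<mu>))" .
      qed
    qed
    then show "(\<integral>\<^sup>+r\<in>D. ennreal (orlicz_Phi \<beta>1 (g r / (2 * \<mu> powr \<theta> * s powr (1 - \<theta>)))) \<partial>lborel) \<le> ennreal (A * d + 1)"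
      using A \<mu> unfolding l_def by (intro orlicz_integral_affine[OF assms(1) _ D d g _ _ _ int]) auto
  qed (use \<beta>1 D g in auto)
  then show thesis
    using that[OF A(1)] unfolding \<theta>_def by blast
qed

text \<open>Integrate \<open>x \<le> k + k\<^bsup>1-p\<^esup> x\<^bsup>p\<^esup>\<close>.\<close>

lemma orlicz_norm_mean_bound:
  assumes \<beta>: "0 < \<beta>" and p: "1 \<le> p"
  obtains A B where "1 \<le> A" "1 \<le> B"
    "\<And>D W w k g. \<lbrakk>W \<in> sets borel; W \<subseteq> D; emeasure lborel W \<le> ennreal w; 0 \<le> w; 0 < k;
        g \<in> borel_measurable borel; \<And>r. 0 \<le> g r\<rbrakk>
      \<Longrightarrow> (\<integral>\<^sup>+r\<in>W. ennreal (g r) \<partial>lborel) \<le> ennreal ((k + k powr (1 - p) * A) * w + k powr (1 - p) * B) * orlicz_norm \<beta> D g"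
proof -
  obtain A B where AB: "1 \<le> A" "1 \<le> B" "\<And>x. 0 \<le> x \<Longrightarrow> x powr p \<le> A + B * orlicz_Phi \<beta> x"
    using orlicz_Phi_dominates_powr[OF \<beta>, of p] p by auto
  have "(\<integral>\<^sup>+r\<in>W. ennreal (g r) \<partial>lborel) \<le> ennreal ((k + k powr (1 - p) * A) * w + k powr (1 - p) * B) * orlicz_norm \<beta> D g"
    if W [measurable]: "W \<in> sets borel" and WD: "W \<subseteq> D" and w: "emeasure lborel W \<le> ennreal w" "0 \<le> w" and k: "0 < k"
      and g [measurable]: "g \<in> borel_measurable borel" and g0: "\<And>r. 0 \<le> g r" for D W w k g
  proof (rule orlicz_norm_leI)
    let ?C = "(k + k powr (1 - p) * A) * w + k powr (1 - p) * B"
    have "0 \<le> (k + k powr (1 - p) * A) * w"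
      using AB w k by (intro mult_nonneg_nonneg add_nonneg_nonneg) auto
    moreover have "0 < k powr (1 - p) * B"
      using AB k by simp
    ultimately show "0 < ?C"
      by linarith
    fix l :: real assume l: "0 < l" "(\<integral>\<^sup>+r\<in>D. ennreal (orlicz_Phi \<beta> (g r / l)) \<partial>lborel) \<le> 1"
    have "(\<integral>\<^sup>+r\<in>W. ennreal (orlicz_Phi \<beta> (g r / l)) \<partial>lborel) \<le> (\<integral>\<^sup>+r\<in>D. ennreal (orlicz_Phi \<beta> (g r / l)) \<partial>lborel)"
    proof (rule nn_integral_mono)
      show "ennreal (orlicz_Phi \<beta> (g r / l)) * indicator W r \<le> ennreal (orlicz_Phi \<beta> (g r / l)) * indicator D r" for r
        using WD by (cases "r \<in> W") auto
    qed
    with l have int: "(\<integral>\<^sup>+r\<in>W. ennreal (orlicz_Phi \<beta> (g r / l)) \<partial>lborel) \<le> 1" by simp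
    have pt: "x \<le> k + k powr (1 - p) * x powr p" if x: "0 \<le> x" for x
    proof (cases "x \<le> k")
      case True
      have "0 \<le> k powr (1 - p) * x powr p" by simp
      with True show ?thesis by linarith
    next
      case False
      then have xk: "k \<le> x" "0 < x" using k by auto
      have "1 \<le> (x / k) powr (p - 1)"
        using xk k p by (intro ge_one_powr_ge_zero) auto
      then have "x * 1 \<le> x * (x / k) powr (p - 1)"
        using xk by (intro mult_left_mono) auto
      also have "(x / k) powr (p - 1) = x powr (p - 1) * k powr (1 - p)"
      proof -
        have "(x / k) powr (p - 1) = x powr (p - 1) / k powr (p - 1)"
          by (rule powr_divide)
        also have "\<dots> = x powr (p - 1) * k powr (- (p - 1))"
          by (simp only: powr_minus divide_inverse)
        finally show ?thesis
          by simp
      qed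
      also have "x * (x powr (p - 1) * k powr (1 - p)) = k powr (1 - p) * x powr p"
      proof -
        have "x * x powr (p - 1) = x powr p"
          using xk by (simp add: powr_mult_base)
        then show ?thesis
          by (metis mult.assoc mult.commute)
      qed
      finally show ?thesis
        using k by simp
    qed
    have "g r / l \<le> (k + k powr (1 - p) * A) + (k powr (1 - p) * B) * orlicz_Phi \<beta> (g r / l)" for r
    proof -
      have gr: "0 \<le> g r / l" using g0 l by simp
      have "k powr (1 - p) * (g r / l) powr p \<le> k powr (1 - p) * (A + B * orlicz_Phi \<beta> (g r / l))"
        by (intro mult_left_mono AB gr) auto
      with pt[OF gr] show ?thesis
        by (simp add: algebra_simps)
    qed
    then have "(\<integral>\<^sup>+r\<in>W. ennreal (g r / l) \<partial>lborel) \<le> ennreal ?C"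
      using AB k by (intro orlicz_integral_affine[OF \<beta> l(1) W w g g0 _ _ _ int]) auto
    then have "ennreal l * (\<integral>\<^sup>+r\<in>W. ennreal (g r / l) \<partial>lborel) \<le> ennreal l * ennreal ?C"
      by (intro mult_left_mono) auto
    also have "ennreal l * (\<integral>\<^sup>+r\<in>W. ennreal (g r / l) \<partial>lborel) = (\<integral>\<^sup>+r. ennreal l * (ennreal (g r / l) * indicator W r) \<partial>lborel)"
      by (simp add: nn_integral_cmult)
    also have "\<dots> = (\<integral>\<^sup>+r\<in>W. ennreal (g r) \<partial>lborel)"
      using l g0 by (intro nn_integral_cong) (simp flip: mult.assoc ennreal_mult)
    also have "ennreal l * ennreal ?C = ennreal (?C * l)"
      using l \<open>0 < ?C\<close> by (simp add: mult.commute flip: ennreal_mult)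
    finally show "(\<integral>\<^sup>+r\<in>W. ennreal (g r) \<partial>lborel) \<le> ennreal (?C * l)" .
  qed (use \<beta> g0 in auto)
  then show thesis
    using that[OF AB(1,2)] by blast
qed

subsection \<open>Weighted integrability over scales\<close>

lemma ennreal_powr_0 [simp]: "ennreal_powr 0 a = 0"
  by (simp add: ennreal_powr_def)

lemma ennreal_powr_top [simp]: "ennreal_powr top a = top"
  by (simp add: ennreal_powr_def)

lemma ennreal_powr_ennreal: "0 \<le> x \<Longrightarrow> ennreal_powr (ennreal x) a = ennreal (x powr a)"
  by (simp add: ennreal_powr_def)

lemma ennreal_powr_one [simp]: "ennreal_powr x 1 = x"
  by (cases x) (auto simp: ennreal_powr_ennreal)

lemma ennreal_powr_mono: "0 \<le> a \<Longrightarrow> x \<le> y \<Longrightarrow> ennreal_powr x a \<le> ennreal_powr y a"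
  by (cases x; cases y) (auto simp: ennreal_powr_ennreal top_unique powr_mono2 intro!: ennreal_leI)

lemma ennreal_powr_mult: "0 < a \<Longrightarrow> ennreal_powr (x * y) a = ennreal_powr x a * ennreal_powr y a"
proof (cases x; cases y)
  fix r s assume "x = ennreal r" "0 \<le> r" "y = ennreal s" "0 \<le> s"
  then show ?thesis
    by (simp add: ennreal_powr_ennreal powr_mult flip: ennreal_mult)
qed (auto simp: ennreal_powr_ennreal ennreal_mult_top ennreal_top_mult)

lemma ennreal_powr_powr: "ennreal_powr (ennreal_powr x a) b = ennreal_powr x (a * b)"
  by (cases x) (auto simp: ennreal_powr_ennreal powr_powr)

lemma ennreal_powr_inverse: "0 < a \<Longrightarrow> ennreal_powr (ennreal_powr x a) (1 / a) = x"
  by (simp add: ennreal_powr_powr)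

lemma ennreal_powr_inverse': "0 < a \<Longrightarrow> ennreal_powr (ennreal_powr x (1 / a)) a = x"
  by (simp add: ennreal_powr_powr)

lemma ennreal_powr_add_exponent:
  "0 < a \<Longrightarrow> 0 < b \<Longrightarrow> ennreal_powr x (a + b) = ennreal_powr x a * ennreal_powr x b"
  by (cases x) (auto simp: ennreal_powr_ennreal powr_add ennreal_mult ennreal_mult_top)

text \<open>The sum is at most twice the maximum, which serves small and large exponents
  alike.\<close>

lemma ennreal_powr_add_le:
  assumes "0 < a"
  shows "ennreal_powr (x + y) a \<le> ennreal (2 powr a) * (ennreal_powr x a + ennreal_powr y a)"
proof -
  have "ennreal_powr (x + y) a \<le> ennreal_powr (ennreal 2 * max x y) a"
    using assms by (intro ennreal_powr_mono) (auto simp: mult_2 intro!: add_mono)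
  also have "\<dots> = ennreal (2 powr a) * ennreal_powr (max x y) a"
    using assms by (simp add: ennreal_powr_mult ennreal_powr_ennreal del: ennreal_numeral)
  also have "\<dots> \<le> ennreal (2 powr a) * (ennreal_powr x a + ennreal_powr y a)"
    by (intro mult_left_mono) (auto simp: max_def)
  finally show ?thesis .
qed

lemma ennreal_powr_measurable [measurable (raw)]:
  assumes [measurable]: "f \<in> borel_measurable M"
  shows "(\<lambda>x. ennreal_powr (f x) a) \<in> borel_measurable M"
  unfolding ennreal_powr_def by measurable

text \<open>Superlevel sets of a monotone function are intervals. All moduli are suprema over
  uncountable families and owe their measurability in the scale to this.\<close>

lemma mono_ennreal_borel_measurable:
  fixes F :: "real \<Rightarrow> ennreal"
  assumes "mono F"
  shows "F \<in> borel_measurable borel"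
proof (rule borel_measurableI_greater)
  fix y
  have "is_interval {x. y < F x}"
    unfolding is_interval_1 using monoD[OF assms] by (auto intro: less_le_trans)
  then show "{x \<in> space borel. y < F x} \<in> sets borel"
    by (simp add: real_interval_borel_measurable)
qed

lemma log_measure_sets: "sets (log_measure T) = sets (restrict_space lborel {0..T})"
  by (simp add: log_measure_def)

lemma log_measure_borel_measurable:
  "F \<in> borel_measurable borel \<Longrightarrow> F \<in> borel_measurable (log_measure T)"
  by (subst measurable_cong_sets[OF log_measure_sets refl]) (simp add: measurable_restrict_space1)

text \<open>The density \<open>1 / \<tau>\<close> vanishes at \<open>\<tau> = 0\<close> by the
  convention for division, so the null sets are those of Lebesgue measure on
  \<open>0 < \<tau> \<le> T\<close>.\<close>

lemma log_measure_AE: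
  assumes "AE \<tau> in lborel. 0 < \<tau> \<and> \<tau> \<le> T \<longrightarrow> P \<tau>"
  shows "AE \<tau> in log_measure T. P \<tau>"
proof -
  have [measurable]: "(\<lambda>\<tau>. ennreal (1 / \<tau>)) \<in> borel_measurable (restrict_space lborel {0..T})"
    by (intro measurable_restrict_space1) measurable
  show ?thesis
    unfolding log_measure_def
    by (subst AE_density, measurable, subst AE_restrict_space_iff)
       (use assms in \<open>auto elim!: eventually_mono\<close>)
qed

lemma log_measure_AE_D:
  assumes "AE \<tau> in log_measure T. P \<tau>"
  shows "AE \<tau> in lborel. 0 < \<tau> \<and> \<tau> \<le> T \<longrightarrow> P \<tau>"
proof -
  have m: "(\<lambda>\<tau>. ennreal (1 / \<tau>)) \<in> borel_measurable (restrict_space lborel {0..T})"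
    by (intro measurable_restrict_space1) measurable
  have "AE x in restrict_space lborel {0..T}. 0 < ennreal (1 / x) \<longrightarrow> P x"
    using assms unfolding log_measure_def AE_density[OF m] .
  then have "AE x in lborel. x \<in> {0..T} \<longrightarrow> 0 < ennreal (1 / x) \<longrightarrow> P x"
    by (subst (asm) AE_restrict_space_iff) auto
  then show ?thesis
    by eventually_elim auto
qed

definition log_integral :: "real \<Rightarrow> real \<Rightarrow> (real \<Rightarrow> ennreal) \<Rightarrow> ennreal" where
  "log_integral T q F = (\<integral>\<^sup>+\<tau>. ennreal_powr (F \<tau>) q * (ennreal (1 / \<tau>) * indicator {0<..T} \<tau>) \<partial>lborel)"

lemma Lq_log_norm_finite:
  assumes [measurable]: "F \<in> borel_measurable borel" and "q \<noteq> \<infinity>"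
  shows "Lq_log_norm T q F = ennreal_powr (log_integral T (enn2real q) F) (1 / enn2real q)"
proof -
  have m: "(\<lambda>\<tau>. ennreal (1 / \<tau>)) \<in> borel_measurable (restrict_space lborel {0..T})"
    by (intro measurable_restrict_space1) measurable
  have "(\<integral>\<^sup>+\<tau>. ennreal_powr (F \<tau>) (enn2real q) \<partial>log_measure T)
     = (\<integral>\<^sup>+\<tau>. ennreal (1 / \<tau>) * ennreal_powr (F \<tau>) (enn2real q) * indicator {0..T} \<tau> \<partial>lborel)"
    unfolding log_measure_def
    by (subst nn_integral_density[OF m]) (auto simp: nn_integral_restrict_space intro!: measurable_restrict_space1)
  also have "\<dots> = log_integral T (enn2real q) F"
    unfolding log_integral_def
  proof (rule nn_integral_cong)
    fix \<tau>
    show "ennreal (1 / \<tau>) * ennreal_powr (F \<tau>) (enn2real q) * indicator {0..T} \<tau>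
        = ennreal_powr (F \<tau>) (enn2real q) * (ennreal (1 / \<tau>) * indicator {0<..T} \<tau>)"
      by (cases "\<tau> = 0") (auto simp: indicator_def mult_ac)
  qed
  finally show ?thesis
    using assms(2) by (simp add: Lq_log_norm_def)
qed

lemma Lq_log_norm_top: "Lq_log_norm T \<infinity> F = esssup (log_measure T) F"
  by (simp add: Lq_log_norm_def)

lemma Lq_log_norm_top_le:
  assumes "F \<in> borel_measurable borel" "AE \<tau> in lborel. 0 < \<tau> \<and> \<tau> \<le> T \<longrightarrow> F \<tau> \<le> c"
  shows "Lq_log_norm T \<infinity> F \<le> c"
  unfolding Lq_log_norm_top
  by (intro esssup_I log_measure_borel_measurable log_measure_AE assms)

lemma Lq_log_norm_top_AE:
  "AE \<tau> in lborel. 0 < \<tau> \<and> \<tau> \<le> T \<longrightarrow> F \<tau> \<le> Lq_log_norm T \<infinity> F"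
  unfolding Lq_log_norm_top by (intro log_measure_AE_D esssup_AE)

lemma enn2real_pos: "0 < q \<Longrightarrow> q \<noteq> \<infinity> \<Longrightarrow> 0 < enn2real q"
  by (simp add: enn2real_positive_iff top.not_eq_extremum)

lemma Lq_log_norm_le_finite:
  assumes "F \<in> borel_measurable borel" "0 < q" "q \<noteq> \<infinity>" "log_integral T (enn2real q) F \<le> ennreal_powr c (enn2real q)"
  shows "Lq_log_norm T q F \<le> c"
proof -
  have "Lq_log_norm T q F \<le> ennreal_powr (ennreal_powr c (enn2real q)) (1 / enn2real q)"
    unfolding Lq_log_norm_finite[OF assms(1,3)] using assms enn2real_pos[OF assms(2,3)]
    by (intro ennreal_powr_mono) auto
  then show ?thesis
    using enn2real_pos[OF assms(2,3)] by (simp add: ennreal_powr_inverse)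
qed

lemma log_integral_eq_powr:
  assumes "F \<in> borel_measurable borel" "0 < q" "q \<noteq> \<infinity>"
  shows "log_integral T (enn2real q) F = ennreal_powr (Lq_log_norm T q F) (enn2real q)"
  unfolding Lq_log_norm_finite[OF assms(1,3)] using enn2real_pos[OF assms(2,3)]
  by (simp add: ennreal_powr_inverse')

lemma log_integral_mono:
  assumes "0 \<le> q" "\<And>\<tau>. 0 < \<tau> \<Longrightarrow> \<tau> \<le> T \<Longrightarrow> F \<tau> \<le> G \<tau>"
  shows "log_integral T q F \<le> log_integral T q G"
  unfolding log_integral_def
proof (rule nn_integral_mono)
  fix \<tau>
  show "ennreal_powr (F \<tau>) q * (ennreal (1 / \<tau>) * indicator {0<..T} \<tau>)
      \<le> ennreal_powr (G \<tau>) q * (ennreal (1 / \<tau>) * indicator {0<..T} \<tau>)"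
    using assms by (cases "\<tau> \<in> {0<..T}") (auto intro!: mult_right_mono ennreal_powr_mono)
qed

lemma log_integral_cmult:
  assumes "0 < q" and [measurable]: "F \<in> borel_measurable borel"
  shows "log_integral T q (\<lambda>\<tau>. c * F \<tau>) = ennreal_powr c q * log_integral T q F"
proof -
  have "log_integral T q (\<lambda>\<tau>. c * F \<tau>)
      = (\<integral>\<^sup>+\<tau>. ennreal_powr c q * (ennreal_powr (F \<tau>) q * (ennreal (1 / \<tau>) * indicator {0<..T} \<tau>)) \<partial>lborel)"
    unfolding log_integral_def using assms(1)
    by (intro nn_integral_cong) (simp add: ennreal_powr_mult mult.assoc)
  also have "\<dots> = ennreal_powr c q * log_integral T q F"
    unfolding log_integral_def by (rule nn_integral_cmult) measurable
  finally show ?thesis .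
qed

lemma Lq_log_norm_mono:
  assumes "0 < q" "F \<in> borel_measurable borel" "G \<in> borel_measurable borel"
    and "\<And>\<tau>. 0 < \<tau> \<Longrightarrow> \<tau> \<le> T \<Longrightarrow> F \<tau> \<le> G \<tau>"
  shows "Lq_log_norm T q F \<le> Lq_log_norm T q G"
proof (cases "q = \<infinity>")
  case True
  have "AE \<tau> in lborel. 0 < \<tau> \<and> \<tau> \<le> T \<longrightarrow> F \<tau> \<le> Lq_log_norm T \<infinity> G"
    using Lq_log_norm_top_AE[of T G] by eventually_elim (use assms(4) in \<open>auto intro: order_trans\<close>)
  then show ?thesis
    using True assms(2) by (simp only: Lq_log_norm_top_le)
next
  case False
  have "log_integral T (enn2real q) F \<le> log_integral T (enn2real q) G"
    by (intro log_integral_mono assms) auto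
  then show ?thesis
    using False assms by (intro Lq_log_norm_le_finite) (auto simp: log_integral_eq_powr)
qed

lemma Lq_log_norm_cmult_le:
  assumes "0 < q" and F [measurable]: "F \<in> borel_measurable borel"
  shows "Lq_log_norm T q (\<lambda>\<tau>. c * F \<tau>) \<le> c * Lq_log_norm T q F"
proof (cases "q = \<infinity>")
  case True
  have "AE \<tau> in lborel. 0 < \<tau> \<and> \<tau> \<le> T \<longrightarrow> c * F \<tau> \<le> c * Lq_log_norm T \<infinity> F"
    using Lq_log_norm_top_AE[of T F] by eventually_elim (auto intro: mult_left_mono)
  then have "Lq_log_norm T \<infinity> (\<lambda>\<tau>. c * F \<tau>) \<le> c * Lq_log_norm T \<infinity> F"
    by (intro Lq_log_norm_top_le) auto
  then show ?thesis
    using True by simp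
next
  case False
  have "log_integral T (enn2real q) (\<lambda>\<tau>. c * F \<tau>) \<le> ennreal_powr (c * Lq_log_norm T q F) (enn2real q)"
    using assms False enn2real_pos[OF assms(1) False]
    by (simp add: log_integral_cmult ennreal_powr_mult log_integral_eq_powr)
  then show ?thesis
    using False assms by (intro Lq_log_norm_le_finite) auto
qed

text \<open>A quasi-norm constant appears because \<open>q < 1\<close> is allowed. For
  \<open>q = \<infinity>\<close> the convention \<open>1 / 0 = 0\<close> reduces it to
  \<open>2\<close>, so that one formula serves all exponents.\<close>

lemma Lq_log_norm_add_le:
  assumes "0 < q" and [measurable]: "F \<in> borel_measurable borel" "G \<in> borel_measurable borel"
  shows "Lq_log_norm T q (\<lambda>\<tau>. F \<tau> + G \<tau>)
      \<le> ennreal (2 * 2 powr (1 / enn2real q)) * (Lq_log_norm T q F + Lq_log_norm T q G)"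
proof (cases "q = \<infinity>")
  case True
  have "Lq_log_norm T \<infinity> (\<lambda>\<tau>. F \<tau> + G \<tau>) \<le> Lq_log_norm T \<infinity> F + Lq_log_norm T \<infinity> G"
    by (rule Lq_log_norm_top_le, measurable)
      (use Lq_log_norm_top_AE[of T F] Lq_log_norm_top_AE[of T G] in eventually_elim, auto intro: add_mono)
  also have "\<dots> \<le> ennreal 2 * (Lq_log_norm T \<infinity> F + Lq_log_norm T \<infinity> G)"
    by (simp add: mult_2)
  finally show ?thesis
    using True by simp
next
  case False
  define p where "p = enn2real q"
  have p: "0 < p" using enn2real_pos[OF assms(1) False] by (simp add: p_def)
  define N where "N = Lq_log_norm T q F + Lq_log_norm T q G"
  have "log_integral T p (\<lambda>\<tau>. F \<tau> + G \<tau>)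
      \<le> (\<integral>\<^sup>+\<tau>. ennreal (2 powr p) * (ennreal_powr (F \<tau>) p * (ennreal (1 / \<tau>) * indicator {0<..T} \<tau>)
          + ennreal_powr (G \<tau>) p * (ennreal (1 / \<tau>) * indicator {0<..T} \<tau>)) \<partial>lborel)"
    unfolding log_integral_def
  proof (rule nn_integral_mono)
    fix \<tau>
    have "ennreal_powr (F \<tau> + G \<tau>) p * (ennreal (1 / \<tau>) * indicator {0<..T} \<tau>)
        \<le> ennreal (2 powr p) * (ennreal_powr (F \<tau>) p + ennreal_powr (G \<tau>) p) * (ennreal (1 / \<tau>) * indicator {0<..T} \<tau>)"
      by (intro mult_right_mono ennreal_powr_add_le p) auto
    then show "ennreal_powr (F \<tau> + G \<tau>) p * (ennreal (1 / \<tau>) * indicator {0<..T} \<tau>)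
      \<le> ennreal (2 powr p) * (ennreal_powr (F \<tau>) p * (ennreal (1 / \<tau>) * indicator {0<..T} \<tau>)
          + ennreal_powr (G \<tau>) p * (ennreal (1 / \<tau>) * indicator {0<..T} \<tau>))"
      by (simp add: distrib_right mult.assoc)
  qed
  also have "\<dots> = ennreal (2 powr p) * (log_integral T p F + log_integral T p G)"
    unfolding log_integral_def by (subst nn_integral_cmult, measurable, subst nn_integral_add) auto
  also have "\<dots> \<le> ennreal (2 powr p) * (ennreal_powr N p + ennreal_powr N p)"
    using False assms p unfolding p_def N_def
    by (intro mult_left_mono add_mono) (auto simp: log_integral_eq_powr intro!: ennreal_powr_mono)
  also have "\<dots> = ennreal_powr (ennreal (2 * 2 powr (1 / p)) * N) p"
  proof -
    have "ennreal_powr (ennreal (2 * 2 powr (1 / p))) p = ennreal (2 powr p * 2)"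
      using p by (simp add: ennreal_powr_ennreal powr_mult powr_powr)
    moreover have "ennreal_powr N p + ennreal_powr N p = ennreal 2 * ennreal_powr N p"
      by (simp add: mult_2)
    moreover have "ennreal (2 powr p * 2) = ennreal (2 powr p) * ennreal 2"
      by (rule ennreal_mult) auto
    ultimately show ?thesis
      using p by (simp only: ennreal_powr_mult mult.assoc)
  qed
  finally show ?thesis
    using False assms unfolding p_def N_def by (intro Lq_log_norm_le_finite) auto
qed

text \<open>The constant is the same for both cases because \<open>1 / enn2real \<infinity> = 0\<close>.\<close>

definition embedding_const :: "real \<Rightarrow> ennreal \<Rightarrow> real" where
  "embedding_const a q = (4 / 3) powr a * 4 powr (1 / enn2real q)"

lemma embedding_const_ge_1: "0 \<le> a \<Longrightarrow> 1 \<le> embedding_const a q"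
proof -
  assume a: "0 \<le> a"
  have "1 \<le> (4 / 3 :: real) powr a" "1 \<le> (4 :: real) powr (1 / enn2real q)"
    using a by (auto intro!: ge_one_powr_ge_zero)
  then have "1 * 1 \<le> (4 / 3 :: real) powr a * 4 powr (1 / enn2real q)"
    by (intro mult_mono) auto
  then show ?thesis by (simp add: embedding_const_def)
qed

text \<open>Together with monotonicity this recovers bounds at every scale from bounds at almost
  every scale; it also supplies intermediate points and dense sets of generic times.\<close>

lemma mono_AE_point:
  fixes u v :: real
  assumes "AE x in lborel. P x" "u < v"
  obtains x where "u < x" "x < v" "P x"
proof -
  have "\<exists>x. u < x \<and> x < v \<and> P x"
  proof (rule ccontr)
    assume "\<not> ?thesis"
    then have "AE x in lborel. x \<notin> {u<..<v}"
      using assms(1) by (auto elim!: eventually_mono)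
    then have "emeasure lborel {u<..<v} = 0"
      by (subst (asm) AE_iff_measurable[of "{u<..<v}"]) auto
    then show False using assms(2) by simp
  qed
  then show thesis using that by blast
qed

text \<open>Monotonicity spreads the value at \<open>\<tau>\<close> over the interval from
  \<open>\<tau>\<close> to \<open>4 / 3 * \<tau>\<close>, whose logarithmic mass is at least
  \<open>1 / 4\<close>. The growth of the weight over this interval and the mass give the two
  factors of \<open>embedding_const\<close>. The restriction to \<open>3 * T / 4\<close> keeps the
  interval inside the range of integration.\<close>

lemma Lq_log_norm_embedding:
  assumes T: "0 < T" and q: "0 < q" and F: "mono F" and a: "0 \<le> a" and \<tau>: "0 < \<tau>" "\<tau> \<le> 3 * T / 4"
  shows "F \<tau> \<le> ennreal (embedding_const a q * \<tau> powr a) * Lq_log_norm T q (\<lambda>\<tau>. ennreal (\<tau> powr (- a)) * F \<tau>)"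
    (is "_ \<le> _ * ?N")
proof (cases "q = \<infinity>")
  case True
  obtain \<sigma> where \<sigma>: "\<tau> < \<sigma>" "\<sigma> < 4 / 3 * \<tau>" "0 < \<sigma> \<and> \<sigma> \<le> T \<longrightarrow> ennreal (\<sigma> powr (- a)) * F \<sigma> \<le> ?N"
    by (rule mono_AE_point[OF Lq_log_norm_top_AE, of \<tau> "4 / 3 * \<tau>" T "\<lambda>\<tau>. ennreal (\<tau> powr (- a)) * F \<tau>"])
      (use \<tau> True in auto)
  have "F \<tau> \<le> F \<sigma>"
    using F \<sigma> by (intro monoD[OF F]) auto
  also have "F \<sigma> = ennreal (\<sigma> powr a) * (ennreal (\<sigma> powr (- a)) * F \<sigma>)"
    using \<sigma> \<tau> by (simp add: powr_minus flip: mult.assoc ennreal_mult)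
  also have "\<dots> \<le> ennreal (embedding_const a q * \<tau> powr a) * ?N"
  proof (intro mult_mono)
    have "\<sigma> powr a \<le> (4 / 3 * \<tau>) powr a"
      using \<sigma> \<tau> a by (intro powr_mono2) auto
    also have "\<dots> = (4 / 3) powr a * \<tau> powr a"
      by (rule powr_mult)
    finally show "ennreal (\<sigma> powr a) \<le> ennreal (embedding_const a q * \<tau> powr a)"
      using True by (intro ennreal_leI) (simp add: embedding_const_def)
  qed (use \<sigma> \<tau> in auto)
  finally show ?thesis .
next
  case False
  define p where "p = enn2real q"
  have p: "0 < p" using enn2real_pos[OF q False] by (simp add: p_def)
  have [measurable]: "F \<in> borel_measurable borel"
    by (rule mono_ennreal_borel_measurable[OF F])
  define c where "c = (4 / 3 * \<tau>) powr (- a)"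
  have c: "0 < c" using \<tau> by (simp add: c_def)
  \<comment> \<open>The number \<open>1 / 4\<close> is the length \<open>\<tau> / 3\<close> of the
    interval times the smallest value of the density on it,
    \<open>1 / (4 / 3 * \<tau>)\<close>.\<close>
  have "ennreal_powr (ennreal c * F \<tau>) p * ennreal (1 / 4)
      = (\<integral>\<^sup>+\<sigma>. ennreal_powr (ennreal c * F \<tau>) p * ennreal (1 / (4 / 3 * \<tau>)) * indicator {\<tau><..4 / 3 * \<tau>} \<sigma> \<partial>lborel)"
    using \<tau> by (simp add: nn_integral_cmult mult.assoc flip: ennreal_mult)
  also have "\<dots> \<le> log_integral T p (\<lambda>\<tau>. ennreal (\<tau> powr (- a)) * F \<tau>)"
    unfolding log_integral_def
  proof (rule nn_integral_mono)
    fix \<sigma>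
    show "ennreal_powr (ennreal c * F \<tau>) p * ennreal (1 / (4 / 3 * \<tau>)) * indicator {\<tau><..4 / 3 * \<tau>} \<sigma>
        \<le> ennreal_powr (ennreal (\<sigma> powr (- a)) * F \<sigma>) p * (ennreal (1 / \<sigma>) * indicator {0<..T} \<sigma>)"
    proof (cases "\<sigma> \<in> {\<tau><..4 / 3 * \<tau>}")
      case True
      then have \<sigma>: "\<tau> < \<sigma>" "\<sigma> \<le> 4 / 3 * \<tau>" "\<sigma> \<in> {0<..T}"
        using \<tau> by auto
      have "c \<le> \<sigma> powr (- a)"
        using \<sigma> \<tau> a unfolding c_def by (intro powr_mono2') auto
      then have "ennreal_powr (ennreal c * F \<tau>) p \<le> ennreal_powr (ennreal (\<sigma> powr (- a)) * F \<sigma>) p"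
        using \<sigma> p by (intro ennreal_powr_mono mult_mono monoD[OF F] ennreal_leI) auto
      moreover have "ennreal (1 / (4 / 3 * \<tau>)) \<le> ennreal (1 / \<sigma>)"
        using \<sigma> \<tau> by (intro ennreal_leI divide_left_mono) auto
      ultimately show ?thesis
        using \<sigma> True by (auto intro!: mult_mono)
    qed simp
  qed
  also have "\<dots> = ennreal_powr ?N p"
    unfolding p_def by (rule log_integral_eq_powr[OF _ q False]) measurable
  finally have "ennreal_powr (ennreal_powr (ennreal c * F \<tau>) p * ennreal (1 / 4)) (1 / p) \<le> ennreal_powr (ennreal_powr ?N p) (1 / p)"
    using p by (intro ennreal_powr_mono) auto
  then have *: "ennreal c * F \<tau> * ennreal ((1 / 4) powr (1 / p)) \<le> ?N"
    using p by (simp add: ennreal_powr_mult ennreal_powr_inverse ennreal_powr_ennreal)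
  have "F \<tau> = ennreal (embedding_const a q * \<tau> powr a) * (ennreal c * F \<tau> * ennreal ((1 / 4) powr (1 / p)))"
  proof -
    have "embedding_const a q * \<tau> powr a * (c * (1 / 4) powr (1 / p)) = 1"
      using \<tau> by (simp add: embedding_const_def c_def powr_minus powr_mult p_def powr_divide field_simps)
    then have "ennreal (embedding_const a q * \<tau> powr a) * (ennreal c * ennreal ((1 / 4) powr (1 / p))) = 1"
      using c by (simp add: embedding_const_def flip: ennreal_mult)
    then show ?thesis
      by (metis (no_types, lifting) mult.assoc mult.commute mult_1)
  qed
  also have "\<dots> \<le> ennreal (embedding_const a q * \<tau> powr a) * ?N"
    by (intro mult_left_mono *) auto
  finally show ?thesis .
qed


text \<open>For \<open>q = \<infinity>\<close> a scale with the essential bound exists arbitrarily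
  close to the right of \<open>\<tau>\<close>, so no constant is lost and every
  \<open>\<tau> < T\<close> is reached.\<close>

lemma Lq_log_norm_top_pointwise:
  assumes F: "mono F" and a: "0 \<le> a" and \<tau>: "0 < \<tau>" "\<tau> < T"
  shows "F \<tau> \<le> ennreal (\<tau> powr a) * Lq_log_norm T \<infinity> (\<lambda>\<tau>. ennreal (\<tau> powr (- a)) * F \<tau>)"
    (is "_ \<le> _ * ?N")
proof (cases ?N)
  case top
  then show ?thesis using \<tau> by (simp add: ennreal_mult_top)
next
  case (real k)
  have le: "F \<tau> \<le> ennreal (x powr a * k)" if x: "\<tau> < x" "x < T" for x
  proof -
    obtain \<sigma> where \<sigma>: "\<tau> < \<sigma>" "\<sigma> < x" "0 < \<sigma> \<and> \<sigma> \<le> T \<longrightarrow> ennreal (\<sigma> powr (- a)) * F \<sigma> \<le> ?N"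
      by (rule mono_AE_point[OF Lq_log_norm_top_AE, of \<tau> x T "\<lambda>\<tau>. ennreal (\<tau> powr (- a)) * F \<tau>"]) (use x in auto)
    have "F \<tau> \<le> F \<sigma>"
      using \<sigma> by (intro monoD[OF F]) auto
    also have "F \<sigma> = ennreal (\<sigma> powr a) * (ennreal (\<sigma> powr (- a)) * F \<sigma>)"
      using \<sigma> \<tau> by (simp add: powr_minus flip: mult.assoc ennreal_mult)
    also have "\<dots> \<le> ennreal (x powr a) * ennreal k"
      using \<sigma> \<tau> x a real by (intro mult_mono ennreal_leI powr_mono2) auto
    also have "\<dots> = ennreal (x powr a * k)"
      using real by (simp add: ennreal_mult)
    finally show ?thesis .
  qed
  have "((\<lambda>x. ennreal (x powr a * k)) \<longlongrightarrow> ennreal (\<tau> powr a * k)) (at_right \<tau>)"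
    using \<tau> by (intro tendsto_intros tendsto_ennrealI) auto
  moreover have "eventually (\<lambda>x. F \<tau> \<le> ennreal (x powr a * k)) (at_right \<tau>)"
    using eventually_at_right_less[of \<tau>] eventually_at_right_real[OF \<tau>(2)]
    by eventually_elim (use le in auto)
  ultimately have "F \<tau> \<le> ennreal (\<tau> powr a * k)"
    by (intro tendsto_lowerbound) auto
  then show ?thesis
    using real by (simp add: ennreal_mult)
qed

text \<open>Interpolation between the exponent \<open>q\<close> and a supremum: the power
  \<open>q'\<close> is split into \<open>q' - q\<close>, bounded by the supremum, and
  \<open>q\<close>. The supremum bound is asked on the whole range of scales, which forces the
  treatment near \<open>T\<close> in the applications.\<close>

lemma Lq_log_norm_increase_exponent:
  assumes q: "0 < q" "q \<le> q'" and [measurable]: "F \<in> borel_measurable borel"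
    and K: "Lq_log_norm T q F \<le> K" "\<And>\<tau>. 0 < \<tau> \<Longrightarrow> \<tau> \<le> T \<Longrightarrow> F \<tau> \<le> K"
  shows "Lq_log_norm T q' F \<le> K"
proof (cases "q' = \<infinity>")
  case True
  have "Lq_log_norm T \<infinity> F \<le> K"
    by (rule Lq_log_norm_top_le) (use K in auto)
  then show ?thesis using True by simp
next
  case False
  then have qf: "q \<noteq> \<infinity>" using q by (auto simp: top_unique)
  define p p' where "p = enn2real q" and "p' = enn2real q'"
  have p: "0 < p" "p \<le> p'"
    using enn2real_pos[OF q(1) qf] q False unfolding p_def p'_def
    by (auto intro!: enn2real_mono simp: top.not_eq_extremum)
  have "log_integral T p' F \<le> ennreal_powr K p'"
  proof (cases "p = p'")
    case True
    have "log_integral T p F \<le> ennreal_powr K p"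
      using q qf K(1) p unfolding p_def by (subst log_integral_eq_powr) (auto intro!: ennreal_powr_mono)
    then show ?thesis using True by simp
  next
    case False
    then have pp: "0 < p' - p" using p by simp
    have "log_integral T p' F \<le> (\<integral>\<^sup>+\<tau>. ennreal_powr K (p' - p) * (ennreal_powr (F \<tau>) p * (ennreal (1 / \<tau>) * indicator {0<..T} \<tau>)) \<partial>lborel)"
      unfolding log_integral_def
    proof (rule nn_integral_mono)
      fix \<tau>
      show "ennreal_powr (F \<tau>) p' * (ennreal (1 / \<tau>) * indicator {0<..T} \<tau>)
          \<le> ennreal_powr K (p' - p) * (ennreal_powr (F \<tau>) p * (ennreal (1 / \<tau>) * indicator {0<..T} \<tau>))"
      proof (cases "\<tau> \<in> {0<..T}")
        case True
        have "ennreal_powr (F \<tau>) p' = ennreal_powr (F \<tau>) (p' - p) * ennreal_powr (F \<tau>) p"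
          using ennreal_powr_add_exponent[OF pp p(1), of "F \<tau>"] by simp
        also have "\<dots> \<le> ennreal_powr K (p' - p) * ennreal_powr (F \<tau>) p"
          using True pp K by (intro mult_right_mono ennreal_powr_mono) auto
        finally show ?thesis
          by (auto simp flip: mult.assoc intro!: mult_right_mono)
      qed simp
    qed
    also have "\<dots> = ennreal_powr K (p' - p) * log_integral T p F"
      unfolding log_integral_def by (rule nn_integral_cmult) measurable
    also have "\<dots> \<le> ennreal_powr K (p' - p) * ennreal_powr K p"
      using q qf K(1) p unfolding p_def by (intro mult_left_mono, subst log_integral_eq_powr) (auto intro!: ennreal_powr_mono)
    also have "\<dots> = ennreal_powr K p'"
      using ennreal_powr_add_exponent[OF pp p(1), of K] by simp
    finally show ?thesis .
  qed
  then show ?thesis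
    using q False unfolding p'_def by (intro Lq_log_norm_le_finite) auto
qed

text \<open>For finite \<open>q\<close> the second entry is the exact norm of
  \<open>\<tau> powr e\<close> for \<open>T = 1\<close>. For \<open>q = \<infinity>\<close> the
  conventions make it \<open>0\<close>, and the maximum supplies the correct value
  \<open>1\<close>.\<close>

definition power_const :: "real \<Rightarrow> ennreal \<Rightarrow> real" where
  "power_const e q = max 1 ((1 / (e * enn2real q)) powr (1 / enn2real q))"

lemma Lq_log_norm_powr_le:
  assumes q: "0 < q" and e: "0 < e" and T: "0 < T"
  shows "Lq_log_norm T q (\<lambda>\<tau>. ennreal (\<tau> powr e)) \<le> ennreal (power_const e q * T powr e)"
proof (cases "q = \<infinity>")
  case True
  have "Lq_log_norm T \<infinity> (\<lambda>\<tau>. ennreal (\<tau> powr e)) \<le> ennreal (T powr e)"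
    by (rule Lq_log_norm_top_le) (use e in \<open>auto intro!: ennreal_leI powr_mono2\<close>)
  also have "\<dots> \<le> ennreal (power_const e q * T powr e)"
  proof -
    have "1 * T powr e \<le> power_const e q * T powr e"
      by (rule mult_right_mono) (auto simp: power_const_def)
    then show ?thesis by (intro ennreal_leI) simp
  qed
  finally show ?thesis using True by simp
next
  case False
  define p where "p = enn2real q"
  have p: "0 < p" using enn2real_pos[OF q False] by (simp add: p_def)
  have "log_integral T p (\<lambda>\<tau>. ennreal (\<tau> powr e)) \<le> (\<integral>\<^sup>+\<tau>. ennreal (\<tau> powr (e * p - 1)) * indicator {0..T} \<tau> \<partial>lborel)"
    unfolding log_integral_def
  proof (rule nn_integral_mono)
    fix \<tau>
    show "ennreal_powr (ennreal (\<tau> powr e)) p * (ennreal (1 / \<tau>) * indicator {0<..T} \<tau>)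
        \<le> ennreal (\<tau> powr (e * p - 1)) * indicator {0..T} \<tau>"
    proof (cases "\<tau> \<in> {0<..T}")
      case True
      then have "ennreal_powr (ennreal (\<tau> powr e)) p * ennreal (1 / \<tau>) = ennreal (\<tau> powr (e * p - 1))"
        by (simp add: ennreal_powr_ennreal powr_powr powr_diff flip: ennreal_mult)
      then show ?thesis
        using True by (simp flip: mult.assoc)
    qed simp
  qed
  also have "\<dots> = ennreal (T powr (e * p - 1 + 1) / (e * p - 1 + 1))"
    using e p T by (intro nn_integral_has_integral_lebesgue' has_integral_powr_from_0) auto
  also have "\<dots> = ennreal_powr (ennreal ((1 / (e * p)) powr (1 / p) * T powr e)) p"
    using e p T by (simp add: ennreal_powr_ennreal powr_mult powr_powr)
  also have "\<dots> \<le> ennreal_powr (ennreal (power_const e q * T powr e)) p"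
  proof -
    have "(1 / (e * p)) powr (1 / p) * T powr e \<le> power_const e q * T powr e"
      by (rule mult_right_mono) (auto simp: power_const_def p_def)
    then show ?thesis
      using p by (intro ennreal_powr_mono ennreal_leI) auto
  qed
  finally show ?thesis
    using False q unfolding p_def by (intro Lq_log_norm_le_finite) auto
qed

subsection \<open>Dyadic sums of a modulus\<close>

definition dyadic_sum :: "(real \<Rightarrow> ennreal) \<Rightarrow> real \<Rightarrow> ennreal" where
  "dyadic_sum W h = (\<Sum>n. ennreal (2 ^ n) * W (h / 2 ^ n))"

text \<open>One error at the full length and two problems of half the length: the inductive
  comparison of sums along finite sets reproduces exactly this recursion.\<close>

lemma dyadic_sum_unfold: "dyadic_sum W h = W h + 2 * dyadic_sum W (h / 2)"
proof -
  have "(\<lambda>n. 2 * (ennreal (2 ^ n) * W (h / 2 / 2 ^ n))) sums (2 * dyadic_sum W (h / 2))"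
    unfolding dyadic_sum_def ennreal_suminf_cmult[symmetric] by (intro summable_sums) simp
  also have "(\<lambda>n. 2 * (ennreal (2 ^ n) * W (h / 2 / 2 ^ n))) = (\<lambda>n. ennreal (2 ^ Suc n) * W (h / 2 ^ Suc n))"
  proof
    fix n
    have "ennreal (2 ^ Suc n) = 2 * ennreal (2 ^ n)"
      using ennreal_mult[of 2 "2 ^ n"] by simp
    then show "2 * (ennreal (2 ^ n) * W (h / 2 / 2 ^ n)) = ennreal (2 ^ Suc n) * W (h / 2 ^ Suc n)"
      by (simp add: mult.assoc divide_divide_eq_left)
  qed
  finally have "(\<lambda>n. ennreal (2 ^ n) * W (h / 2 ^ n)) sums (2 * dyadic_sum W (h / 2) + ennreal (2 ^ 0) * W (h / 2 ^ 0))"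
    by (rule sums_Suc)
  then show ?thesis
    by (simp add: dyadic_sum_def[of W h] sums_unique[symmetric] add.commute)
qed

lemma dyadic_sum_mono: "mono W \<Longrightarrow> mono (dyadic_sum W)"
  unfolding dyadic_sum_def
  by (intro monoI suminf_le mult_left_mono) (auto intro!: monoD[of W] divide_right_mono)

lemma ennreal_geometric:
  assumes "0 \<le> c" "c < 1"
  shows "(\<Sum>n. ennreal (c ^ n)) = ennreal (1 / (1 - c))"
proof -
  have "(\<lambda>n. c ^ n) sums (1 / (1 - c))"
    using assms by (intro geometric_sums) auto
  then show ?thesis
    using assms by (intro suminf_ennreal_eq) auto
qed

text \<open>Takes the place of Minkowski's inequality and treats \<open>p < 1\<close> and
  \<open>p \<ge> 1\<close> alike. Each \<open>a n\<close> is at most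
  \<open>2 powr (- (n * \<delta>))\<close> times the \<open>p\<close>-th root of the weighted sum,
  since a single term is bounded by the whole sum; the remaining series is geometric.\<close>

lemma ennreal_powr_suminf_le:
  fixes a :: "nat \<Rightarrow> ennreal"
  assumes p: "0 < p" and \<delta>: "0 < \<delta>"
  shows "ennreal_powr (\<Sum>n. a n) p
    \<le> ennreal ((1 / (1 - 2 powr (- \<delta>))) powr p) * (\<Sum>n. ennreal (2 powr (real n * \<delta> * p)) * ennreal_powr (a n) p)"
proof -
  define B where "B = (\<Sum>n. ennreal (2 powr (real n * \<delta> * p)) * ennreal_powr (a n) p)"
  define c :: real where "c = 2 powr (- \<delta>)"
  have c: "0 < c" "c < 1"
    using \<delta> by (auto simp: c_def powr_less_one)
  have a: "a n \<le> ennreal (c ^ n) * ennreal_powr B (1 / p)" for n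
  proof -
    have "ennreal (2 powr (real n * \<delta> * p)) * ennreal_powr (a n) p \<le> B"
      unfolding B_def using sum_le_suminf[OF summableI, of "{n}" "\<lambda>n. ennreal (2 powr (real n * \<delta> * p)) * ennreal_powr (a n) p"]
      by simp
    then have "ennreal_powr (ennreal (2 powr (real n * \<delta> * p)) * ennreal_powr (a n) p) (1 / p) \<le> ennreal_powr B (1 / p)"
      using p by (intro ennreal_powr_mono) auto
    then have "ennreal (2 powr (real n * \<delta>)) * a n \<le> ennreal_powr B (1 / p)"
      using p by (simp add: ennreal_powr_mult ennreal_powr_inverse ennreal_powr_ennreal powr_powr)
    then have "ennreal (c ^ n) * (ennreal (2 powr (real n * \<delta>)) * a n) \<le> ennreal (c ^ n) * ennreal_powr B (1 / p)"
      by (intro mult_left_mono) auto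
    moreover have "c ^ n * 2 powr (real n * \<delta>) = 1"
    proof -
      have "c ^ n = 2 powr (- (real n * \<delta>))"
        using c by (simp add: c_def powr_powr mult.commute flip: powr_realpow)
      then show ?thesis by (simp flip: powr_add)
    qed
    then have "ennreal (c ^ n) * (ennreal (2 powr (real n * \<delta>)) * a n) = a n"
      using c by (simp flip: mult.assoc ennreal_mult)
    ultimately show ?thesis by simp
  qed
  have "(\<Sum>n. a n) \<le> (\<Sum>n. ennreal (c ^ n) * ennreal_powr B (1 / p))"
    by (intro suminf_le a) auto
  also have "\<dots> = ennreal (1 / (1 - c)) * ennreal_powr B (1 / p)"
    using c by (simp only: ennreal_suminf_multc ennreal_geometric less_imp_le)
  finally have "ennreal_powr (\<Sum>n. a n) p \<le> ennreal_powr (ennreal (1 / (1 - c)) * ennreal_powr B (1 / p)) p"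
    using p by (intro ennreal_powr_mono) auto
  also have "\<dots> = ennreal ((1 / (1 - c)) powr p) * B"
    using p c by (simp add: ennreal_powr_mult ennreal_powr_inverse' ennreal_powr_ennreal)
  finally show ?thesis
    unfolding B_def c_def .
qed

text \<open>The measure with density \<open>1 / \<tau>\<close> is invariant under scaling, so the
  power of \<open>\<Delta>\<close> stems from the weight alone. It is only an inequality because the
  scaled function is seen up to \<open>\<Delta> * T \<le> T\<close>.\<close>

lemma log_integral_scale:
  assumes p: "0 < p" and F [measurable]: "F \<in> borel_measurable borel" and \<Delta>: "0 < \<Delta>" "\<Delta> \<le> 1"
  shows "log_integral T p (\<lambda>\<tau>. ennreal (\<tau> powr (- a)) * F (\<Delta> * \<tau>))
    \<le> ennreal (\<Delta> powr (a * p)) * log_integral T p (\<lambda>\<tau>. ennreal (\<tau> powr (- a)) * F \<tau>)"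
proof -
  let ?G = "\<lambda>\<tau>. ennreal_powr (ennreal (\<tau> powr (- a)) * F \<tau>) p * (ennreal (1 / \<tau>) * indicator {0<..T} \<tau>)"
  let ?c = "ennreal (\<Delta> powr (a * p))"
  have "?c * log_integral T p (\<lambda>\<tau>. ennreal (\<tau> powr (- a)) * F \<tau>) = ?c * (ennreal \<Delta> * (\<integral>\<^sup>+\<tau>. ?G (0 + \<Delta> * \<tau>) \<partial>lborel))"
    unfolding log_integral_def using \<Delta> by (subst nn_integral_real_affine[where c = \<Delta> and t = 0]) auto
  also have "\<dots> = (\<integral>\<^sup>+\<tau>. ?c * (ennreal \<Delta> * ?G (0 + \<Delta> * \<tau>)) \<partial>lborel)"
    by (subst nn_integral_cmult[symmetric], measurable, subst nn_integral_cmult[symmetric], measurable)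
  also have "\<dots> \<ge> log_integral T p (\<lambda>\<tau>. ennreal (\<tau> powr (- a)) * F (\<Delta> * \<tau>))"
    unfolding log_integral_def
  proof (rule nn_integral_mono)
    fix \<tau>
    show "ennreal_powr (ennreal (\<tau> powr (- a)) * F (\<Delta> * \<tau>)) p * (ennreal (1 / \<tau>) * indicator {0<..T} \<tau>)
        \<le> ?c * (ennreal \<Delta> * ?G (0 + \<Delta> * \<tau>))"
    proof (cases "\<tau> \<in> {0<..T}")
      case True
      have "\<Delta> * \<tau> \<le> 1 * T"
        using True \<Delta> by (intro mult_mono) auto
      then have 1: "\<Delta> * \<tau> \<in> {0<..T}"
        using True \<Delta> by auto
      have "\<Delta> powr (a * p) * \<Delta> * ((\<Delta> * \<tau>) powr (- a)) powr p * (1 / (\<Delta> * \<tau>)) = (\<tau> powr (- a)) powr p * (1 / \<tau>)"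
      proof -
        have "((\<Delta> * \<tau>) powr (- a)) powr p = \<Delta> powr (- (a * p)) * (\<tau> powr (- a)) powr p"
          by (simp add: powr_powr powr_mult)
        moreover have "\<Delta> powr (a * p) * \<Delta> powr (- (a * p)) = 1"
          using \<Delta> by (simp flip: powr_add)
        ultimately show ?thesis
          using \<Delta> True by (simp add: field_simps)
      qed
      then have "?c * ennreal \<Delta> * ennreal (((\<Delta> * \<tau>) powr (- a)) powr p) * ennreal (1 / (\<Delta> * \<tau>))
          = ennreal ((\<tau> powr (- a)) powr p) * ennreal (1 / \<tau>)"
        using \<Delta> True by (simp flip: ennreal_mult)
      then have "?c * ennreal \<Delta> * ennreal (((\<Delta> * \<tau>) powr (- a)) powr p) * ennreal (1 / (\<Delta> * \<tau>)) * ennreal_powr (F (\<Delta> * \<tau>)) p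
          = ennreal ((\<tau> powr (- a)) powr p) * ennreal (1 / \<tau>) * ennreal_powr (F (\<Delta> * \<tau>)) p"
        by simp
      then show ?thesis
        using True 1 p by (simp add: ennreal_powr_mult ennreal_powr_ennreal mult_ac)
    qed simp
  qed
  finally show ?thesis .
qed

text \<open>Half of the surplus \<open>\<gamma> - 1\<close> is spent as \<open>\<delta>\<close> in
  the power inequality for series and gives the first factor; the other half makes the series of
  scaled integrals geometric and gives the second. The maximum with \<open>1\<close> covers
  \<open>q = \<infinity>\<close>.\<close>

definition hardy_const :: "real \<Rightarrow> ennreal \<Rightarrow> real" where
  "hardy_const \<gamma> q = 1 / (1 - 2 powr (- ((\<gamma> - 1) / 2)))
     * max 1 ((1 / (1 - 2 powr (- ((\<gamma> - 1) / 2 * enn2real q)))) powr (1 / enn2real q))"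

lemma hardy_const_ge: "1 < \<gamma> \<Longrightarrow> 1 / (1 - 2 powr (- ((\<gamma> - 1) / 2))) \<le> hardy_const \<gamma> q"
  and hardy_const_pos: "1 < \<gamma> \<Longrightarrow> 0 < hardy_const \<gamma> q"
proof -
  assume "1 < \<gamma>"
  then have "2 powr (- ((\<gamma> - 1) / 2)) < (1 :: real)"
    by (auto simp: powr_less_one)
  then have *: "0 < 1 / (1 - 2 powr (- ((\<gamma> - 1) / 2)) :: real)"
    by simp
  have "1 / (1 - 2 powr (- ((\<gamma> - 1) / 2))) * 1 \<le> hardy_const \<gamma> q"
    unfolding hardy_const_def using * by (intro mult_left_mono) auto
  then show "1 / (1 - 2 powr (- ((\<gamma> - 1) / 2))) \<le> hardy_const \<gamma> q"
    by simp
  with * show "0 < hardy_const \<gamma> q"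
    by linarith
qed

lemma dyadic_sum_power_bound:
  assumes \<gamma>: "1 < \<gamma>" and h: "0 < h" and W: "\<And>n. W (h / 2 ^ n) \<le> ennreal ((h / 2 ^ n) powr \<gamma>) * k"
  shows "dyadic_sum W h \<le> ennreal (1 / (1 - 2 powr (- ((\<gamma> - 1) / 2))) * h powr \<gamma>) * k"
proof -
  define c :: real where "c = 2 powr (- (\<gamma> - 1))"
  define d :: real where "d = 2 powr (- ((\<gamma> - 1) / 2))"
  have c: "0 < c" "c \<le> d" "d < 1"
  proof -
    have "(\<gamma> - 1) / 2 \<le> \<gamma> - 1"
      using \<gamma> by (simp add: field_simps)
    then have "- (\<gamma> - 1) \<le> - ((\<gamma> - 1) / 2)"
      by (rule le_imp_neg_le)
    then show "c \<le> d" unfolding c_def d_def by (rule powr_mono) simp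
  qed (use \<gamma> in \<open>auto simp: c_def d_def powr_less_one\<close>)
  have eq: "2 ^ n * (h / 2 ^ n) powr \<gamma> = c ^ n * h powr \<gamma>" for n
  proof -
    have "(h / 2 ^ n) powr \<gamma> = h powr \<gamma> / (2 ^ n) powr \<gamma>"
      by (rule powr_divide)
    moreover have "(2 ^ n) powr \<gamma> = 2 powr (real n * \<gamma>)"
      by (simp add: powr_powr flip: powr_realpow)
    moreover have "2 ^ n = 2 powr real n"
      by (simp add: powr_realpow)
    moreover have "c ^ n = 2 powr (- (\<gamma> - 1) * real n)"
      by (simp add: c_def powr_powr flip: powr_realpow)
    then have "c ^ n = 2 powr (- (real n * (\<gamma> - 1)))"
      by (simp add: mult.commute minus_mult_right)
    moreover have "2 powr real n / 2 powr (real n * \<gamma>) = (2::real) powr (- (real n * (\<gamma> - 1)))"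
    proof -
      have "real n - real n * \<gamma> = - (real n * (\<gamma> - 1))"
        by (simp add: algebra_simps)
      then show ?thesis
        by (simp only: powr_diff[symmetric])
    qed
    ultimately show ?thesis
      by (metis (no_types, lifting) mult.commute times_divide_eq_left)
  qed
  have "dyadic_sum W h \<le> (\<Sum>n. ennreal (c ^ n) * (ennreal (h powr \<gamma>) * k))"
    unfolding dyadic_sum_def
  proof (rule suminf_le)
    fix n
    have "ennreal (2 ^ n) * W (h / 2 ^ n) \<le> ennreal (2 ^ n) * (ennreal ((h / 2 ^ n) powr \<gamma>) * k)"
      by (intro mult_left_mono W) auto
    also have "\<dots> = ennreal (2 ^ n * (h / 2 ^ n) powr \<gamma>) * k"
      by (simp add: ennreal_mult mult.assoc)
    also have "\<dots> = ennreal (c ^ n) * (ennreal (h powr \<gamma>) * k)"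
      using c unfolding eq by (simp add: ennreal_mult mult.assoc)
    finally show "ennreal (2 ^ n) * W (h / 2 ^ n) \<le> ennreal (c ^ n) * (ennreal (h powr \<gamma>) * k)" .
  qed auto
  also have "\<dots> = ennreal (1 / (1 - c)) * (ennreal (h powr \<gamma>) * k)"
    using c by (simp only: ennreal_suminf_multc ennreal_geometric less_imp_le)
  \<comment> \<open>The ratio \<open>c\<close> uses the full surplus; passing to the weaker
    \<open>d\<close> makes the constant agree with the first factor of
    \<open>hardy_const\<close>.\<close>
  also have "\<dots> \<le> ennreal (1 / (1 - d)) * (ennreal (h powr \<gamma>) * k)"
    using c by (intro mult_right_mono ennreal_leI divide_left_mono) auto
  also have "\<dots> = ennreal (1 / (1 - d) * h powr \<gamma>) * k"
  proof -
    have "ennreal (1 / (1 - d) * h powr \<gamma>) = ennreal (1 / (1 - d)) * ennreal (h powr \<gamma>)"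
      using c by (intro ennreal_mult) auto
    then show ?thesis by (simp only: mult.assoc)
  qed
  finally show ?thesis by (simp add: d_def)
qed

text \<open>For \<open>q = \<infinity>\<close> the pointwise power bound is summed over dyadic
  scales. Otherwise the power inequality for series reduces the claim to scaled copies of the same
  integral, each of which is controlled by the unscaled one.\<close>

lemma Lq_log_norm_dyadic_sum:
  assumes T: "0 < T" and q: "0 < q" and \<gamma>: "1 < \<gamma>" and W: "mono W"
  shows "Lq_log_norm T q (\<lambda>\<tau>. ennreal (\<tau> powr (- \<gamma>)) * dyadic_sum W \<tau>)
    \<le> ennreal (hardy_const \<gamma> q) * Lq_log_norm T q (\<lambda>\<tau>. ennreal (\<tau> powr (- \<gamma>)) * W \<tau>)"
proof -
  have [measurable]: "W \<in> borel_measurable borel" "dyadic_sum W \<in> borel_measurable borel"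
    using W dyadic_sum_mono[OF W] by (auto intro!: mono_ennreal_borel_measurable)
  define \<delta> where "\<delta> = (\<gamma> - 1) / 2"
  have \<delta>: "0 < \<delta>" using \<gamma> by (simp add: \<delta>_def)
  show ?thesis
  proof (cases "q = \<infinity>")
    case True
    let ?N = "Lq_log_norm T \<infinity> (\<lambda>\<tau>. ennreal (\<tau> powr (- \<gamma>)) * W \<tau>)"
    have *: "ennreal (\<tau> powr (- \<gamma>)) * dyadic_sum W \<tau> \<le> ennreal (hardy_const \<gamma> q) * ?N" if \<tau>: "0 < \<tau>" "\<tau> < T" for \<tau>
    proof -
      have lt: "\<tau> / 2 ^ n < T" for n
      proof -
        have "\<tau> / 2 ^ n \<le> \<tau> / 1"
          using \<tau> by (intro divide_left_mono) auto
        then show ?thesis using \<tau> by simp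
      qed
      have "dyadic_sum W \<tau> \<le> ennreal (1 / (1 - 2 powr (- ((\<gamma> - 1) / 2))) * \<tau> powr \<gamma>) * ?N"
        using \<gamma> \<tau> lt by (intro dyadic_sum_power_bound Lq_log_norm_top_pointwise W) auto
      also have "\<dots> \<le> ennreal (hardy_const \<gamma> q * \<tau> powr \<gamma>) * ?N"
        using hardy_const_ge[OF \<gamma>] by (intro mult_right_mono ennreal_leI) auto
      finally have "ennreal (\<tau> powr (- \<gamma>)) * dyadic_sum W \<tau> \<le> ennreal (\<tau> powr (- \<gamma>)) * (ennreal (hardy_const \<gamma> q * \<tau> powr \<gamma>) * ?N)"
        by (intro mult_left_mono) auto
      also have "\<dots> = ennreal (\<tau> powr (- \<gamma>) * (hardy_const \<gamma> q * \<tau> powr \<gamma>)) * ?N"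
        using hardy_const_pos[OF \<gamma>, of q] by (simp add: ennreal_mult mult.assoc)
      also have "\<tau> powr (- \<gamma>) * (hardy_const \<gamma> q * \<tau> powr \<gamma>) = hardy_const \<gamma> q"
        using \<tau> by (simp add: powr_minus)
      finally show ?thesis .
    qed
    have "AE \<tau> in lborel. 0 < \<tau> \<and> \<tau> \<le> T \<longrightarrow> ennreal (\<tau> powr (- \<gamma>)) * dyadic_sum W \<tau> \<le> ennreal (hardy_const \<gamma> q) * ?N"
      using AE_lborel_singleton[of T] by eventually_elim (use * in auto)
    then have "Lq_log_norm T \<infinity> (\<lambda>\<tau>. ennreal (\<tau> powr (- \<gamma>)) * dyadic_sum W \<tau>) \<le> ennreal (hardy_const \<gamma> q) * ?N"
      by (intro Lq_log_norm_top_le) measurable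
    then show ?thesis
      using True by simp
  next
    case False
    define p where "p = enn2real q"
    have p: "0 < p" using enn2real_pos[OF q False] by (simp add: p_def)
    define I where "I = log_integral T p (\<lambda>\<tau>. ennreal (\<tau> powr (- \<gamma>)) * W \<tau>)"
    define c :: real where "c = 2 powr (- (\<delta> * p))"
    have c: "0 < c" "c < 1" using \<delta> p by (auto simp: c_def powr_less_one)
    define D where "D = (1 / (1 - 2 powr (- \<delta>))) powr p"
    have D: "0 \<le> D" by (simp add: D_def)
    have "log_integral T p (\<lambda>\<tau>. ennreal (\<tau> powr (- \<gamma>)) * dyadic_sum W \<tau>)
        \<le> (\<integral>\<^sup>+\<tau>. ennreal D * (\<Sum>n. ennreal (2 powr (real n * \<delta> * p) * (2 ^ n) powr p) *
            (ennreal_powr (ennreal (\<tau> powr (- \<gamma>)) * W (1 / 2 ^ n * \<tau>)) p * (ennreal (1 / \<tau>) * indicator {0<..T} \<tau>))) \<partial>lborel)"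
      unfolding log_integral_def
    proof (rule nn_integral_mono)
      fix \<tau>
      let ?i = "ennreal (1 / \<tau>) * indicator {0<..T} \<tau>"
      have "ennreal (\<tau> powr (- \<gamma>)) * dyadic_sum W \<tau>
          = (\<Sum>n. ennreal (2 ^ n) * (ennreal (\<tau> powr (- \<gamma>)) * W (1 / 2 ^ n * \<tau>)))"
        by (simp add: dyadic_sum_def mult.left_commute flip: ennreal_suminf_cmult)
      then have "ennreal_powr (ennreal (\<tau> powr (- \<gamma>)) * dyadic_sum W \<tau>) p
          \<le> ennreal D * (\<Sum>n. ennreal (2 powr (real n * \<delta> * p)) * ennreal_powr (ennreal (2 ^ n) * (ennreal (\<tau> powr (- \<gamma>)) * W (1 / 2 ^ n * \<tau>))) p)"
        unfolding D_def by (simp only: ennreal_powr_suminf_le[OF p \<delta>])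
      also have "\<dots> = ennreal D * (\<Sum>n. ennreal (2 powr (real n * \<delta> * p) * (2 ^ n) powr p) *
            ennreal_powr (ennreal (\<tau> powr (- \<gamma>)) * W (1 / 2 ^ n * \<tau>)) p)"
        using p by (simp add: ennreal_powr_mult[of p "ennreal (2 ^ _)"] ennreal_powr_ennreal ennreal_mult mult.assoc)
      finally have "ennreal_powr (ennreal (\<tau> powr (- \<gamma>)) * dyadic_sum W \<tau>) p * ?i
          \<le> ennreal D * (\<Sum>n. ennreal (2 powr (real n * \<delta> * p) * (2 ^ n) powr p) *
            ennreal_powr (ennreal (\<tau> powr (- \<gamma>)) * W (1 / 2 ^ n * \<tau>)) p) * ?i"
        by (intro mult_right_mono) auto
      also have "\<dots> = ennreal D * (\<Sum>n. ennreal (2 powr (real n * \<delta> * p) * (2 ^ n) powr p) *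
            (ennreal_powr (ennreal (\<tau> powr (- \<gamma>)) * W (1 / 2 ^ n * \<tau>)) p * ?i))"
        by (simp add: mult.assoc flip: ennreal_suminf_multc)
      finally show "ennreal_powr (ennreal (\<tau> powr (- \<gamma>)) * dyadic_sum W \<tau>) p * ?i
          \<le> ennreal D * (\<Sum>n. ennreal (2 powr (real n * \<delta> * p) * (2 ^ n) powr p) *
            (ennreal_powr (ennreal (\<tau> powr (- \<gamma>)) * W (1 / 2 ^ n * \<tau>)) p * ?i))" .
    qed
    also have "\<dots> = ennreal D * (\<Sum>n. ennreal (2 powr (real n * \<delta> * p) * (2 ^ n) powr p) *
        log_integral T p (\<lambda>\<tau>. ennreal (\<tau> powr (- \<gamma>)) * W (1 / 2 ^ n * \<tau>)))"
      unfolding log_integral_def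
      by (subst nn_integral_cmult, measurable, subst nn_integral_suminf, measurable, subst nn_integral_cmult, measurable)
    also have "\<dots> \<le> ennreal D * (\<Sum>n. ennreal (c ^ n) * I)"
    proof (intro mult_left_mono suminf_le)
      fix n
      have "log_integral T p (\<lambda>\<tau>. ennreal (\<tau> powr (- \<gamma>)) * W (1 / 2 ^ n * \<tau>)) \<le> ennreal ((1 / 2 ^ n) powr (\<gamma> * p)) * I"
        unfolding I_def by (intro log_integral_scale p) auto
      then have "ennreal (2 powr (real n * \<delta> * p) * (2 ^ n) powr p) * log_integral T p (\<lambda>\<tau>. ennreal (\<tau> powr (- \<gamma>)) * W (1 / 2 ^ n * \<tau>))
          \<le> ennreal (2 powr (real n * \<delta> * p) * (2 ^ n) powr p) * (ennreal ((1 / 2 ^ n) powr (\<gamma> * p)) * I)"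
        by (intro mult_left_mono) auto
      also have "\<dots> = ennreal (2 powr (real n * \<delta> * p) * (2 ^ n) powr p * (1 / 2 ^ n) powr (\<gamma> * p)) * I"
        by (simp add: ennreal_mult mult.assoc)
      \<comment> \<open>Per level the exponents add up to
        \<open>p * (\<delta> + 1 - \<gamma>) = - (\<delta> * p)\<close>, because
        \<open>\<gamma> - 1 = 2 * \<delta>\<close>.\<close>
      also have "2 powr (real n * \<delta> * p) * (2 ^ n) powr p * (1 / 2 ^ n) powr (\<gamma> * p) = c ^ n"
      proof -
        have "(2 ^ n) powr p = (2::real) powr (real n * p)"
          by (simp add: powr_powr flip: powr_realpow)
        moreover have "(1 / 2 ^ n) powr (\<gamma> * p) = (2::real) powr (- (real n * (\<gamma> * p)))"
          by (simp add: powr_divide powr_powr powr_minus_divide flip: powr_realpow)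
        moreover have "c ^ n = 2 powr (- (\<delta> * p) * real n)"
          by (simp add: c_def powr_powr flip: powr_realpow)
        moreover have "real n * \<delta> * p + real n * p + - (real n * (\<gamma> * p)) = - (\<delta> * p) * real n"
          by (simp add: \<delta>_def field_simps)
        ultimately show ?thesis
          by (simp only: powr_add[symmetric])
      qed
      finally show "ennreal (2 powr (real n * \<delta> * p) * (2 ^ n) powr p) * log_integral T p (\<lambda>\<tau>. ennreal (\<tau> powr (- \<gamma>)) * W (1 / 2 ^ n * \<tau>))
          \<le> ennreal (c ^ n) * I" .
    qed auto
    also have "\<dots> = ennreal D * (ennreal (1 / (1 - c)) * I)"
      using c by (simp only: ennreal_suminf_multc ennreal_geometric less_imp_le)
    also have "I = ennreal_powr (Lq_log_norm T q (\<lambda>\<tau>. ennreal (\<tau> powr (- \<gamma>)) * W \<tau>)) p"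
      unfolding I_def p_def by (intro log_integral_eq_powr q False) measurable
    also have "ennreal D * (ennreal (1 / (1 - c)) * ennreal_powr (Lq_log_norm T q (\<lambda>\<tau>. ennreal (\<tau> powr (- \<gamma>)) * W \<tau>)) p)
        = ennreal_powr (ennreal (1 / (1 - 2 powr (- \<delta>)) * (1 / (1 - c)) powr (1 / p)) * Lq_log_norm T q (\<lambda>\<tau>. ennreal (\<tau> powr (- \<gamma>)) * W \<tau>)) p"
    proof -
      have "0 < 1 - 2 powr (- \<delta>)" using \<delta> by (simp add: powr_less_one)
      then have "ennreal_powr (ennreal (1 / (1 - 2 powr (- \<delta>)) * (1 / (1 - c)) powr (1 / p))) p = ennreal D * ennreal (1 / (1 - c))"
      proof -
        have "(1 / (1 - 2 powr (- \<delta>)) * (1 / (1 - c)) powr (1 / p)) powr p = D * (1 / (1 - c))"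
          using c p unfolding D_def by (subst powr_mult) (simp add: powr_powr)
        moreover have "0 \<le> 1 / (1 - 2 powr (- \<delta>)) * (1 / (1 - c)) powr (1 / p)"
          using \<open>0 < 1 - 2 powr (- \<delta>)\<close> by (intro mult_nonneg_nonneg) auto
        ultimately have "ennreal_powr (ennreal (1 / (1 - 2 powr (- \<delta>)) * (1 / (1 - c)) powr (1 / p))) p = ennreal (D * (1 / (1 - c)))"
          by (simp only: ennreal_powr_ennreal)
        also have "\<dots> = ennreal D * ennreal (1 / (1 - c))"
          using c D by (intro ennreal_mult) auto
        finally show ?thesis .
      qed
      then show ?thesis
        using p by (simp add: ennreal_powr_mult mult.assoc)
    qed
    also have "\<dots> \<le> ennreal_powr (ennreal (hardy_const \<gamma> q) * Lq_log_norm T q (\<lambda>\<tau>. ennreal (\<tau> powr (- \<gamma>)) * W \<tau>)) p"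
    proof -
      have "0 < 1 - 2 powr (- \<delta>)" using \<delta> by (simp add: powr_less_one)
      then have "1 / (1 - 2 powr (- \<delta>)) * (1 / (1 - c)) powr (1 / p) \<le> hardy_const \<gamma> q"
        unfolding hardy_const_def \<delta>_def[symmetric] p_def[symmetric] c_def
        by (intro mult_left_mono) auto
      then show ?thesis
        using p by (intro ennreal_powr_mono mult_right_mono ennreal_leI) auto
    qed
    finally show ?thesis
      using False q unfolding p_def by (intro Lq_log_norm_le_finite) auto
  qed
qed


subsection \<open>Moduli along partitions\<close>

lemma ennreal_powr_sum_concave:
  assumes p: "0 < p" "p \<le> 1" and "finite A"
  shows "ennreal_powr (\<Sum>i\<in>A. f i) p \<le> (\<Sum>i\<in>A. ennreal_powr (f i) p)"
  using assms(3)
proof induction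
  case (insert i A)
  have add: "ennreal_powr (x + y) p \<le> ennreal_powr x p + ennreal_powr y p" for x y
  proof (cases x; cases y)
    fix r s assume rs: "x = ennreal r" "0 \<le> r" "y = ennreal s" "0 \<le> s"
    have "(r + s) powr p \<le> r powr p + s powr p"
    proof (cases "r + s = 0")
      case False
      then have pos: "0 < r + s" using rs by linarith
      \<comment> \<open>After division by \<open>r + s\<close> both summands lie in the unit
        interval, where taking a power \<open>p \<le> 1\<close> only increases them.\<close>
      have le: "t \<le> t powr p" if "0 \<le> t" "t \<le> 1" for t :: real
        using that p powr_mono'[of p 1 t] by (cases "t = 0") auto
      have "1 = r / (r + s) + s / (r + s)"
        using pos by (simp flip: add_divide_distrib)
      also have "\<dots> \<le> (r / (r + s)) powr p + (s / (r + s)) powr p"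
        using pos rs by (intro add_mono le) auto
      also have "\<dots> = (r powr p + s powr p) / (r + s) powr p"
        by (simp add: powr_divide add_divide_distrib)
      finally show ?thesis
        using pos by (simp add: field_simps)
    qed (use rs in auto)
    then show ?thesis
      using rs by (simp add: ennreal_powr_ennreal ennreal_leI flip: ennreal_plus)
  qed auto
  show ?case
    using insert by (simp, intro order_trans[OF add] add_left_mono)
qed simp

text \<open>Jensen's inequality for finite weights. With \<open>m\<close> the weighted mean, Young's
  inequality is applied to \<open>x i * m powr (p - 1)\<close> and summed; the terms in
  \<open>m\<close> then cancel down to the claim.\<close>

lemma ennreal_powr_sum_convex:
  assumes p: "1 \<le> p" and fin: "finite A" and w: "\<And>i. i \<in> A \<Longrightarrow> 0 < w i" "(\<Sum>i\<in>A. w i) = 1"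
  shows "ennreal_powr (\<Sum>i\<in>A. ennreal (w i) * b i) p \<le> (\<Sum>i\<in>A. ennreal (w i) * ennreal_powr (b i) p)"
proof (cases "\<exists>i\<in>A. b i = top")
  case True
  then obtain i where "i \<in> A" "b i = top" by blast
  then have "(\<Sum>i\<in>A. ennreal (w i) * ennreal_powr (b i) p) = top"
  proof -
    have "ennreal (w i) * ennreal_powr (b i) p \<le> (\<Sum>i\<in>A. ennreal (w i) * ennreal_powr (b i) p)"
      using fin \<open>i \<in> A\<close> by (intro member_le_sum) auto
    then show ?thesis
      using w(1)[OF \<open>i \<in> A\<close>] \<open>b i = top\<close> by (simp add: ennreal_mult_top top_unique)
  qed
  then show ?thesis by simp
next
  case False
  define x where "x i = enn2real (b i)" for i
  have x: "b i = ennreal (x i)" "0 \<le> x i" if "i \<in> A" for i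
    using False that by (auto simp: x_def less_top)
  define m where "m = (\<Sum>i\<in>A. w i * x i)"
  have m: "0 \<le> m" using w x unfolding m_def by (intro sum_nonneg mult_nonneg_nonneg) (auto intro: less_imp_le)
  have "m powr p \<le> (\<Sum>i\<in>A. w i * x i powr p)"
  proof (cases "p = 1 \<or> m = 0")
    case True
    then show ?thesis
    proof
      assume "p = 1"
      then have "(\<Sum>i\<in>A. w i * x i powr p) = m"
        using x by (auto simp: m_def intro!: sum.cong)
      then show ?thesis using m \<open>p = 1\<close> by simp
    next
      assume "m = 0"
      then show ?thesis using w by (simp, intro sum_nonneg mult_nonneg_nonneg) (auto intro: less_imp_le)
    qed
  next
    case False
    then have p1: "1 < p" and m0: "0 < m" using p m by auto
    define q where "q = p / (p - 1)"
    have q: "1 < q" "1 / p + 1 / q = 1"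
      using p1 by (auto simp: q_def field_simps)
    have "w i * (x i * m powr (p - 1)) \<le> w i * (x i powr p / p + m powr p / q)" if "i \<in> A" for i
    proof -
      have "x i * m powr (p - 1) \<le> x i powr p / p + (m powr (p - 1)) powr q / q"
        using p1 q x[OF that] by (intro Youngs_inequality) auto
      also have "(m powr (p - 1)) powr q = m powr p"
        using p1 by (simp add: powr_powr q_def)
      finally show ?thesis
        using w(1)[OF that] by (intro mult_left_mono) auto
    qed
    then have "(\<Sum>i\<in>A. w i * (x i * m powr (p - 1))) \<le> (\<Sum>i\<in>A. w i * (x i powr p / p + m powr p / q))"
      by (rule sum_mono)
    also have "(\<Sum>i\<in>A. w i * (x i * m powr (p - 1))) = m * m powr (p - 1)"
      by (simp add: m_def sum_distrib_right mult.assoc)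
    also have "\<dots> = m powr p"
      using m0 by (simp add: powr_mult_base)
    also have "(\<Sum>i\<in>A. w i * (x i powr p / p + m powr p / q)) = (\<Sum>i\<in>A. w i * x i powr p) / p + (\<Sum>i\<in>A. w i) * (m powr p / q)"
      by (simp add: distrib_left sum.distrib sum_divide_distrib sum_distrib_right)
    finally have "m powr p * (1 - 1 / q) \<le> (\<Sum>i\<in>A. w i * x i powr p) / p"
      using w(2) by (simp add: algebra_simps)
    also have "1 - 1 / q = 1 / p"
      using q by linarith
    finally show ?thesis
      using p1 by (simp add: field_simps)
  qed
  moreover have "(\<Sum>i\<in>A. ennreal (w i) * b i) = ennreal m"
    unfolding m_def using w x by (subst sum_ennreal[symmetric]) (auto intro!: sum.cong simp: ennreal_mult less_imp_le)
  moreover have "(\<Sum>i\<in>A. ennreal (w i) * ennreal_powr (b i) p) = ennreal (\<Sum>i\<in>A. w i * x i powr p)"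
    using w x by (subst sum_ennreal[symmetric]) (auto intro!: sum.cong simp: ennreal_mult less_imp_le ennreal_powr_ennreal)
  ultimately show ?thesis
    using m by (simp add: ennreal_powr_ennreal ennreal_leI)
qed

text \<open>The power of the mesh that survives when errors are summed over a partition:
  \<open>\<gamma> - 1\<close> in the convex range of exponents, \<open>\<gamma> - 1 / q\<close> in
  the concave one. The condition \<open>1 / \<gamma> < r\<close> in the limit statement is what
  makes the latter positive.\<close>

definition partition_exponent :: "real \<Rightarrow> ennreal \<Rightarrow> real" where
  "partition_exponent \<gamma> q = (if q = \<infinity> \<or> 1 \<le> enn2real q then \<gamma> - 1 else \<gamma> - 1 / enn2real q)"

lemma partition_exponent_pos:
  assumes "1 < \<gamma>" "ennreal (1 / \<gamma>) < q"
  shows "0 < partition_exponent \<gamma> q"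
proof (cases "q = \<infinity> \<or> 1 \<le> enn2real q")
  case False
  then obtain x where x: "q = ennreal x" "0 \<le> x"
    by (cases q) auto
  then have "1 / \<gamma> < x" using assms by (simp add: ennreal_less_iff)
  moreover have "0 < x"
    using \<open>1 / \<gamma> < x\<close> assms(1) by (smt (verit) divide_pos_pos)
  ultimately have "1 / x < \<gamma>" using assms by (simp add: field_simps)
  then show ?thesis
    using False x by (simp add: partition_exponent_def)
qed (use assms in \<open>simp add: partition_exponent_def\<close>)

text \<open>The interval lengths form a probability weight. Convexity with this weight is used for
  \<open>p \<ge> 1\<close>, subadditivity for \<open>p < 1\<close>. After scaling, the
  \<open>i\<close>-th term carries \<open>\<Delta> i * \<Delta> i powr (\<sigma> * p)\<close>: the
  first factor sums to \<open>1\<close>, the second is bounded by a power of the mesh.\<close>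

lemma Lq_log_norm_partition:
  fixes n :: nat
  assumes q: "0 < q" and \<gamma>: "1 < \<gamma>" "ennreal (1 / \<gamma>) < q" and H: "mono H"
    and \<Delta>: "\<And>i. i < n \<Longrightarrow> 0 < \<Delta> i" "\<And>i. i < n \<Longrightarrow> \<Delta> i \<le> \<epsilon>" "(\<Sum>i<n. \<Delta> i) = 1" and \<epsilon>: "\<epsilon> \<le> 1"
  shows "Lq_log_norm T q (\<lambda>\<tau>. ennreal (\<tau> powr (- \<gamma>)) * (\<Sum>i<n. H (\<Delta> i * \<tau>)))
    \<le> ennreal (\<epsilon> powr partition_exponent \<gamma> q) * Lq_log_norm T q (\<lambda>\<tau>. ennreal (\<tau> powr (- \<gamma>)) * H \<tau>)"
proof -
  have [measurable]: "H \<in> borel_measurable borel"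
    by (rule mono_ennreal_borel_measurable[OF H])
  have \<Delta>1: "\<Delta> i \<le> 1" if "i < n" for i
    using \<Delta>(2)[OF that] \<epsilon> by simp
  show ?thesis
  proof (cases "q = \<infinity>")
    case True
    let ?N = "Lq_log_norm T \<infinity> (\<lambda>\<tau>. ennreal (\<tau> powr (- \<gamma>)) * H \<tau>)"
    have *: "ennreal (\<tau> powr (- \<gamma>)) * (\<Sum>i<n. H (\<Delta> i * \<tau>)) \<le> ennreal (\<epsilon> powr (\<gamma> - 1)) * ?N" if \<tau>: "0 < \<tau>" "\<tau> < T" for \<tau>
    proof -
      have "H (\<Delta> i * \<tau>) \<le> ennreal (\<Delta> i * \<epsilon> powr (\<gamma> - 1) * \<tau> powr \<gamma>) * ?N" if i: "i < n" for i
      proof -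
        have "\<Delta> i * \<tau> \<le> 1 * \<tau>"
          using \<Delta>1[OF i] \<tau> by (intro mult_right_mono) auto
        then have "\<Delta> i * \<tau> < T" using \<tau> by linarith
        then have "H (\<Delta> i * \<tau>) \<le> ennreal ((\<Delta> i * \<tau>) powr \<gamma>) * ?N"
          using \<tau> \<Delta>(1)[OF i] \<gamma> by (intro Lq_log_norm_top_pointwise H) auto
        also have "(\<Delta> i * \<tau>) powr \<gamma> = \<Delta> i * \<Delta> i powr (\<gamma> - 1) * \<tau> powr \<gamma>"
          using \<Delta>(1)[OF i] by (simp add: powr_mult powr_mult_base)
        also have "ennreal \<dots> \<le> ennreal (\<Delta> i * \<epsilon> powr (\<gamma> - 1) * \<tau> powr \<gamma>)"
          using \<Delta>(1,2)[OF i] \<gamma> by (intro ennreal_leI mult_right_mono mult_left_mono powr_mono2) (auto simp: less_imp_le)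
        finally show ?thesis by (simp add: mult_right_mono)
      qed
      then have "(\<Sum>i<n. H (\<Delta> i * \<tau>)) \<le> (\<Sum>i<n. ennreal (\<Delta> i * \<epsilon> powr (\<gamma> - 1) * \<tau> powr \<gamma>) * ?N)"
        by (intro sum_mono) auto
      also have "\<dots> = ennreal (\<Sum>i<n. \<Delta> i * \<epsilon> powr (\<gamma> - 1) * \<tau> powr \<gamma>) * ?N"
        using \<Delta>(1) by (subst sum_ennreal[symmetric]) (auto simp: sum_distrib_right less_imp_le)
      also have "(\<Sum>i<n. \<Delta> i * \<epsilon> powr (\<gamma> - 1) * \<tau> powr \<gamma>) = \<epsilon> powr (\<gamma> - 1) * \<tau> powr \<gamma>"
        using \<Delta>(3) by (simp flip: sum_distrib_right)
      finally have "ennreal (\<tau> powr (- \<gamma>)) * (\<Sum>i<n. H (\<Delta> i * \<tau>)) \<le> ennreal (\<tau> powr (- \<gamma>)) * (ennreal (\<epsilon> powr (\<gamma> - 1) * \<tau> powr \<gamma>) * ?N)"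
        by (intro mult_left_mono) auto
      also have "\<dots> = ennreal (\<tau> powr (- \<gamma>) * (\<epsilon> powr (\<gamma> - 1) * \<tau> powr \<gamma>)) * ?N"
        by (simp add: ennreal_mult mult.assoc)
      also have "\<tau> powr (- \<gamma>) * (\<epsilon> powr (\<gamma> - 1) * \<tau> powr \<gamma>) = \<epsilon> powr (\<gamma> - 1)"
        using \<tau> by (simp add: powr_minus)
      finally show ?thesis .
    qed
    have "AE \<tau> in lborel. 0 < \<tau> \<and> \<tau> \<le> T \<longrightarrow> ennreal (\<tau> powr (- \<gamma>)) * (\<Sum>i<n. H (\<Delta> i * \<tau>)) \<le> ennreal (\<epsilon> powr (\<gamma> - 1)) * ?N"
      using AE_lborel_singleton[of T] by eventually_elim (use * in auto)
    then have "Lq_log_norm T \<infinity> (\<lambda>\<tau>. ennreal (\<tau> powr (- \<gamma>)) * (\<Sum>i<n. H (\<Delta> i * \<tau>))) \<le> ennreal (\<epsilon> powr (\<gamma> - 1)) * ?N"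
      by (intro Lq_log_norm_top_le) measurable
    then show ?thesis
      using True by (simp add: partition_exponent_def)
  next
    case False
    define p where "p = enn2real q"
    have p: "0 < p" using enn2real_pos[OF q False] by (simp add: p_def)
    define \<sigma> where "\<sigma> = partition_exponent \<gamma> q"
    have \<sigma>: "\<sigma> = (if 1 \<le> p then \<gamma> - 1 else \<gamma> - 1 / p)" "0 < \<sigma>"
      using False partition_exponent_pos[OF \<gamma>] by (auto simp: \<sigma>_def partition_exponent_def p_def)
    \<comment> \<open>Jensen's inequality leaves the weight
      \<open>\<Delta> i * (1 / \<Delta> i) powr p\<close>, subadditivity the weight
      \<open>1\<close>.\<close>
    define w where "w i = (if 1 \<le> p then \<Delta> i powr (1 - p) else 1)" for i
    have w0: "0 \<le> w i" for i by (simp add: w_def)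
    define I where "I = log_integral T p (\<lambda>\<tau>. ennreal (\<tau> powr (- \<gamma>)) * H \<tau>)"
    define g where "g i \<tau> = ennreal (\<tau> powr (- \<gamma>)) * H (\<Delta> i * \<tau>)" for i \<tau>
    have [measurable]: "g i \<in> borel_measurable borel" for i unfolding g_def by measurable
    have pt: "ennreal_powr (\<Sum>i<n. g i \<tau>) p \<le> (\<Sum>i<n. ennreal (w i) * ennreal_powr (g i \<tau>) p)" for \<tau>
    proof (cases "1 \<le> p")
      case True
      have "(\<Sum>i<n. g i \<tau>) = (\<Sum>i<n. ennreal (\<Delta> i) * (ennreal (1 / \<Delta> i) * g i \<tau>))"
      proof (intro sum.cong refl)
        fix i assume i: "i \<in> {..<n}"
        then have "ennreal (\<Delta> i) * ennreal (1 / \<Delta> i) = 1"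
          using \<Delta>(1)[of i] by (simp flip: ennreal_mult)
        then show "g i \<tau> = ennreal (\<Delta> i) * (ennreal (1 / \<Delta> i) * g i \<tau>)"
          by (simp flip: mult.assoc)
      qed
      then have "ennreal_powr (\<Sum>i<n. g i \<tau>) p \<le> (\<Sum>i<n. ennreal (\<Delta> i) * ennreal_powr (ennreal (1 / \<Delta> i) * g i \<tau>) p)"
        using ennreal_powr_sum_convex[OF True, of "{..<n}" \<Delta> "\<lambda>i. ennreal (1 / \<Delta> i) * g i \<tau>"] \<Delta> by simp
      also have "\<dots> = (\<Sum>i<n. ennreal (w i) * ennreal_powr (g i \<tau>) p)"
      proof (intro sum.cong refl)
        fix i assume i: "i \<in> {..<n}"
        then have d: "0 < \<Delta> i" using \<Delta> by auto
        have "\<Delta> i * (1 / \<Delta> i) powr p = w i"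
          using d True by (simp add: w_def powr_divide powr_diff)
        then have "ennreal (\<Delta> i) * ennreal ((1 / \<Delta> i) powr p) = ennreal (w i)"
          using d by (simp flip: ennreal_mult)
        then show "ennreal (\<Delta> i) * ennreal_powr (ennreal (1 / \<Delta> i) * g i \<tau>) p = ennreal (w i) * ennreal_powr (g i \<tau>) p"
          using d p by (simp add: ennreal_powr_mult ennreal_powr_ennreal flip: mult.assoc)
      qed
      finally show ?thesis .
    next
      case False
      then show ?thesis
        using ennreal_powr_sum_concave[OF p, of "{..<n}" "\<lambda>i. g i \<tau>"] by (simp add: w_def)
    qed
    have "log_integral T p (\<lambda>\<tau>. ennreal (\<tau> powr (- \<gamma>)) * (\<Sum>i<n. H (\<Delta> i * \<tau>)))
        \<le> (\<integral>\<^sup>+\<tau>. (\<Sum>i<n. ennreal (w i) * (ennreal_powr (g i \<tau>) p * (ennreal (1 / \<tau>) * indicator {0<..T} \<tau>))) \<partial>lborel)"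
      unfolding log_integral_def
    proof (rule nn_integral_mono)
      fix \<tau>
      let ?i = "ennreal (1 / \<tau>) * indicator {0<..T} \<tau>"
      have "ennreal_powr (ennreal (\<tau> powr (- \<gamma>)) * (\<Sum>i<n. H (\<Delta> i * \<tau>))) p * ?i = ennreal_powr (\<Sum>i<n. g i \<tau>) p * ?i"
        by (simp add: g_def sum_distrib_left)
      also have "\<dots> \<le> (\<Sum>i<n. ennreal (w i) * ennreal_powr (g i \<tau>) p) * ?i"
        by (intro mult_right_mono pt) auto
      also have "\<dots> = (\<Sum>i<n. ennreal (w i) * (ennreal_powr (g i \<tau>) p * ?i))"
        by (simp add: sum_distrib_right mult.assoc)
      finally show "ennreal_powr (ennreal (\<tau> powr (- \<gamma>)) * (\<Sum>i<n. H (\<Delta> i * \<tau>))) p * ?i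
          \<le> (\<Sum>i<n. ennreal (w i) * (ennreal_powr (g i \<tau>) p * ?i))" .
    qed
    also have "\<dots> = (\<Sum>i<n. ennreal (w i) * log_integral T p (g i))"
      unfolding log_integral_def
      by (subst nn_integral_sum, measurable) (intro sum.cong refl nn_integral_cmult, measurable)
    also have "\<dots> \<le> (\<Sum>i<n. ennreal (\<Delta> i * \<epsilon> powr (\<sigma> * p)) * I)"
    proof (rule sum_mono)
      fix i assume i: "i \<in> {..<n}"
      then have d: "0 < \<Delta> i" "\<Delta> i \<le> \<epsilon>" using \<Delta> by auto
      have "ennreal (w i) * log_integral T p (g i) \<le> ennreal (w i) * (ennreal (\<Delta> i powr (\<gamma> * p)) * I)"
        unfolding I_def g_def[abs_def] using d \<epsilon> by (intro mult_left_mono log_integral_scale p) auto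
      also have "\<dots> = ennreal (w i * \<Delta> i powr (\<gamma> * p)) * I"
        using w0 by (simp add: ennreal_mult mult.assoc)
      also have "w i * \<Delta> i powr (\<gamma> * p) = \<Delta> i * \<Delta> i powr (\<sigma> * p)"
      proof (cases "1 \<le> p")
        case True
        have "w i * \<Delta> i powr (\<gamma> * p) = \<Delta> i powr (1 - p + \<gamma> * p)"
          using True by (simp add: w_def powr_add)
        also have "1 - p + \<gamma> * p = 1 + \<sigma> * p"
          using True by (simp add: \<sigma> algebra_simps)
        finally show ?thesis using d by (simp add: powr_add)
      next
        case False
        have "\<gamma> * p = 1 + \<sigma> * p"
          using False p by (simp add: \<sigma> algebra_simps)
        then show ?thesis using False d by (simp add: w_def powr_add)
      qed
      also have "ennreal (\<Delta> i * \<Delta> i powr (\<sigma> * p)) * I \<le> ennreal (\<Delta> i * \<epsilon> powr (\<sigma> * p)) * I"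
        using d \<sigma> p by (intro mult_right_mono ennreal_leI mult_left_mono powr_mono2) auto
      finally show "ennreal (w i) * log_integral T p (g i) \<le> ennreal (\<Delta> i * \<epsilon> powr (\<sigma> * p)) * I" .
    qed
    also have "\<dots> = ennreal (\<Sum>i<n. \<Delta> i * \<epsilon> powr (\<sigma> * p)) * I"
      using \<Delta>(1) by (subst sum_ennreal[symmetric]) (auto simp: sum_distrib_right less_imp_le)
    also have "(\<Sum>i<n. \<Delta> i * \<epsilon> powr (\<sigma> * p)) = (\<epsilon> powr \<sigma>) powr p"
      using \<Delta>(3) by (simp add: powr_powr flip: sum_distrib_right)
    also have "I = ennreal_powr (Lq_log_norm T q (\<lambda>\<tau>. ennreal (\<tau> powr (- \<gamma>)) * H \<tau>)) p"
      unfolding I_def p_def by (intro log_integral_eq_powr q False) measurable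
    also have "ennreal ((\<epsilon> powr \<sigma>) powr p) * ennreal_powr (Lq_log_norm T q (\<lambda>\<tau>. ennreal (\<tau> powr (- \<gamma>)) * H \<tau>)) p
       = ennreal_powr (ennreal (\<epsilon> powr \<sigma>) * Lq_log_norm T q (\<lambda>\<tau>. ennreal (\<tau> powr (- \<gamma>)) * H \<tau>)) p"
      using p by (simp add: ennreal_powr_mult ennreal_powr_ennreal)
    finally show ?thesis
      using False q unfolding p_def \<sigma>_def by (intro Lq_log_norm_le_finite) auto
  qed
qed

subsection \<open>Sums along finite sets of points\<close>

definition next_point :: "real set \<Rightarrow> real \<Rightarrow> real" where
  "next_point P x = Min {y \<in> P. x < y}"

text \<open>Indexing sums by finite sets of points instead of enumerated partitions makes refinement
  an inclusion and the common refinement a union. The largest point has no successor and contributes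
  nothing.\<close>

definition psum :: "(real \<Rightarrow> real \<Rightarrow> 'v::comm_monoid_add) \<Rightarrow> real set \<Rightarrow> 'v" where
  "psum X P = (\<Sum>x | x \<in> P \<and> (\<exists>y\<in>P. x < y). X x (next_point P x))"

lemma psum_split:
  assumes "finite P" "c \<in> P"
  shows "psum X P = psum X (P \<inter> {..c}) + psum X (P \<inter> {c..})"
proof -
  let ?A = "{x. x \<in> P \<and> x < c}" and ?B = "{x. x \<in> P \<and> c \<le> x \<and> (\<exists>y\<in>P. x < y)}"
  have "{x. x \<in> P \<and> (\<exists>y\<in>P. x < y)} = ?A \<union> ?B"
    using assms by auto
  then have "psum X P = (\<Sum>x\<in>?A. X x (next_point P x)) + (\<Sum>x\<in>?B. X x (next_point P x))"
    unfolding psum_def using assms(1) by (simp, intro sum.union_disjoint) auto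
  also have "(\<Sum>x\<in>?A. X x (next_point P x)) = psum X (P \<inter> {..c})"
    unfolding psum_def
  proof (rule sum.cong)
    show "?A = {x \<in> P \<inter> {..c}. \<exists>y\<in>P \<inter> {..c}. x < y}"
      using assms by auto
    fix x assume "x \<in> {x \<in> P \<inter> {..c}. \<exists>y\<in>P \<inter> {..c}. x < y}"
    then have x: "x \<in> P" "x < c" by auto
    define m where "m = Min {y \<in> P \<inter> {..c}. x < y}"
    have fin: "finite {y \<in> P \<inter> {..c}. x < y}" using assms by auto
    have m: "m \<in> {y \<in> P \<inter> {..c}. x < y}"
      unfolding m_def using x assms by (intro Min_in fin) auto
    have "Min {y \<in> P. x < y} = m"
    proof (rule Min_eqI)
      fix y assume y: "y \<in> {y \<in> P. x < y}"
      show "m \<le> y"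
      proof (cases "y \<le> c")
        case True
        then show ?thesis unfolding m_def using y fin by (intro Min_le) auto
      qed (use m in auto)
    qed (use m assms in auto)
    then show "X x (next_point P x) = X x (next_point (P \<inter> {..c}) x)"
      by (simp add: next_point_def m_def)
  qed
  also have "(\<Sum>x\<in>?B. X x (next_point P x)) = psum X (P \<inter> {c..})"
    unfolding psum_def
  proof (rule sum.cong)
    show "?B = {x \<in> P \<inter> {c..}. \<exists>y\<in>P \<inter> {c..}. x < y}"
      by auto
    fix x assume "x \<in> {x \<in> P \<inter> {c..}. \<exists>y\<in>P \<inter> {c..}. x < y}"
    then have "{y \<in> P. x < y} = {y \<in> P \<inter> {c..}. x < y}" by auto
    then show "X x (next_point P x) = X x (next_point (P \<inter> {c..}) x)"
      by (simp add: next_point_def)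
  qed
  finally show ?thesis .
qed

lemma psum_singleton [simp]: "psum X {a} = 0"
proof -
  have "{x. x \<in> {a} \<and> (\<exists>y\<in>{a}. x < y)} = {}"
    by auto
  then show ?thesis
    by (simp only: psum_def sum.empty)
qed

lemma psum_pair:
  assumes "a < b"
  shows "psum X {a, b} = X a b"
proof -
  have "{x. x \<in> {a, b} \<and> (\<exists>y\<in>{a, b}. x < y)} = {a}" "{y \<in> {a, b}. a < y} = {b}"
    using assms by auto
  then show ?thesis
    by (simp add: psum_def next_point_def)
qed

lemma psum_image:
  assumes "\<And>i. i < K \<Longrightarrow> p i < p (Suc i)"
  shows "psum X (p ` {..K}) = (\<Sum>i<K. X (p i) (p (Suc i)))"
  using assms
proof (induction K)
  case (Suc K)
  have mono: "p i \<le> p K" if "i \<le> K" for i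
  proof (rule inc_induct[OF that])
    fix n assume "n < K" "p (Suc n) \<le> p K"
    then show "p n \<le> p K" using Suc.prems[of n] by simp
  qed simp
  have lt: "p K < p (Suc K)" using Suc.prems by auto
  have 1: "p ` {..Suc K} \<inter> {..p K} = p ` {..K}"
    using mono lt by (auto simp: atMost_Suc)
  have 2: "p ` {..Suc K} \<inter> {p K..} = {p K, p (Suc K)}"
    using mono lt by (auto simp: atMost_Suc intro: antisym)
  have "psum X (p ` {..Suc K}) = psum X (p ` {..K}) + X (p K) (p (Suc K))"
    using psum_split[of "p ` {..Suc K}" "p K" X] psum_pair[OF lt, of X] unfolding 1 2 by simp
  then show ?case
    using Suc by simp
qed simp

text \<open>The comparison of sums uses nothing but a seminorm. It is restricted to \<open>M\<close>
  because the triangle inequality for the Luxemburg norm is available for measurable functions; the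
  instances are the norms along the lines \<open>(r, r + h)\<close>, one for each
  \<open>h\<close>.\<close>

locale seminorm_on =
  fixes N :: "'v::ab_group_add \<Rightarrow> ennreal" and M :: "'v set"
  assumes zero: "0 \<in> M" "N 0 = 0"
    and add: "x \<in> M \<Longrightarrow> y \<in> M \<Longrightarrow> x + y \<in> M"
    and uminus: "x \<in> M \<Longrightarrow> - x \<in> M" "x \<in> M \<Longrightarrow> N (- x) = N x"
    and triangle: "x \<in> M \<Longrightarrow> y \<in> M \<Longrightarrow> N (x + y) \<le> N x + N y"
begin

lemma diff: "x \<in> M \<Longrightarrow> y \<in> M \<Longrightarrow> x - y \<in> M"
  using add[of x "- y"] uminus by simp

lemma triangle_diff: "x \<in> M \<Longrightarrow> y \<in> M \<Longrightarrow> N (x - y) \<le> N x + N y"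
  using triangle[of x "- y"] uminus by simp

lemma sum_in: "(\<And>i. i \<in> A \<Longrightarrow> f i \<in> M) \<Longrightarrow> sum f A \<in> M"
  by (induction A rule: infinite_finite_induct) (auto intro: zero add)

lemma triangle_sum: "(\<And>i. i \<in> A \<Longrightarrow> f i \<in> M) \<Longrightarrow> N (sum f A) \<le> (\<Sum>i\<in>A. N (f i))"
proof (induction A rule: infinite_finite_induct)
  case (insert i A)
  then have "N (sum f (insert i A)) \<le> N (f i) + N (sum f A)"
    by (simp add: triangle sum_in)
  also have "\<dots> \<le> N (f i) + (\<Sum>i\<in>A. N (f i))"
    using insert by (intro add_left_mono) auto
  finally show ?case
    using insert by simp
qed (auto simp: zero)

lemma psum_in:
  assumes "finite P" "\<And>x y. x \<in> P \<Longrightarrow> y \<in> P \<Longrightarrow> x < y \<Longrightarrow> X x y \<in> M"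
  shows "psum X P \<in> M"
  unfolding psum_def
proof (rule sum_in)
  fix x assume x: "x \<in> {x. x \<in> P \<and> (\<exists>y\<in>P. x < y)}"
  then have "next_point P x \<in> {y \<in> P. x < y}"
    unfolding next_point_def using assms(1) by (intro Min_in) auto
  then show "X x (next_point P x) \<in> M"
    using x assms(2) by auto
qed

text \<open>Cutting out the interval of the partition that contains the midpoint halves the lengths and
  costs two terms \<open>W (b - a)\<close>; hence the bound satisfies the recursion of \<open>dyadic_sum\<close>.\<close>

lemma psum_coarsen:
  assumes W: "mono W"
    and X: "\<And>a b. l \<le> a \<Longrightarrow> a \<le> b \<Longrightarrow> b \<le> u \<Longrightarrow> X a b \<in> M"
    and X0: "\<And>a. X a a = 0"
    and \<delta>: "\<And>a c b. l \<le> a \<Longrightarrow> a \<le> c \<Longrightarrow> c \<le> b \<Longrightarrow> b \<le> u \<Longrightarrow> N (X a b - X a c - X c b) \<le> W (b - a)"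
  shows "finite P \<Longrightarrow> a \<in> P \<Longrightarrow> b \<in> P \<Longrightarrow> P \<subseteq> {a..b} \<Longrightarrow> l \<le> a \<Longrightarrow> b \<le> u
    \<Longrightarrow> N (psum X P - X a b) \<le> 2 * dyadic_sum W (b - a)"
proof (induction "card P" arbitrary: P a b rule: less_induct)
  case less
  show ?case
  proof (cases "a = b")
    case True
    then have "P = {a}" using less by auto
    then show ?thesis using True by (simp add: X0 zero)
  next
    case False
    then have ab: "a < b" using less by auto
    define m where "m = (a + b) / 2"
    have m: "a < m" "m < b" using ab by (auto simp: m_def)
    define x where "x = Max {y \<in> P. y \<le> m}"
    define y where "y = Min {y \<in> P. m < y}"
    have x: "x \<in> {y \<in> P. y \<le> m}"
      unfolding x_def using less m by (intro Max_in) auto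
    have y: "y \<in> {y \<in> P. m < y}"
      unfolding y_def using less m by (intro Min_in) auto
    have xy: "x < y" "a \<le> x" "y \<le> b" using x y less by auto
    have gap: "z \<le> x \<or> y \<le> z" if "z \<in> P" for z
      using that less(2) by (cases "z \<le> m") (auto simp: x_def y_def)
    define P1 P2 where "P1 = P \<inter> {..x}" and "P2 = P \<inter> {y..}"
    have "P \<inter> {x..} \<inter> {..y} = {x, y}" "P \<inter> {x..} \<inter> {y..} = P2"
      using gap x y xy by (auto simp: P2_def) force+
    then have split: "psum X P = psum X P1 + (X x y + psum X P2)"
      using psum_split[of P x X] psum_split[of "P \<inter> {x..}" y X] psum_pair[OF xy(1), of X] x y xy less(2)
      by (simp add: P1_def)
    have in1: "psum X P1 \<in> M" and in2: "psum X P2 \<in> M"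
      using less by (auto intro!: psum_in X simp: P1_def P2_def subset_iff)
    \<comment> \<open>Each side misses the endpoint of the gap that belongs to the other side, so
      the induction on the number of points applies to both.\<close>
    have card: "card P1 < card P" "card P2 < card P"
    proof -
      have "y \<in> P" "y \<notin> P1" "P1 \<subseteq> P" "x \<in> P" "x \<notin> P2" "P2 \<subseteq> P"
        using x y xy(1) by (auto simp: P1_def P2_def)
      then have "P1 \<subset> P" "P2 \<subset> P" by blast+
      then show "card P1 < card P" "card P2 < card P"
        using less(2) by (auto intro: psubset_card_mono)
    qed
    have 1: "N (psum X P1 - X a x) \<le> 2 * dyadic_sum W (x - a)"
      using x y xy less by (intro less(1) card) (auto simp: P1_def)
    have 2: "N (psum X P2 - X y b) \<le> 2 * dyadic_sum W (b - y)"
      using x y xy less by (intro less(1) card) (auto simp: P2_def)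
    have half: "dyadic_sum W (x - a) \<le> dyadic_sum W ((b - a) / 2)" "dyadic_sum W (b - y) \<le> dyadic_sum W ((b - a) / 2)"
      using x y by (auto intro!: monoD[OF dyadic_sum_mono[OF W]] simp: m_def field_simps)
    have 3: "N (X a b - X a x - X x b) \<le> W (b - a)"
      using x xy less by (intro \<delta>) auto
    have "N (X x b - X x y - X y b) \<le> W (b - x)"
      using x xy less by (intro \<delta>) auto
    also have "\<dots> \<le> W (b - a)"
      using xy by (intro monoD[OF W]) auto
    finally have 4: "N (X x b - X x y - X y b) \<le> W (b - a)" .
    have inX: "X a b \<in> M" "X a x \<in> M" "X x b \<in> M" "X x y \<in> M" "X y b \<in> M"
      using xy less by (auto intro!: X)
    \<comment> \<open>The single increment is split twice, at \<open>x\<close> and then at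
      \<open>y\<close>. The increment over the gap itself cancels, and each splitting costs one
      defect.\<close>
    have "psum X P - X a b = ((psum X P1 - X a x) + (psum X P2 - X y b)) - ((X a b - X a x - X x b) + (X x b - X x y - X y b))"
      by (simp add: split algebra_simps)
    also have "N \<dots> \<le> N ((psum X P1 - X a x) + (psum X P2 - X y b)) + N ((X a b - X a x - X x b) + (X x b - X x y - X y b))"
      by (intro triangle_diff add diff in1 in2 inX)
    also have "\<dots> \<le> (N (psum X P1 - X a x) + N (psum X P2 - X y b)) + (N (X a b - X a x - X x b) + N (X x b - X x y - X y b))"
      by (intro add_mono triangle add diff in1 in2 inX)
    also have "\<dots> \<le> (2 * dyadic_sum W ((b - a) / 2) + 2 * dyadic_sum W ((b - a) / 2)) + (W (b - a) + W (b - a))"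
      by (intro add_mono order_trans[OF 1] order_trans[OF 2] mult_left_mono half 3 4) auto
    also have "\<dots> = 2 * dyadic_sum W (b - a)"
      by (subst (3) dyadic_sum_unfold) (simp add: mult_2 distrib_left add_ac)
    finally show ?thesis .
  qed
qed

text \<open>Induction over the intervals of \<open>Q\<close>, peeling off the last one. The part of
  \<open>P\<close> inside it is compared with a single increment by \<open>psum_coarsen\<close>, and
  the bounds collect into a sum along \<open>Q\<close>.\<close>

lemma psum_refine:
  assumes W: "mono W"
    and X: "\<And>a b. l \<le> a \<Longrightarrow> a \<le> b \<Longrightarrow> b \<le> u \<Longrightarrow> X a b \<in> M"
    and X0: "\<And>a. X a a = 0"
    and \<delta>: "\<And>a c b. l \<le> a \<Longrightarrow> a \<le> c \<Longrightarrow> c \<le> b \<Longrightarrow> b \<le> u \<Longrightarrow> N (X a b - X a c - X c b) \<le> W (b - a)"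
  shows "finite P \<Longrightarrow> Q \<subseteq> P \<Longrightarrow> a \<in> Q \<Longrightarrow> b \<in> Q \<Longrightarrow> P \<subseteq> {a..b} \<Longrightarrow> l \<le> a \<Longrightarrow> b \<le> u
    \<Longrightarrow> N (psum X P - psum X Q) \<le> psum (\<lambda>x y. 2 * dyadic_sum W (y - x)) Q"
proof (induction "card Q" arbitrary: P Q b rule: less_induct)
  case less
  have finQ: "finite Q" using less finite_subset by blast
  show ?case
  proof (cases "a = b")
    case True
    then have "P = {a}" "Q = {a}" using less by auto
    then show ?thesis by (simp add: zero)
  next
    case False
    then have ab: "a < b" using less by auto
    define c where "c = Max (Q - {b})"
    have c: "c \<in> Q - {b}"
      unfolding c_def using less ab finQ by (intro Max_in) auto
    have cb: "c < b" "a \<le> c" using c less by auto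
    have 1: "Q \<inter> {..c} = Q - {b}"
      using cb finQ by (auto simp: c_def)
    have "x \<le> c \<or> x = b" if "x \<in> Q" for x
      using that finQ by (auto simp: c_def)
    then have 2: "Q \<inter> {c..} = {c, b}"
      using cb c less by force
    have Q: "psum X Q = psum X (Q - {b}) + X c b"
        "psum (\<lambda>x y. 2 * dyadic_sum W (y - x)) Q = psum (\<lambda>x y. 2 * dyadic_sum W (y - x)) (Q - {b}) + 2 * dyadic_sum W (b - c)"
      using psum_split[OF finQ, of c] c cb unfolding 1 2 by (auto simp: psum_pair)
    have P: "psum X P = psum X (P \<inter> {..c}) + psum X (P \<inter> {c..})"
      using less c by (intro psum_split) auto
    have A: "N (psum X (P \<inter> {..c}) - psum X (Q - {b})) \<le> psum (\<lambda>x y. 2 * dyadic_sum W (y - x)) (Q - {b})"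
    proof (rule less.hyps[where b = c])
      show "card (Q - {b}) < card Q"
        using finQ less.prems by (intro card_Diff1_less) auto
      show "Q - {b} \<subseteq> P \<inter> {..c}"
        using 1 less.prems by auto
    qed (use less.prems c cb in auto)
    have B: "N (psum X (P \<inter> {c..}) - X c b) \<le> 2 * dyadic_sum W (b - c)"
      using less c cb by (intro psum_coarsen[OF W X X0 \<delta>]) auto
    have "psum X P - psum X Q = (psum X (P \<inter> {..c}) - psum X (Q - {b})) + (psum X (P \<inter> {c..}) - X c b)"
      by (simp add: P Q algebra_simps)
    also have "N \<dots> \<le> N (psum X (P \<inter> {..c}) - psum X (Q - {b})) + N (psum X (P \<inter> {c..}) - X c b)"
    proof (intro triangle diff)
      have *: "X x y \<in> M" if "x \<in> P" "y \<in> P" "x < y" for x y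
        using that less by (intro X) (auto simp: subset_iff intro: order_trans)
      show "psum X (P \<inter> {..c}) \<in> M" "psum X (P \<inter> {c..}) \<in> M" "psum X (Q - {b}) \<in> M" "X c b \<in> M"
        using less finQ c cb by (auto intro!: psum_in *)
    qed
    also have "\<dots> \<le> psum (\<lambda>x y. 2 * dyadic_sum W (y - x)) Q"
      unfolding Q(2) by (intro add_mono A B)
    finally show ?thesis .
  qed
qed

text \<open>Neither set needs to refine the other, but the union refines both, and each comparison
  with it costs one bound.\<close>

lemma psum_common_refinement:
  assumes W: "mono W"
    and X: "\<And>a b. l \<le> a \<Longrightarrow> a \<le> b \<Longrightarrow> b \<le> u \<Longrightarrow> X a b \<in> M"
    and X0: "\<And>a. X a a = 0"
    and \<delta>: "\<And>a c b. l \<le> a \<Longrightarrow> a \<le> c \<Longrightarrow> c \<le> b \<Longrightarrow> b \<le> u \<Longrightarrow> N (X a b - X a c - X c b) \<le> W (b - a)"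
    and Q: "finite Q" "finite Q'" "l \<in> Q" "u \<in> Q" "Q \<subseteq> {l..u}" "l \<in> Q'" "u \<in> Q'" "Q' \<subseteq> {l..u}"
  shows "N (psum X Q - psum X Q')
    \<le> psum (\<lambda>x y. 2 * dyadic_sum W (y - x)) Q + psum (\<lambda>x y. 2 * dyadic_sum W (y - x)) Q'"
proof -
  let ?P = "Q \<union> Q'"
  have in_M: "psum X A \<in> M" if "A \<subseteq> ?P" for A
  proof -
    have "finite A" using that Q finite_subset[of A ?P] by auto
    then show ?thesis
      using that Q by (intro psum_in X) (auto simp: subset_iff)
  qed
  have 1: "N (psum X ?P - psum X Q) \<le> psum (\<lambda>x y. 2 * dyadic_sum W (y - x)) Q"
    using Q by (intro psum_refine[OF W X X0 \<delta>, where a = l and b = u]) auto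
  have 2: "N (psum X ?P - psum X Q') \<le> psum (\<lambda>x y. 2 * dyadic_sum W (y - x)) Q'"
    using Q by (intro psum_refine[OF W X X0 \<delta>, where a = l and b = u]) auto
  have "psum X Q - psum X Q' = (psum X ?P - psum X Q') - (psum X ?P - psum X Q)"
    by simp
  also have "N \<dots> \<le> N (psum X ?P - psum X Q') + N (psum X ?P - psum X Q)"
    by (intro triangle_diff diff in_M) auto
  also have "\<dots> \<le> psum (\<lambda>x y. 2 * dyadic_sum W (y - x)) Q' + psum (\<lambda>x y. 2 * dyadic_sum W (y - x)) Q"
    by (intro add_mono 1 2)
  finally show ?thesis by (simp add: add.commute)
qed

end

subsection \<open>From mean bounds to pointwise bounds\<close>

lemma lborel_distr_affine_unit:
  fixes c t :: real
  assumes "\<bar>c\<bar> = 1"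
  shows "distr lborel borel (\<lambda>x. t + c * x) = lborel"
  using lborel_real_affine[of c t] assms by (auto simp: density_1)

lemma AE_lborel_affine_unit:
  fixes c t :: real
  assumes "\<bar>c\<bar> = 1" "AE x in lborel. P x"
  shows "AE x in lborel. P (t + c * x)"
proof (rule AE_distrD[where M' = borel and P = P])
  show "(\<lambda>x. t + c * x) \<in> lborel \<rightarrow>\<^sub>M borel" by measurable
  show "AE x in distr lborel borel (\<lambda>x. t + c * x). P x"
    using assms(2) unfolding lborel_distr_affine_unit[OF assms(1)] .
qed

lemma nn_integral_affine_unit:
  fixes c t :: real
  assumes "\<bar>c\<bar> = 1" "f \<in> borel_measurable borel"
  shows "(\<integral>\<^sup>+x. f (t + c * x) \<partial>lborel) = (\<integral>\<^sup>+x. f x \<partial>lborel)"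
  using nn_integral_real_affine[OF assms(2), of c t] assms(1) by auto

text \<open>The coordinates \<open>r = s\<close> and \<open>h = t - s\<close> connect what is known
  along lines of constant increment with integrals over pairs of times.\<close>

lemma nn_integral_shear:
  fixes F :: "real \<Rightarrow> real \<Rightarrow> ennreal"
  assumes F: "case_prod F \<in> borel_measurable (borel \<Otimes>\<^sub>M borel)"
  shows "(\<integral>\<^sup>+h. \<integral>\<^sup>+r. F r (r + h) \<partial>lborel \<partial>lborel) = (\<integral>\<^sup>+s. \<integral>\<^sup>+t. F s t \<partial>lborel \<partial>lborel)"
proof -
  have [measurable (raw)]: "f \<in> borel_measurable M \<Longrightarrow> g \<in> borel_measurable M \<Longrightarrow> (\<lambda>x. F (f x) (g x)) \<in> borel_measurable M" for f g :: "_ \<Rightarrow> real" and M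
    using measurable_compose[OF measurable_Pair F, of f M g] by simp
  have "(\<integral>\<^sup>+h. \<integral>\<^sup>+r. F r (r + h) \<partial>lborel \<partial>lborel) = (\<integral>\<^sup>+r. \<integral>\<^sup>+h. F r (r + h) \<partial>lborel \<partial>lborel)"
    by (rule lborel_pair.Fubini') measurable
  also have "\<dots> = (\<integral>\<^sup>+s. \<integral>\<^sup>+t. F s t \<partial>lborel \<partial>lborel)"
  proof (rule nn_integral_cong)
    fix r
    show "(\<integral>\<^sup>+h. F r (r + h) \<partial>lborel) = (\<integral>\<^sup>+t. F r t \<partial>lborel)"
      using nn_integral_affine_unit[of 1 "F r" r] by simp
  qed
  finally show ?thesis .
qed

lemma powr_divide_power2:
  fixes x a :: real
  shows "(x / 2 ^ k) powr a = x powr a * (2 powr (- a)) ^ k"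
proof -
  have "(2 ^ k) powr a = ((2 :: real) powr a) ^ k"
    by (simp add: powr_powr mult.commute flip: powr_realpow)
  moreover have "((2 :: real) powr (- a)) ^ k = inverse ((2 powr a) ^ k)"
    by (simp only: powr_minus power_inverse)
  moreover have "(x / 2 ^ k) powr a = x powr a / (2 ^ k) powr a"
    by (rule powr_divide)
  ultimately show ?thesis
    by (simp only: divide_inverse)
qed

text \<open>A Campanato-type setting. \<open>\<phi>\<close> stands for the size of a function of
  pairs that is additive up to \<open>M * (t - s) powr \<kappa>\<close>, expressed in the three
  arrangements of the triangle inequality, and whose averages over short windows are small. The
  constant \<open>L\<close> enters the final bound; \<open>global\<close> is qualitative and serves
  to show that averages at a point vanish in the limit.\<close>

locale mean_bounded =
  fixes T \<kappa> M L :: real and \<phi> :: "real \<Rightarrow> real \<Rightarrow> real"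
  assumes T: "0 < T" and \<kappa>: "0 < \<kappa>" and M: "0 \<le> M" and L: "0 \<le> L"
    and nonneg: "0 \<le> \<phi> s t"
    and meas: "case_prod \<phi> \<in> borel_measurable (borel \<Otimes>\<^sub>M borel)"
    and tri1: "\<lbrakk>0 \<le> s; s \<le> u; u \<le> t; t \<le> T\<rbrakk> \<Longrightarrow> \<phi> s t \<le> \<phi> s u + \<phi> u t + M * (t - s) powr \<kappa>"
    and tri2: "\<lbrakk>0 \<le> s; s \<le> u; u \<le> t; t \<le> T\<rbrakk> \<Longrightarrow> \<phi> s u \<le> \<phi> s t + \<phi> u t + M * (t - s) powr \<kappa>"
    and tri3: "\<lbrakk>0 \<le> s; s \<le> u; u \<le> t; t \<le> T\<rbrakk> \<Longrightarrow> \<phi> u t \<le> \<phi> s t + \<phi> s u + M * (t - s) powr \<kappa>"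
    and window: "\<lbrakk>0 < \<epsilon>; \<epsilon> \<le> 3 * T / 4; 0 \<le> h; h \<le> \<epsilon>; 0 \<le> a; a + \<epsilon> \<le> T\<rbrakk>
      \<Longrightarrow> (\<integral>\<^sup>+r\<in>{a..a + \<epsilon> - h}. ennreal (\<phi> r (r + h)) \<partial>lborel) \<le> ennreal (L * \<epsilon> powr (1 + \<kappa>))"
    and global: "\<exists>L'. 0 \<le> L' \<and> (\<forall>h. 0 < h \<and> h \<le> T / 2 \<longrightarrow>
      (\<integral>\<^sup>+r\<in>{0..T - h}. ennreal (\<phi> r (r + h)) \<partial>lborel) \<le> ennreal (L' * h powr \<kappa>))"
begin

lemma measurable_phi [measurable (raw)]:
  "f \<in> borel_measurable N \<Longrightarrow> g \<in> borel_measurable N \<Longrightarrow> (\<lambda>x. \<phi> (f x) (g x)) \<in> borel_measurable N"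
  using measurable_compose[OF measurable_Pair meas, of f N g] by simp

definition decay :: real where "decay = 1 / (1 - 2 powr (- \<kappa>))"

lemma decay_ge_1: "1 \<le> decay"
  using \<kappa> by (simp add: decay_def powr_less_one)

text \<open>The window bound is integrated over all increments \<open>h \<le> \<epsilon>\<close>,
  which gains one power of \<open>\<epsilon>\<close>; the shear turns the result into an integral
  over a triangle of pairs.\<close>

lemma double_window:
  assumes \<epsilon>: "0 < \<epsilon>" "\<epsilon> \<le> 3 * T / 4" and a: "0 \<le> a" "a + \<epsilon> \<le> T"
  shows "(\<integral>\<^sup>+s. \<integral>\<^sup>+t. ennreal (\<phi> s t) * indicator {(s, t). a \<le> s \<and> s \<le> t \<and> t \<le> a + \<epsilon>} (s, t) \<partial>lborel \<partial>lborel)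
    \<le> ennreal (L * \<epsilon> powr (2 + \<kappa>))"
proof -
  let ?F = "\<lambda>s t. ennreal (\<phi> s t) * indicator {(s, t). a \<le> s \<and> s \<le> t \<and> t \<le> a + \<epsilon>} (s, t)"
  have "(\<integral>\<^sup>+s. \<integral>\<^sup>+t. ?F s t \<partial>lborel \<partial>lborel) = (\<integral>\<^sup>+h. \<integral>\<^sup>+r. ?F r (r + h) \<partial>lborel \<partial>lborel)"
    by (rule nn_integral_shear[symmetric]) (unfold indicator_def, measurable)
  also have "\<dots> \<le> (\<integral>\<^sup>+h. ennreal (L * \<epsilon> powr (1 + \<kappa>)) * indicator {0..\<epsilon>} h \<partial>lborel)"
  proof (rule nn_integral_mono)
    fix h
    show "(\<integral>\<^sup>+r. ?F r (r + h) \<partial>lborel) \<le> ennreal (L * \<epsilon> powr (1 + \<kappa>)) * indicator {0..\<epsilon>} h"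
    proof (cases "h \<in> {0..\<epsilon>}")
      case True
      have "(\<integral>\<^sup>+r. ?F r (r + h) \<partial>lborel) = (\<integral>\<^sup>+r\<in>{a..a + \<epsilon> - h}. ennreal (\<phi> r (r + h)) \<partial>lborel)"
        using True by (intro nn_integral_cong) (auto simp: indicator_def)
      also have "\<dots> \<le> ennreal (L * \<epsilon> powr (1 + \<kappa>))"
        using True \<epsilon> a by (intro window) auto
      finally show ?thesis using True by simp
    next
      case False
      then have "(\<integral>\<^sup>+r. ?F r (r + h) \<partial>lborel) = (\<integral>\<^sup>+(r::real). 0 \<partial>lborel)"
        by (intro nn_integral_cong) (auto simp: indicator_def)
      then show ?thesis by simp
    qed
  qed
  also have "\<dots> = ennreal (L * \<epsilon> powr (1 + \<kappa>) * \<epsilon>)"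
    using \<epsilon> L by (simp add: nn_integral_cmult ennreal_mult)
  also have "L * \<epsilon> powr (1 + \<kappa>) * \<epsilon> = L * \<epsilon> powr (2 + \<kappa>)"
  proof -
    have "\<epsilon> powr (1 + \<kappa>) * \<epsilon> = \<epsilon> powr (1 + \<kappa> + 1)"
      using \<epsilon> by (simp only: powr_add[of \<epsilon> "1 + \<kappa>" 1] powr_one less_imp_le)
    then show ?thesis by (simp add: add.commute add.left_commute)
  qed
  finally show ?thesis .
qed

definition rmean :: "real \<Rightarrow> real \<Rightarrow> ennreal" where
  "rmean \<epsilon> s = ennreal (1 / \<epsilon>) * (\<integral>\<^sup>+x\<in>{s..s + \<epsilon>}. ennreal (\<phi> s x) \<partial>lborel)"

lemma measurable_rmean [measurable]: "rmean \<epsilon> \<in> borel_measurable borel"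
  unfolding rmean_def[abs_def] indicator_def atLeastAtMost_iff by measurable

text \<open>The almost triangle inequality between \<open>s\<close>, \<open>x\<close> and
  \<open>y\<close> is averaged over \<open>x\<close> in the full window and \<open>y\<close> in its
  left half. The double integral enters once for each order of \<open>x\<close> and
  \<open>y\<close>; dividing \<open>2 * L * \<epsilon> powr (2 + \<kappa>)\<close> by
  \<open>\<epsilon> * (\<epsilon> / 2)\<close> produces the coefficient
  \<open>4 * L\<close>.\<close>

lemma rmean_half:
  assumes \<epsilon>: "0 < \<epsilon>" "\<epsilon> \<le> T / 2" and s: "0 \<le> s" "s + \<epsilon> \<le> T"
  shows "rmean \<epsilon> s \<le> rmean (\<epsilon> / 2) s + ennreal ((4 * L + M) * \<epsilon> powr \<kappa>)"
proof -
  define a1 where "a1 = (\<integral>\<^sup>+x\<in>{s..s + \<epsilon>}. ennreal (\<phi> s x) \<partial>lborel)"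
  define a2 where "a2 = (\<integral>\<^sup>+x\<in>{s..s + \<epsilon> / 2}. ennreal (\<phi> s x) \<partial>lborel)"
  define D where "D x y = ennreal (\<phi> x y) * indicator {(x, y). s \<le> x \<and> x \<le> y \<and> y \<le> s + \<epsilon>} (x, y)" for x y
  have D: "(\<integral>\<^sup>+x. \<integral>\<^sup>+y. D x y \<partial>lborel \<partial>lborel) \<le> ennreal (L * \<epsilon> powr (2 + \<kappa>))"
    unfolding D_def using \<epsilon> s T by (intro double_window) auto
  have Dm [measurable]: "case_prod D \<in> borel_measurable (borel \<Otimes>\<^sub>M borel)"
    unfolding D_def indicator_def by measurable
  have [measurable (raw)]: "f \<in> borel_measurable N \<Longrightarrow> g \<in> borel_measurable N \<Longrightarrow> (\<lambda>x. D (f x) (g x)) \<in> borel_measurable N" for f g :: "_ \<Rightarrow> real" and N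
    using measurable_compose[OF measurable_Pair Dm, of f N g] by simp
  let ?I = "indicator {s..s + \<epsilon>} :: real \<Rightarrow> ennreal" and ?J = "indicator {s..s + \<epsilon> / 2} :: real \<Rightarrow> ennreal"
  let ?m = "ennreal (M * \<epsilon> powr \<kappa>)"
  have pt: "ennreal (\<phi> s x) * ?I x * ?J y
      \<le> ennreal (\<phi> s y) * ?J y * ?I x + D x y + D y x + ?m * ?I x * ?J y" for x y
  proof (cases "x \<in> {s..s + \<epsilon>} \<and> y \<in> {s..s + \<epsilon> / 2}")
    case True
    define \<psi> where "\<psi> = (if x \<le> y then \<phi> x y else \<phi> y x)"
    have k: "M * (z - s) powr \<kappa> \<le> M * \<epsilon> powr \<kappa>" if "z \<in> {s..s + \<epsilon>}" for z
      using that M \<kappa> by (intro mult_left_mono powr_mono2) auto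
    have "\<phi> s x \<le> \<phi> s y + \<psi> + M * \<epsilon> powr \<kappa>"
    proof (cases "x \<le> y")
      case xy: True
      have "\<phi> s x \<le> \<phi> s y + \<phi> x y + M * (y - s) powr \<kappa>"
        using True xy s \<epsilon> by (intro tri2) auto
      with k[of y] True xy \<epsilon> show ?thesis by (auto simp: \<psi>_def)
    next
      case xy: False
      have "\<phi> s x \<le> \<phi> s y + \<phi> y x + M * (x - s) powr \<kappa>"
        using True xy s \<epsilon> by (intro tri1) auto
      with k[of x] True xy \<epsilon> show ?thesis by (auto simp: \<psi>_def)
    qed
    then have "ennreal (\<phi> s x) \<le> ennreal (\<phi> s y + \<psi> + M * \<epsilon> powr \<kappa>)"
      by (rule ennreal_leI)
    also have "\<dots> = ennreal (\<phi> s y) + ennreal \<psi> + ?m"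
      using nonneg M by (simp add: \<psi>_def)
    also have "ennreal \<psi> \<le> D x y + D y x"
      using True \<epsilon> by (auto simp: \<psi>_def D_def)
    finally show ?thesis
      using True by (simp add: add_left_mono add_right_mono add.assoc)
  next
    case False
    then have "ennreal (\<phi> s x) * ?I x * ?J y = 0" by auto
    then show ?thesis by (simp only: zero_le)
  qed
  have "ennreal (\<epsilon> / 2) * a1 = (\<integral>\<^sup>+y. \<integral>\<^sup>+x. ennreal (\<phi> s x) * ?I x * ?J y \<partial>lborel \<partial>lborel)"
    using \<epsilon> unfolding a1_def by (simp add: nn_integral_multc nn_integral_cmult mult.commute)
  also have "\<dots> \<le> (\<integral>\<^sup>+y. \<integral>\<^sup>+x. ennreal (\<phi> s y) * ?J y * ?I x + D x y + D y x + ?m * ?I x * ?J y \<partial>lborel \<partial>lborel)"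
    by (intro nn_integral_mono pt)
  also have "\<dots> = (\<integral>\<^sup>+y. ennreal (\<phi> s y) * ?J y * ennreal \<epsilon> + (\<integral>\<^sup>+x. D x y \<partial>lborel) + (\<integral>\<^sup>+x. D y x \<partial>lborel) + ?m * ennreal \<epsilon> * ?J y \<partial>lborel)"
    using \<epsilon> by (intro nn_integral_cong) (simp add: nn_integral_add nn_integral_cmult nn_integral_multc)
  also have "\<dots> = a2 * ennreal \<epsilon> + (\<integral>\<^sup>+y. \<integral>\<^sup>+x. D x y \<partial>lborel \<partial>lborel) + (\<integral>\<^sup>+y. \<integral>\<^sup>+x. D y x \<partial>lborel \<partial>lborel) + ?m * ennreal \<epsilon> * ennreal (\<epsilon> / 2)"
    unfolding a2_def using \<epsilon> by (simp add: nn_integral_add nn_integral_cmult nn_integral_multc)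
  also have "(\<integral>\<^sup>+y. \<integral>\<^sup>+x. D x y \<partial>lborel \<partial>lborel) = (\<integral>\<^sup>+x. \<integral>\<^sup>+y. D x y \<partial>lborel \<partial>lborel)"
    by (rule lborel_pair.Fubini') measurable
  also have "a2 * ennreal \<epsilon> + \<dots> + (\<integral>\<^sup>+y. \<integral>\<^sup>+x. D y x \<partial>lborel \<partial>lborel) + ?m * ennreal \<epsilon> * ennreal (\<epsilon> / 2)
      \<le> a2 * ennreal \<epsilon> + ennreal (L * \<epsilon> powr (2 + \<kappa>)) + ennreal (L * \<epsilon> powr (2 + \<kappa>)) + ?m * ennreal \<epsilon> * ennreal (\<epsilon> / 2)"
    by (intro add_mono D order_refl)
  also have "\<dots> = a2 * ennreal \<epsilon> + ennreal (2 * L * \<epsilon> powr (2 + \<kappa>) + M * \<epsilon> powr \<kappa> * \<epsilon> * (\<epsilon> / 2))"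
    using \<epsilon> L M by (simp add: add.assoc ennreal_mult[symmetric] ennreal_plus[symmetric] del: ennreal_plus)
  finally have "ennreal (2 / \<epsilon>\<^sup>2) * (ennreal (\<epsilon> / 2) * a1)
      \<le> ennreal (2 / \<epsilon>\<^sup>2) * (a2 * ennreal \<epsilon> + ennreal (2 * L * \<epsilon> powr (2 + \<kappa>) + M * \<epsilon> powr \<kappa> * \<epsilon> * (\<epsilon> / 2)))"
    by (rule mult_left_mono) simp
  moreover have "ennreal (2 / \<epsilon>\<^sup>2) * (ennreal (\<epsilon> / 2) * a1) = rmean \<epsilon> s"
  proof -
    have "2 / \<epsilon>\<^sup>2 * (\<epsilon> / 2) = 1 / \<epsilon>" using \<epsilon> by (simp add: power2_eq_square)
    then show ?thesis
      using \<epsilon> by (simp add: rmean_def a1_def flip: mult.assoc ennreal_mult)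
  qed
  moreover have "ennreal (2 / \<epsilon>\<^sup>2) * (a2 * ennreal \<epsilon> + ennreal (2 * L * \<epsilon> powr (2 + \<kappa>) + M * \<epsilon> powr \<kappa> * \<epsilon> * (\<epsilon> / 2)))
      = rmean (\<epsilon> / 2) s + ennreal ((4 * L + M) * \<epsilon> powr \<kappa>)"
  proof -
    have "2 / \<epsilon>\<^sup>2 * \<epsilon> = 1 / (\<epsilon> / 2)" using \<epsilon> by (simp add: power2_eq_square)
    then have "ennreal (2 / \<epsilon>\<^sup>2) * (a2 * ennreal \<epsilon>) = rmean (\<epsilon> / 2) s"
      using \<epsilon> by (simp add: rmean_def a2_def mult.left_commute mult.commute flip: mult.assoc ennreal_mult)
    moreover have "2 / \<epsilon>\<^sup>2 * (2 * L * \<epsilon> powr (2 + \<kappa>) + M * \<epsilon> powr \<kappa> * \<epsilon> * (\<epsilon> / 2)) = (4 * L + M) * \<epsilon> powr \<kappa>"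
      using \<epsilon> by (simp add: powr_add field_simps power2_eq_square)
    then have "ennreal (2 / \<epsilon>\<^sup>2) * ennreal (2 * L * \<epsilon> powr (2 + \<kappa>) + M * \<epsilon> powr \<kappa> * \<epsilon> * (\<epsilon> / 2)) = ennreal ((4 * L + M) * \<epsilon> powr \<kappa>)"
      using \<epsilon> L M by (subst ennreal_mult[symmetric]) auto
    ultimately show ?thesis
      by (simp add: distrib_left)
  qed
  ultimately show ?thesis by simp
qed

lemma rmean_iterate:
  assumes \<epsilon>: "0 < \<epsilon>" "\<epsilon> \<le> T / 2" and s: "0 \<le> s" "s + \<epsilon> \<le> T"
  shows "rmean \<epsilon> s \<le> rmean (\<epsilon> / 2 ^ k) s + ennreal ((4 * L + M) * \<epsilon> powr \<kappa> * (\<Sum>j<k. (2 powr (- \<kappa>)) ^ j))"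
proof (induction k)
  case (Suc k)
  let ?e = "\<epsilon> / 2 ^ k"
  have e: "0 < ?e" "?e \<le> \<epsilon>"
    using \<epsilon> divide_left_mono[of 1 "2 ^ k" \<epsilon>] by auto
  note Suc
  also have "rmean ?e s \<le> rmean (?e / 2) s + ennreal ((4 * L + M) * ?e powr \<kappa>)"
    using e \<epsilon> s by (intro rmean_half; linarith)
  also have "?e powr \<kappa> = \<epsilon> powr \<kappa> * (2 powr (- \<kappa>)) ^ k"
    by (rule powr_divide_power2)
  finally have *: "rmean \<epsilon> s \<le> rmean (\<epsilon> / 2 ^ Suc k) s
      + ennreal ((4 * L + M) * (\<epsilon> powr \<kappa> * (2 powr (- \<kappa>)) ^ k))
      + ennreal ((4 * L + M) * \<epsilon> powr \<kappa> * (\<Sum>j<k. (2 powr (- \<kappa>)) ^ j))"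
    by (simp add: mult.commute)
  have "0 \<le> (4 * L + M) * (\<epsilon> powr \<kappa> * (2 powr (- \<kappa>)) ^ k)"
      "0 \<le> (4 * L + M) * \<epsilon> powr \<kappa> * (\<Sum>j<k. (2 powr (- \<kappa>)) ^ j)"
    using L M by (auto intro!: mult_nonneg_nonneg sum_nonneg)
  moreover have "(4 * L + M) * (\<epsilon> powr \<kappa> * (2 powr (- \<kappa>)) ^ k) + (4 * L + M) * \<epsilon> powr \<kappa> * (\<Sum>j<k. (2 powr (- \<kappa>)) ^ j)
      = (4 * L + M) * \<epsilon> powr \<kappa> * (\<Sum>j<Suc k. (2 powr (- \<kappa>)) ^ j)"
    by (simp add: distrib_left)
  ultimately show ?case
    using * by (simp only: add.assoc ennreal_plus[symmetric])
qed simp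

text \<open>The integral of the averages over all starting points is at most a multiple of
  \<open>e n powr \<kappa>\<close>, which is summable over dyadic scales. Hence at almost every
  point the series of averages converges and its terms tend to \<open>0\<close>. This argument takes
  the place of a differentiation theorem.\<close>

lemma rmean_tendsto_0:
  "AE s in lborel. 0 \<le> s \<and> s < T \<longrightarrow> (\<lambda>n. rmean (T / 2 ^ Suc n) s) \<longlonglongrightarrow> 0"
proof -
  obtain L' where L': "0 \<le> L'" and glob: "\<And>h. 0 < h \<Longrightarrow> h \<le> T / 2 \<Longrightarrow>
      (\<integral>\<^sup>+r\<in>{0..T - h}. ennreal (\<phi> r (r + h)) \<partial>lborel) \<le> ennreal (L' * h powr \<kappa>)"
    using global by blast
  define e where "e n = T / 2 ^ Suc n" for n
  have e: "0 < e n" "e n \<le> T / 2" for n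
    using T divide_left_mono[of 2 "2 * 2 ^ n" T] by (auto simp: e_def)
  have "(\<integral>\<^sup>+s\<in>{0..T - e n}. rmean (e n) s \<partial>lborel) \<le> ennreal (L' * e n powr \<kappa>)" for n
  proof -
    let ?F = "\<lambda>s t. ennreal (1 / e n) * ennreal (\<phi> s t) * indicator {(s, t). 0 \<le> s \<and> s \<le> t \<and> t \<le> s + e n \<and> t \<le> T} (s, t)"
    have "(\<integral>\<^sup>+s\<in>{0..T - e n}. rmean (e n) s \<partial>lborel) \<le> (\<integral>\<^sup>+s. \<integral>\<^sup>+t. ?F s t \<partial>lborel \<partial>lborel)"
    proof (rule nn_integral_mono)
      fix s
      show "rmean (e n) s * indicator {0..T - e n} s \<le> (\<integral>\<^sup>+t. ?F s t \<partial>lborel)"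
      proof (cases "s \<in> {0..T - e n}")
        case True
        have "rmean (e n) s = (\<integral>\<^sup>+x. ennreal (1 / e n) * (ennreal (\<phi> s x) * indicator {s..s + e n} x) \<partial>lborel)"
          unfolding rmean_def by (rule nn_integral_cmult[symmetric]) measurable
        also have "\<dots> \<le> (\<integral>\<^sup>+t. ?F s t \<partial>lborel)"
          using True by (intro nn_integral_mono) (auto simp: indicator_def)
        finally show ?thesis using True by simp
      qed simp
    qed
    also have "\<dots> = (\<integral>\<^sup>+h. \<integral>\<^sup>+r. ?F r (r + h) \<partial>lborel \<partial>lborel)"
      by (rule nn_integral_shear[symmetric]) (unfold indicator_def, measurable)
    also have "\<dots> \<le> (\<integral>\<^sup>+h. ennreal (1 / e n) * ennreal (L' * e n powr \<kappa>) * indicator {0..e n} h \<partial>lborel)"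
    proof (rule nn_integral_mono_AE, use AE_lborel_singleton[of 0] in eventually_elim)
      case (elim h)
      show ?case
      proof (cases "h \<in> {0..e n}")
        case True
        have "(\<integral>\<^sup>+r. ?F r (r + h) \<partial>lborel) = (\<integral>\<^sup>+r. ennreal (1 / e n) * (ennreal (\<phi> r (r + h)) * indicator {0..T - h} r) \<partial>lborel)"
          using True by (intro nn_integral_cong) (auto simp: indicator_def)
        also have "\<dots> = ennreal (1 / e n) * (\<integral>\<^sup>+r\<in>{0..T - h}. ennreal (\<phi> r (r + h)) \<partial>lborel)"
          by (rule nn_integral_cmult) measurable
        also have "\<dots> \<le> ennreal (1 / e n) * ennreal (L' * h powr \<kappa>)"
          using True elim e[of n] by (intro mult_left_mono glob) auto
        also have "\<dots> \<le> ennreal (1 / e n) * ennreal (L' * e n powr \<kappa>)"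
          using True L' \<kappa> by (intro mult_left_mono ennreal_leI powr_mono2) auto
        finally show ?thesis using True by simp
      next
        case False
        then have "(\<integral>\<^sup>+r. ?F r (r + h) \<partial>lborel) = (\<integral>\<^sup>+(r::real). 0 \<partial>lborel)"
          by (intro nn_integral_cong) (auto simp: indicator_def)
        then show ?thesis by simp
      qed
    qed
    also have "\<dots> = ennreal (1 / e n) * ennreal (L' * e n powr \<kappa>) * ennreal (e n)"
      using e[of n] by (simp add: nn_integral_cmult)
    also have "\<dots> = ennreal (L' * e n powr \<kappa>)"
      using e[of n] L' by (simp add: mult_ac flip: ennreal_mult)
    finally show ?thesis .
  qed
  then have "(\<Sum>n. \<integral>\<^sup>+s\<in>{0..T - e n}. rmean (e n) s \<partial>lborel) \<le> (\<Sum>n. ennreal (L' * e n powr \<kappa>))"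
    by (intro suminf_le) auto
  also have "\<dots> = (\<Sum>n. ennreal (L' * (T / 2) powr \<kappa>) * ennreal ((2 powr (- \<kappa>)) ^ n))"
  proof (rule suminf_cong)
    fix n
    have "e n powr \<kappa> = (T / 2) powr \<kappa> * (2 powr (- \<kappa>)) ^ n"
    proof -
      have "e n = T / 2 / 2 ^ n" by (simp add: e_def)
      then show ?thesis by (simp only: powr_divide_power2)
    qed
    then show "ennreal (L' * e n powr \<kappa>) = ennreal (L' * (T / 2) powr \<kappa>) * ennreal ((2 powr (- \<kappa>)) ^ n)"
      using L' by (simp add: mult.assoc flip: ennreal_mult)
  qed
  also have "\<dots> = ennreal (L' * (T / 2) powr \<kappa>) * ennreal (1 / (1 - 2 powr (- \<kappa>)))"
    unfolding ennreal_suminf_cmult using \<kappa> by (subst ennreal_geometric) (auto simp: powr_less_one)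
  also have "\<dots> < \<infinity>"
    by (simp flip: ennreal_mult'' add: ennreal_mult_less_top)
  finally have "(\<integral>\<^sup>+s. (\<Sum>n. rmean (e n) s * indicator {0..T - e n} s) \<partial>lborel) < \<infinity>"
    by (subst nn_integral_suminf) auto
  then have "AE s in lborel. (\<Sum>n. rmean (e n) s * indicator {0..T - e n} s) \<noteq> \<infinity>"
    by (intro nn_integral_noteq_infinite) auto
  then show ?thesis
  proof eventually_elim
    case (elim s)
    show ?case
    proof
      assume s: "0 \<le> s \<and> s < T"
      have "(\<lambda>n. rmean (e n) s * indicator {0..T - e n} s) \<longlonglongrightarrow> 0"
      proof -
        define f where "f n = enn2real (rmean (e n) s * indicator {0..T - e n} s)" for n
        have fin: "rmean (e n) s * indicator {0..T - e n} s = ennreal (f n)" for n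
          using elim ennreal_suminf_lessD[of "\<lambda>n. rmean (e n) s * indicator {0..T - e n} s" \<infinity> n]
          by (simp add: f_def less_top[symmetric])
        then have "summable f"
          using elim by (intro summable_suminf_not_top) (auto simp: f_def)
        then have "(\<lambda>n. ennreal (f n)) \<longlonglongrightarrow> ennreal 0"
          by (intro tendsto_ennrealI summable_LIMSEQ_zero)
        then show ?thesis
          unfolding fin by simp
      qed
      moreover have "eventually (\<lambda>n. e n < T - s) sequentially"
      proof -
        have "(\<lambda>n. T / 2 * (1 / 2) ^ n) \<longlonglongrightarrow> T / 2 * 0"
          by (intro tendsto_intros LIMSEQ_realpow_zero) auto
        moreover have "e = (\<lambda>n. T / 2 * (1 / 2) ^ n)"
          by (rule ext) (simp add: e_def power_divide)
        ultimately have "e \<longlonglongrightarrow> 0" by simp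
        then show ?thesis using s by (intro order_tendstoD(2)) auto
      qed
      then have "eventually (\<lambda>n. rmean (e n) s * indicator {0..T - e n} s = rmean (e n) s) sequentially"
        by eventually_elim (use s in auto)
      ultimately show "(\<lambda>n. rmean (T / 2 ^ Suc n) s) \<longlonglongrightarrow> 0"
        unfolding e_def by (rule Lim_transform_eventually)
    qed
  qed
qed

text \<open>The telescoping over scales ends in averages that vanish in the limit, so only the
  geometric series of the errors remains.\<close>

lemma rmean_bound:
  "AE s in lborel. 0 \<le> s \<and> s < T \<longrightarrow> (\<forall>n. s + T / 2 ^ Suc n \<le> T \<longrightarrow>
     rmean (T / 2 ^ Suc n) s \<le> ennreal ((4 * L + M) * decay * (T / 2 ^ Suc n) powr \<kappa>))"
  using rmean_tendsto_0
proof eventually_elim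
  case (elim s)
  show ?case
  proof (intro impI allI)
    fix n assume s: "0 \<le> s \<and> s < T" and n: "s + T / 2 ^ Suc n \<le> T"
    let ?e = "T / 2 ^ Suc n" and ?B = "ennreal ((4 * L + M) * decay * (T / 2 ^ Suc n) powr \<kappa>)"
    have e: "0 < ?e" "?e \<le> T / 2"
      using T divide_left_mono[of 2 "2 * 2 ^ n" T] by auto
    have le: "rmean ?e s \<le> rmean (T / 2 ^ Suc (k + n)) s + ?B" for k
    proof -
      have "rmean ?e s \<le> rmean (?e / 2 ^ k) s + ennreal ((4 * L + M) * ?e powr \<kappa> * (\<Sum>j<k. (2 powr (- \<kappa>)) ^ j))"
        using e s n by (intro rmean_iterate) auto
      also have "(\<Sum>j<k. (2 powr (- \<kappa>)) ^ j) \<le> decay"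
      proof -
        have S: "(\<lambda>j. (2 powr (- \<kappa>)) ^ j) sums decay"
          unfolding decay_def using \<kappa> by (intro geometric_sums) (auto simp: powr_less_one)
        show ?thesis
          by (subst sums_unique[OF S]) (rule sum_le_suminf[OF sums_summable[OF S]], simp_all)
      qed
      then have "ennreal ((4 * L + M) * ?e powr \<kappa> * (\<Sum>j<k. (2 powr (- \<kappa>)) ^ j)) \<le> ?B"
        using L M by (intro ennreal_leI) (simp add: mult_left_mono mult.assoc mult.commute[of decay])
      finally show ?thesis
        by (simp add: power_add mult_ac add_left_mono)
    qed
    have "(\<lambda>k. rmean (T / 2 ^ Suc (k + n)) s + ?B) \<longlonglongrightarrow> 0 + ?B"
      using elim s by (intro tendsto_add LIMSEQ_ignore_initial_segment[of "\<lambda>n. rmean (T / 2 ^ Suc n) s"]) auto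
    then show "rmean ?e s \<le> ?B"
      using le by (intro LIMSEQ_le_const[of _ "?B"]) auto
  qed
qed


end

section \<open>Two-sided averages and bounds between generic points\<close>

context mean_bounded
begin

text \<open>Time reversal exchanges the second and third almost triangle inequality and preserves
  the other assumptions, so results on averages to the right of a point yield those to its
  left.\<close>

lemma reflect: "mean_bounded T \<kappa> M L (\<lambda>s t. \<phi> (T - t) (T - s))"
proof
  show "(\<lambda>(s, t). \<phi> (T - t) (T - s)) \<in> borel_measurable (borel \<Otimes>\<^sub>M borel)"
    by measurable
  fix s u t assume "0 \<le> s" "s \<le> u" "u \<le> t" "t \<le> T"
  then show "\<phi> (T - t) (T - s) \<le> \<phi> (T - u) (T - s) + \<phi> (T - t) (T - u) + M * (t - s) powr \<kappa>"
    "\<phi> (T - u) (T - s) \<le> \<phi> (T - t) (T - s) + \<phi> (T - t) (T - u) + M * (t - s) powr \<kappa>"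
    "\<phi> (T - t) (T - u) \<le> \<phi> (T - t) (T - s) + \<phi> (T - u) (T - s) + M * (t - s) powr \<kappa>"
    using tri1[of "T - t" "T - u" "T - s"] tri2[of "T - t" "T - u" "T - s"] tri3[of "T - t" "T - u" "T - s"] by auto
next
  fix \<epsilon> h a assume *: "0 < \<epsilon>" "\<epsilon> \<le> 3 * T / 4" "0 \<le> h" "h \<le> \<epsilon>" "0 \<le> a" "a + \<epsilon> \<le> T"
  have "(\<integral>\<^sup>+r\<in>{a..a + \<epsilon> - h}. ennreal (\<phi> (T - (r + h)) (T - r)) \<partial>lborel)
      = (\<integral>\<^sup>+r. ennreal (\<phi> ((T - h) + (- 1) * r) ((T - h) + (- 1) * r + h)) * indicator {T - a - \<epsilon>..T - a - \<epsilon> + \<epsilon> - h} ((T - h) + (- 1) * r) \<partial>lborel)"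
    by (intro nn_integral_cong) (auto simp: indicator_def algebra_simps)
  also have "\<dots> = (\<integral>\<^sup>+r\<in>{T - a - \<epsilon>..T - a - \<epsilon> + \<epsilon> - h}. ennreal (\<phi> r (r + h)) \<partial>lborel)"
    by (rule nn_integral_affine_unit[where f = "\<lambda>r. ennreal (\<phi> r (r + h)) * indicator {T - a - \<epsilon>..T - a - \<epsilon> + \<epsilon> - h} r"]) auto
  also have "\<dots> \<le> ennreal (L * \<epsilon> powr (1 + \<kappa>))"
    using * by (intro window) auto
  finally show "(\<integral>\<^sup>+r\<in>{a..a + \<epsilon> - h}. ennreal (\<phi> (T - (r + h)) (T - r)) \<partial>lborel) \<le> ennreal (L * \<epsilon> powr (1 + \<kappa>))" .
next
  have "(\<integral>\<^sup>+r\<in>{0..T - h}. ennreal (\<phi> (T - (r + h)) (T - r)) \<partial>lborel) = (\<integral>\<^sup>+r\<in>{0..T - h}. ennreal (\<phi> r (r + h)) \<partial>lborel)" for h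
  proof -
    have "(\<integral>\<^sup>+r\<in>{0..T - h}. ennreal (\<phi> (T - (r + h)) (T - r)) \<partial>lborel)
        = (\<integral>\<^sup>+r. ennreal (\<phi> ((T - h) + (- 1) * r) ((T - h) + (- 1) * r + h)) * indicator {0..T - h} ((T - h) + (- 1) * r) \<partial>lborel)"
      by (intro nn_integral_cong) (auto simp: indicator_def algebra_simps)
    also have "\<dots> = (\<integral>\<^sup>+r\<in>{0..T - h}. ennreal (\<phi> r (r + h)) \<partial>lborel)"
      by (rule nn_integral_affine_unit[where f = "\<lambda>r. ennreal (\<phi> r (r + h)) * indicator {0..T - h} r"]) auto
    finally show ?thesis .
  qed
  then show "\<exists>L'\<ge>0. \<forall>h. 0 < h \<and> h \<le> T / 2 \<longrightarrow>
      (\<integral>\<^sup>+r\<in>{0..T - h}. ennreal (\<phi> (T - (r + h)) (T - r)) \<partial>lborel) \<le> ennreal (L' * h powr \<kappa>)"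
    using global by simp
qed (use T \<kappa> M L nonneg in auto)

lemma lmean_bound:
  "AE t in lborel. 0 < t \<and> t \<le> T \<longrightarrow> (\<forall>n. T / 2 ^ Suc n \<le> t \<longrightarrow>
     ennreal (1 / (T / 2 ^ Suc n)) * (\<integral>\<^sup>+y\<in>{t - T / 2 ^ Suc n..t}. ennreal (\<phi> y t) \<partial>lborel)
       \<le> ennreal ((4 * L + M) * decay * (T / 2 ^ Suc n) powr \<kappa>))"
proof -
  interpret R: mean_bounded T \<kappa> M L "\<lambda>s t. \<phi> (T - t) (T - s)"
    by (rule reflect)
  have eq: "R.rmean e (T + - 1 * t) = ennreal (1 / e) * (\<integral>\<^sup>+y\<in>{t - e..t}. ennreal (\<phi> y t) \<partial>lborel)" for e t
  proof -
    have "(\<integral>\<^sup>+x\<in>{T + - 1 * t..T + - 1 * t + e}. ennreal (\<phi> (T - x) (T - (T + - 1 * t))) \<partial>lborel)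
       = (\<integral>\<^sup>+x. ennreal (\<phi> (T + (- 1) * x) t) * indicator {t - e..t} (T + (- 1) * x) \<partial>lborel)"
      by (intro nn_integral_cong) (auto simp: indicator_def)
    also have "\<dots> = (\<integral>\<^sup>+y\<in>{t - e..t}. ennreal (\<phi> y t) \<partial>lborel)"
      by (rule nn_integral_affine_unit[where f = "\<lambda>y. ennreal (\<phi> y t) * indicator {t - e..t} y"]) auto
    finally show ?thesis by (simp add: R.rmean_def)
  qed
  have "AE t in lborel. 0 \<le> T + - 1 * t \<and> T + - 1 * t < T \<longrightarrow> (\<forall>n. T + - 1 * t + T / 2 ^ Suc n \<le> T \<longrightarrow>
     R.rmean (T / 2 ^ Suc n) (T + - 1 * t) \<le> ennreal ((4 * L + M) * R.decay * (T / 2 ^ Suc n) powr \<kappa>))"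
    by (rule AE_lborel_affine_unit[OF _ R.rmean_bound]) simp
  then show ?thesis
    unfolding eq
  proof eventually_elim
    case (elim t)
    show ?case
    proof (intro impI allI)
      fix n assume t: "0 < t \<and> t \<le> T" and n: "T / 2 ^ Suc n \<le> t"
      have "0 \<le> T + - 1 * t \<and> T + - 1 * t < T" using t by simp
      moreover have "T + - 1 * t + T / 2 ^ Suc n \<le> T" using n by linarith
      ultimately show "ennreal (1 / (T / 2 ^ Suc n)) * (\<integral>\<^sup>+y\<in>{t - T / 2 ^ Suc n..t}. ennreal (\<phi> y t) \<partial>lborel)
          \<le> ennreal ((4 * L + M) * decay * (T / 2 ^ Suc n) powr \<kappa>)"
        by (rule mp[OF spec[OF mp[OF elim]]])
    qed
  qed
qed

text \<open>The counterpart of Lebesgue points. The condition is two-sided because a point may serve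
  as the left or as the right end of an increment.\<close>

definition good :: "real set" where
  "good = {s. 0 < s \<and> s < T \<and>
     (\<forall>n. s + T / 2 ^ Suc n \<le> T \<longrightarrow> rmean (T / 2 ^ Suc n) s \<le> ennreal ((4 * L + M) * decay * (T / 2 ^ Suc n) powr \<kappa>)) \<and>
     (\<forall>n. T / 2 ^ Suc n \<le> s \<longrightarrow>
       ennreal (1 / (T / 2 ^ Suc n)) * (\<integral>\<^sup>+y\<in>{s - T / 2 ^ Suc n..s}. ennreal (\<phi> y s) \<partial>lborel)
         \<le> ennreal ((4 * L + M) * decay * (T / 2 ^ Suc n) powr \<kappa>))}"

lemma goodD:
  assumes "s \<in> good"
  shows "0 < s" "s < T"
    "s + T / 2 ^ Suc n \<le> T \<Longrightarrow> rmean (T / 2 ^ Suc n) s \<le> ennreal ((4 * L + M) * decay * (T / 2 ^ Suc n) powr \<kappa>)"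
    "T / 2 ^ Suc n \<le> s \<Longrightarrow>
       ennreal (1 / (T / 2 ^ Suc n)) * (\<integral>\<^sup>+y\<in>{s - T / 2 ^ Suc n..s}. ennreal (\<phi> y s) \<partial>lborel)
         \<le> ennreal ((4 * L + M) * decay * (T / 2 ^ Suc n) powr \<kappa>)"
proof -
  note good = assms[unfolded good_def mem_Collect_eq]
  show "0 < s" "s < T"
    by (rule conjunct1[OF good], rule conjunct1[OF conjunct2[OF good]])
  show "rmean (T / 2 ^ Suc n) s \<le> ennreal ((4 * L + M) * decay * (T / 2 ^ Suc n) powr \<kappa>)"
    if "s + T / 2 ^ Suc n \<le> T"
    by (rule mp[OF spec[OF conjunct1[OF conjunct2[OF conjunct2[OF good]]]] that])
  show "ennreal (1 / (T / 2 ^ Suc n)) * (\<integral>\<^sup>+y\<in>{s - T / 2 ^ Suc n..s}. ennreal (\<phi> y s) \<partial>lborel)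
         \<le> ennreal ((4 * L + M) * decay * (T / 2 ^ Suc n) powr \<kappa>)" if "T / 2 ^ Suc n \<le> s"
    by (rule mp[OF spec[OF conjunct2[OF conjunct2[OF conjunct2[OF good]]]] that])
qed

lemma AE_good: "AE s in lborel. s \<in> {0..T} \<longrightarrow> s \<in> good"
  using rmean_bound lmean_bound AE_lborel_singleton[of 0] AE_lborel_singleton[of T]
proof eventually_elim
  case (elim s)
  show ?case
  proof
    assume "s \<in> {0..T}"
    then have s: "0 < s" "s < T" using elim(3,4) by auto
    then have s': "0 \<le> s \<and> s < T" "0 < s \<and> s \<le> T" by auto
    show "s \<in> good"
      unfolding good_def mem_Collect_eq
      by (rule conjI[OF s(1) conjI[OF s(2) conjI[OF mp[OF elim(1) s'(1)] mp[OF elim(2) s'(2)]]]])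
  qed
qed

text \<open>The value at \<open>(s, t)\<close> is averaged over \<open>x\<close> near
  \<open>s\<close> and \<open>y\<close> near \<open>t\<close>. The outer pieces are controlled by
  the one-sided averages at the good points, the middle piece by the double integral over the
  triangle between \<open>s\<close> and \<open>t\<close>.\<close>

lemma good_bound_short:
  assumes st: "s \<in> good" "t \<in> good" "s < t" "t - s \<le> 3 * T / 4"
  shows "\<phi> s t \<le> (8 * decay + 16) * (L + M) * (t - s) powr \<kappa>"
proof -
  define h where "h = t - s"
  have h: "0 < h" "h \<le> 3 * T / 4" using st by (auto simp: h_def)
  have s: "0 < s" "t < T" using goodD(1)[OF st(1)] goodD(2)[OF st(2)] .
  \<comment> \<open>The dyadic scale \<open>e\<close> lies between \<open>h / 4\<close> and
    \<open>h / 2\<close>: small enough that \<open>x \<le> y\<close> for all points of the two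
    windows, large enough that \<open>h * h\<close> is at most \<open>16 * (e * e)\<close>.\<close>
  obtain n where n: "T / 2 ^ Suc n \<le> h / 2" "h / 2 < T / 2 ^ n"
  proof -
    obtain m where "2 * T / h < 2 ^ m"
      using real_arch_pow[of 2 "2 * T / h"] by auto
    then have m: "T / 2 ^ m \<le> h / 2"
      using h by (simp add: field_simps)
    define k where "k = (LEAST n. T / 2 ^ n \<le> h / 2)"
    have k: "T / 2 ^ k \<le> h / 2"
      unfolding k_def by (rule LeastI[of "\<lambda>n. T / 2 ^ n \<le> h / 2", OF m])
    have "k \<noteq> 0"
    proof
      assume "k = 0"
      with k h T show False by simp
    qed
    then obtain n where n: "k = Suc n" by (cases k) auto
    then have "n < (LEAST n. T / 2 ^ n \<le> h / 2)"
      unfolding k_def[symmetric] by simp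
    then have "h / 2 < T / 2 ^ n"
      using not_less_Least[of n "\<lambda>n. T / 2 ^ n \<le> h / 2"] by linarith
    then show thesis
      using k unfolding n by (intro that[of n])
  qed
  define e where "e = T / 2 ^ Suc n"
  have "T / 2 ^ n = 2 * e" by (simp add: e_def)
  then have e: "0 < e" "e \<le> h / 2" "h < 4 * e"
    using n T unfolding e_def[symmetric] by auto
  define B where "B = (4 * L + M) * decay * e powr \<kappa>"
  have B: "0 \<le> B" using L M decay_ge_1 by (simp add: B_def)
  let ?I = "indicator {s..s + e} :: real \<Rightarrow> ennreal" and ?J = "indicator {t - e..t} :: real \<Rightarrow> ennreal"
  let ?a = "\<integral>\<^sup>+x\<in>{s..s + e}. ennreal (\<phi> s x) \<partial>lborel" and ?b = "\<integral>\<^sup>+y\<in>{t - e..t}. ennreal (\<phi> y t) \<partial>lborel"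
  have norm: "X \<le> ennreal (e * B)" if "ennreal (1 / e) * X \<le> ennreal B" for X
  proof -
    have "ennreal e * (ennreal (1 / e) * X) \<le> ennreal e * ennreal B"
      using that by (rule mult_left_mono) simp
    moreover have "ennreal e * ennreal (1 / e) = 1"
      using e by (subst ennreal_mult[symmetric]) auto
    moreover have "ennreal e * ennreal B = ennreal (e * B)"
      using e B by (intro ennreal_mult[symmetric]) auto
    ultimately show ?thesis
      by (simp only: mult.assoc[symmetric] mult_1_left)
  qed
  have "s + e \<le> T" "e \<le> t"
    using e s st by (auto simp: h_def)
  note se = this
  have a: "?a \<le> ennreal (e * B)"
    by (rule norm) (rule goodD(3)[OF st(1), of n, folded e_def, folded B_def, unfolded rmean_def, OF se(1)])
  have b: "?b \<le> ennreal (e * B)"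
    by (rule norm) (rule goodD(4)[OF st(2), of n, folded e_def, folded B_def, OF se(2)])
  define D where "D x y = ennreal (\<phi> x y) * indicator {(x, y). s \<le> x \<and> x \<le> y \<and> y \<le> s + h} (x, y)" for x y
  have D: "(\<integral>\<^sup>+x. \<integral>\<^sup>+y. D x y \<partial>lborel \<partial>lborel) \<le> ennreal (L * h powr (2 + \<kappa>))"
    unfolding D_def using h s by (intro double_window) (auto simp: h_def)
  have Dm [measurable]: "case_prod D \<in> borel_measurable (borel \<Otimes>\<^sub>M borel)"
    unfolding D_def indicator_def by measurable
  have [measurable (raw)]: "f \<in> borel_measurable N \<Longrightarrow> g \<in> borel_measurable N \<Longrightarrow> (\<lambda>x. D (f x) (g x)) \<in> borel_measurable N" for f g :: "_ \<Rightarrow> real" and N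
    using measurable_compose[OF measurable_Pair Dm, of f N g] by simp
  let ?m = "ennreal (2 * M * h powr \<kappa>)"
  have pt: "ennreal (\<phi> s t) * ?I x * ?J y
      \<le> ennreal (\<phi> s x) * ?I x * ?J y + D x y + ennreal (\<phi> y t) * ?J y * ?I x + ?m * ?I x * ?J y" for x y
  proof (cases "x \<in> {s..s + e} \<and> y \<in> {t - e..t}")
    case True
    then have xy: "s \<le> x" "x \<le> y" "y \<le> t" using e by (auto simp: h_def)
    have "\<phi> s t \<le> \<phi> s x + \<phi> x t + M * (t - s) powr \<kappa>"
      using xy s by (intro tri1) auto
    moreover have "\<phi> x t \<le> \<phi> x y + \<phi> y t + M * (t - x) powr \<kappa>"
      using xy s by (intro tri1) auto
    moreover have "M * (t - x) powr \<kappa> \<le> M * (t - s) powr \<kappa>"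
      using xy M \<kappa> by (intro mult_left_mono powr_mono2) auto
    ultimately have "\<phi> s t \<le> \<phi> s x + \<phi> x y + \<phi> y t + 2 * M * h powr \<kappa>"
      by (simp add: h_def)
    then have "ennreal (\<phi> s t) \<le> ennreal (\<phi> s x + \<phi> x y + \<phi> y t + 2 * M * h powr \<kappa>)"
      by (rule ennreal_leI)
    also have "\<dots> = ennreal (\<phi> s x) + ennreal (\<phi> x y) + ennreal (\<phi> y t) + ?m"
      using nonneg M by simp
    also have "ennreal (\<phi> x y) = D x y"
      using xy by (auto simp: D_def h_def)
    finally show ?thesis
      using True by simp
  next
    case False
    then have "ennreal (\<phi> s t) * ?I x * ?J y = 0" by auto
    then show ?thesis by (simp only: zero_le)
  qed
  have "ennreal (\<phi> s t) * ennreal e * ennreal e = (\<integral>\<^sup>+x. \<integral>\<^sup>+y. ennreal (\<phi> s t) * ?I x * ?J y \<partial>lborel \<partial>lborel)"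
    using e by (simp add: nn_integral_multc nn_integral_cmult)
  also have "\<dots> \<le> (\<integral>\<^sup>+x. \<integral>\<^sup>+y. ennreal (\<phi> s x) * ?I x * ?J y + D x y + ennreal (\<phi> y t) * ?J y * ?I x + ?m * ?I x * ?J y \<partial>lborel \<partial>lborel)"
    by (intro nn_integral_mono pt)
  also have "\<dots> = (\<integral>\<^sup>+x. ennreal (\<phi> s x) * ?I x * ennreal e + (\<integral>\<^sup>+y. D x y \<partial>lborel) + ?b * ?I x + ?m * ?I x * ennreal e \<partial>lborel)"
    using e by (intro nn_integral_cong) (simp add: nn_integral_add nn_integral_cmult nn_integral_multc)
  also have "\<dots> = ?a * ennreal e + (\<integral>\<^sup>+x. \<integral>\<^sup>+y. D x y \<partial>lborel \<partial>lborel) + ?b * ennreal e + ?m * ennreal e * ennreal e"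
    using e by (simp add: nn_integral_add nn_integral_cmult nn_integral_multc)
  also have "\<dots> \<le> ennreal (e * B) * ennreal e + ennreal (L * h powr (2 + \<kappa>)) + ennreal (e * B) * ennreal e + ?m * ennreal e * ennreal e"
    by (intro add_mono mult_right_mono a b D order_refl) auto
  also have "\<dots> = ennreal (e * B * e + L * h powr (2 + \<kappa>) + e * B * e + 2 * M * h powr \<kappa> * e * e)"
  proof -
    have nn: "0 \<le> e * B" "0 \<le> e" "0 \<le> e * B * e" "0 \<le> L * h powr (2 + \<kappa>)" "0 \<le> 2 * M * h powr \<kappa>"
        "0 \<le> 2 * M * h powr \<kappa> * e" "0 \<le> 2 * M * h powr \<kappa> * e * e"
      using e L M B by auto
    then show ?thesis
      by (simp only: ennreal_mult[symmetric] ennreal_plus[symmetric] add_nonneg_nonneg)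
  qed
  finally have "ennreal (\<phi> s t * e * e) \<le> ennreal (e * B * e + L * h powr (2 + \<kappa>) + e * B * e + 2 * M * h powr \<kappa> * e * e)"
    using e nonneg by (simp add: ennreal_mult)
  then have le: "\<phi> s t * e * e \<le> e * B * e + L * h powr (2 + \<kappa>) + e * B * e + 2 * M * h powr \<kappa> * e * e"
    using e L M B by (subst (asm) ennreal_le_iff) auto
  have "L * h powr (2 + \<kappa>) \<le> 16 * L * h powr \<kappa> * e * e"
  proof -
    have "h powr (2 + \<kappa>) = h * h * h powr \<kappa>"
      using h by (simp add: powr_add power2_eq_square)
    moreover have "h * h \<le> (4 * e) * (4 * e)"
      using h e by (intro mult_mono) auto
    then have "h * h * h powr \<kappa> \<le> (4 * e) * (4 * e) * h powr \<kappa>"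
      by (intro mult_right_mono) auto
    ultimately have "L * h powr (2 + \<kappa>) \<le> L * ((4 * e) * (4 * e) * h powr \<kappa>)"
      using L by (intro mult_left_mono) auto
    then show ?thesis by (simp add: mult_ac)
  qed
  with le have "\<phi> s t * (e * e) \<le> (2 * B + 16 * L * h powr \<kappa> + 2 * M * h powr \<kappa>) * (e * e)"
    by (simp add: algebra_simps)
  then have "\<phi> s t \<le> 2 * B + 16 * L * h powr \<kappa> + 2 * M * h powr \<kappa>"
    using e by simp
  also have "B \<le> (4 * L + M) * decay * h powr \<kappa>"
    unfolding B_def using e L M decay_ge_1 \<kappa> by (intro mult_left_mono powr_mono2) auto
  also have "2 * ((4 * L + M) * decay * h powr \<kappa>) + 16 * L * h powr \<kappa> + 2 * M * h powr \<kappa>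
      = ((8 * decay + 16) * L + (2 * decay + 2) * M) * h powr \<kappa>"
    by (simp add: algebra_simps)
  also have "\<dots> \<le> ((8 * decay + 16) * L + (8 * decay + 16) * M) * h powr \<kappa>"
    using M decay_ge_1 by (intro mult_right_mono add_left_mono) auto
  finally show ?thesis
    by (simp add: h_def algebra_simps)
qed

text \<open>An increment longer than \<open>3 * T / 4\<close> is split at a good point of its middle
  half, so that both pieces are short. The constant is \<open>2 * (8 * decay + 16) + 1\<close>, the
  last summand for the defect of the splitting.\<close>

lemma good_bound:
  assumes st: "s \<in> good" "t \<in> good" "s < t"
  shows "\<phi> s t \<le> (16 * decay + 33) * (L + M) * (t - s) powr \<kappa>"
proof (cases "t - s \<le> 3 * T / 4")
  case True
  have "(8 * decay + 16) * (L + M) * (t - s) powr \<kappa> \<le> (16 * decay + 33) * (L + M) * (t - s) powr \<kappa>"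
    using L M decay_ge_1 by (intro mult_right_mono) auto
  with good_bound_short[OF st True] show ?thesis by linarith
next
  case False
  have s: "0 < s" "t < T" using goodD(1)[OF st(1)] goodD(2)[OF st(2)] .
  obtain u where u: "s + (t - s) / 4 < u" "u < s + 3 * (t - s) / 4" "u \<in> {0..T} \<longrightarrow> u \<in> good"
    by (rule mono_AE_point[OF AE_good, of "s + (t - s) / 4" "s + 3 * (t - s) / 4"]) (use st in auto)
  then have u': "u \<in> good" "s < u" "u < t" "u - s \<le> 3 * T / 4" "t - u \<le> 3 * T / 4"
    using s st by (auto simp: field_simps)
  let ?C = "(8 * decay + 16) * (L + M)"
  have C: "0 \<le> ?C" using L M decay_ge_1 by simp
  have "\<phi> s u \<le> ?C * (u - s) powr \<kappa>" "\<phi> u t \<le> ?C * (t - u) powr \<kappa>"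
    using u' st by (auto intro!: good_bound_short)
  moreover have "?C * (u - s) powr \<kappa> \<le> ?C * (t - s) powr \<kappa>" "?C * (t - u) powr \<kappa> \<le> ?C * (t - s) powr \<kappa>"
    using u' C \<kappa> by (auto intro!: mult_left_mono powr_mono2)
  moreover have "\<phi> s t \<le> \<phi> s u + \<phi> u t + M * (t - s) powr \<kappa>"
    using u' s by (intro tri1) auto
  moreover have "M * (t - s) powr \<kappa> \<le> (L + M) * (t - s) powr \<kappa>"
    using L by (intro mult_right_mono) auto
  ultimately have "\<phi> s t \<le> 2 * (?C * (t - s) powr \<kappa>) + (L + M) * (t - s) powr \<kappa>"
    by linarith
  then show ?thesis by (simp add: algebra_simps)
qed

end

subsection \<open>Vectors and their Luxemburg norms\<close>

lemma vec_norm_nonneg [simp]: "0 \<le> vec_norm m x"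
  by (simp add: vec_norm_def)

lemma vec_norm_0 [simp]: "vec_norm m 0 = 0"
  by (simp add: vec_norm_def L2_set_def)

lemma vec_norm_triangle: "vec_norm m (x + y) \<le> vec_norm m x + vec_norm m y"
  unfolding vec_norm_def plus_fun_def by (rule L2_set_triangle_ineq)

lemma vec_norm_uminus [simp]: "vec_norm m (- x) = vec_norm m x"
  by (simp add: vec_norm_def L2_set_def fun_Compl_def)

lemma vec_norm_diff_triangle: "vec_norm m (x - y) \<le> vec_norm m x + vec_norm m y"
  using vec_norm_triangle[of m x "- y"] by simp

lemma vec_norm_component: "i < m \<Longrightarrow> \<bar>x i\<bar> \<le> vec_norm m x"
  using member_le_L2_set[of "{..<m}" i "\<lambda>j. \<bar>x j\<bar>"] by (simp add: vec_norm_def L2_set_def)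

lemma vec_norm_cong: "(\<And>i. i < m \<Longrightarrow> x i = y i) \<Longrightarrow> vec_norm m x = vec_norm m y"
  unfolding vec_norm_def by (rule L2_set_cong) auto

lemma vec_norm_eq_0_iff: "vec_norm m x = 0 \<longleftrightarrow> (\<forall>i<m. x i = 0)"
  by (auto simp: vec_norm_def L2_set_eq_0_iff)

lemma vec_norm_measurable [measurable (raw)]:
  assumes "\<And>i. i < m \<Longrightarrow> (\<lambda>x. f x i) \<in> borel_measurable M"
  shows "(\<lambda>x. vec_norm m (f x)) \<in> borel_measurable M"
  unfolding vec_norm_def L2_set_def using assms
  by (intro borel_measurable_sqrt[THEN measurable_compose[rotated]] borel_measurable_sum borel_measurable_power) auto

lemma vec_norm_tendsto:
  assumes "\<And>i. i < m \<Longrightarrow> (\<lambda>n. f n i) \<longlonglongrightarrow> g i"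
  shows "(\<lambda>n. vec_norm m (f n)) \<longlonglongrightarrow> vec_norm m g"
  unfolding vec_norm_def L2_set_def by (intro tendsto_intros assms) auto

text \<open>All coordinates are required to be measurable, which keeps the set independent of
  \<open>m\<close>. Representatives are made to vanish in the coordinates from \<open>m\<close> on,
  so they satisfy this.\<close>

definition measurable_paths :: "(real \<Rightarrow> nat \<Rightarrow> real) set" where
  "measurable_paths = {f. \<forall>i. (\<lambda>r. f r i) \<in> borel_measurable borel}"

definition path_norm :: "nat \<Rightarrow> real \<Rightarrow> real \<Rightarrow> (real \<Rightarrow> nat \<Rightarrow> real) \<Rightarrow> ennreal" where
  "path_norm m \<beta> c f = orlicz_norm \<beta> {0..c} (\<lambda>r. vec_norm m (f r))"

lemma measurable_pathsD: "f \<in> measurable_paths \<Longrightarrow> (\<lambda>r. f r i) \<in> borel_measurable borel"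
  by (simp add: measurable_paths_def)

lemma measurable_paths_vec_norm: "f \<in> measurable_paths \<Longrightarrow> (\<lambda>r. vec_norm m (f r)) \<in> borel_measurable borel"
  by (intro vec_norm_measurable measurable_pathsD)

lemma path_norm_seminorm:
  assumes "0 < \<beta>"
  shows "seminorm_on (path_norm m \<beta> c) measurable_paths"
proof
  show "0 \<in> measurable_paths"
    by (simp add: measurable_paths_def)
  have "(\<integral>\<^sup>+r\<in>{0..c}. ennreal (orlicz_Phi \<beta> (0 / l)) \<partial>lborel) = 0" for l by simp
  then have "path_norm m \<beta> c 0 \<le> ennreal e" if "0 < e" for e
    unfolding path_norm_def using that by (intro orlicz_norm_le) auto
  then have "path_norm m \<beta> c 0 \<le> 0"
    by (intro ennreal_le_epsilon[where y = 0]) simp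
  then show "path_norm m \<beta> c 0 = 0" by simp
next
  fix f g :: "real \<Rightarrow> nat \<Rightarrow> real" assume f: "f \<in> measurable_paths"
  then show "- f \<in> measurable_paths"
    by (auto simp: measurable_paths_def)
  show "path_norm m \<beta> c (- f) = path_norm m \<beta> c f"
    by (simp add: path_norm_def)
  assume g: "g \<in> measurable_paths"
  show "f + g \<in> measurable_paths"
    using f g by (auto simp: measurable_paths_def intro: borel_measurable_add)
  have "path_norm m \<beta> c (f + g) \<le> orlicz_norm \<beta> {0..c} (\<lambda>r. vec_norm m (f r) + vec_norm m (g r))"
    unfolding path_norm_def using assms
    by (intro orlicz_norm_mono_AE) (auto intro: vec_norm_triangle add_nonneg_nonneg)
  also have "\<dots> \<le> path_norm m \<beta> c f + path_norm m \<beta> c g"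
    unfolding path_norm_def using f g assms
    by (intro orlicz_norm_triangle measurable_paths_vec_norm) auto
  finally show "path_norm m \<beta> c (f + g) \<le> path_norm m \<beta> c f + path_norm m \<beta> c g" .
qed

lemma path_norm_cong_AE:
  assumes "AE r in lborel. r \<in> {0..c} \<longrightarrow> (\<forall>i<m. f r i = g r i)"
  shows "path_norm m \<beta> c f = path_norm m \<beta> c g"
  unfolding path_norm_def
  by (rule orlicz_norm_cong_AE) (use assms in \<open>eventually_elim, auto intro: vec_norm_cong\<close>)

lemma path_norm_trivial_interval: "c \<le> 0 \<Longrightarrow> path_norm m \<beta> c f = 0"
  unfolding path_norm_def
  by (rule orlicz_norm_null) (use AE_lborel_singleton[of 0] in eventually_elim, auto)

lemma path_norm_shift:
  assumes "0 < \<beta>" "f \<in> measurable_paths" "0 \<le> a" "a + c \<le> d"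
  shows "path_norm m \<beta> c (\<lambda>r. f (a + r)) \<le> path_norm m \<beta> d f"
  unfolding path_norm_def
  using orlicz_norm_shift[OF assms(1) _ measurable_paths_vec_norm[OF assms(2)] assms(3,4)] by simp

lemma path_norm_Fatou:
  assumes "0 < \<beta>" "\<And>n. g n \<in> measurable_paths"
    and "AE r in lborel. r \<in> {0..c} \<longrightarrow> (\<forall>i<m. (\<lambda>n. g n r i) \<longlonglongrightarrow> f r i)"
    and "\<And>n. path_norm m \<beta> c (g n) \<le> L"
  shows "path_norm m \<beta> c f \<le> L"
  unfolding path_norm_def
proof (rule orlicz_norm_Fatou[OF assms(1)])
  show "AE r in lborel. r \<in> {0..c} \<longrightarrow> (\<lambda>n. vec_norm m (g n r)) \<longlonglongrightarrow> vec_norm m (f r)"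
    using assms(3) by eventually_elim (auto intro: vec_norm_tendsto)
qed (use assms in \<open>auto simp: path_norm_def intro: measurable_paths_vec_norm\<close>)

text \<open>The mean bound with \<open>p = 1\<close> and level \<open>k = 1\<close>. Through
  \<open>L\<^sup>1\<close>, norm estimates yield convergence and vanishing at almost every
  point.\<close>

lemma path_norm_L1:
  assumes "0 < \<beta>" "0 \<le> T"
  obtains C where "0 < C" "\<And>c f. c \<le> T \<Longrightarrow> f \<in> measurable_paths \<Longrightarrow>
    (\<integral>\<^sup>+r\<in>{0..c}. ennreal (vec_norm m (f r)) \<partial>lborel) \<le> ennreal C * path_norm m \<beta> c f"
proof -
  obtain A B where AB: "1 \<le> A" "1 \<le> B" and *:
    "\<And>D W w k g. \<lbrakk>W \<in> sets borel; W \<subseteq> D; emeasure lborel W \<le> ennreal w; 0 \<le> w; 0 < k;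
        g \<in> borel_measurable borel; \<And>r. 0 \<le> g r\<rbrakk>
      \<Longrightarrow> (\<integral>\<^sup>+r\<in>W. ennreal (g r) \<partial>lborel) \<le> ennreal ((k + k powr (1 - 1) * A) * w + k powr (1 - 1) * B) * orlicz_norm \<beta> D g"
    by (rule orlicz_norm_mean_bound[OF assms(1) order_refl]) blast
  have "(\<integral>\<^sup>+r\<in>{0..c}. ennreal (vec_norm m (f r)) \<partial>lborel) \<le> ennreal ((1 + A) * T + B) * path_norm m \<beta> c f"
    if "c \<le> T" "f \<in> measurable_paths" for c f
    using *[of "{0..c}" "{0..c}" T 1 "\<lambda>r. vec_norm m (f r)"] that assms AB
    by (cases "0 \<le> c") (auto simp: path_norm_def measurable_paths_vec_norm ennreal_leI)
  moreover have "0 < (1 + A) * T + B"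
  proof -
    have "0 \<le> (1 + A) * T" using AB assms by simp
    then show ?thesis using AB by linarith
  qed
  ultimately show thesis using that by blast
qed

lemma path_norm_eq_0D:
  assumes "0 < \<beta>" "f \<in> measurable_paths" "path_norm m \<beta> c f = 0"
  shows "AE r in lborel. r \<in> {0..c} \<longrightarrow> (\<forall>i<m. f r i = 0)"
proof -
  obtain C where "\<And>c' f. c' \<le> max 0 c \<Longrightarrow> f \<in> measurable_paths \<Longrightarrow>
      (\<integral>\<^sup>+r\<in>{0..c'}. ennreal (vec_norm m (f r)) \<partial>lborel) \<le> ennreal C * path_norm m \<beta> c' f"
    by (rule path_norm_L1[OF assms(1), of "max 0 c" m]) (simp, blast)
  from this[of c f] have "(\<integral>\<^sup>+r\<in>{0..c}. ennreal (vec_norm m (f r)) \<partial>lborel) = 0"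
    using assms by simp
  moreover have [measurable]: "(\<lambda>r. vec_norm m (f r)) \<in> borel_measurable borel"
    using assms by (intro measurable_paths_vec_norm)
  ultimately have "AE r in lborel. ennreal (vec_norm m (f r)) * indicator {0..c} r = 0"
    by (subst (asm) nn_integral_0_iff_AE) auto
  then show ?thesis
  proof eventually_elim
    case (elim r)
    show ?case
    proof
      assume "r \<in> {0..c}"
      with elim have "vec_norm m (f r) \<le> 0" by (simp add: ennreal_eq_0_iff)
      then have "vec_norm m (f r) = 0" using vec_norm_nonneg[of m "f r"] by linarith
      then show "\<forall>i<m. f r i = 0" by (simp add: vec_norm_eq_0_iff)
    qed
  qed
qed

subsection \<open>Dyadic Riemann sums\<close>

definition dyad :: "(real \<Rightarrow> real \<Rightarrow> nat \<Rightarrow> real) \<Rightarrow> nat \<Rightarrow> real \<Rightarrow> real \<Rightarrow> nat \<Rightarrow> real" where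
  "dyad X n s t = (\<Sum>i<2 ^ n. X (s + real i / 2 ^ n * (t - s)) (s + real (Suc i) / 2 ^ n * (t - s)))"

text \<open>\<open>lim\<close> is total, so the limit is measurable in the two times without
  reference to convergence; its value carries information only where the sums converge.\<close>

definition dyad_lim :: "(real \<Rightarrow> real \<Rightarrow> nat \<Rightarrow> real) \<Rightarrow> real \<Rightarrow> real \<Rightarrow> nat \<Rightarrow> real" where
  "dyad_lim X s t i = lim (\<lambda>n. dyad X n s t i)"

lemma sum_fun_apply [simp]: "(\<Sum>i\<in>A. f i) x = (\<Sum>i\<in>A. f i x)"
  by (induction A rule: infinite_finite_induct) auto

lemma dyad_apply: "dyad X n s t j = (\<Sum>i<2 ^ n. X (s + real i / 2 ^ n * (t - s)) (s + real (Suc i) / 2 ^ n * (t - s)) j)"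
  by (simp add: dyad_def)

lemma sum_even_odd:
  fixes f :: "nat \<Rightarrow> 'v::comm_monoid_add"
  shows "(\<Sum>i<2 * n. f i) = (\<Sum>i<n. f (2 * i) + f (Suc (2 * i)))"
  by (induction n) (auto simp: add.assoc)

lemma dyad_Suc_diff:
  "dyad X (Suc n) s t - dyad X n s t = - (\<Sum>i<2 ^ n. delta2 X (s + real i / 2 ^ n * (t - s))
      (s + (real i + 1 / 2) / 2 ^ n * (t - s)) (s + real (Suc i) / 2 ^ n * (t - s)))"
proof -
  let ?a = "\<lambda>i. s + real i / 2 ^ n * (t - s)" and ?c = "\<lambda>i. s + (real i + 1 / 2) / 2 ^ n * (t - s)"
    and ?b = "\<lambda>i. s + real (Suc i) / 2 ^ n * (t - s)"
  have eqs: "real (2 * i) / (2 * 2 ^ n) = real i / 2 ^ n" "real (Suc (2 * i)) / (2 * 2 ^ n) = (real i + 1 / 2) / 2 ^ n"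
    "real (Suc (Suc (2 * i))) / (2 * 2 ^ n) = real (Suc i) / 2 ^ n" for i
    by (simp_all add: field_simps)
  have "dyad X (Suc n) s t = (\<Sum>i<2 ^ n. X (?a i) (?c i) + X (?c i) (?b i))"
    by (simp only: dyad_def power_Suc sum_even_odd eqs)
  then have "dyad X (Suc n) s t - dyad X n s t = (\<Sum>i<2 ^ n. X (?a i) (?c i) + X (?c i) (?b i) - X (?a i) (?b i))"
    by (simp only: dyad_def sum_subtractf)
  also have "\<dots> = (\<Sum>i<2 ^ n. - delta2 X (?a i) (?c i) (?b i))"
    by (intro sum.cong) (auto simp: delta2_def fun_eq_iff)
  finally show ?thesis
    by (simp only: sum_negf)
qed

text \<open>What the construction uses about an integrand: a power bound for the modulus up to
  \<open>3 * T / 4\<close>, its finiteness below \<open>T\<close>, and integrability along lines.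
  Finiteness is stated separately because the power bound says nothing near
  \<open>T\<close>.\<close>

locale germ =
  fixes T \<beta> \<gamma> k :: real and m :: nat and X :: "real \<Rightarrow> real \<Rightarrow> nat \<Rightarrow> real"
  assumes T: "0 < T" and \<beta>: "0 < \<beta>" and \<gamma>: "1 < \<gamma>" and k: "0 \<le> k"
    and meas: "(\<lambda>p. X (fst p) (snd p) i) \<in> borel_measurable (borel \<Otimes>\<^sub>M borel)"
    and fin: "\<tau> < T \<Longrightarrow> modulus3 T m \<beta> (delta2 X) \<tau> < \<infinity>"
    and pow: "0 < \<tau> \<Longrightarrow> \<tau> \<le> 3 * T / 4 \<Longrightarrow> modulus3 T m \<beta> (delta2 X) \<tau> \<le> ennreal (k * \<tau> powr \<gamma>)"
    and int: "\<exists>L. \<forall>h. 0 \<le> h \<longrightarrow> h \<le> 3 * T / 4 \<longrightarrow>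
      (\<integral>\<^sup>+r\<in>{0..T - h}. ennreal (vec_norm m (X r (r + h))) \<partial>lborel) \<le> ennreal L"
begin

abbreviation \<omega> :: "real \<Rightarrow> ennreal" where "\<omega> \<equiv> modulus3 T m \<beta> (delta2 X)"

abbreviation N :: "real \<Rightarrow> (real \<Rightarrow> nat \<Rightarrow> real) \<Rightarrow> ennreal" where "N h \<equiv> path_norm m \<beta> (T - h)"

lemma measurable_X [measurable (raw)]:
  "f \<in> borel_measurable M \<Longrightarrow> g \<in> borel_measurable M \<Longrightarrow> (\<lambda>x. X (f x) (g x) i) \<in> borel_measurable M"
  using measurable_compose[OF measurable_Pair meas, of f M g] by simp

lemma measurable_dyad [measurable (raw)]:
  "f \<in> borel_measurable M \<Longrightarrow> g \<in> borel_measurable M \<Longrightarrow> (\<lambda>x. dyad X n (f x) (g x) i) \<in> borel_measurable M"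
  unfolding dyad_apply
  by (intro borel_measurable_sum measurable_X borel_measurable_add borel_measurable_times borel_measurable_diff borel_measurable_const)

lemma measurable_dyad_lim [measurable (raw)]:
  "f \<in> borel_measurable M \<Longrightarrow> g \<in> borel_measurable M \<Longrightarrow> (\<lambda>x. dyad_lim X (f x) (g x) i) \<in> borel_measurable M"
  unfolding dyad_lim_def by measurable

lemma mono_omega: "mono \<omega>"
  unfolding modulus3_def by (intro monoI SUP_mono) (auto intro!: SUP_subset_mono)

text \<open>The triple is one with increment \<open>(b - a) * h\<close> started at
  \<open>r + a * h\<close>. The shifted interval of starting points stays inside the one on which
  the modulus of that smaller increment is computed.\<close>

lemma delta_bound:
  assumes h: "0 \<le> h" "h \<le> T" and ab: "0 \<le> a" "a \<le> c" "c \<le> b" "b \<le> 1"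
  shows "N h (\<lambda>r. delta2 X (r + a * h) (r + c * h) (r + b * h)) \<le> \<omega> ((b - a) * h)"
proof -
  define h' where "h' = (b - a) * h"
  \<comment> \<open>For \<open>a = b\<close> any value in the unit interval would do: then
    \<open>c = a\<close> and the increment \<open>h'\<close> is \<open>0\<close>.\<close>
  define \<theta> where "\<theta> = (if a = b then 0 else (c - a) / (b - a))"
  have \<theta>: "0 \<le> \<theta>" "\<theta> \<le> 1" "\<theta> * h' = (c - a) * h"
    using ab by (auto simp: \<theta>_def h'_def)
  have h': "0 \<le> h'" using ab h by (simp add: h'_def)
  define f where "f r = delta2 X r (r + \<theta> * h') (r + h')" for r
  have f: "f \<in> measurable_paths"
    unfolding measurable_paths_def f_def delta2_def by auto
  have le: "a * h + (T - h) \<le> T - h'"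
  proof -
    have "b * h \<le> 1 * h" using ab h by (intro mult_right_mono) auto
    then show ?thesis by (simp add: h'_def algebra_simps)
  qed
  have "(\<lambda>r. delta2 X (r + a * h) (r + c * h) (r + b * h)) = (\<lambda>r. f (a * h + r))"
    using \<theta> by (simp add: f_def h'_def fun_eq_iff algebra_simps)
  then have "N h (\<lambda>r. delta2 X (r + a * h) (r + c * h) (r + b * h)) = N h (\<lambda>r. f (a * h + r))"
    by simp
  also have "\<dots> \<le> N h' f"
    using \<beta> f ab h le by (intro path_norm_shift) auto
  also have "\<dots> \<le> \<omega> h'"
    unfolding modulus3_def path_norm_def f_def
    using \<theta> h' by (intro SUP_upper2[of \<theta>] SUP_upper2[of h']) auto
  finally show ?thesis by (simp add: h'_def)
qed

interpretation S: seminorm_on "N h" measurable_paths for h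
  by (rule path_norm_seminorm[OF \<beta>])

lemma dyad_step:
  assumes h: "0 \<le> h" "h \<le> T"
  shows "N h (\<lambda>r. dyad X (Suc n) r (r + h) - dyad X n r (r + h)) \<le> ennreal (2 ^ n) * \<omega> (h / 2 ^ n)"
proof -
  define f where "f i = (\<lambda>r. delta2 X (r + real i / 2 ^ n * h) (r + (real i + 1 / 2) / 2 ^ n * h) (r + real (Suc i) / 2 ^ n * h))" for i
  have f: "f i \<in> measurable_paths" for i
    unfolding measurable_paths_def f_def delta2_def by auto
  have "(\<lambda>r. dyad X (Suc n) r (r + h) - dyad X n r (r + h)) = - (\<Sum>i<2 ^ n. f i)"
    unfolding dyad_Suc_diff by (simp add: fun_eq_iff f_def)
  then have "N h (\<lambda>r. dyad X (Suc n) r (r + h) - dyad X n r (r + h)) = N h (\<Sum>i<2 ^ n. f i)"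
    using f by (simp only: S.uminus(2) S.sum_in)
  also have "\<dots> \<le> (\<Sum>i<2 ^ n. N h (f i))"
    by (intro S.triangle_sum f)
  also have "\<dots> \<le> (\<Sum>i<(2::nat) ^ n. \<omega> (h / 2 ^ n))"
  proof (rule sum_mono)
    fix i :: nat assume "i \<in> {..<2 ^ n}"
    then have i: "real (Suc i) \<le> 2 ^ n"
    proof -
      have "Suc i \<le> 2 ^ n" using \<open>i \<in> {..<2 ^ n}\<close> by auto
      then have "real (Suc i) \<le> real (2 ^ n)" by (simp only: of_nat_le_iff)
      then show ?thesis by simp
    qed
    have "N h (f i) \<le> \<omega> ((real (Suc i) / 2 ^ n - real i / 2 ^ n) * h)"
      unfolding f_def using i h by (intro delta_bound) (auto simp: divide_simps)
    also have "(real (Suc i) / 2 ^ n - real i / 2 ^ n) * h = h / 2 ^ n"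
      by (simp add: field_simps)
    finally show "N h (f i) \<le> \<omega> (h / 2 ^ n)" .
  qed
  also have "\<dots> = ennreal (2 ^ n) * \<omega> (h / 2 ^ n)"
    by (simp add: ennreal_of_nat_eq_real_of_nat)
  finally show ?thesis .
qed

text \<open>One step of the recursion moves the series to \<open>h / 2\<close>, where the power
  bound applies at all scales; the remaining term at \<open>h\<close> is finite since
  \<open>h < T\<close>.\<close>

lemma dyadic_sum_omega_finite:
  assumes "0 \<le> h" "h < T"
  shows "dyadic_sum \<omega> h < \<infinity>"
proof -
  have small: "dyadic_sum \<omega> \<tau> < \<infinity>" if "0 < \<tau>" "\<tau> \<le> 3 * T / 4" for \<tau>
  proof -
    have "\<tau> / 2 ^ n \<le> 3 * T / 4" for n
    proof -
      have "\<tau> / 2 ^ n \<le> \<tau> / 1"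
        using that by (intro divide_left_mono) auto
      with that show ?thesis by linarith
    qed
    then have "dyadic_sum \<omega> \<tau> \<le> ennreal (1 / (1 - 2 powr (- ((\<gamma> - 1) / 2))) * \<tau> powr \<gamma>) * ennreal k"
      using that k by (intro dyadic_sum_power_bound \<gamma>) (auto simp: mult.commute intro!: order_trans[OF pow] simp flip: ennreal_mult)
    also have "\<dots> < \<infinity>" by (simp add: ennreal_mult_less_top)
    finally show ?thesis .
  qed
  show ?thesis
  proof (cases "h = 0")
    case True
    have "dyadic_sum \<omega> 0 \<le> dyadic_sum \<omega> (T / 2)"
      using T by (intro monoD[OF dyadic_sum_mono[OF mono_omega]]) auto
    with small[of "T / 2"] T True show ?thesis by (simp add: le_less_trans)
  next
    case False
    then show ?thesis
      using assms fin[of h] small[of "h / 2"] by (subst dyadic_sum_unfold) (auto simp: ennreal_mult_less_top)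
  qed
qed

text \<open>The norms of successive differences are summable, hence so are their
  \<open>L\<^sup>1\<close> norms. The series of their absolute values is then finite at almost every
  starting point, and the sums converge there by telescoping.\<close>

lemma dyad_converges:
  assumes h: "0 \<le> h" "h < T"
  shows "AE r in lborel. r \<in> {0..T - h} \<longrightarrow> (\<forall>i<m. (\<lambda>n. dyad X n r (r + h) i) \<longlonglongrightarrow> dyad_lim X r (r + h) i)"
proof -
  define d where "d n r = dyad X (Suc n) r (r + h) - dyad X n r (r + h)" for n r
  have d: "d n \<in> measurable_paths" for n
    unfolding measurable_paths_def d_def by auto
  have [measurable]: "(\<lambda>r. vec_norm m (d n r)) \<in> borel_measurable borel" for n
    by (intro measurable_paths_vec_norm d)
  obtain C where C: "0 < C" "\<And>c f. c \<le> T \<Longrightarrow> f \<in> measurable_paths \<Longrightarrow>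
    (\<integral>\<^sup>+r\<in>{0..c}. ennreal (vec_norm m (f r)) \<partial>lborel) \<le> ennreal C * path_norm m \<beta> c f"
    by (rule path_norm_L1[OF \<beta>, of T m]) (use T in simp, blast)
  have "(\<integral>\<^sup>+r. (\<Sum>n. ennreal (vec_norm m (d n r)) * indicator {0..T - h} r) \<partial>lborel)
      = (\<Sum>n. \<integral>\<^sup>+r\<in>{0..T - h}. ennreal (vec_norm m (d n r)) \<partial>lborel)"
    by (rule nn_integral_suminf) measurable
  also have "\<dots> \<le> (\<Sum>n. ennreal C * (ennreal (2 ^ n) * \<omega> (h / 2 ^ n)))"
  proof (rule suminf_le)
    fix n
    have "(\<integral>\<^sup>+r\<in>{0..T - h}. ennreal (vec_norm m (d n r)) \<partial>lborel) \<le> ennreal C * N h (d n)"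
      using h by (intro C d) auto
    also have "\<dots> \<le> ennreal C * (ennreal (2 ^ n) * \<omega> (h / 2 ^ n))"
      using dyad_step[of h n] h unfolding d_def[abs_def] by (intro mult_left_mono) auto
    finally show "(\<integral>\<^sup>+r\<in>{0..T - h}. ennreal (vec_norm m (d n r)) \<partial>lborel) \<le> ennreal C * (ennreal (2 ^ n) * \<omega> (h / 2 ^ n))" .
  qed auto
  also have "\<dots> = ennreal C * dyadic_sum \<omega> h"
    by (simp add: dyadic_sum_def)
  also have "\<dots> < \<infinity>"
    using dyadic_sum_omega_finite[OF h] by (simp add: ennreal_mult_less_top)
  finally have "AE r in lborel. (\<Sum>n. ennreal (vec_norm m (d n r)) * indicator {0..T - h} r) \<noteq> \<infinity>"
    by (intro nn_integral_noteq_infinite) auto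
  then show ?thesis
  proof eventually_elim
    case (elim r)
    show ?case
    proof (intro impI allI)
      fix i assume r: "r \<in> {0..T - h}" and i: "i < m"
      have "summable (\<lambda>n. vec_norm m (d n r))"
        using elim r by (intro summable_suminf_not_top) auto
      then have "summable (\<lambda>n. d n r i)"
        using vec_norm_component[OF i] by (intro summable_comparison_test[of "\<lambda>n. d n r i"]) auto
      then have "summable (\<lambda>n. dyad X (Suc n) r (r + h) i - dyad X n r (r + h) i)"
        by (simp add: d_def)
      then have "convergent (\<lambda>n. \<Sum>j<n. dyad X (Suc j) r (r + h) i - dyad X j r (r + h) i)"
        by (simp add: summable_iff_convergent)
      then have "convergent (\<lambda>n. dyad X n r (r + h) i - dyad X 0 r (r + h) i)"
        using sum_lessThan_telescope[of "\<lambda>j. dyad X j r (r + h) i"] by simp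
      then have "convergent (\<lambda>n. (dyad X n r (r + h) i - dyad X 0 r (r + h) i) + dyad X 0 r (r + h) i)"
        by (intro convergent_add convergent_const)
      then show "(\<lambda>n. dyad X n r (r + h) i) \<longlonglongrightarrow> dyad_lim X r (r + h) i"
        unfolding dyad_lim_def by (simp add: convergent_LIMSEQ_iff)
    qed
  qed
qed

lemma dyad_0: "dyad X 0 s t = X s t"
  by (simp add: dyad_def)

text \<open>The telescoped bound is uniform in the level, and Fatou's lemma for the norm passes it
  to the limit. At \<open>h = T\<close> the set of starting points is null.\<close>

lemma dyad_lim_bound:
  assumes h: "0 \<le> h" "h \<le> T"
  shows "N h (\<lambda>r. dyad_lim X r (r + h) - X r (r + h)) \<le> dyadic_sum \<omega> h"
proof (cases "h = T")
  case True
  then show ?thesis by (simp add: path_norm_trivial_interval)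
next
  case False
  then have h': "h < T" using h by simp
  show ?thesis
  proof (rule path_norm_Fatou[OF \<beta>, of "\<lambda>n r. dyad X n r (r + h) - X r (r + h)"])
    show "(\<lambda>r. dyad X n r (r + h) - X r (r + h)) \<in> measurable_paths" for n
      unfolding measurable_paths_def by auto
    show "AE r in lborel. r \<in> {0..T - h} \<longrightarrow> (\<forall>i<m. (\<lambda>n. (dyad X n r (r + h) - X r (r + h)) i) \<longlonglongrightarrow> (dyad_lim X r (r + h) - X r (r + h)) i)"
      using dyad_converges[OF h(1) h'] by eventually_elim (auto intro!: tendsto_diff)
    fix n
    have "(\<lambda>r. dyad X n r (r + h) - X r (r + h)) = (\<Sum>j<n. (\<lambda>r. dyad X (Suc j) r (r + h) - dyad X j r (r + h)))"
      using sum_lessThan_telescope[of "\<lambda>j. dyad X j r (r + h) i" n for r i] by (simp add: fun_eq_iff dyad_0)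
    then have "N h (\<lambda>r. dyad X n r (r + h) - X r (r + h)) \<le> (\<Sum>j<n. N h (\<lambda>r. dyad X (Suc j) r (r + h) - dyad X j r (r + h)))"
      by (simp only:) (intro S.triangle_sum, auto simp: measurable_paths_def)
    also have "\<dots> \<le> (\<Sum>j<n. ennreal (2 ^ j) * \<omega> (h / 2 ^ j))"
      using h by (intro sum_mono dyad_step) auto
    also have "\<dots> \<le> dyadic_sum \<omega> h"
      unfolding dyadic_sum_def by (intro sum_le_suminf) auto
    finally show "N h (\<lambda>r. dyad X n r (r + h) - X r (r + h)) \<le> dyadic_sum \<omega> h" .
  qed
qed

end

lemma dyadic_sum_rescale: "dyadic_sum (\<lambda>l. W (l * h)) l = dyadic_sum W (l * h)"
  by (simp add: dyadic_sum_def)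

lemma Un_Int_split:
  fixes t :: "'a::order"
  assumes "\<And>x. x \<in> A \<Longrightarrow> x \<le> t" "\<And>x. x \<in> B \<Longrightarrow> t \<le> x" "t \<in> A" "t \<in> B"
  shows "(A \<union> B) \<inter> {..t} = A" "(A \<union> B) \<inter> {t..} = B"
proof -
  have *: "x = t" if "x \<in> A" "t \<le> x" for x
    using assms(1)[OF that(1)] that(2) by simp
  have **: "x = t" if "x \<in> B" "x \<le> t" for x
    using assms(2)[OF that(1)] that(2) by simp
  show "(A \<union> B) \<inter> {..t} = A"
    using assms(1,3) ** by fastforce
  show "(A \<union> B) \<inter> {t..} = B"
    using assms(2,4) * by fastforce
qed

section \<open>Additivity of the limit of dyadic sums\<close>

context germ
begin

interpretation S: seminorm_on "N h" measurable_paths for h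
  by (rule path_norm_seminorm[OF \<beta>])

text \<open>A sum of \<open>2 ^ n\<close> errors at scale \<open>h / 2 ^ n\<close> is of order
  \<open>(2 * 2 powr (- \<gamma>)) ^ n\<close>, and the ratio is below \<open>1\<close> because
  \<open>\<gamma> > 1\<close>. Levels \<open>n \<ge> 1\<close> are considered since at
  \<open>n = 0\<close> the scale may exceed \<open>3 * T / 4\<close>.\<close>

lemma dyadic_sum_tail:
  assumes h: "0 < h" "h \<le> T"
  shows "(\<lambda>n. ennreal (2 ^ n) * (2 * dyadic_sum \<omega> (h / 2 ^ n))) \<longlonglongrightarrow> 0"
proof -
  define D where "D = 1 / (1 - 2 powr (- ((\<gamma> - 1) / 2)) :: real)"
  have "2 powr (- ((\<gamma> - 1) / 2)) < (1 :: real)" using \<gamma> by (simp add: powr_less_one)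
  then have D: "0 \<le> D" by (simp add: D_def)
  define c :: real where "c = 2 * 2 powr (- \<gamma>)"
  have c: "0 \<le> c" "c < 1"
  proof -
    have "c = 2 powr (1 - \<gamma>)" by (simp add: c_def powr_diff powr_minus_divide)
    also have "\<dots> < 1" using \<gamma> by (simp add: powr_less_one)
    finally show "c < 1" .
  qed (simp add: c_def)
  have le: "ennreal (2 ^ n) * (2 * dyadic_sum \<omega> (h / 2 ^ n)) \<le> ennreal (2 * D * h powr \<gamma> * k * c ^ n)" if n: "1 \<le> n" for n
  proof -
    have pos: "0 < h / 2 ^ n" using h by simp
    have small: "h / 2 ^ n / 2 ^ j \<le> 3 * T / 4" for j
    proof -
      have "(2::real) ^ 1 \<le> 2 ^ (n + j)" using n by (intro power_increasing) auto
      then have "h / 2 ^ (n + j) \<le> h / 2 ^ 1" using h by (intro divide_left_mono) auto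
      moreover have "h / 2 ^ n / 2 ^ j = h / 2 ^ (n + j)"
        by (simp add: power_add)
      moreover have "h / 2 ^ 1 \<le> 3 * T / 4" using h T by simp
      ultimately show ?thesis by (metis order_trans)
    qed
    have "dyadic_sum \<omega> (h / 2 ^ n) \<le> ennreal (D * (h / 2 ^ n) powr \<gamma>) * ennreal k"
      unfolding D_def
    proof (rule dyadic_sum_power_bound[OF \<gamma> pos])
      fix j
      have "\<omega> (h / 2 ^ n / 2 ^ j) \<le> ennreal (k * (h / 2 ^ n / 2 ^ j) powr \<gamma>)"
        using h by (intro pow small) simp
      then show "\<omega> (h / 2 ^ n / 2 ^ j) \<le> ennreal ((h / 2 ^ n / 2 ^ j) powr \<gamma>) * ennreal k"
        using k by (simp add: ennreal_mult mult.commute)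
    qed
    then have "ennreal 2 * dyadic_sum \<omega> (h / 2 ^ n) \<le> ennreal 2 * (ennreal (D * (h / 2 ^ n) powr \<gamma>) * ennreal k)"
      by (rule mult_left_mono) simp
    then have "ennreal (2 ^ n) * (ennreal 2 * dyadic_sum \<omega> (h / 2 ^ n)) \<le> ennreal (2 ^ n) * (ennreal 2 * (ennreal (D * (h / 2 ^ n) powr \<gamma>) * ennreal k))"
      by (rule mult_left_mono) simp
    also have "\<dots> = ennreal (2 ^ n * (2 * (D * (h / 2 ^ n) powr \<gamma> * k)))"
    proof -
      have "0 \<le> D * (h / 2 ^ n) powr \<gamma>" "0 \<le> D * (h / 2 ^ n) powr \<gamma> * k" "0 \<le> 2 * (D * (h / 2 ^ n) powr \<gamma> * k)"
        "(0::real) \<le> 2 ^ n" "(0::real) \<le> 2"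
        using D k by auto
      then show ?thesis
        using k by (simp only: ennreal_mult[symmetric])
    qed
    also have "2 ^ n * (2 * (D * (h / 2 ^ n) powr \<gamma> * k)) = 2 * D * h powr \<gamma> * k * c ^ n"
      unfolding powr_divide_power2 c_def power_mult_distrib by simp
    finally show ?thesis by (simp only: ennreal_numeral)
  qed
  have "eventually (\<lambda>n. ennreal (2 ^ n) * (2 * dyadic_sum \<omega> (h / 2 ^ n)) \<le> ennreal (2 * D * h powr \<gamma> * k * c ^ n)) sequentially"
    using eventually_ge_at_top[of "1::nat"] by eventually_elim (rule le)
  moreover have "(\<lambda>n. ennreal (2 * D * h powr \<gamma> * k * c ^ n)) \<longlonglongrightarrow> ennreal (2 * D * h powr \<gamma> * k * 0)"
    by (intro tendsto_ennrealI tendsto_mult[OF tendsto_const LIMSEQ_realpow_zero[OF c]])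
  then have "(\<lambda>n. ennreal (2 * D * h powr \<gamma> * k * c ^ n)) \<longlonglongrightarrow> 0"
    by simp
  ultimately show ?thesis
    by (rule tendsto_sandwich[OF _ _ tendsto_const, rotated]) simp
qed

text \<open>The points of the dyadic sum over \<open>h1 + h2\<close> and those of the two
  concatenated dyadic sums are in general not nested. Rescaled to the unit interval, with
  \<open>\<theta>\<close> the junction of the two pieces, they fall under the common refinement
  estimate.\<close>

lemma dyad_additive_bound:
  assumes h: "0 < h1" "0 < h2" "h1 + h2 \<le> T"
  shows "N (h1 + h2) (\<lambda>r. dyad X n r (r + (h1 + h2)) - (dyad X n r (r + h1) + dyad X n (r + h1) (r + (h1 + h2))))
    \<le> ennreal (2 ^ n) * (2 * dyadic_sum \<omega> ((h1 + h2) / 2 ^ n))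
      + (ennreal (2 ^ n) * (2 * dyadic_sum \<omega> (h1 / 2 ^ n)) + ennreal (2 ^ n) * (2 * dyadic_sum \<omega> (h2 / 2 ^ n)))"
proof -
  define h where "h = h1 + h2"
  define \<theta> where "\<theta> = h1 / h"
  have h0: "0 < h" "h \<le> T" using h by (auto simp: h_def)
  have \<theta>: "0 < \<theta>" "\<theta> < 1" "\<theta> * h = h1" "(1 - \<theta>) * h = h2"
    using h by (auto simp: \<theta>_def h_def field_simps)
  \<comment> \<open>The comparison of sums asks for increments that vanish on the diagonal, which
    \<open>X\<close> need not do. Setting them to \<open>0\<close> changes no sum, since degenerate
    intervals do not occur.\<close>
  define Y where "Y a b = (if a = b then 0 else (\<lambda>r. X (r + a * h) (r + b * h)))" for a b
  define W where "W l = \<omega> (l * h)" for l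
  have W: "mono W"
    using h0 unfolding W_def by (intro monoI monoD[OF mono_omega] mult_right_mono) auto
  have YM: "Y a b \<in> measurable_paths" for a b
    unfolding Y_def measurable_paths_def by auto
  have Y\<delta>: "N h (Y a b - Y a c - Y c b) \<le> W (b - a)" if "0 \<le> a" "a \<le> c" "c \<le> b" "b \<le> 1" for a c b
  proof (cases "a = c \<or> c = b")
    case True
    then have "Y a b - Y a c - Y c b = 0" by (auto simp: Y_def)
    then show ?thesis by (simp only: S.zero zero_le)
  next
    case False
    then have "Y a b - Y a c - Y c b = (\<lambda>r. delta2 X (r + a * h) (r + c * h) (r + b * h))"
      using that by (auto simp: Y_def delta2_def fun_eq_iff)
    then show ?thesis
      unfolding W_def using that h0 by (simp only: delta_bound less_imp_le)
  qed
  define p1 p2 p3 where "p1 i = real i / 2 ^ n" and "p2 i = \<theta> * (real i / 2 ^ n)" and "p3 i = \<theta> + (1 - \<theta>) * (real i / 2 ^ n)" for i :: nat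
  let ?K = "2 ^ n :: nat"
  have lt: "p1 i < p1 (Suc i)" "p2 i < p2 (Suc i)" "p3 i < p3 (Suc i)" for i
    using \<theta> by (auto simp: p1_def p2_def p3_def divide_strict_right_mono)
  have rng: "p1 ` {..?K} \<subseteq> {0..1}" "p2 ` {..?K} \<subseteq> {0..\<theta>}" "p3 ` {..?K} \<subseteq> {\<theta>..1}"
  proof -
    have u: "0 \<le> real i / 2 ^ n" "real i / 2 ^ n \<le> 1" if "i \<le> ?K" for i
    proof -
      have "real i \<le> real ?K" using that by (simp only: of_nat_le_iff)
      then show "0 \<le> real i / 2 ^ n" "real i / 2 ^ n \<le> 1" by auto
    qed
    have "p1 i \<in> {0..1}" "p2 i \<in> {0..\<theta>}" "p3 i \<in> {\<theta>..1}" if "i \<le> ?K" for i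
    proof -
      have A: "(1 - \<theta>) * (real i / 2 ^ n) \<le> (1 - \<theta>) * 1"
        using u[OF that] \<theta> by (intro mult_left_mono; simp)
      have B: "\<theta> * (real i / 2 ^ n) \<le> \<theta> * 1"
        using u[OF that] \<theta> by (intro mult_left_mono; simp)
      have C: "0 \<le> (1 - \<theta>) * (real i / 2 ^ n)"
        using u[OF that] \<theta> by (intro mult_nonneg_nonneg; simp)
      have D: "0 \<le> \<theta> * (real i / 2 ^ n)"
        using u[OF that] \<theta> by (intro mult_nonneg_nonneg; simp)
      show "p1 i \<in> {0..1}"
        unfolding p1_def atLeastAtMost_iff by (intro conjI u that)
      show "p2 i \<in> {0..\<theta>}"
        unfolding p2_def atLeastAtMost_iff using D B by (intro conjI; simp only: mult_1_right)
      have "p3 i \<le> \<theta> + (1 - \<theta>) * 1"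
        unfolding p3_def by (intro add_left_mono A)
      moreover have "\<theta> + 0 \<le> p3 i"
        unfolding p3_def by (intro add_left_mono C)
      ultimately show "p3 i \<in> {\<theta>..1}"
        by simp
    qed
    then show "p1 ` {..?K} \<subseteq> {0..1}" "p2 ` {..?K} \<subseteq> {0..\<theta>}" "p3 ` {..?K} \<subseteq> {\<theta>..1}"
      by blast+
  qed
  have ends: "p1 0 = 0" "p1 ?K = 1" "p2 0 = 0" "p2 ?K = \<theta>" "p3 0 = \<theta>" "p3 ?K = 1"
    by (auto simp: p1_def p2_def p3_def)
  have mem: "p1 0 \<in> p1 ` {..?K}" "p1 ?K \<in> p1 ` {..?K}" "p2 0 \<in> p2 ` {..?K}" "p2 ?K \<in> p2 ` {..?K}" "p3 0 \<in> p3 ` {..?K}" "p3 ?K \<in> p3 ` {..?K}"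
    by (intro imageI; simp)+
  define Q1 Q2 where "Q1 = p1 ` {..?K}" and "Q2 = p2 ` {..?K} \<union> p3 ` {..?K}"
  have split: "psum Z Q2 = psum Z (p2 ` {..?K}) + psum Z (p3 ` {..?K})" for Z :: "real \<Rightarrow> real \<Rightarrow> 'v::comm_monoid_add"
  proof -
    have t: "\<theta> \<in> p2 ` {..?K}" "\<theta> \<in> p3 ` {..?K}"
      using mem(4,5) unfolding ends by auto
    have "Q2 \<inter> {..\<theta>} = p2 ` {..?K}" "Q2 \<inter> {\<theta>..} = p3 ` {..?K}"
      unfolding Q2_def using rng(2,3) t by (intro Un_Int_split; force)+
    moreover have "finite Q2" "\<theta> \<in> Q2"
      using t by (auto simp: Q2_def)
    ultimately show ?thesis
      using psum_split[of Q2 \<theta> Z] by simp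
  qed
  have neq: "p1 i \<noteq> p1 (Suc i)" "p2 i \<noteq> p2 (Suc i)" "p3 i \<noteq> p3 (Suc i)" for i
    using lt[of i] by auto
  have s1: "psum Y Q1 = (\<lambda>r. dyad X n r (r + (h1 + h2)))"
    unfolding Q1_def using lt neq
    by (subst psum_image) (simp_all add: fun_eq_iff dyad_apply Y_def p1_def h_def)
  have s2: "psum Y (p2 ` {..?K}) = (\<lambda>r. dyad X n r (r + h1))"
  proof -
    have "p2 i * h = real i / 2 ^ n * h1" for i
      using \<theta>(3) by (simp add: p2_def mult.commute mult.left_commute)
    then show ?thesis
      using lt neq by (subst psum_image) (simp_all add: fun_eq_iff dyad_apply Y_def)
  qed
  have s3: "psum Y (p3 ` {..?K}) = (\<lambda>r. dyad X n (r + h1) (r + (h1 + h2)))"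
  proof -
    have "r + p3 i * h = r + h1 + real i / 2 ^ n * (r + (h1 + h2) - (r + h1))" for i r
    proof -
      have "p3 i * h = \<theta> * h + real i / 2 ^ n * ((1 - \<theta>) * h)"
        by (simp add: p3_def algebra_simps)
      then show ?thesis unfolding \<theta> by simp
    qed
    then show ?thesis
      using lt neq by (subst psum_image) (simp_all only: fun_eq_iff dyad_apply Y_def sum_fun_apply if_False simp_thms)
  qed
  have e1: "psum (\<lambda>x y. 2 * dyadic_sum W (y - x)) Q1 = ennreal (2 ^ n) * (2 * dyadic_sum \<omega> ((h1 + h2) / 2 ^ n))"
  proof -
    have "(p1 (Suc i) - p1 i) * h = (h1 + h2) / 2 ^ n" for i
      by (simp add: p1_def h_def field_simps)
    then show ?thesis
      unfolding Q1_def using lt by (subst psum_image)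
        (simp_all add: W_def[abs_def] dyadic_sum_rescale ennreal_of_nat_eq_real_of_nat)
  qed
  have e2: "psum (\<lambda>x y. 2 * dyadic_sum W (y - x)) (p2 ` {..?K}) = ennreal (2 ^ n) * (2 * dyadic_sum \<omega> (h1 / 2 ^ n))"
  proof -
    have "(p2 (Suc i) - p2 i) * h = h1 / 2 ^ n" for i
      unfolding \<theta>(3)[symmetric] by (simp add: p2_def field_simps)
    then show ?thesis
      using lt by (subst psum_image)
        (simp_all add: W_def[abs_def] dyadic_sum_rescale ennreal_of_nat_eq_real_of_nat)
  qed
  have e3: "psum (\<lambda>x y. 2 * dyadic_sum W (y - x)) (p3 ` {..?K}) = ennreal (2 ^ n) * (2 * dyadic_sum \<omega> (h2 / 2 ^ n))"
  proof -
    have "(p3 (Suc i) - p3 i) * h = h2 / 2 ^ n" for i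
      unfolding \<theta>(4)[symmetric] by (simp add: p3_def field_simps)
    then show ?thesis
      using lt by (subst psum_image)
        (simp_all add: W_def[abs_def] dyadic_sum_rescale ennreal_of_nat_eq_real_of_nat)
  qed
  have "N h (psum Y Q1 - psum Y Q2) \<le> psum (\<lambda>x y. 2 * dyadic_sum W (y - x)) Q1 + psum (\<lambda>x y. 2 * dyadic_sum W (y - x)) Q2"
  proof (rule S.psum_common_refinement[OF W _ _ Y\<delta>, where l = 0 and u = 1])
    show "Q1 \<subseteq> {0..1}"
      unfolding Q1_def by (rule rng(1))
    show "Q2 \<subseteq> {0..1}"
      unfolding Q2_def using \<theta>(1,2)
      by (intro Un_least order_trans[OF rng(2)] order_trans[OF rng(3)]; simp)
    note m = mem[unfolded ends]
    show "0 \<in> Q1" "1 \<in> Q1"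
      unfolding Q1_def by (rule m(1), rule m(2))
    show "0 \<in> Q2" "1 \<in> Q2"
      unfolding Q2_def by (rule UnI1[OF m(3)], rule UnI2[OF m(6)])
    show "finite Q1" "finite Q2"
      unfolding Q1_def Q2_def by simp_all
    show "Y a b \<in> measurable_paths" "Y a a = 0" for a b
      by (rule YM) (simp add: Y_def)
  qed
  moreover have "psum Y Q1 - psum Y Q2 = (\<lambda>r. dyad X n r (r + (h1 + h2)) - (dyad X n r (r + h1) + dyad X n (r + h1) (r + (h1 + h2))))"
    unfolding split s1 s2 s3 by (rule ext) simp
  ultimately show ?thesis
    unfolding split e1 e2 e3 h_def by simp
qed

text \<open>The defect of additivity at level \<open>n\<close> converges at almost every starting
  point and tends to \<open>0\<close> in norm. Fatou's lemma shows that its limit has norm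
  \<open>0\<close>.\<close>

lemma dyad_lim_additive:
  assumes h: "0 < h1" "0 < h2" "h1 + h2 \<le> T"
  shows "AE r in lborel. r \<in> {0..T - (h1 + h2)} \<longrightarrow>
    (\<forall>i<m. dyad_lim X r (r + (h1 + h2)) i = dyad_lim X r (r + h1) i + dyad_lim X (r + h1) (r + (h1 + h2)) i)"
proof (cases "h1 + h2 = T")
  case True
  show ?thesis using AE_lborel_singleton[of 0] by eventually_elim (use True in auto)
next
  case False
  define h where "h = h1 + h2"
  have h': "0 < h" "h < T" "h1 < T" "h2 < T" using h False by (auto simp: h_def)
  define g where "g n r = dyad X n r (r + h) - (dyad X n r (r + h1) + dyad X n (r + h1) (r + h))" for n r
  define f where "f r = dyad_lim X r (r + h) - (dyad_lim X r (r + h1) + dyad_lim X (r + h1) (r + h))" for r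
  have gM: "g n \<in> measurable_paths" for n
    unfolding g_def measurable_paths_def by auto
  have fM: "f \<in> measurable_paths"
    unfolding f_def measurable_paths_def by auto
  \<comment> \<open>Convergence on the second piece is the known convergence at the shifted starting
    point \<open>h1 + r\<close>.\<close>
  have "AE r in lborel. h1 + 1 * r \<in> {0..T - h2} \<longrightarrow> (\<forall>i<m. (\<lambda>n. dyad X n (h1 + 1 * r) (h1 + 1 * r + h2) i) \<longlonglongrightarrow> dyad_lim X (h1 + 1 * r) (h1 + 1 * r + h2) i)"
    by (rule AE_lborel_affine_unit[OF _ dyad_converges]) (use h h' in auto)
  then have c3: "AE r in lborel. r \<in> {0..T - h} \<longrightarrow> (\<forall>i<m. (\<lambda>n. dyad X n (r + h1) (r + h) i) \<longlonglongrightarrow> dyad_lim X (r + h1) (r + h) i)"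
    by eventually_elim (use h in \<open>auto simp: h_def add_ac\<close>)
  have lim: "AE r in lborel. r \<in> {0..T - h} \<longrightarrow> (\<forall>i<m. (\<lambda>n. g n r i) \<longlonglongrightarrow> f r i)"
    using c3 dyad_converges[OF less_imp_le[OF h'(1)] h'(2)] dyad_converges[OF less_imp_le[OF h(1)] h'(3)]
    by eventually_elim (use h in \<open>auto simp: g_def f_def h_def intro!: tendsto_intros\<close>)
  have "N h f \<le> 0 + ennreal \<delta>" if \<delta>: "0 < \<delta>" for \<delta>
  proof -
    define e where "e n = ennreal (2 ^ n) * (2 * dyadic_sum \<omega> ((h1 + h2) / 2 ^ n))
      + (ennreal (2 ^ n) * (2 * dyadic_sum \<omega> (h1 / 2 ^ n)) + ennreal (2 ^ n) * (2 * dyadic_sum \<omega> (h2 / 2 ^ n)))" for n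
    have "e \<longlonglongrightarrow> 0 + (0 + 0)"
      unfolding e_def using h by (intro tendsto_add dyadic_sum_tail) auto
    then have "eventually (\<lambda>n. e n < ennreal \<delta>) sequentially"
      using \<delta> by (intro order_tendstoD(2)) auto
    then obtain n0 where n0: "\<And>n. n0 \<le> n \<Longrightarrow> e n < ennreal \<delta>"
      unfolding eventually_sequentially by blast
    have "N h f \<le> ennreal \<delta>"
    proof (rule path_norm_Fatou[OF \<beta>, of "\<lambda>n. g (n + n0)"])
      show "AE r in lborel. r \<in> {0..T - h} \<longrightarrow> (\<forall>i<m. (\<lambda>n. g (n + n0) r i) \<longlonglongrightarrow> f r i)"
        using lim by eventually_elim (auto intro: LIMSEQ_ignore_initial_segment)
      show "N h (g (n + n0)) \<le> ennreal \<delta>" for n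
        using dyad_additive_bound[OF h, of "n + n0"] n0[of "n + n0"]
        unfolding g_def[abs_def] e_def h_def by (meson le_add2 less_imp_le order_trans)
    qed (rule gM)
    then show ?thesis by simp
  qed
  then have "N h f \<le> 0"
    by (rule ennreal_le_epsilon)
  then have "AE r in lborel. r \<in> {0..T - h} \<longrightarrow> (\<forall>i<m. f r i = 0)"
    by (intro path_norm_eq_0D[OF \<beta> fM]) simp
  then show ?thesis
    unfolding h_def[symmetric] by eventually_elim (auto simp: f_def)
qed


text \<open>On the diagonal \<open>delta2 X\<close> equals \<open>- X\<close>, so a vanishing
  modulus at scale \<open>0\<close> makes almost all diagonal values of \<open>X\<close>, and with
  them all dyadic sums there, vanish.\<close>

lemma dyad_lim_self:
  "AE r in lborel. r \<in> {0..T} \<longrightarrow> (\<forall>i<m. dyad_lim X r r i = 0)"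
proof -
  \<comment> \<open>By monotonicity the modulus at \<open>0\<close> is below its value at any small
    \<open>\<tau>\<close>, where the power bound applies.\<close>
  have "\<omega> 0 \<le> 0 + ennreal e" if e: "0 < e" for e
  proof -
    have "((\<lambda>\<tau>. k * \<tau> powr \<gamma>) \<longlongrightarrow> k * 0 powr \<gamma>) (at_right 0)"
      using \<gamma> by (intro tendsto_intros tendsto_powr') (auto simp: eventually_at_filter)
    then have "eventually (\<lambda>\<tau>. k * \<tau> powr \<gamma> < e) (at_right 0)"
      using e by (intro order_tendstoD(2)) auto
    moreover have "eventually (\<lambda>\<tau>. 0 < \<tau> \<and> \<tau> < T / 2) (at_right 0)"
      using eventually_at_right_less[of 0] eventually_at_right_real[of 0 "T / 2"] T
      by (simp add: eventually_conj_iff)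
    ultimately have "eventually (\<lambda>\<tau>. k * \<tau> powr \<gamma> < e \<and> 0 < \<tau> \<and> \<tau> < T / 2) (at_right 0)"
      by (rule eventually_conj)
    then obtain \<tau> where \<tau>: "k * \<tau> powr \<gamma> < e" "0 < \<tau>" "\<tau> < T / 2"
      using eventually_happens'[of "at_right (0::real)"] by (auto simp: trivial_limit_at_right_real)
    have "\<omega> 0 \<le> \<omega> \<tau>" using \<tau> by (intro monoD[OF mono_omega]) auto
    also have "\<dots> \<le> ennreal (k * \<tau> powr \<gamma>)" using \<tau> T by (intro pow) auto
    also have "\<dots> \<le> ennreal e" using \<tau> by (intro ennreal_leI) auto
    finally show ?thesis by simp
  qed
  then have "\<omega> 0 \<le> 0" by (rule ennreal_le_epsilon)
  then have "N 0 (\<lambda>r. delta2 X (r + 0 * 0) (r + 0 * 0) (r + 0 * 0)) = 0"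
    using delta_bound[of 0 0 0 0] T by simp
  then have "AE r in lborel. r \<in> {0..T - 0} \<longrightarrow> (\<forall>i<m. delta2 X (r + 0 * 0) (r + 0 * 0) (r + 0 * 0) i = 0)"
    by (intro path_norm_eq_0D[OF \<beta>]) (auto simp: measurable_paths_def delta2_def)
  then show ?thesis
    by eventually_elim (auto simp: delta2_def dyad_lim_def dyad_apply)
qed

end

text \<open>The antisymmetric extension allows the base point of the path to lie on either side of
  the time at which the path is evaluated.\<close>

definition signed_lim :: "(real \<Rightarrow> real \<Rightarrow> nat \<Rightarrow> real) \<Rightarrow> real \<Rightarrow> real \<Rightarrow> nat \<Rightarrow> real" where
  "signed_lim X s t i = (if s \<le> t then dyad_lim X s t i else - dyad_lim X t s i)"

text \<open>Freezing the first variable at a generic point would already trivialise the cocycle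
  \<open>dyad_lim X\<close>; averaging over that point makes the choice linear in \<open>X\<close>.\<close>

definition sew :: "real \<Rightarrow> (real \<Rightarrow> real \<Rightarrow> nat \<Rightarrow> real) \<Rightarrow> real \<Rightarrow> nat \<Rightarrow> real" where
  "sew T X t i = 4 / T * (\<integral>s. indicator {T / 4..T / 2} s * signed_lim X s t i \<partial>lborel)"

text \<open>The exceptional set may depend on the increment. Measurability of the relation lets
  Fubini exchange increment and starting point, and a translation turns the increment into the
  second time; a further exchange gives the other order.\<close>

lemma AE_shear:
  fixes P :: "real \<Rightarrow> real \<Rightarrow> bool"
  assumes meas: "Measurable.pred (borel \<Otimes>\<^sub>M borel) (\<lambda>p. P (fst p) (snd p))"
    and ae: "\<And>h. AE r in lborel. P r (r + h)"
  shows "AE s in lborel. AE t in lborel. P s t" "AE t in lborel. AE s in lborel. P s t"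
proof -
  have Pm [measurable (raw)]: "f \<in> borel_measurable M \<Longrightarrow> g \<in> borel_measurable M \<Longrightarrow> Measurable.pred M (\<lambda>x. P (f x) (g x))" for f g :: "_ \<Rightarrow> real" and M
    using measurable_compose[OF measurable_Pair meas, of f M g] by simp
  have "Measurable.pred (lborel \<Otimes>\<^sub>M lborel) (\<lambda>x. P (snd x) (snd x + fst x))"
    by (intro Pm) measurable
  then have "(AE h in lborel. AE r in lborel. P r (r + h)) \<longleftrightarrow> (AE r in lborel. AE h in lborel. P r (r + h))"
    by (intro lborel_pair.AE_commute) (simp only: pred_def)
  then have "AE r in lborel. AE h in lborel. P r (r + h)"
    using ae by simp
  then show *: "AE s in lborel. AE t in lborel. P s t"
  proof eventually_elim
    case (elim r)
    have "AE t in lborel. P r (r + (- r + 1 * t))"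
      by (rule AE_lborel_affine_unit[OF _ elim]) simp
    then show ?case by simp
  qed
  have "Measurable.pred (lborel \<Otimes>\<^sub>M lborel) (\<lambda>x. P (fst x) (snd x))"
    by (intro Pm) measurable
  then have "(AE s in lborel. AE t in lborel. P s t) \<longleftrightarrow> (AE t in lborel. AE s in lborel. P s t)"
    by (intro lborel_pair.AE_commute) (simp only: pred_def)
  with * show "AE t in lborel. AE s in lborel. P s t"
    by simp
qed

section \<open>The path obtained by averaging over base points\<close>

context germ
begin

lemma measurable_signed_lim [measurable (raw)]:
  "f \<in> borel_measurable M \<Longrightarrow> g \<in> borel_measurable M \<Longrightarrow> (\<lambda>x. signed_lim X (f x) (g x) i) \<in> borel_measurable M"
proof -
  assume [measurable]: "f \<in> borel_measurable M" "g \<in> borel_measurable M"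
  show ?thesis unfolding signed_lim_def by measurable
qed

lemma measurable_sew [measurable]: "(\<lambda>t. sew T X t i) \<in> borel_measurable borel"
  unfolding sew_def by measurable

lemma dyad_lim_L1:
  obtains L where "0 \<le> L" "\<And>h. 0 \<le> h \<Longrightarrow> h \<le> 3 * T / 4 \<Longrightarrow>
    (\<integral>\<^sup>+r\<in>{0..T - h}. ennreal (vec_norm m (dyad_lim X r (r + h))) \<partial>lborel) \<le> ennreal L"
proof -
  obtain L where L: "\<And>h. 0 \<le> h \<Longrightarrow> h \<le> 3 * T / 4 \<Longrightarrow>
      (\<integral>\<^sup>+r\<in>{0..T - h}. ennreal (vec_norm m (X r (r + h))) \<partial>lborel) \<le> ennreal L"
    using int by blast
  obtain C where C: "0 < C" "\<And>c f. c \<le> T \<Longrightarrow> f \<in> measurable_paths \<Longrightarrow>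
    (\<integral>\<^sup>+r\<in>{0..c}. ennreal (vec_norm m (f r)) \<partial>lborel) \<le> ennreal C * path_norm m \<beta> c f"
    by (rule path_norm_L1[OF \<beta>, of T m]) (use T in simp, blast)
  define K where "K = enn2real (dyadic_sum \<omega> (3 * T / 4))"
  have K: "dyadic_sum \<omega> (3 * T / 4) = ennreal K" "0 \<le> K"
    using dyadic_sum_omega_finite[of "3 * T / 4"] T by (auto simp: K_def)
  have "(\<integral>\<^sup>+r\<in>{0..T - h}. ennreal (vec_norm m (dyad_lim X r (r + h))) \<partial>lborel) \<le> ennreal (max 0 L + C * K)"
    if h: "0 \<le> h" "h \<le> 3 * T / 4" for h
  proof -
    have [measurable]: "(\<lambda>r. vec_norm m (X r (r + h))) \<in> borel_measurable borel"
        "(\<lambda>r. vec_norm m (dyad_lim X r (r + h) - X r (r + h))) \<in> borel_measurable borel"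
      by (intro vec_norm_measurable; simp)+
    have "(\<integral>\<^sup>+r\<in>{0..T - h}. ennreal (vec_norm m (dyad_lim X r (r + h))) \<partial>lborel)
        \<le> (\<integral>\<^sup>+r. ennreal (vec_norm m (X r (r + h))) * indicator {0..T - h} r
           + ennreal (vec_norm m (dyad_lim X r (r + h) - X r (r + h))) * indicator {0..T - h} r \<partial>lborel)"
    proof (rule nn_integral_mono)
      fix r
      have "vec_norm m (X r (r + h) + (dyad_lim X r (r + h) - X r (r + h))) \<le> vec_norm m (X r (r + h)) + vec_norm m (dyad_lim X r (r + h) - X r (r + h))"
        by (rule vec_norm_triangle)
      then have "ennreal (vec_norm m (dyad_lim X r (r + h))) \<le> ennreal (vec_norm m (X r (r + h)) + vec_norm m (dyad_lim X r (r + h) - X r (r + h)))"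
        by (intro ennreal_leI) simp
      then show "ennreal (vec_norm m (dyad_lim X r (r + h))) * indicator {0..T - h} r
          \<le> ennreal (vec_norm m (X r (r + h))) * indicator {0..T - h} r
           + ennreal (vec_norm m (dyad_lim X r (r + h) - X r (r + h))) * indicator {0..T - h} r"
        by (cases "r \<in> {0..T - h}") simp_all
    qed
    also have "\<dots> = (\<integral>\<^sup>+r\<in>{0..T - h}. ennreal (vec_norm m (X r (r + h))) \<partial>lborel)
        + (\<integral>\<^sup>+r\<in>{0..T - h}. ennreal (vec_norm m (dyad_lim X r (r + h) - X r (r + h))) \<partial>lborel)"
      by (rule nn_integral_add) measurable
    also have "\<dots> \<le> ennreal (max 0 L) + ennreal C * ennreal K"
    proof (rule add_mono)
      have "(\<integral>\<^sup>+r\<in>{0..T - h}. ennreal (vec_norm m (X r (r + h))) \<partial>lborel) \<le> ennreal L"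
        by (rule L[OF h])
      also have "\<dots> \<le> ennreal (max 0 L)" by (intro ennreal_leI) simp
      finally show "(\<integral>\<^sup>+r\<in>{0..T - h}. ennreal (vec_norm m (X r (r + h))) \<partial>lborel) \<le> ennreal (max 0 L)" .
      have "(\<integral>\<^sup>+r\<in>{0..T - h}. ennreal (vec_norm m (dyad_lim X r (r + h) - X r (r + h))) \<partial>lborel)
          \<le> ennreal C * N h (\<lambda>r. dyad_lim X r (r + h) - X r (r + h))"
        using h by (intro C) (auto simp: measurable_paths_def)
      also have "\<dots> \<le> ennreal C * dyadic_sum \<omega> h"
        using h T by (intro mult_left_mono dyad_lim_bound) auto
      also have "\<dots> \<le> ennreal C * dyadic_sum \<omega> (3 * T / 4)"
        using h by (intro mult_left_mono monoD[OF dyadic_sum_mono[OF mono_omega]]) auto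
      finally show "(\<integral>\<^sup>+r\<in>{0..T - h}. ennreal (vec_norm m (dyad_lim X r (r + h) - X r (r + h))) \<partial>lborel) \<le> ennreal C * ennreal K"
        unfolding K .
    qed
    also have "\<dots> = ennreal (max 0 L + C * K)"
      using C K by (simp add: ennreal_mult)
    finally show ?thesis .
  qed
  moreover have "0 \<le> max 0 L + C * K"
    using C K by (intro add_nonneg_nonneg) auto
  ultimately show thesis using that by blast
qed

lemma signed_lim_integrable:
  "AE t in lborel. t \<in> {0..T} \<longrightarrow> (\<forall>i<m. integrable lborel (\<lambda>s. indicator {T / 4..T / 2} s * signed_lim X s t i))"
proof -
  obtain L where L: "0 \<le> L" "\<And>h. 0 \<le> h \<Longrightarrow> h \<le> 3 * T / 4 \<Longrightarrow>
    (\<integral>\<^sup>+r\<in>{0..T - h}. ennreal (vec_norm m (dyad_lim X r (r + h))) \<partial>lborel) \<le> ennreal L"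
    by (rule dyad_lim_L1) blast
  \<comment> \<open>For \<open>s\<close> between \<open>T / 4\<close> and \<open>T / 2\<close> and
    \<open>t\<close> in \<open>{0..T}\<close> the distance is at most \<open>3 * T / 4\<close>, the
    range of increments with an \<open>L\<^sup>1\<close> bound. This explains the window of base
    points in \<open>sew\<close>.\<close>
  define F where "F s t = ennreal (vec_norm m (dyad_lim X s t)) * indicator {(s, t). 0 \<le> s \<and> s \<le> t \<and> t \<le> T \<and> t - s \<le> 3 * T / 4} (s, t)" for s t
  have Fm: "case_prod F \<in> borel_measurable (borel \<Otimes>\<^sub>M borel)"
  proof -
    have [measurable]: "(\<lambda>x. vec_norm m (dyad_lim X (fst x) (snd x))) \<in> borel_measurable (borel \<Otimes>\<^sub>M borel)"
      by (intro vec_norm_measurable) measurable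
    show ?thesis
      unfolding F_def indicator_def split_beta' by measurable
  qed
  have [measurable (raw)]: "f \<in> borel_measurable M \<Longrightarrow> g \<in> borel_measurable M \<Longrightarrow> (\<lambda>x. F (f x) (g x)) \<in> borel_measurable M" for f g :: "_ \<Rightarrow> real" and M
    using measurable_compose[OF measurable_Pair Fm, of f M g] by simp
  have "(\<integral>\<^sup>+s. \<integral>\<^sup>+t. F s t \<partial>lborel \<partial>lborel) = (\<integral>\<^sup>+h. \<integral>\<^sup>+r. F r (r + h) \<partial>lborel \<partial>lborel)"
    by (rule nn_integral_shear[symmetric, OF Fm])
  also have "\<dots> \<le> (\<integral>\<^sup>+h. ennreal L * indicator {0..3 * T / 4} h \<partial>lborel)"
  proof (rule nn_integral_mono)
    fix h
    show "(\<integral>\<^sup>+r. F r (r + h) \<partial>lborel) \<le> ennreal L * indicator {0..3 * T / 4} h"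
    proof (cases "h \<in> {0..3 * T / 4}")
      case True
      have "(\<integral>\<^sup>+r. F r (r + h) \<partial>lborel) = (\<integral>\<^sup>+r\<in>{0..T - h}. ennreal (vec_norm m (dyad_lim X r (r + h))) \<partial>lborel)"
        using True by (intro nn_integral_cong) (auto simp: F_def indicator_def)
      also have "\<dots> \<le> ennreal L"
        using True by (intro L) auto
      finally show ?thesis using True by simp
    next
      case False
      then have "(\<integral>\<^sup>+r. F r (r + h) \<partial>lborel) = (\<integral>\<^sup>+(r::real). 0 \<partial>lborel)"
        by (intro nn_integral_cong) (auto simp: F_def indicator_def)
      then show ?thesis by simp
    qed
  qed
  also have "\<dots> < \<infinity>"
    using T by (simp add: nn_integral_cmult ennreal_mult_less_top)
  finally have fin1: "(\<integral>\<^sup>+s. \<integral>\<^sup>+t. F s t \<partial>lborel \<partial>lborel) < \<infinity>" .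
  then have fin2: "(\<integral>\<^sup>+t. \<integral>\<^sup>+s. F s t \<partial>lborel \<partial>lborel) < \<infinity>"
  proof -
    have "(\<integral>\<^sup>+t. \<integral>\<^sup>+s. F s t \<partial>lborel \<partial>lborel) = (\<integral>\<^sup>+s. \<integral>\<^sup>+t. F s t \<partial>lborel \<partial>lborel)"
      by (rule lborel_pair.Fubini') measurable
    then show ?thesis using fin1 by simp
  qed
  have "AE t in lborel. (\<integral>\<^sup>+s. F t s \<partial>lborel) \<noteq> \<infinity>"
    using fin1 by (intro nn_integral_noteq_infinite) auto
  moreover have "AE t in lborel. (\<integral>\<^sup>+s. F s t \<partial>lborel) \<noteq> \<infinity>"
    using fin2 by (intro nn_integral_noteq_infinite) auto
  ultimately show ?thesis
  proof eventually_elim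
    case (elim t)
    show ?case
    proof (intro impI allI)
      fix i assume t: "t \<in> {0..T}" and i: "i < m"
      have "(\<integral>\<^sup>+s. ennreal (norm (indicator {T / 4..T / 2} s * signed_lim X s t i)) \<partial>lborel) \<le> (\<integral>\<^sup>+s. F t s + F s t \<partial>lborel)"
      proof (rule nn_integral_mono)
        fix s
        show "ennreal (norm (indicator {T / 4..T / 2} s * signed_lim X s t i)) \<le> F t s + F s t"
        proof (cases "s \<in> {T / 4..T / 2}")
          case True
          have "ennreal \<bar>signed_lim X s t i\<bar> \<le> F t s + F s t"
          proof (cases "s \<le> t")
            case st: True
            have "ennreal \<bar>signed_lim X s t i\<bar> \<le> F s t"
              using st True t T vec_norm_component[OF i, of "dyad_lim X s t"]
              by (auto simp: F_def signed_lim_def intro!: ennreal_leI)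
            also have "\<dots> \<le> F t s + F s t" by simp
            finally show ?thesis .
          next
            case st: False
            have "ennreal \<bar>signed_lim X s t i\<bar> \<le> F t s"
              using st True t T vec_norm_component[OF i, of "dyad_lim X t s"]
              by (auto simp: F_def signed_lim_def intro!: ennreal_leI)
            also have "\<dots> \<le> F t s + F s t" by simp
            finally show ?thesis .
          qed
          then show ?thesis
            using True by simp
        qed simp
      qed
      also have "\<dots> = (\<integral>\<^sup>+s. F t s \<partial>lborel) + (\<integral>\<^sup>+s. F s t \<partial>lborel)"
        by (rule nn_integral_add) measurable
      also have "\<dots> < \<infinity>"
        using elim by (simp add: less_top)
      finally show "integrable lborel (\<lambda>s. indicator {T / 4..T / 2} s * signed_lim X s t i)"
        by (intro integrableI_bounded) auto
    qed
  qed
qed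

text \<open>For almost every base point the difference of the two integrands is the limit over the
  increment from \<open>t\<close> to \<open>t + h\<close>, wherever the base point lies. The window
  has length \<open>T / 4\<close>, which cancels against the factor \<open>4 / T\<close>.\<close>

lemma sew_increment:
  assumes h: "0 \<le> h" "h \<le> T"
  shows "AE r in lborel. r \<in> {0..T - h} \<longrightarrow> (\<forall>i<m. sew T X (r + h) i - sew T X r i = dyad_lim X r (r + h) i)"
proof -
  consider "h = 0" | "h = T" | "0 < h" "h < T" using h by linarith
  then show ?thesis
  proof cases
    case 1
    show ?thesis
      using dyad_lim_self by eventually_elim (use 1 in auto)
  next
    case 2
    show ?thesis
      using AE_lborel_singleton[of 0] by eventually_elim (use 2 in auto)
  next
    case 3
    \<comment> \<open>The three relations are additivity for the three positions of the base point:
      before \<open>t\<close>, between \<open>t\<close> and \<open>t + h\<close>, and after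
      \<open>t + h\<close>.\<close>
    define P1 where "P1 s t \<longleftrightarrow> (0 \<le> s \<and> s < t \<and> t + h \<le> T \<longrightarrow> (\<forall>i<m. dyad_lim X s (t + h) i = dyad_lim X s t i + dyad_lim X t (t + h) i))" for s t
    define P2 where "P2 t s \<longleftrightarrow> (0 \<le> t \<and> t < s \<and> s < t + h \<and> t + h \<le> T \<longrightarrow> (\<forall>i<m. dyad_lim X t (t + h) i = dyad_lim X t s i + dyad_lim X s (t + h) i))" for s t
    define P3 where "P3 t s \<longleftrightarrow> (0 \<le> t \<and> t + h < s \<and> s \<le> T \<longrightarrow> (\<forall>i<m. dyad_lim X t s i = dyad_lim X t (t + h) i + dyad_lim X (t + h) s i))" for s t
    have "AE t in lborel. AE s in lborel. P1 s t"
    proof (rule AE_shear(2))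
      show "Measurable.pred (borel \<Otimes>\<^sub>M borel) (\<lambda>p. P1 (fst p) (snd p))"
        unfolding P1_def by measurable
      fix h' show "AE r in lborel. P1 r (r + h')"
      proof (cases "0 < h' \<and> h' + h \<le> T")
        case True
        then have hs: "0 < h'" "0 < h" "h' + h \<le> T"
          using 3 by auto
        have eq: "r + h' + h = r + (h' + h)" for r by simp
        show ?thesis
          using dyad_lim_additive[OF hs] by eventually_elim (simp add: P1_def eq)
      qed (auto simp: P1_def)
    qed
    moreover have "AE t in lborel. AE s in lborel. P2 t s"
    proof (rule AE_shear(1))
      show "Measurable.pred (borel \<Otimes>\<^sub>M borel) (\<lambda>p. P2 (fst p) (snd p))"
        unfolding P2_def by measurable
      fix h' show "AE r in lborel. P2 r (r + h')"
      proof (cases "0 < h' \<and> h' < h")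
        case True
        then have hs: "0 < h'" "0 < h - h'" "h' + (h - h') \<le> T"
          using 3 by auto
        show ?thesis
          using dyad_lim_additive[OF hs] by eventually_elim (simp add: P2_def)
      qed (auto simp: P2_def)
    qed
    moreover have "AE t in lborel. AE s in lborel. P3 t s"
    proof (rule AE_shear(1))
      show "Measurable.pred (borel \<Otimes>\<^sub>M borel) (\<lambda>p. P3 (fst p) (snd p))"
        unfolding P3_def by measurable
      fix h' show "AE r in lborel. P3 r (r + h')"
      proof (cases "h < h' \<and> h' \<le> T")
        case True
        then have hs: "0 < h" "0 < h' - h" "h + (h' - h) \<le> T"
          using 3 by auto
        show ?thesis
          using dyad_lim_additive[OF hs] by eventually_elim (simp add: P3_def)
      qed (auto simp: P3_def)
    qed
    moreover have "AE t in lborel. h + 1 * t \<in> {0..T} \<longrightarrow> (\<forall>i<m. integrable lborel (\<lambda>s. indicator {T / 4..T / 2} s * signed_lim X s (h + 1 * t) i))"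
      by (rule AE_lborel_affine_unit[OF _ signed_lim_integrable]) simp
    ultimately show ?thesis
      using signed_lim_integrable
    proof eventually_elim
      case (elim t)
      show ?case
      proof (intro impI allI)
        fix i assume t: "t \<in> {0..T - h}" and i: "i < m"
        have int1: "integrable lborel (\<lambda>s. indicator {T / 4..T / 2} s * signed_lim X s (t + h) i)"
          using elim(4) t i h by (auto simp: add.commute)
        have int2: "integrable lborel (\<lambda>s. indicator {T / 4..T / 2} s * signed_lim X s t i)"
          using elim(5) t i h by auto
        have "sew T X (t + h) i - sew T X t i = 4 / T * (\<integral>s. indicator {T / 4..T / 2} s * signed_lim X s (t + h) i - indicator {T / 4..T / 2} s * signed_lim X s t i \<partial>lborel)"
          unfolding sew_def Bochner_Integration.integral_diff[OF int1 int2] by (simp add: right_diff_distrib)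
        also have "(\<integral>s. indicator {T / 4..T / 2} s * signed_lim X s (t + h) i - indicator {T / 4..T / 2} s * signed_lim X s t i \<partial>lborel)
            = (\<integral>s. indicator {T / 4..T / 2} s * dyad_lim X t (t + h) i \<partial>lborel)"
        proof (rule integral_cong_AE)
          show "AE s in lborel. indicator {T / 4..T / 2} s * signed_lim X s (t + h) i - indicator {T / 4..T / 2} s * signed_lim X s t i = indicator {T / 4..T / 2} s * dyad_lim X t (t + h) i"
            using elim(1-3) AE_lborel_singleton[of t] AE_lborel_singleton[of "t + h"]
          proof eventually_elim
            case (elim s)
            show ?case
            proof (cases "s \<in> {T / 4..T / 2}")
              case True
              consider "s < t" | "t < s" "s < t + h" | "t + h < s"
                using elim(4,5) by linarith
              then have "signed_lim X s (t + h) i - signed_lim X s t i = dyad_lim X t (t + h) i"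
              proof cases
                case 1
                then show ?thesis using elim(1) True t i h T by (auto simp: P1_def signed_lim_def)
              next
                case 2
                then show ?thesis using elim(2) True t i h T by (auto simp: P2_def signed_lim_def)
              next
                case 3
                then show ?thesis using elim(3) True t i h T by (auto simp: P3_def signed_lim_def)
              qed
              then show ?thesis using True by simp
            qed simp
          qed
        qed measurable
        also have "\<dots> = T / 4 * dyad_lim X t (t + h) i"
          using T by simp
        finally show "sew T X (t + h) i - sew T X t i = dyad_lim X t (t + h) i"
          using T by simp
      qed
    qed
  qed
qed

end

subsection \<open>Representatives\<close>

text \<open>Setting a representative to \<open>0\<close> outside its domain and in the coordinates
  from \<open>m\<close> on makes it Borel measurable on the whole space. The moduli do not see this
  change, so the estimates can be carried out without restricted spaces.\<close>

definition clip1 :: "real \<Rightarrow> nat \<Rightarrow> (real \<Rightarrow> nat \<Rightarrow> real) \<Rightarrow> real \<Rightarrow> nat \<Rightarrow> real" where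
  "clip1 T m f t i = (if 0 \<le> t \<and> t \<le> T \<and> i < m then f t i else 0)"

definition clip2 :: "real \<Rightarrow> nat \<Rightarrow> (real \<Rightarrow> real \<Rightarrow> nat \<Rightarrow> real) \<Rightarrow> real \<Rightarrow> real \<Rightarrow> nat \<Rightarrow> real" where
  "clip2 T m X s t i = (if 0 \<le> s \<and> s \<le> t \<and> t \<le> T \<and> i < m then X s t i else 0)"

lemma clip1_measurable:
  assumes "f \<in> L0_1 T m"
  shows "(\<lambda>t. clip1 T m f t i) \<in> borel_measurable borel"
proof (cases "i < m")
  case True
  then have "(\<lambda>t. f t i) \<in> borel_measurable (restrict_space borel {0..T})"
    using assms by (simp add: L0_1_def vec_measurable_on_def)
  then have "(\<lambda>t. indicator {0..T} t *\<^sub>R f t i) \<in> borel_measurable borel"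
    by (subst (asm) borel_measurable_restrict_space_iff) auto
  also have "(\<lambda>t. indicator {0..T} t *\<^sub>R f t i) = (\<lambda>t. clip1 T m f t i)"
    using True by (auto simp: clip1_def indicator_def)
  finally show ?thesis .
qed (simp add: clip1_def)

lemma closed_triangle2: "closed (triangle2 T)"
proof -
  have "triangle2 T = {x. 0 \<le> fst x} \<inter> {x. fst x \<le> snd x} \<inter> {x. snd x \<le> T}"
    by (auto simp: triangle2_def)
  moreover have "closed {x :: real \<times> real. 0 \<le> fst x}" "closed {x :: real \<times> real. fst x \<le> snd x}" "closed {x :: real \<times> real. snd x \<le> T}"
    by (intro closed_Collect_le continuous_intros)+
  ultimately show ?thesis by auto
qed

lemma clip2_measurable:
  assumes "X \<in> L0_2 T m"
  shows "(\<lambda>p. clip2 T m X (fst p) (snd p) i) \<in> borel_measurable (borel \<Otimes>\<^sub>M borel)"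
proof (cases "i < m")
  case True
  have "(\<lambda>x. (\<lambda>(s, t). X s t) x i) \<in> borel_measurable (restrict_space borel (triangle2 T))"
    using assms True by (simp add: L0_2_def vec_measurable_on_def)
  then have "(\<lambda>x. indicator (triangle2 T) x *\<^sub>R (\<lambda>(s, t). X s t) x i) \<in> borel_measurable borel"
    using closed_triangle2[of T] by (subst (asm) borel_measurable_restrict_space_iff) auto
  also have "(\<lambda>x. indicator (triangle2 T) x *\<^sub>R (\<lambda>(s, t). X s t) x i) = (\<lambda>p. clip2 T m X (fst p) (snd p) i)"
    using True by (auto simp: clip2_def indicator_def triangle2_def fun_eq_iff)
  finally show ?thesis
    unfolding borel_prod .
qed (simp add: clip2_def)

lemma clip2_measurable':
  assumes "X \<in> L0_2 T m" "f \<in> borel_measurable N" "g \<in> borel_measurable N"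
  shows "(\<lambda>x. clip2 T m X (f x) (g x) i) \<in> borel_measurable N"
  using measurable_compose[OF measurable_Pair[OF assms(2,3)] clip2_measurable[OF assms(1)], of i] by simp

lemma modulus2_cong_AE:
  assumes "\<And>h. 0 \<le> h \<Longrightarrow> h \<le> T \<Longrightarrow> h \<le> \<tau> \<Longrightarrow> AE r in lborel. r \<in> {0..T - h} \<longrightarrow> (\<forall>i<m. X r (r + h) i = Y r (r + h) i)"
  shows "modulus2 T m \<beta> X \<tau> = modulus2 T m \<beta> Y \<tau>"
  unfolding modulus2_def
proof (rule SUP_cong[OF refl])
  fix h assume h: "h \<in> {0..\<tau>}"
  show "orlicz_norm \<beta> {0..T - h} (\<lambda>r. vec_norm m (X r (r + h))) = orlicz_norm \<beta> {0..T - h} (\<lambda>r. vec_norm m (Y r (r + h)))"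
  proof (cases "h \<le> T")
    case True
    have "AE r in lborel. r \<in> {0..T - h} \<longrightarrow> vec_norm m (X r (r + h)) = vec_norm m (Y r (r + h))"
      using assms[of h] h True by (auto elim!: eventually_mono intro: vec_norm_cong)
    then show ?thesis by (rule orlicz_norm_cong_AE)
  qed (auto intro!: orlicz_norm_cong_AE)
qed

lemma modulus2_clip: "modulus2 T m \<beta> (clip2 T m X) \<tau> = modulus2 T m \<beta> X \<tau>"
  by (rule modulus2_cong_AE) (auto simp: clip2_def)

lemma modulus3_clip: "modulus3 T m \<beta> (delta2 (clip2 T m X)) \<tau> = modulus3 T m \<beta> (delta2 X) \<tau>"
  unfolding modulus3_def
proof (intro SUP_cong refl)
  fix \<theta> h :: real assume *: "\<theta> \<in> {0..1}" "h \<in> {0..\<tau>}"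
  have "\<theta> * h \<le> 1 * h" by (rule mult_right_mono) (use * in auto)
  moreover have "0 \<le> \<theta> * h" using * by simp
  ultimately have "vec_norm m (delta2 (clip2 T m X) r (r + \<theta> * h) (r + h)) = vec_norm m (delta2 X r (r + \<theta> * h) (r + h))" if "r \<in> {0..T - h}" for r
    using * that by (intro vec_norm_cong) (auto simp: delta2_def clip2_def)
  then show "orlicz_norm \<beta> {0..T - h} (\<lambda>r. vec_norm m (delta2 (clip2 T m X) r (r + \<theta> * h) (r + h)))
      = orlicz_norm \<beta> {0..T - h} (\<lambda>r. vec_norm m (delta2 X r (r + \<theta> * h) (r + h)))"
    by (intro orlicz_norm_cong_AE) auto
qed

lemma mono_modulus2: "mono (modulus2 T m \<beta> X)"
  unfolding modulus2_def by (intro monoI SUP_subset_mono) auto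

lemma mono_modulus3: "mono (modulus3 T m \<beta> Y)"
  unfolding modulus3_def by (intro monoI SUP_mono) (auto intro!: SUP_subset_mono)

lemma modulus2_leI:
  assumes "\<And>h. 0 \<le> h \<Longrightarrow> h \<le> \<tau> \<Longrightarrow> h < T \<Longrightarrow> path_norm m \<beta> (T - h) (\<lambda>r. X r (r + h)) \<le> c"
  shows "modulus2 T m \<beta> X \<tau> \<le> c"
  unfolding modulus2_def
proof (rule SUP_least)
  fix h assume "h \<in> {0..\<tau>}"
  then show "orlicz_norm \<beta> {0..T - h} (\<lambda>r. vec_norm m (X r (r + h))) \<le> c"
    using assms[of h] path_norm_trivial_interval[of "T - h" m \<beta> "\<lambda>r. X r (r + h)"]
    by (cases "h < T") (auto simp: path_norm_def)
qed

lemma path_norm_le_modulus2: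
  "0 \<le> h \<Longrightarrow> h \<le> \<tau> \<Longrightarrow> path_norm m \<beta> (T - h) (\<lambda>r. X r (r + h)) \<le> modulus2 T m \<beta> X \<tau>"
  unfolding modulus2_def path_norm_def by (rule SUP_upper) auto

text \<open>A finite norm forces finiteness at almost every scale, and monotonicity passes it down
  from a slightly larger one. In contrast to the quantitative embedding this reaches every scale
  below \<open>T\<close>.\<close>

lemma Lq_log_norm_finite_pointwise:
  assumes q: "0 < q" and F: "mono F" and a: "0 \<le> a" and fin: "Lq_log_norm T q (\<lambda>\<tau>. ennreal (\<tau> powr (- a)) * F \<tau>) < \<infinity>"
    and \<tau>: "\<tau> < T" "0 < T"
  shows "F \<tau> < \<infinity>"
proof -
  have [measurable]: "F \<in> borel_measurable borel"
    by (rule mono_ennreal_borel_measurable[OF F])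
  have ae: "AE \<sigma> in lborel. 0 < \<sigma> \<and> \<sigma> \<le> T \<longrightarrow> ennreal (\<sigma> powr (- a)) * F \<sigma> < \<infinity>"
  proof (cases "q = \<infinity>")
    case True
    show ?thesis
      using Lq_log_norm_top_AE[of T "\<lambda>\<tau>. ennreal (\<tau> powr (- a)) * F \<tau>"]
      by eventually_elim (use fin True in \<open>auto intro: le_less_trans\<close>)
  next
    case False
    define p where "p = enn2real q"
    have p: "0 < p" using enn2real_pos[OF q False] by (simp add: p_def)
    have "log_integral T p (\<lambda>\<tau>. ennreal (\<tau> powr (- a)) * F \<tau>) = ennreal_powr (Lq_log_norm T q (\<lambda>\<tau>. ennreal (\<tau> powr (- a)) * F \<tau>)) p"
      unfolding p_def by (rule log_integral_eq_powr[OF _ q False]) measurable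
    also have "\<dots> < \<infinity>"
      using fin by (simp add: ennreal_powr_def)
    finally have "AE \<sigma> in lborel. ennreal_powr (ennreal (\<sigma> powr (- a)) * F \<sigma>) p * (ennreal (1 / \<sigma>) * indicator {0<..T} \<sigma>) \<noteq> \<infinity>"
      unfolding log_integral_def by (intro nn_integral_noteq_infinite) auto
    then show ?thesis
    proof eventually_elim
      case (elim \<sigma>)
      show ?case
      proof
        assume \<sigma>: "0 < \<sigma> \<and> \<sigma> \<le> T"
        show "ennreal (\<sigma> powr (- a)) * F \<sigma> < \<infinity>"
        proof (rule ccontr)
          assume "\<not> ?thesis"
          then have "ennreal (\<sigma> powr (- a)) * F \<sigma> = top" by (simp add: not_less top_unique)
          then show False
            using elim \<sigma> by (simp add: ennreal_top_mult)
        qed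
      qed
    qed
  qed
  \<comment> \<open>The maximum with \<open>0\<close> places \<open>\<sigma>\<close> in the range of
    the norm even when \<open>\<tau>\<close> is not positive.\<close>
  obtain \<sigma> where \<sigma>: "max 0 \<tau> < \<sigma>" "\<sigma> < T" "0 < \<sigma> \<and> \<sigma> \<le> T \<longrightarrow> ennreal (\<sigma> powr (- a)) * F \<sigma> < \<infinity>"
    by (rule mono_AE_point[OF ae, of "max 0 \<tau>" T]) (use \<tau> in auto)
  then have "F \<sigma> < \<infinity>"
    by (auto simp: ennreal_mult_less_top)
  moreover have "F \<tau> \<le> F \<sigma>" using \<sigma> by (intro monoD[OF F]) auto
  ultimately show ?thesis by (rule le_less_trans[rotated])
qed

text \<open>The constant of the pointwise bound for the remainder: the geometric factor from summing
  over dyadic scales times the embedding constant of the modulus.\<close>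

definition sewn_const :: "real \<Rightarrow> ennreal \<Rightarrow> real" where
  "sewn_const \<gamma> q = 1 / (1 - 2 powr (- ((\<gamma> - 1) / 2))) * embedding_const \<gamma> q"

lemma sewn_const_pos: "1 < \<gamma> \<Longrightarrow> 0 < sewn_const \<gamma> q"
proof -
  assume "1 < \<gamma>"
  then have "2 powr (- ((\<gamma> - 1) / 2)) < (1 :: real)" "1 \<le> embedding_const \<gamma> q"
    by (auto simp: powr_less_one intro!: embedding_const_ge_1)
  then show ?thesis by (simp add: sewn_const_def)
qed

locale sewing_parameters =
  fixes T :: real and m :: nat and \<alpha> \<gamma> \<beta>1 \<beta>2 :: real and q1 q2 :: ennreal
  assumes T: "0 < T" and \<alpha>: "0 < \<alpha>" "\<alpha> < 1" and \<gamma>: "1 < \<gamma>" and \<beta>: "0 < \<beta>1" "0 < \<beta>2" and q: "0 < q1" "0 < q2"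
begin

lemma germ_clip2:
  assumes X: "X \<in> sewing_domain T m \<alpha> \<gamma> \<beta>1 \<beta>2 q1 q2"
  obtains k where "germ T \<beta>2 \<gamma> k m (clip2 T m X)"
proof -
  have XL: "X \<in> L0_2 T m"
    and b2: "Lq_log_norm T q1 (\<lambda>\<tau>. ennreal (\<tau> powr (- \<alpha>)) * modulus2 T m \<beta>1 X \<tau>) < \<infinity>"
    and b3: "Lq_log_norm T q2 (\<lambda>\<tau>. ennreal (\<tau> powr (- \<gamma>)) * modulus3 T m \<beta>2 (delta2 X) \<tau>) < \<infinity>"
    using X by (auto simp: sewing_domain_def besov2_def besov3_def besov2_norm_def besov3_norm_def)
  define K where "K = enn2real (Lq_log_norm T q2 (\<lambda>\<tau>. ennreal (\<tau> powr (- \<gamma>)) * modulus3 T m \<beta>2 (delta2 X) \<tau>))"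
  have K: "Lq_log_norm T q2 (\<lambda>\<tau>. ennreal (\<tau> powr (- \<gamma>)) * modulus3 T m \<beta>2 (delta2 X) \<tau>) = ennreal K" "0 \<le> K"
    using b3 by (auto simp: K_def)
  have ec: "1 \<le> embedding_const \<gamma> q2" using \<gamma> by (intro embedding_const_ge_1) simp
  have "germ T \<beta>2 \<gamma> (embedding_const \<gamma> q2 * K) m (clip2 T m X)"
  proof (unfold_locales, unfold modulus3_clip)
    show "0 < T" "0 < \<beta>2" "1 < \<gamma>" by (rule T \<beta> \<gamma>)+
    show "0 \<le> embedding_const \<gamma> q2 * K" using ec K by simp
    show "(\<lambda>p. clip2 T m X (fst p) (snd p) i) \<in> borel_measurable (borel \<Otimes>\<^sub>M borel)" for i
      by (rule clip2_measurable[OF XL])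
    show "modulus3 T m \<beta>2 (delta2 X) \<tau> < \<infinity>" if "\<tau> < T" for \<tau>
      using \<gamma> by (intro Lq_log_norm_finite_pointwise[OF q(2) mono_modulus3 _ b3 that T]) simp
    show "modulus3 T m \<beta>2 (delta2 X) \<tau> \<le> ennreal (embedding_const \<gamma> q2 * K * \<tau> powr \<gamma>)" if "0 < \<tau>" "\<tau> \<le> 3 * T / 4" for \<tau>
    proof -
      have "modulus3 T m \<beta>2 (delta2 X) \<tau> \<le> ennreal (embedding_const \<gamma> q2 * \<tau> powr \<gamma>) * ennreal K"
        unfolding K(1)[symmetric] using \<gamma> by (intro Lq_log_norm_embedding T q mono_modulus3 that) simp
      also have "\<dots> = ennreal (embedding_const \<gamma> q2 * K * \<tau> powr \<gamma>)"
        using ec K by (simp add: mult_ac flip: ennreal_mult)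
      finally show ?thesis .
    qed
    obtain C where C: "0 < C" "\<And>c f. c \<le> T \<Longrightarrow> f \<in> measurable_paths \<Longrightarrow>
        (\<integral>\<^sup>+r\<in>{0..c}. ennreal (vec_norm m (f r)) \<partial>lborel) \<le> ennreal C * path_norm m \<beta>1 c f"
      by (rule path_norm_L1[OF \<beta>(1), of T m]) (use T in simp, blast)
    have "modulus2 T m \<beta>1 X (3 * T / 4) < \<infinity>"
      using \<alpha> T by (intro Lq_log_norm_finite_pointwise[OF q(1) mono_modulus2 _ b2]) auto
    then have "ennreal C * modulus2 T m \<beta>1 X (3 * T / 4) < \<infinity>"
      by (simp add: ennreal_mult_less_top)
    then obtain L where L: "ennreal C * modulus2 T m \<beta>1 X (3 * T / 4) = ennreal L"
      by (cases "ennreal C * modulus2 T m \<beta>1 X (3 * T / 4)") auto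
    have cm: "(\<lambda>r. clip2 T m X r (r + h)) \<in> measurable_paths" for h
    proof -
      have "(\<lambda>r. clip2 T m X r (r + h) i) \<in> borel_measurable borel" for i
        using measurable_compose[OF measurable_Pair clip2_measurable[OF XL, of i], of "\<lambda>r. r" borel "\<lambda>r. r + h"] by simp
      then show ?thesis by (simp add: measurable_paths_def)
    qed
    have "(\<integral>\<^sup>+r\<in>{0..T - h}. ennreal (vec_norm m (clip2 T m X r (r + h))) \<partial>lborel) \<le> ennreal L" if h: "0 \<le> h" "h \<le> 3 * T / 4" for h
    proof -
      have "(\<integral>\<^sup>+r\<in>{0..T - h}. ennreal (vec_norm m (clip2 T m X r (r + h))) \<partial>lborel)
          \<le> ennreal C * path_norm m \<beta>1 (T - h) (\<lambda>r. clip2 T m X r (r + h))"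
        using h by (intro C cm) auto
      also have "\<dots> \<le> ennreal C * modulus2 T m \<beta>1 (clip2 T m X) (3 * T / 4)"
        by (intro mult_left_mono path_norm_le_modulus2 h) auto
      finally show ?thesis by (simp only: modulus2_clip L)
    qed
    then show "\<exists>L. \<forall>h\<ge>0. h \<le> 3 * T / 4 \<longrightarrow>
        (\<integral>\<^sup>+r\<in>{0..T - h}. ennreal (vec_norm m (clip2 T m X r (r + h))) \<partial>lborel) \<le> ennreal L"
      by blast
  qed
  then show thesis by (rule that)
qed

end

text \<open>Serves for linearity and, with coefficients \<open>1\<close> and \<open>0\<close>, for
  independence of the representative. The relation is given almost everywhere on each line only; all
  dyadic sums over an increment \<open>h\<close> involve countably many shifted lines, so the
  exceptional sets unite to a null set.\<close>

lemma germ_sew_lincomb: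
  assumes gX: "germ T \<beta> \<gamma> kX m X" and gY: "germ T \<beta> \<gamma> kY m Y" and gZ: "germ T \<beta>' \<gamma>' kZ m Z"
    and ae: "\<And>h. 0 \<le> h \<Longrightarrow> h \<le> T \<Longrightarrow> AE r in lborel. r \<in> {0..T - h} \<longrightarrow> (\<forall>i<m. Z r (r + h) i = a * X r (r + h) i + b * Y r (r + h) i)"
  shows "AE t in lborel. t \<in> {0..T} \<longrightarrow> (\<forall>i<m. sew T Z t i = a * sew T X t i + b * sew T Y t i)"
proof -
  interpret X: germ T \<beta> \<gamma> kX m X by fact
  interpret Y: germ T \<beta> \<gamma> kY m Y by fact
  interpret Z: germ T \<beta>' \<gamma>' kZ m Z by fact
  have dy: "AE r in lborel. r \<in> {0..T - h} \<longrightarrow> (\<forall>n. \<forall>i<m. dyad Z n r (r + h) i = a * dyad X n r (r + h) i + b * dyad Y n r (r + h) i)"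
    if h: "0 \<le> h" "h < T" for h
  proof -
    have "AE r in lborel. \<forall>n. \<forall>j<2 ^ n. r \<in> {0..T - h} \<longrightarrow> (\<forall>i<m.
        Z (r + real j / 2 ^ n * h) (r + real (Suc j) / 2 ^ n * h) i
        = a * X (r + real j / 2 ^ n * h) (r + real (Suc j) / 2 ^ n * h) i + b * Y (r + real j / 2 ^ n * h) (r + real (Suc j) / 2 ^ n * h) i)"
    proof (unfold AE_all_countable, intro allI, rule AE_impI)
      fix n j :: nat assume "j < 2 ^ n"
      then have "Suc j \<le> 2 ^ n" by simp
      then have "real (Suc j) \<le> real (2 ^ n)" by (simp only: of_nat_le_iff)
      then have j: "real (Suc j) / 2 ^ n \<le> 1" by simp
      have n1: "h / 2 ^ n \<le> h / 1" using h by (intro divide_left_mono) auto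
      have le: "real (Suc j) / 2 ^ n * h \<le> 1 * h" using j h by (intro mult_right_mono) auto
      have eq: "real (Suc j) / 2 ^ n * h = real j / 2 ^ n * h + h / 2 ^ n" by (simp add: field_simps)
      have "AE r in lborel. r \<in> {0..T - h / 2 ^ n} \<longrightarrow> (\<forall>i<m. Z r (r + h / 2 ^ n) i = a * X r (r + h / 2 ^ n) i + b * Y r (r + h / 2 ^ n) i)"
        using h n1 by (intro ae) auto
      from AE_lborel_affine_unit[OF _ this, of 1 "real j / 2 ^ n * h"]
      have "AE r in lborel. real j / 2 ^ n * h + 1 * r \<in> {0..T - h / 2 ^ n} \<longrightarrow> (\<forall>i<m. Z (real j / 2 ^ n * h + 1 * r) (real j / 2 ^ n * h + 1 * r + h / 2 ^ n) i = a * X (real j / 2 ^ n * h + 1 * r) (real j / 2 ^ n * h + 1 * r + h / 2 ^ n) i + b * Y (real j / 2 ^ n * h + 1 * r) (real j / 2 ^ n * h + 1 * r + h / 2 ^ n) i)"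
        by simp
      then show "AE r in lborel. r \<in> {0..T - h} \<longrightarrow> (\<forall>i<m.
        Z (r + real j / 2 ^ n * h) (r + real (Suc j) / 2 ^ n * h) i
        = a * X (r + real j / 2 ^ n * h) (r + real (Suc j) / 2 ^ n * h) i + b * Y (r + real j / 2 ^ n * h) (r + real (Suc j) / 2 ^ n * h) i)"
      proof eventually_elim
        case (elim r)
        have e1: "real j / 2 ^ n * h + 1 * r = r + real j / 2 ^ n * h"
          and e2: "r + real j / 2 ^ n * h + h / 2 ^ n = r + real (Suc j) / 2 ^ n * h"
          unfolding eq by simp_all
        show ?case
        proof
          assume "r \<in> {0..T - h}"
          moreover have "0 \<le> real j / 2 ^ n * h" using h by simp
          ultimately have "r + real j / 2 ^ n * h \<in> {0..T - h / 2 ^ n}"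
            using le eq by auto
          then show "\<forall>i<m. Z (r + real j / 2 ^ n * h) (r + real (Suc j) / 2 ^ n * h) i
              = a * X (r + real j / 2 ^ n * h) (r + real (Suc j) / 2 ^ n * h) i + b * Y (r + real j / 2 ^ n * h) (r + real (Suc j) / 2 ^ n * h) i"
            using elim unfolding e1 e2 by blast
        qed
      qed
    qed
    then show ?thesis
    proof eventually_elim
      case (elim r)
      show ?case
      proof (intro impI allI)
        fix n i assume r: "r \<in> {0..T - h}" and i: "i < m"
        have "dyad Z n r (r + h) i = (\<Sum>j<2 ^ n. a * X (r + real j / 2 ^ n * h) (r + real (Suc j) / 2 ^ n * h) i + b * Y (r + real j / 2 ^ n * h) (r + real (Suc j) / 2 ^ n * h) i)"
          unfolding dyad_apply add_diff_cancel_left' using elim r i by (intro sum.cong refl) blast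
        then show "dyad Z n r (r + h) i = a * dyad X n r (r + h) i + b * dyad Y n r (r + h) i"
          by (simp only: dyad_apply add_diff_cancel_left' sum.distrib sum_distrib_left)
      qed
    qed
  qed
  have lim: "AE r in lborel. r \<in> {0..T - h} \<longrightarrow> (\<forall>i<m. dyad_lim Z r (r + h) i = a * dyad_lim X r (r + h) i + b * dyad_lim Y r (r + h) i)"
    if h: "0 \<le> h" "h < T" for h
    using dy[OF h] X.dyad_converges[OF h] Y.dyad_converges[OF h]
  proof eventually_elim
    case (elim r)
    show ?case
    proof (intro impI allI)
      fix i assume r: "r \<in> {0..T - h}" and i: "i < m"
      have "(\<lambda>n. a * dyad X n r (r + h) i + b * dyad Y n r (r + h) i) \<longlonglongrightarrow> a * dyad_lim X r (r + h) i + b * dyad_lim Y r (r + h) i"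
        using elim(2,3) r i by (intro tendsto_intros) auto
      then have "(\<lambda>n. dyad Z n r (r + h) i) \<longlonglongrightarrow> a * dyad_lim X r (r + h) i + b * dyad_lim Y r (r + h) i"
        using elim(1) r i by simp
      then show "dyad_lim Z r (r + h) i = a * dyad_lim X r (r + h) i + b * dyad_lim Y r (r + h) i"
        unfolding dyad_lim_def by (rule limI)
    qed
  qed
  \<comment> \<open>The time \<open>t = T\<close> is left out because the increments must be smaller
    than \<open>T\<close> for convergence; this removes a null set of times.\<close>
  define P where "P s t \<longleftrightarrow> (0 \<le> s \<and> s \<le> t \<and> t < T \<longrightarrow> (\<forall>i<m. dyad_lim Z s t i = a * dyad_lim X s t i + b * dyad_lim Y s t i))" for s t
  have Pm: "Measurable.pred (borel \<Otimes>\<^sub>M borel) (\<lambda>p. P (fst p) (snd p))"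
    unfolding P_def by measurable
  have Pae: "AE r in lborel. P r (r + h)" for h
  proof (cases "0 \<le> h \<and> h < T")
    case True
    then have "0 \<le> h" "h < T" by auto
    from lim[OF this] show ?thesis
      by eventually_elim (auto simp: P_def)
  qed (auto simp: P_def)
  have "AE s in lborel. AE t in lborel. P s t" "AE t in lborel. AE s in lborel. P s t"
    by (rule AE_shear[OF Pm Pae])+
  then show ?thesis
    using X.signed_lim_integrable Y.signed_lim_integrable AE_lborel_singleton[of T]
  proof eventually_elim
    case (elim t)
    show ?case
    proof (intro impI allI)
      fix i assume t: "t \<in> {0..T}" and i: "i < m"
      have iX: "integrable lborel (\<lambda>s. indicator {T / 4..T / 2} s * signed_lim X s t i)"
        and iY: "integrable lborel (\<lambda>s. indicator {T / 4..T / 2} s * signed_lim Y s t i)"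
        using elim(3,4) t i by auto
      have "(\<integral>s. indicator {T / 4..T / 2} s * signed_lim Z s t i \<partial>lborel)
          = (\<integral>s. a * (indicator {T / 4..T / 2} s * signed_lim X s t i) + b * (indicator {T / 4..T / 2} s * signed_lim Y s t i) \<partial>lborel)"
      proof (rule integral_cong_AE)
        show "AE s in lborel. indicator {T / 4..T / 2} s * signed_lim Z s t i
            = a * (indicator {T / 4..T / 2} s * signed_lim X s t i) + b * (indicator {T / 4..T / 2} s * signed_lim Y s t i)"
          using elim(1,2)
        proof eventually_elim
          case (elim s)
          have "t < T" using t \<open>t \<noteq> T\<close> by auto
          then show ?case
            using elim t i X.T by (cases "s \<in> {T / 4..T / 2}"; cases "s \<le> t") (auto simp: P_def signed_lim_def algebra_simps)
        qed
      qed measurable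
      also have "\<dots> = a * (\<integral>s. indicator {T / 4..T / 2} s * signed_lim X s t i \<partial>lborel) + b * (\<integral>s. indicator {T / 4..T / 2} s * signed_lim Y s t i \<partial>lborel)"
        using iX iY by (simp only: Bochner_Integration.integral_add integrable_mult_right integral_mult_right_zero)
      finally show "sew T Z t i = a * sew T X t i + b * sew T Y t i"
        by (simp add: sew_def algebra_simps)
    qed
  qed
qed

subsection \<open>The sewn path\<close>

lemma unit_partition_bounds:
  assumes "unit_partition K p" "i \<le> K"
  shows "0 \<le> p i" "p i \<le> 1"
proof -
  have lt: "\<And>j. j < K \<Longrightarrow> p j < p (Suc j)" and e: "p 0 = 0" "p K = 1"
    using assms(1) by (auto simp: unit_partition_def)
  have "i \<le> K \<Longrightarrow> 0 \<le> p i"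
  proof (induction i)
    case (Suc i)
    then show ?case using lt[of i] by simp
  qed (simp add: e)
  then show "0 \<le> p i" using assms(2) by simp
  have "p (K - j) \<le> 1" for j
  proof (induction j)
    case (Suc j)
    show ?case
    proof (cases "j < K")
      case True
      then have "Suc (K - Suc j) = K - j" by simp
      then show ?thesis using Suc lt[of "K - Suc j"] True by simp
    qed (use Suc in simp)
  qed (simp add: e)
  from this[of "K - i"] show "p i \<le> 1" using assms(2) by simp
qed

lemma partition_mesh_ge: "i < K \<Longrightarrow> p (Suc i) - p i \<le> partition_mesh K p"
  unfolding partition_mesh_def by (intro Max_ge) auto

text \<open>The estimates are formulated for any path with this remainder bound, so that they apply
  both to the path produced by \<open>sew\<close> and to its continuous versions.\<close>

locale sewn = sewing_parameters +
  fixes X :: "real \<Rightarrow> real \<Rightarrow> nat \<Rightarrow> real" and I :: "real \<Rightarrow> nat \<Rightarrow> real"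
  assumes X: "X \<in> sewing_domain T m \<alpha> \<gamma> \<beta>1 \<beta>2 q1 q2" and I: "I \<in> L0_1 T m"
    and remainder: "0 \<le> h \<Longrightarrow> h \<le> T \<Longrightarrow>
      path_norm m \<beta>2 (T - h) (\<lambda>r i. clip1 T m I (r + h) i - clip1 T m I r i - clip2 T m X r (r + h) i)
        \<le> dyadic_sum (modulus3 T m \<beta>2 (delta2 X)) h"
begin

definition K3 :: ennreal where "K3 = besov3_norm T m \<gamma> \<beta>2 q2 (delta2 X)"

definition W :: "real \<Rightarrow> ennreal" where "W = modulus3 T m \<beta>2 (delta2 X)"

definition S :: "real \<Rightarrow> ennreal" where "S = dyadic_sum W"

definition E :: "real \<Rightarrow> real \<Rightarrow> nat \<Rightarrow> real" where
  "E = (\<lambda>s t i. clip1 T m I t i - clip1 T m I s i - clip2 T m X s t i)"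

lemma E_bound: "0 \<le> h \<Longrightarrow> h \<le> T \<Longrightarrow> path_norm m \<beta>2 (T - h) (\<lambda>r. E r (r + h)) \<le> S h"
  unfolding E_def S_def W_def by (rule remainder)

lemma K3_finite: "K3 < \<infinity>"
  using X by (auto simp: sewing_domain_def besov3_def K3_def)

lemma mono_W: "mono W"
  unfolding W_def by (rule mono_modulus3)

lemma mono_S: "mono S"
  unfolding S_def by (rule dyadic_sum_mono[OF mono_W])

lemma measurable_S [measurable]: "S \<in> borel_measurable borel"
  by (rule mono_ennreal_borel_measurable[OF mono_S])

lemma measurable_I [measurable (raw)]: "f \<in> borel_measurable N \<Longrightarrow> (\<lambda>x. clip1 T m I (f x) i) \<in> borel_measurable N"
  by (rule measurable_compose[OF _ clip1_measurable[OF I]])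

lemma X_L0_2: "X \<in> L0_2 T m"
  using X by (simp add: sewing_domain_def besov2_def)

lemmas measurable_clip2 [measurable (raw)] = clip2_measurable'[OF X_L0_2]

lemma measurable_E [measurable (raw)]:
  assumes "f \<in> borel_measurable N" "g \<in> borel_measurable N"
  shows "(\<lambda>x. E (f x) (g x) i) \<in> borel_measurable N"
  unfolding E_def by (intro borel_measurable_diff measurable_I measurable_clip2 assms)

lemma E_path: "(\<lambda>r. E (r + a) (r + b)) \<in> measurable_paths"
  unfolding measurable_paths_def by auto

lemma E_path': "(\<lambda>r. E r (r + b)) \<in> measurable_paths"
  unfolding measurable_paths_def by auto

lemma S_power:
  assumes "0 < \<tau>" "\<tau> \<le> 3 * T / 4"
  shows "S \<tau> \<le> ennreal (sewn_const \<gamma> q2 * \<tau> powr \<gamma>) * K3"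
proof -
  have ec: "0 \<le> embedding_const \<gamma> q2" using embedding_const_ge_1[of \<gamma> q2] \<gamma> by simp
  have "W (\<tau> / 2 ^ n) \<le> ennreal ((\<tau> / 2 ^ n) powr \<gamma>) * (ennreal (embedding_const \<gamma> q2) * K3)" for n
  proof -
    have "\<tau> / 2 ^ n \<le> \<tau> / 1" using assms by (intro divide_left_mono) auto
    then have "W (\<tau> / 2 ^ n) \<le> ennreal (embedding_const \<gamma> q2 * (\<tau> / 2 ^ n) powr \<gamma>) * K3"
      unfolding K3_def besov3_norm_def W_def[symmetric]
    proof (intro Lq_log_norm_embedding T q mono_W)
      show "\<tau> / 2 ^ n \<le> 3 * T / 4" using \<open>\<tau> / 2 ^ n \<le> \<tau> / 1\<close> assms(2) by linarith
    qed (use \<gamma> assms in auto)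
    also have "\<dots> = ennreal ((\<tau> / 2 ^ n) powr \<gamma>) * (ennreal (embedding_const \<gamma> q2) * K3)"
      using ec by (simp only: ennreal_mult powr_ge_zero mult.assoc mult.left_commute)
    finally show ?thesis .
  qed
  then have "S \<tau> \<le> ennreal (1 / (1 - 2 powr (- ((\<gamma> - 1) / 2))) * \<tau> powr \<gamma>) * (ennreal (embedding_const \<gamma> q2) * K3)"
    unfolding S_def using assms by (intro dyadic_sum_power_bound \<gamma>)
  also have "\<dots> = ennreal (sewn_const \<gamma> q2 * \<tau> powr \<gamma>) * K3"
  proof -
    have "2 powr (- ((\<gamma> - 1) / 2)) < (1 :: real)" using \<gamma> by (simp add: powr_less_one)
    then have p: "0 \<le> 1 / (1 - 2 powr (- ((\<gamma> - 1) / 2))) * \<tau> powr \<gamma>" by simp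
    have "1 / (1 - 2 powr (- ((\<gamma> - 1) / 2))) * \<tau> powr \<gamma> * embedding_const \<gamma> q2 = sewn_const \<gamma> q2 * \<tau> powr \<gamma>"
      by (simp add: sewn_const_def)
    then show ?thesis
      by (simp only: mult.assoc[symmetric] ennreal_mult[OF p ec, symmetric])
  qed
  finally show ?thesis .
qed

lemma besov_S: "Lq_log_norm T q2 (\<lambda>\<tau>. ennreal (\<tau> powr (- \<gamma>)) * S \<tau>) \<le> ennreal (hardy_const \<gamma> q2) * K3"
  unfolding K3_def besov3_norm_def S_def W_def[symmetric]
  by (intro Lq_log_norm_dyadic_sum T q \<gamma> mono_W)

lemma remainder_eq:
  assumes "0 \<le> h" "r \<in> {0..T - h}" "i < m"
  shows "sub2 (delta1 I) X r (r + h) i = E r (r + h) i"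
  using assms by (simp add: sub2_def delta1_def E_def clip1_def clip2_def)

lemma modulus2_remainder: "modulus2 T m \<beta>2 (sub2 (delta1 I) X) \<tau> \<le> S \<tau>"
proof -
  have "modulus2 T m \<beta>2 (sub2 (delta1 I) X) \<tau> = modulus2 T m \<beta>2 E \<tau>"
    by (rule modulus2_cong_AE) (auto simp: remainder_eq)
  also have "\<dots> \<le> S \<tau>"
  proof (rule modulus2_leI)
    fix h assume h: "0 \<le> h" "h \<le> \<tau>" "h < T"
    have "path_norm m \<beta>2 (T - h) (\<lambda>r. E r (r + h)) \<le> S h" using h by (intro E_bound) auto
    also have "S h \<le> S \<tau>" using h by (intro monoD[OF mono_S])
    finally show "path_norm m \<beta>2 (T - h) (\<lambda>r. E r (r + h)) \<le> S \<tau>" .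
  qed
  finally show ?thesis .
qed

lemma besov_remainder:
  "besov2_norm T m \<gamma> \<beta>2 q2 (sub2 (delta1 I) X) \<le> ennreal (hardy_const \<gamma> q2) * K3"
proof -
  have [measurable]: "modulus2 T m \<beta>2 (sub2 (delta1 I) X) \<in> borel_measurable borel"
    by (rule mono_ennreal_borel_measurable[OF mono_modulus2])
  have "besov2_norm T m \<gamma> \<beta>2 q2 (sub2 (delta1 I) X) \<le> Lq_log_norm T q2 (\<lambda>\<tau>. ennreal (\<tau> powr (- \<gamma>)) * S \<tau>)"
    unfolding besov2_norm_def
  proof (rule Lq_log_norm_mono[OF q(2)])
    show "ennreal (\<tau> powr (- \<gamma>)) * modulus2 T m \<beta>2 (sub2 (delta1 I) X) \<tau> \<le> ennreal (\<tau> powr (- \<gamma>)) * S \<tau>" for \<tau>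
      by (intro mult_left_mono modulus2_remainder) simp
  qed measurable
  also note besov_S
  finally show ?thesis .
qed

text \<open>The increments of the path telescope along the partition, so the error of the Riemann
  sum is the sum of the remainders over its intervals. Each is controlled by \<open>S\<close> at its
  own length after a shift of the starting point.\<close>

lemma modulus2_riemann_sum:
  assumes p: "unit_partition K p"
  shows "modulus2 T m \<beta>2 (sub2 (delta1 I) (riemann_sum K p X)) \<tau> \<le> (\<Sum>i<K. S ((p (Suc i) - p i) * \<tau>))"
proof -
  interpret seminorm_on "path_norm m \<beta>2 c" measurable_paths for c
    by (rule path_norm_seminorm[OF \<beta>(2)])
  have lt: "\<And>j. j < K \<Longrightarrow> p j < p (Suc j)" and e: "p 0 = 0" "p K = 1"
    using p by (auto simp: unit_partition_def)
  show ?thesis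
  proof (rule modulus2_leI)
    fix h assume h: "0 \<le> h" "h \<le> \<tau>" "h < T"
    have "path_norm m \<beta>2 (T - h) (\<lambda>r. sub2 (delta1 I) (riemann_sum K p X) r (r + h))
        = path_norm m \<beta>2 (T - h) (\<Sum>i<K. (\<lambda>r. E (r + p i * h) (r + p (Suc i) * h)))"
    proof (rule path_norm_cong_AE, intro AE_I2 impI allI)
      fix r j assume r: "r \<in> {0..T - h}" and j: "j < m"
      have pt: "0 \<le> r + p i * h \<and> r + p i * h \<le> T" if "i \<le> K" for i
      proof -
        have "0 \<le> p i * h" using unit_partition_bounds[OF p that] h by simp
        moreover have "p i * h \<le> 1 * h" using unit_partition_bounds[OF p that] h by (intro mult_right_mono)
        ultimately show ?thesis using r by simp
      qed
      have "(\<Sum>i<K. E (r + p i * h) (r + p (Suc i) * h) j)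
          = (\<Sum>i<K. (I (r + p (Suc i) * h) j - I (r + p i * h) j) - X (r + p i * h) (r + p (Suc i) * h) j)"
      proof (intro sum.cong refl)
        fix i assume "i \<in> {..<K}"
        then have i: "i \<le> K" "Suc i \<le> K" "i < K" by auto
        have "p i * h \<le> p (Suc i) * h" using lt[OF i(3)] h by (intro mult_right_mono) auto
        then show "E (r + p i * h) (r + p (Suc i) * h) j
            = (I (r + p (Suc i) * h) j - I (r + p i * h) j) - X (r + p i * h) (r + p (Suc i) * h) j"
          using pt[OF i(1)] pt[OF i(2)] j by (simp add: E_def clip1_def clip2_def)
      qed
      also have "\<dots> = (\<Sum>i<K. I (r + p (Suc i) * h) j - I (r + p i * h) j) - (\<Sum>i<K. X (r + p i * h) (r + p (Suc i) * h) j)"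
        by (rule sum_subtractf)
      also have "(\<Sum>i<K. I (r + p (Suc i) * h) j - I (r + p i * h) j) = I (r + h) j - I r j"
        using sum_lessThan_telescope[of "\<lambda>i. I (r + p i * h) j" K] by (simp add: e)
      finally show "sub2 (delta1 I) (riemann_sum K p X) r (r + h) j
          = (\<Sum>i<K. (\<lambda>r. E (r + p i * h) (r + p (Suc i) * h))) r j"
        by (simp add: sub2_def delta1_def riemann_sum_def)
    qed
    also have "\<dots> \<le> (\<Sum>i<K. path_norm m \<beta>2 (T - h) (\<lambda>r. E (r + p i * h) (r + p (Suc i) * h)))"
      by (intro triangle_sum E_path)
    also have "\<dots> \<le> (\<Sum>i<K. S ((p (Suc i) - p i) * \<tau>))"
    proof (rule sum_mono)
      fix i assume "i \<in> {..<K}"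
      then have i: "i \<le> K" "Suc i \<le> K" "i < K" by auto
      define d where "d = (p (Suc i) - p i) * h"
      note b = unit_partition_bounds[OF p i(1)] unit_partition_bounds[OF p i(2)]
      have d0: "0 \<le> d" using lt[OF i(3)] h by (simp add: d_def)
      have d1: "d \<le> 1 * h" unfolding d_def using b h by (intro mult_right_mono) auto
      have d2: "p (Suc i) * h = p i * h + d" by (simp add: d_def algebra_simps)
      have d3: "p (Suc i) * h \<le> 1 * h" using b h by (intro mult_right_mono) auto
      have "path_norm m \<beta>2 (T - h) (\<lambda>r. E (r + p i * h) (r + p (Suc i) * h))
          = path_norm m \<beta>2 (T - h) (\<lambda>r. (\<lambda>r. E r (r + d)) (p i * h + r))"
        unfolding d2 by (simp add: add.commute add.left_commute)
      also have "\<dots> \<le> path_norm m \<beta>2 (T - d) (\<lambda>r. E r (r + d))"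
        using b h d2 d3 by (intro path_norm_shift[OF \<beta>(2) E_path']) auto
      also have "\<dots> \<le> S d" using d0 d1 h by (intro E_bound) auto
      also have "S d \<le> S ((p (Suc i) - p i) * \<tau>)"
        unfolding d_def using lt[OF i(3)] h by (intro monoD[OF mono_S] mult_left_mono) auto
      finally show "path_norm m \<beta>2 (T - h) (\<lambda>r. E (r + p i * h) (r + p (Suc i) * h)) \<le> S ((p (Suc i) - p i) * \<tau>)" .
    qed
    finally show "path_norm m \<beta>2 (T - h) (\<lambda>r. sub2 (delta1 I) (riemann_sum K p X) r (r + h))
        \<le> (\<Sum>i<K. S ((p (Suc i) - p i) * \<tau>))" .
  qed
qed

text \<open>Near \<open>\<tau> = T\<close> the modulus \<open>S\<close> need not be bounded when \<open>q2 < \<infinity>\<close>, so it is frozen beyond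
  \<open>T / 2\<close> before the exponent \<open>q2\<close> is increased.\<close>

lemma besov_S_truncated:
  assumes r: "q2 \<le> r"
  shows "Lq_log_norm T r (\<lambda>\<tau>. ennreal (\<tau> powr (- \<gamma>)) * S (min \<tau> (T / 2)))
    \<le> ennreal (hardy_const \<gamma> q2 + sewn_const \<gamma> q2) * K3"
proof (rule Lq_log_norm_increase_exponent[OF q(2) r])
  have mm: "mono (\<lambda>\<tau>. S (min \<tau> (T / 2)))"
    by (intro monoI monoD[OF mono_S]) auto
  have [measurable]: "(\<lambda>\<tau>. S (min \<tau> (T / 2))) \<in> borel_measurable borel"
    by (rule mono_ennreal_borel_measurable[OF mm])
  show "(\<lambda>\<tau>. ennreal (\<tau> powr (- \<gamma>)) * S (min \<tau> (T / 2))) \<in> borel_measurable borel"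
    by measurable
  have c: "0 < hardy_const \<gamma> q2" "0 < sewn_const \<gamma> q2"
    by (intro hardy_const_pos sewn_const_pos \<gamma>)+
  have "Lq_log_norm T q2 (\<lambda>\<tau>. ennreal (\<tau> powr (- \<gamma>)) * S (min \<tau> (T / 2)))
      \<le> Lq_log_norm T q2 (\<lambda>\<tau>. ennreal (\<tau> powr (- \<gamma>)) * S \<tau>)"
  proof (rule Lq_log_norm_mono[OF q(2)])
    show "ennreal (\<tau> powr (- \<gamma>)) * S (min \<tau> (T / 2)) \<le> ennreal (\<tau> powr (- \<gamma>)) * S \<tau>" for \<tau>
      by (intro mult_left_mono monoD[OF mono_S]) simp_all
  qed measurable
  also note besov_S
  also have "ennreal (hardy_const \<gamma> q2) * K3 \<le> ennreal (hardy_const \<gamma> q2 + sewn_const \<gamma> q2) * K3"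
    using c by (intro mult_right_mono ennreal_leI) auto
  finally show "Lq_log_norm T q2 (\<lambda>\<tau>. ennreal (\<tau> powr (- \<gamma>)) * S (min \<tau> (T / 2)))
      \<le> ennreal (hardy_const \<gamma> q2 + sewn_const \<gamma> q2) * K3" .
  fix \<tau> assume \<tau>: "0 < \<tau>" "\<tau> \<le> T"
  define \<sigma> where "\<sigma> = min \<tau> (T / 2)"
  have \<sigma>: "0 < \<sigma>" "\<sigma> \<le> 3 * T / 4" "\<sigma> \<le> \<tau>" using \<tau> T by (auto simp: \<sigma>_def)
  have "ennreal (\<tau> powr (- \<gamma>)) * S \<sigma> \<le> ennreal (\<tau> powr (- \<gamma>)) * (ennreal (sewn_const \<gamma> q2 * \<sigma> powr \<gamma>) * K3)"
    by (intro mult_left_mono S_power \<sigma>) simp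
  also have "\<dots> = ennreal (\<tau> powr (- \<gamma>) * (sewn_const \<gamma> q2 * \<sigma> powr \<gamma>)) * K3"
    using c by (simp add: ennreal_mult mult.assoc)
  also have "\<dots> \<le> ennreal (hardy_const \<gamma> q2 + sewn_const \<gamma> q2) * K3"
  proof (intro mult_right_mono ennreal_leI)
    have "\<sigma> powr \<gamma> \<le> \<tau> powr \<gamma>" using \<sigma> \<gamma> by (intro powr_mono2) auto
    then have "\<tau> powr (- \<gamma>) * (sewn_const \<gamma> q2 * \<sigma> powr \<gamma>) \<le> \<tau> powr (- \<gamma>) * (sewn_const \<gamma> q2 * \<tau> powr \<gamma>)"
      using c by (intro mult_left_mono) auto
    also have "\<dots> = sewn_const \<gamma> q2"
      using \<tau> by (simp add: powr_minus)
    finally show "\<tau> powr (- \<gamma>) * (sewn_const \<gamma> q2 * \<sigma> powr \<gamma>) \<le> hardy_const \<gamma> q2 + sewn_const \<gamma> q2"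
      using c by linarith
  qed simp
  finally show "ennreal (\<tau> powr (- \<gamma>)) * S (min \<tau> (T / 2)) \<le> ennreal (hardy_const \<gamma> q2 + sewn_const \<gamma> q2) * K3"
    by (simp only: \<sigma>_def)
qed

text \<open>A mesh of at most \<open>1 / 2\<close> keeps all interval lengths at most
  \<open>T / 2\<close>, where the truncated modulus agrees with the original one. The truncated
  modulus then carries the power of the mesh.\<close>

lemma besov_riemann_sum:
  assumes p: "unit_partition K p" and mesh: "partition_mesh K p \<le> 1 / 2" and r: "q2 \<le> r" "ennreal (1 / \<gamma>) < r"
  shows "besov2_norm T m \<gamma> \<beta>2 r (sub2 (delta1 I) (riemann_sum K p X))
    \<le> ennreal (partition_mesh K p powr partition_exponent \<gamma> r) * (ennreal (hardy_const \<gamma> q2 + sewn_const \<gamma> q2) * K3)"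
proof -
  define H where "H \<tau> = S (min \<tau> (T / 2))" for \<tau>
  have r0: "0 < r" using q(2) r(1) by simp
  have mH: "mono H"
    unfolding H_def by (intro monoI monoD[OF mono_S]) auto
  have [measurable]: "H \<in> borel_measurable borel"
    by (rule mono_ennreal_borel_measurable[OF mH])
  have [measurable]: "modulus2 T m \<beta>2 (sub2 (delta1 I) (riemann_sum K p X)) \<in> borel_measurable borel"
    by (rule mono_ennreal_borel_measurable[OF mono_modulus2])
  have lt: "\<And>j. j < K \<Longrightarrow> p j < p (Suc j)" and e: "p 0 = 0" "p K = 1"
    using p by (auto simp: unit_partition_def)
  have "besov2_norm T m \<gamma> \<beta>2 r (sub2 (delta1 I) (riemann_sum K p X))
      \<le> Lq_log_norm T r (\<lambda>\<tau>. ennreal (\<tau> powr (- \<gamma>)) * (\<Sum>i<K. H ((p (Suc i) - p i) * \<tau>)))"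
    unfolding besov2_norm_def
  proof (rule Lq_log_norm_mono[OF r0])
    fix \<tau> assume \<tau>: "0 < \<tau>" "\<tau> \<le> T"
    have "modulus2 T m \<beta>2 (sub2 (delta1 I) (riemann_sum K p X)) \<tau> \<le> (\<Sum>i<K. S ((p (Suc i) - p i) * \<tau>))"
      by (rule modulus2_riemann_sum[OF p])
    also have "\<dots> = (\<Sum>i<K. H ((p (Suc i) - p i) * \<tau>))"
    proof (intro sum.cong refl)
      fix i assume "i \<in> {..<K}"
      then have "p (Suc i) - p i \<le> 1 / 2" using partition_mesh_ge[of i K p] mesh by simp
      then have "(p (Suc i) - p i) * \<tau> \<le> 1 / 2 * \<tau>" using \<tau> by (intro mult_right_mono) auto
      then have "min ((p (Suc i) - p i) * \<tau>) (T / 2) = (p (Suc i) - p i) * \<tau>"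
        using \<tau> by (intro min_absorb1) linarith
      then show "S ((p (Suc i) - p i) * \<tau>) = H ((p (Suc i) - p i) * \<tau>)"
        by (simp only: H_def)
    qed
    finally show "ennreal (\<tau> powr (- \<gamma>)) * modulus2 T m \<beta>2 (sub2 (delta1 I) (riemann_sum K p X)) \<tau>
        \<le> ennreal (\<tau> powr (- \<gamma>)) * (\<Sum>i<K. H ((p (Suc i) - p i) * \<tau>))"
      by (intro mult_left_mono) auto
  qed measurable
  also have "\<dots> \<le> ennreal (partition_mesh K p powr partition_exponent \<gamma> r) * Lq_log_norm T r (\<lambda>\<tau>. ennreal (\<tau> powr (- \<gamma>)) * H \<tau>)"
  proof (rule Lq_log_norm_partition[OF r0 \<gamma> r(2) mH])
    show "(\<Sum>i<K. p (Suc i) - p i) = 1"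
      using sum_lessThan_telescope[of p K] e by simp
  qed (use mesh lt partition_mesh_ge[of _ K p] in auto)
  also have "\<dots> \<le> ennreal (partition_mesh K p powr partition_exponent \<gamma> r) * (ennreal (hardy_const \<gamma> q2 + sewn_const \<gamma> q2) * K3)"
    unfolding H_def by (intro mult_left_mono besov_S_truncated r) simp
  finally show ?thesis .
qed

lemma sewing_limit: "sewing_limit T m \<gamma> \<beta>2 q2 X I"
  unfolding sewing_limit_def
proof (intro allI impI)
  fix K :: "nat \<Rightarrow> nat" and p :: "nat \<Rightarrow> nat \<Rightarrow> real" and r :: ennreal
  assume p: "\<forall>N. unit_partition (K N) (p N)" and mesh: "(\<lambda>N. partition_mesh (K N) (p N)) \<longlonglongrightarrow> 0"
    and r: "q2 \<le> r" "ennreal (1 / \<gamma>) < r"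
  define k where "k = enn2real (ennreal (hardy_const \<gamma> q2 + sewn_const \<gamma> q2) * K3)"
  have "ennreal (hardy_const \<gamma> q2 + sewn_const \<gamma> q2) * K3 < \<infinity>"
    using K3_finite by (simp add: ennreal_mult_less_top)
  then have k: "ennreal (hardy_const \<gamma> q2 + sewn_const \<gamma> q2) * K3 = ennreal k"
    by (simp add: k_def)
  have le: "\<forall>\<^sub>F N in sequentially. besov2_norm T m \<gamma> \<beta>2 r (sub2 (delta1 I) (riemann_sum (K N) (p N) X))
      \<le> ennreal (partition_mesh (K N) (p N) powr partition_exponent \<gamma> r) * ennreal k"
    using order_tendstoD(2)[OF mesh, of "1 / 2"]
  proof (rule eventually_mono)
    fix N assume "partition_mesh (K N) (p N) < 1 / 2"
    then show "besov2_norm T m \<gamma> \<beta>2 r (sub2 (delta1 I) (riemann_sum (K N) (p N) X))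
      \<le> ennreal (partition_mesh (K N) (p N) powr partition_exponent \<gamma> r) * ennreal k"
      unfolding k[symmetric] by (intro besov_riemann_sum p[rule_format] r) auto
  qed simp
  have "(\<lambda>N. partition_mesh (K N) (p N) powr partition_exponent \<gamma> r) \<longlonglongrightarrow> 0"
  proof (rule tendsto_zero_powrI[OF mesh tendsto_const])
    show "0 < partition_exponent \<gamma> r" by (rule partition_exponent_pos[OF \<gamma> r(2)])
    have "0 \<le> partition_mesh (K N) (p N)" for N
    proof -
      have "0 < K N" "p N 0 < p N (Suc 0)" using p[rule_format, of N] by (auto simp: unit_partition_def)
      then show ?thesis using partition_mesh_ge[of 0 "K N" "p N"] by simp
    qed
    then show "\<forall>\<^sub>F N in sequentially. 0 \<le> partition_mesh (K N) (p N)" by simp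
  qed
  then have "(\<lambda>N. ennreal (partition_mesh (K N) (p N) powr partition_exponent \<gamma> r) * ennreal k) \<longlonglongrightarrow> ennreal 0 * ennreal k"
    by (intro tendsto_mult_ennreal tendsto_ennrealI tendsto_const) auto
  then have lim: "(\<lambda>N. ennreal (partition_mesh (K N) (p N) powr partition_exponent \<gamma> r) * ennreal k) \<longlonglongrightarrow> 0"
    by simp
  show "(\<lambda>N. besov2_norm T m \<gamma> \<beta>2 r (sub2 (delta1 I) (riemann_sum (K N) (p N) X))) \<longlonglongrightarrow> 0"
    by (rule tendsto_sandwich[OF _ le tendsto_const lim]) simp
qed

end

subsection \<open>Linearity\<close>

lemma vec_norm_scale: "vec_norm m (\<lambda>i. a * x i) = \<bar>a\<bar> * vec_norm m x"
  by (simp add: vec_norm_def L2_set_def power_mult_distrib real_sqrt_mult flip: sum_distrib_left)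

text \<open>The summand \<open>1\<close> keeps the factor positive when both coefficients vanish, as
  the scaling of the Luxemburg norm asks for.\<close>

lemma vec_norm_lincomb:
  "vec_norm m (\<lambda>i. a * x i + b * y i) \<le> (\<bar>a\<bar> + \<bar>b\<bar> + 1) * (vec_norm m x + vec_norm m y)"
proof -
  have "vec_norm m (\<lambda>i. a * x i + b * y i) \<le> vec_norm m (\<lambda>i. a * x i) + vec_norm m (\<lambda>i. b * y i)"
    using vec_norm_triangle[of m "\<lambda>i. a * x i" "\<lambda>i. b * y i"] by (simp add: plus_fun_def)
  also have "\<dots> = \<bar>a\<bar> * vec_norm m x + \<bar>b\<bar> * vec_norm m y"
    by (simp only: vec_norm_scale)
  also have "\<dots> \<le> (\<bar>a\<bar> + \<bar>b\<bar> + 1) * vec_norm m x + (\<bar>a\<bar> + \<bar>b\<bar> + 1) * vec_norm m y"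
    by (intro add_mono mult_right_mono) auto
  finally show ?thesis by (simp add: algebra_simps)
qed

lemma orlicz_norm_scale:
  assumes "0 < c" "0 < \<beta>" "\<And>r. 0 \<le> g r"
  shows "orlicz_norm \<beta> D (\<lambda>r. c * g r) \<le> ennreal c * orlicz_norm \<beta> D g"
proof (rule orlicz_norm_leI[OF assms(1,2)])
  fix l :: real assume l: "0 < l" "(\<integral>\<^sup>+r\<in>D. ennreal (orlicz_Phi \<beta> (g r / l)) \<partial>lborel) \<le> 1"
  then show "orlicz_norm \<beta> D (\<lambda>r. c * g r) \<le> ennreal (c * l)"
    using assms(1) by (intro orlicz_norm_le) auto
qed (use assms in auto)

lemma orlicz_norm_lincomb:
  assumes \<beta>: "0 < \<beta>" and c: "0 < c" and D: "D \<in> sets borel"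
    and fg: "f \<in> borel_measurable borel" "g \<in> borel_measurable borel" "\<And>r. 0 \<le> f r" "\<And>r. 0 \<le> g r"
    and h: "\<And>r. r \<in> D \<Longrightarrow> 0 \<le> h r \<and> h r \<le> c * (f r + g r)"
  shows "orlicz_norm \<beta> D h \<le> ennreal c * (orlicz_norm \<beta> D f + orlicz_norm \<beta> D g)"
proof -
  have "orlicz_norm \<beta> D h \<le> orlicz_norm \<beta> D (\<lambda>r. c * (f r + g r))"
    using h fg c by (intro orlicz_norm_mono_AE[OF \<beta>]) (auto intro!: AE_I2 add_nonneg_nonneg)
  also have "\<dots> \<le> ennreal c * orlicz_norm \<beta> D (\<lambda>r. f r + g r)"
    using fg by (intro orlicz_norm_scale c \<beta>) (auto intro!: add_nonneg_nonneg)
  also have "\<dots> \<le> ennreal c * (orlicz_norm \<beta> D f + orlicz_norm \<beta> D g)"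
    by (intro mult_left_mono orlicz_norm_triangle \<beta> D fg) simp
  finally show ?thesis .
qed

lemma clip2_lincomb: "clip2 T m (lincomb2 a X b Y) s t i = a * clip2 T m X s t i + b * clip2 T m Y s t i"
  by (simp add: clip2_def lincomb2_def)

lemma delta2_clip2_lincomb:
  "delta2 (clip2 T m (lincomb2 a X b Y)) s u t = (\<lambda>i. a * delta2 (clip2 T m X) s u t i + b * delta2 (clip2 T m Y) s u t i)"
  by (simp add: delta2_def clip2_lincomb algebra_simps)

lemma modulus2_lincomb:
  assumes \<beta>: "0 < \<beta>" and X: "X \<in> L0_2 T m" and Y: "Y \<in> L0_2 T m"
  shows "modulus2 T m \<beta> (lincomb2 a X b Y) \<tau> \<le> ennreal (\<bar>a\<bar> + \<bar>b\<bar> + 1) * (modulus2 T m \<beta> X \<tau> + modulus2 T m \<beta> Y \<tau>)"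
proof -
  note [measurable] = clip2_measurable'[OF X] clip2_measurable'[OF Y]
  have "modulus2 T m \<beta> (clip2 T m (lincomb2 a X b Y)) \<tau>
      \<le> ennreal (\<bar>a\<bar> + \<bar>b\<bar> + 1) * (modulus2 T m \<beta> (clip2 T m X) \<tau> + modulus2 T m \<beta> (clip2 T m Y) \<tau>)"
  proof (rule modulus2_leI)
    fix h assume h: "0 \<le> h" "h \<le> \<tau>" "h < T"
    have "path_norm m \<beta> (T - h) (\<lambda>r. clip2 T m (lincomb2 a X b Y) r (r + h))
        \<le> ennreal (\<bar>a\<bar> + \<bar>b\<bar> + 1) * (path_norm m \<beta> (T - h) (\<lambda>r. clip2 T m X r (r + h)) + path_norm m \<beta> (T - h) (\<lambda>r. clip2 T m Y r (r + h)))"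
      unfolding path_norm_def
    proof (rule orlicz_norm_lincomb[OF \<beta>])
      show "0 \<le> vec_norm m (clip2 T m (lincomb2 a X b Y) r (r + h)) \<and>
          vec_norm m (clip2 T m (lincomb2 a X b Y) r (r + h))
          \<le> (\<bar>a\<bar> + \<bar>b\<bar> + 1) * (vec_norm m (clip2 T m X r (r + h)) + vec_norm m (clip2 T m Y r (r + h)))" for r
        using vec_norm_lincomb[of m a "clip2 T m X r (r + h)" b "clip2 T m Y r (r + h)"]
        by (simp add: clip2_lincomb[abs_def])
    qed auto
    also have "\<dots> \<le> ennreal (\<bar>a\<bar> + \<bar>b\<bar> + 1) * (modulus2 T m \<beta> (clip2 T m X) \<tau> + modulus2 T m \<beta> (clip2 T m Y) \<tau>)"
      using h by (intro mult_left_mono add_mono path_norm_le_modulus2) auto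
    finally show "path_norm m \<beta> (T - h) (\<lambda>r. clip2 T m (lincomb2 a X b Y) r (r + h))
      \<le> ennreal (\<bar>a\<bar> + \<bar>b\<bar> + 1) * (modulus2 T m \<beta> (clip2 T m X) \<tau> + modulus2 T m \<beta> (clip2 T m Y) \<tau>)" .
  qed
  then show ?thesis by (simp only: modulus2_clip)
qed

lemma modulus3_lincomb:
  assumes \<beta>: "0 < \<beta>" and X: "X \<in> L0_2 T m" and Y: "Y \<in> L0_2 T m"
  shows "modulus3 T m \<beta> (delta2 (lincomb2 a X b Y)) \<tau>
    \<le> ennreal (\<bar>a\<bar> + \<bar>b\<bar> + 1) * (modulus3 T m \<beta> (delta2 X) \<tau> + modulus3 T m \<beta> (delta2 Y) \<tau>)"
proof -
  note [measurable] = clip2_measurable'[OF X] clip2_measurable'[OF Y]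
  let ?D = "\<lambda>X \<theta> h r. delta2 (clip2 T m X) r (r + \<theta> * h) (r + h)"
  have "modulus3 T m \<beta> (delta2 (clip2 T m (lincomb2 a X b Y))) \<tau>
      \<le> ennreal (\<bar>a\<bar> + \<bar>b\<bar> + 1) * (modulus3 T m \<beta> (delta2 (clip2 T m X)) \<tau> + modulus3 T m \<beta> (delta2 (clip2 T m Y)) \<tau>)"
    unfolding modulus3_def[of T m \<beta> "delta2 (clip2 T m (lincomb2 a X b Y))"]
  proof (intro SUP_least)
    fix \<theta> h :: real assume th: "\<theta> \<in> {0..1}" "h \<in> {0..\<tau>}"
    have "orlicz_norm \<beta> {0..T - h} (\<lambda>r. vec_norm m (?D (lincomb2 a X b Y) \<theta> h r))
        \<le> ennreal (\<bar>a\<bar> + \<bar>b\<bar> + 1) * (orlicz_norm \<beta> {0..T - h} (\<lambda>r. vec_norm m (?D X \<theta> h r)) + orlicz_norm \<beta> {0..T - h} (\<lambda>r. vec_norm m (?D Y \<theta> h r)))"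
    proof (rule orlicz_norm_lincomb[OF \<beta>])
      show "0 \<le> vec_norm m (?D (lincomb2 a X b Y) \<theta> h r) \<and>
          vec_norm m (?D (lincomb2 a X b Y) \<theta> h r) \<le> (\<bar>a\<bar> + \<bar>b\<bar> + 1) * (vec_norm m (?D X \<theta> h r) + vec_norm m (?D Y \<theta> h r))" for r
        unfolding delta2_clip2_lincomb by (intro conjI vec_norm_lincomb vec_norm_nonneg)
      show "(\<lambda>r. vec_norm m (?D X \<theta> h r)) \<in> borel_measurable borel" "(\<lambda>r. vec_norm m (?D Y \<theta> h r)) \<in> borel_measurable borel"
        unfolding delta2_def by measurable
    qed auto
    also have "\<dots> \<le> ennreal (\<bar>a\<bar> + \<bar>b\<bar> + 1) * (modulus3 T m \<beta> (delta2 (clip2 T m X)) \<tau> + modulus3 T m \<beta> (delta2 (clip2 T m Y)) \<tau>)"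
      unfolding modulus3_def using th by (intro mult_left_mono add_mono SUP_upper2[of \<theta>] SUP_upper2[of h]) auto
    finally show "orlicz_norm \<beta> {0..T - h} (\<lambda>r. vec_norm m (?D (lincomb2 a X b Y) \<theta> h r))
        \<le> ennreal (\<bar>a\<bar> + \<bar>b\<bar> + 1) * (modulus3 T m \<beta> (delta2 (clip2 T m X)) \<tau> + modulus3 T m \<beta> (delta2 (clip2 T m Y)) \<tau>)" .
  qed
  then show ?thesis by (simp only: modulus3_clip)
qed

text \<open>Shows that the domain of sewing is closed under linear combinations, without which
  linearity on it could not be stated through \<open>sew\<close>.\<close>

lemma Lq_log_norm_lincomb_finite:
  assumes q: "0 < q" and m: "mono F" "mono G" "mono H"
    and le: "\<And>\<tau>. H \<tau> \<le> ennreal c * (F \<tau> + G \<tau>)"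
    and fin: "Lq_log_norm T q (\<lambda>\<tau>. ennreal (\<tau> powr a) * F \<tau>) < \<infinity>" "Lq_log_norm T q (\<lambda>\<tau>. ennreal (\<tau> powr a) * G \<tau>) < \<infinity>"
  shows "Lq_log_norm T q (\<lambda>\<tau>. ennreal (\<tau> powr a) * H \<tau>) < \<infinity>"
proof -
  note [measurable] = m[THEN mono_ennreal_borel_measurable]
  have "Lq_log_norm T q (\<lambda>\<tau>. ennreal (\<tau> powr a) * H \<tau>)
      \<le> Lq_log_norm T q (\<lambda>\<tau>. ennreal c * (ennreal (\<tau> powr a) * F \<tau> + ennreal (\<tau> powr a) * G \<tau>))"
  proof (rule Lq_log_norm_mono[OF q])
    fix \<tau>
    have "ennreal (\<tau> powr a) * H \<tau> \<le> ennreal (\<tau> powr a) * (ennreal c * (F \<tau> + G \<tau>))"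
      by (intro mult_left_mono le) simp
    then show "ennreal (\<tau> powr a) * H \<tau> \<le> ennreal c * (ennreal (\<tau> powr a) * F \<tau> + ennreal (\<tau> powr a) * G \<tau>)"
      by (simp add: ring_distribs mult.left_commute)
  qed measurable
  also have "\<dots> \<le> ennreal c * Lq_log_norm T q (\<lambda>\<tau>. ennreal (\<tau> powr a) * F \<tau> + ennreal (\<tau> powr a) * G \<tau>)"
    by (intro Lq_log_norm_cmult_le q) measurable
  also have "\<dots> \<le> ennreal c * (ennreal (2 * 2 powr (1 / enn2real q)) * (Lq_log_norm T q (\<lambda>\<tau>. ennreal (\<tau> powr a) * F \<tau>) + Lq_log_norm T q (\<lambda>\<tau>. ennreal (\<tau> powr a) * G \<tau>)))"
    by (intro mult_left_mono Lq_log_norm_add_le q) simp_all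
  also have "\<dots> < \<infinity>" using fin by (simp add: ennreal_mult_less_top)
  finally show ?thesis .
qed

context sewing_parameters
begin

lemma lincomb2_sewing_domain:
  assumes X: "X \<in> sewing_domain T m \<alpha> \<gamma> \<beta>1 \<beta>2 q1 q2" and Y: "Y \<in> sewing_domain T m \<alpha> \<gamma> \<beta>1 \<beta>2 q1 q2"
  shows "lincomb2 a X b Y \<in> sewing_domain T m \<alpha> \<gamma> \<beta>1 \<beta>2 q1 q2"
proof -
  have XY: "X \<in> L0_2 T m" "Y \<in> L0_2 T m" "delta2 X \<in> L0_3 T m" "delta2 Y \<in> L0_3 T m"
    using X Y by (auto simp: sewing_domain_def besov2_def besov3_def)
  have "lincomb2 a X b Y \<in> L0_2 T m"
    unfolding L0_2_def vec_measurable_on_def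
  proof (intro CollectI allI impI)
    fix i assume "i < m"
    then have "(\<lambda>x. (\<lambda>(s, t). X s t) x i) \<in> borel_measurable (restrict_space borel (triangle2 T))"
      "(\<lambda>x. (\<lambda>(s, t). Y s t) x i) \<in> borel_measurable (restrict_space borel (triangle2 T))"
      using XY by (auto simp: L0_2_def vec_measurable_on_def)
    then have "(\<lambda>x. a * (\<lambda>(s, t). X s t) x i + b * (\<lambda>(s, t). Y s t) x i) \<in> borel_measurable (restrict_space borel (triangle2 T))"
      by measurable
    then show "(\<lambda>x. (\<lambda>(s, t). lincomb2 a X b Y s t) x i) \<in> borel_measurable (restrict_space borel (triangle2 T))"
      by (simp add: lincomb2_def split_beta)
  qed
  moreover have "delta2 (lincomb2 a X b Y) \<in> L0_3 T m"
    unfolding L0_3_def vec_measurable_on_def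
  proof (intro CollectI allI impI)
    fix i assume "i < m"
    then have "(\<lambda>x. (\<lambda>(s, u, t). delta2 X s u t) x i) \<in> borel_measurable (restrict_space borel (triangle3 T))"
      "(\<lambda>x. (\<lambda>(s, u, t). delta2 Y s u t) x i) \<in> borel_measurable (restrict_space borel (triangle3 T))"
      using XY by (auto simp: L0_3_def vec_measurable_on_def)
    then have "(\<lambda>x. a * (\<lambda>(s, u, t). delta2 X s u t) x i + b * (\<lambda>(s, u, t). delta2 Y s u t) x i) \<in> borel_measurable (restrict_space borel (triangle3 T))"
      by measurable
    then show "(\<lambda>x. (\<lambda>(s, u, t). delta2 (lincomb2 a X b Y) s u t) x i) \<in> borel_measurable (restrict_space borel (triangle3 T))"
      by (simp add: delta2_def lincomb2_def split_beta algebra_simps)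
  qed
  moreover have "besov2_norm T m \<alpha> \<beta>1 q1 (lincomb2 a X b Y) < \<infinity>"
    using X Y unfolding besov2_norm_def sewing_domain_def besov2_def
    by (intro Lq_log_norm_lincomb_finite[OF q(1) mono_modulus2 mono_modulus2 mono_modulus2 modulus2_lincomb[OF \<beta>(1) XY(1,2)]]) auto
  moreover have "besov3_norm T m \<gamma> \<beta>2 q2 (delta2 (lincomb2 a X b Y)) < \<infinity>"
    using X Y unfolding besov3_norm_def sewing_domain_def besov3_def
    by (intro Lq_log_norm_lincomb_finite[OF q(2) mono_modulus3 mono_modulus3 mono_modulus3 modulus3_lincomb[OF \<beta>(2) XY(1,2)]]) auto
  ultimately show ?thesis
    by (simp add: sewing_domain_def besov2_def besov3_def)
qed

lemma sew_L0_1: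
  assumes X: "X \<in> sewing_domain T m \<alpha> \<gamma> \<beta>1 \<beta>2 q1 q2"
  shows "sew T (clip2 T m X) \<in> L0_1 T m"
proof -
  obtain k where "germ T \<beta>2 \<gamma> k m (clip2 T m X)" by (rule germ_clip2[OF X])
  then interpret germ T \<beta>2 \<gamma> k m "clip2 T m X" .
  show ?thesis
    unfolding L0_1_def vec_measurable_on_def by (auto intro: measurable_restrict_space1 measurable_sew)
qed

lemma sew_linear: "linear_on_classes T m (sewing_domain T m \<alpha> \<gamma> \<beta>1 \<beta>2 q1 q2) (\<lambda>X. sew T (clip2 T m X))"
  unfolding linear_on_classes_def
proof (intro conjI ballI allI impI)
  fix X assume X: "X \<in> sewing_domain T m \<alpha> \<gamma> \<beta>1 \<beta>2 q1 q2"
  then show "sew T (clip2 T m X) \<in> L0_1 T m" by (rule sew_L0_1)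
  fix Y assume Y: "Y \<in> sewing_domain T m \<alpha> \<gamma> \<beta>1 \<beta>2 q1 q2"
  obtain kX where gX: "germ T \<beta>2 \<gamma> kX m (clip2 T m X)" by (rule germ_clip2[OF X])
  obtain kY where gY: "germ T \<beta>2 \<gamma> kY m (clip2 T m Y)" by (rule germ_clip2[OF Y])
  show "L0_1_eq T m (sew T (clip2 T m X)) (sew T (clip2 T m Y))" if eq: "L0_2_eq T m X Y"
  proof -
    have "AE t in lborel. t \<in> {0..T} \<longrightarrow> (\<forall>i<m. sew T (clip2 T m X) t i = 1 * sew T (clip2 T m Y) t i + 0 * sew T (clip2 T m Y) t i)"
    proof (rule germ_sew_lincomb[OF gY gY gX])
      fix h assume h: "0 \<le> h" "h \<le> T"
      have "AE r in lborel. r \<in> {0..T - h} \<longrightarrow> vec_eq m (X r (r + h)) (Y r (r + h))"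
        using eq h by (simp add: L0_2_eq_def)
      then show "AE r in lborel. r \<in> {0..T - h} \<longrightarrow> (\<forall>i<m. clip2 T m X r (r + h) i = 1 * clip2 T m Y r (r + h) i + 0 * clip2 T m Y r (r + h) i)"
        by eventually_elim (auto simp: vec_eq_def clip2_def)
    qed
    then show ?thesis by (simp add: L0_1_eq_def vec_eq_def)
  qed
  fix a b :: real
  obtain kZ where gZ: "germ T \<beta>2 \<gamma> kZ m (clip2 T m (lincomb2 a X b Y))"
    by (rule germ_clip2[OF lincomb2_sewing_domain[OF X Y]])
  have "AE t in lborel. t \<in> {0..T} \<longrightarrow> (\<forall>i<m. sew T (clip2 T m (lincomb2 a X b Y)) t i = a * sew T (clip2 T m X) t i + b * sew T (clip2 T m Y) t i)"
    by (rule germ_sew_lincomb[OF gX gY gZ]) (simp add: clip2_lincomb)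
  then show "L0_1_eq T m (sew T (clip2 T m (lincomb2 a X b Y))) (lincomb1 a (sew T (clip2 T m X)) b (sew T (clip2 T m Y)))"
    by (simp add: L0_1_eq_def vec_eq_def lincomb1_def)
qed

text \<open>Changing a path on a null set changes its increments along each line on a null set only,
  so the remainder bound passes to every version of the path.\<close>

lemma sewn_sew:
  assumes X: "X \<in> sewing_domain T m \<alpha> \<gamma> \<beta>1 \<beta>2 q1 q2" and I: "I \<in> L0_1 T m" "L0_1_eq T m I (sew T (clip2 T m X))"
  shows "sewn T m \<alpha> \<gamma> \<beta>1 \<beta>2 q1 q2 X I"
proof unfold_locales
  obtain k where "germ T \<beta>2 \<gamma> k m (clip2 T m X)" by (rule germ_clip2[OF X])
  then interpret germ T \<beta>2 \<gamma> k m "clip2 T m X" .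
  show "X \<in> sewing_domain T m \<alpha> \<gamma> \<beta>1 \<beta>2 q1 q2" "I \<in> L0_1 T m" by fact+
  fix h assume h: "0 \<le> h" "h \<le> T"
  have "AE t in lborel. t \<in> {0..T} \<longrightarrow> (\<forall>i<m. I t i = sew T (clip2 T m X) t i)"
    using I(2) by (simp add: L0_1_eq_def vec_eq_def)
  moreover from AE_lborel_affine_unit[OF _ this, of 1 h]
  have "AE r in lborel. h + 1 * r \<in> {0..T} \<longrightarrow> (\<forall>i<m. I (h + 1 * r) i = sew T (clip2 T m X) (h + 1 * r) i)"
    by simp
  moreover note sew_increment[OF h]
  ultimately
  have "AE r in lborel. r \<in> {0..T - h} \<longrightarrow> (\<forall>i<m. (\<lambda>i. clip1 T m I (r + h) i - clip1 T m I r i - clip2 T m X r (r + h) i) i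
      = (dyad_lim (clip2 T m X) r (r + h) - clip2 T m X r (r + h)) i)"
  proof eventually_elim
    case (elim r)
    show ?case
    proof (intro impI allI)
      fix i assume r: "r \<in> {0..T - h}" and i: "i < m"
      have "I r i = sew T (clip2 T m X) r i" "I (r + h) i = sew T (clip2 T m X) (r + h) i"
        using elim(1,2) r i h by (auto simp: add.commute)
      then show "(\<lambda>i. clip1 T m I (r + h) i - clip1 T m I r i - clip2 T m X r (r + h) i) i
          = (dyad_lim (clip2 T m X) r (r + h) - clip2 T m X r (r + h)) i"
        using elim(3) r i h by (simp add: clip1_def)
    qed
  qed
  then have "path_norm m \<beta>2 (T - h) (\<lambda>r i. clip1 T m I (r + h) i - clip1 T m I r i - clip2 T m X r (r + h) i)
      = path_norm m \<beta>2 (T - h) (\<lambda>r. dyad_lim (clip2 T m X) r (r + h) - clip2 T m X r (r + h))"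
    by (rule path_norm_cong_AE)
  also have "\<dots> \<le> dyadic_sum \<omega> h" by (rule dyad_lim_bound[OF h])
  finally show "path_norm m \<beta>2 (T - h) (\<lambda>r i. clip1 T m I (r + h) i - clip1 T m I r i - clip2 T m X r (r + h) i)
      \<le> dyadic_sum (modulus3 T m \<beta>2 (delta2 X)) h"
    by (simp only: modulus3_clip[abs_def])
qed

end

subsection \<open>Averages and continuity\<close>

text \<open>The constants of the theorem are functions of the parameters; the witnesses of
  \<open>orlicz_norm_mean_bound\<close> are therefore fixed by choice, as are similar ones below.\<close>

definition admissible_mean_consts :: "real \<Rightarrow> real \<Rightarrow> real \<times> real \<Rightarrow> bool" where
  "admissible_mean_consts \<beta> p c \<longleftrightarrow> 1 \<le> fst c \<and> 1 \<le> snd c \<and>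
    (\<forall>D W w k g. W \<in> sets borel \<and> W \<subseteq> D \<and> emeasure lborel W \<le> ennreal w \<and> 0 \<le> w \<and> 0 < k \<and>
        g \<in> borel_measurable borel \<and> (\<forall>r. 0 \<le> g r) \<longrightarrow>
      (\<integral>\<^sup>+r\<in>W. ennreal (g r) \<partial>lborel)
        \<le> ennreal ((k + k powr (1 - p) * fst c) * w + k powr (1 - p) * snd c) * orlicz_norm \<beta> D g)"

definition mean_consts :: "real \<Rightarrow> real \<Rightarrow> real \<times> real" where
  "mean_consts \<beta> p = (SOME c. admissible_mean_consts \<beta> p c)"

lemma admissible_mean_consts:
  assumes "0 < \<beta>" "1 \<le> p"
  shows "admissible_mean_consts \<beta> p (mean_consts \<beta> p)"
  unfolding mean_consts_def
proof (rule someI_ex, rule orlicz_norm_mean_bound[OF assms], goal_cases)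
  case (1 A B)
  have "admissible_mean_consts \<beta> p (A, B)"
    unfolding admissible_mean_consts_def fst_conv snd_conv by (intro conjI allI impI 1) auto
  then show ?case ..
qed

lemma mean_consts:
  assumes "0 < \<beta>" "1 \<le> p"
  shows "1 \<le> fst (mean_consts \<beta> p)" "1 \<le> snd (mean_consts \<beta> p)"
    "\<lbrakk>W \<in> sets borel; W \<subseteq> D; emeasure lborel W \<le> ennreal w; 0 \<le> w; 0 < k; g \<in> borel_measurable borel; \<And>r. 0 \<le> g r\<rbrakk>
      \<Longrightarrow> (\<integral>\<^sup>+r\<in>W. ennreal (g r) \<partial>lborel)
        \<le> ennreal ((k + k powr (1 - p) * fst (mean_consts \<beta> p)) * w + k powr (1 - p) * snd (mean_consts \<beta> p)) * orlicz_norm \<beta> D g"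
  using admissible_mean_consts[OF assms] unfolding admissible_mean_consts_def by (simp_all del: ennreal_plus)

definition mean_factor :: "real \<Rightarrow> real \<Rightarrow> real \<Rightarrow> real" where
  "mean_factor \<beta> p T = 1 + fst (mean_consts \<beta> p) * T + snd (mean_consts \<beta> p)"

lemma mean_factor_ge_1: "0 < \<beta> \<Longrightarrow> 1 \<le> p \<Longrightarrow> 0 < T \<Longrightarrow> 1 \<le> mean_factor \<beta> p T"
  using mean_consts(1,2)[of \<beta> p] by (simp add: mean_factor_def)

lemma mean_factor_mono: "0 < \<beta> \<Longrightarrow> 1 \<le> p \<Longrightarrow> T \<le> T' \<Longrightarrow> mean_factor \<beta> p T \<le> mean_factor \<beta> p T'"
  using mean_consts(1)[of \<beta> p] by (simp add: mean_factor_def mult_left_mono)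

text \<open>The level \<open>\<epsilon> powr (- 1 / p)\<close> at which the function is split balances the exponential
  integrability against the length of the window, at the cost of \<open>1 / p\<close> in the exponent.\<close>

lemma orlicz_mean_window:
  assumes \<beta>: "0 < \<beta>" and p: "1 \<le> p" and \<epsilon>: "0 < \<epsilon>" "\<epsilon> \<le> 3 * T / 4" and h: "0 \<le> h" "h \<le> \<epsilon>" and a: "0 \<le> a" "a + \<epsilon> \<le> T"
    and C: "0 \<le> C" and g: "g \<in> borel_measurable borel" "\<And>r. 0 \<le> g r"
    and N: "orlicz_norm \<beta> {0..T - h} g \<le> ennreal (C * \<epsilon> powr \<eta>)"
  shows "(\<integral>\<^sup>+r\<in>{a..a + \<epsilon> - h}. ennreal (g r) \<partial>lborel) \<le> ennreal (mean_factor \<beta> p T * C * \<epsilon> powr (1 + (\<eta> - 1 / p)))"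
proof -
  let ?A = "fst (mean_consts \<beta> p)" and ?B = "snd (mean_consts \<beta> p)"
  define k where "k = \<epsilon> powr (- 1 / p)"
  have T: "0 < T" using \<epsilon> by simp
  have k: "0 < k" using \<epsilon> by (simp add: k_def)
  have AB: "1 \<le> ?A" "1 \<le> ?B" by (intro mean_consts \<beta> p)+
  have "(\<integral>\<^sup>+r\<in>{a..a + \<epsilon> - h}. ennreal (g r) \<partial>lborel)
      \<le> ennreal ((k + k powr (1 - p) * ?A) * \<epsilon> + k powr (1 - p) * ?B) * orlicz_norm \<beta> {0..T - h} g"
    using h a \<epsilon> by (intro mean_consts(3)[OF \<beta> p _ _ _ _ k g]) (auto intro!: ennreal_leI)
  also have "\<dots> \<le> ennreal ((k + k powr (1 - p) * ?A) * \<epsilon> + k powr (1 - p) * ?B) * ennreal (C * \<epsilon> powr \<eta>)"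
    by (intro mult_left_mono N) simp
  also have "\<dots> = ennreal (((k + k powr (1 - p) * ?A) * \<epsilon> + k powr (1 - p) * ?B) * (C * \<epsilon> powr \<eta>))"
    using k AB \<epsilon> C by (intro ennreal_mult[symmetric]) (auto intro!: add_nonneg_nonneg mult_nonneg_nonneg)
  also have "\<dots> \<le> ennreal (mean_factor \<beta> p T * C * \<epsilon> powr (1 + (\<eta> - 1 / p)))"
  proof (rule ennreal_leI)
    \<comment> \<open>The level is chosen such that the two contributions
      \<open>k * \<epsilon>\<close> and \<open>k powr (1 - p)\<close> coincide.\<close>
    have e1: "k * \<epsilon> = \<epsilon> powr (1 - 1 / p)"
      using \<epsilon> powr_add[of \<epsilon> "- 1 / p" 1] by (simp add: k_def add.commute)
    have e2: "k powr (1 - p) = \<epsilon> powr (1 - 1 / p)"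
      using p by (simp add: k_def powr_powr diff_divide_distrib)
    have "(k + k powr (1 - p) * ?A) * \<epsilon> + k powr (1 - p) * ?B
        = \<epsilon> powr (1 - 1 / p) * (1 + ?A * \<epsilon> + ?B)"
      unfolding distrib_right e1 e2 by (simp add: algebra_simps)
    also have "\<dots> \<le> \<epsilon> powr (1 - 1 / p) * mean_factor \<beta> p T"
      unfolding mean_factor_def using AB \<epsilon> T by (intro mult_left_mono add_mono order_refl) auto
    finally have "((k + k powr (1 - p) * ?A) * \<epsilon> + k powr (1 - p) * ?B) * (C * \<epsilon> powr \<eta>)
        \<le> \<epsilon> powr (1 - 1 / p) * mean_factor \<beta> p T * (C * \<epsilon> powr \<eta>)"
      using C by (intro mult_right_mono) auto
    also have "\<dots> = mean_factor \<beta> p T * C * (\<epsilon> powr (1 - 1 / p) * \<epsilon> powr \<eta>)"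
      by simp
    also have "\<epsilon> powr (1 - 1 / p) * \<epsilon> powr \<eta> = \<epsilon> powr (1 + (\<eta> - 1 / p))"
    proof -
      have "1 - 1 / p + \<eta> = 1 + (\<eta> - 1 / p)" by simp
      then show ?thesis by (simp only: powr_add[symmetric])
    qed
    finally show "((k + k powr (1 - p) * ?A) * \<epsilon> + k powr (1 - p) * ?B) * (C * \<epsilon> powr \<eta>)
      \<le> mean_factor \<beta> p T * C * \<epsilon> powr (1 + (\<eta> - 1 / p))" .
  qed
  finally show ?thesis .
qed

text \<open>Over the whole interval nothing is gained from a short window. The loss
  \<open>1 / p\<close> in the exponent is introduced through \<open>T powr (1 / p)\<close>, so that
  the result has the form of the assumption \<open>global\<close>.\<close>

lemma orlicz_mean_global:
  assumes \<beta>: "0 < \<beta>" and p: "1 \<le> p" and T: "0 < T" and h: "0 < h" "h \<le> T / 2"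
    and C: "0 \<le> C" and g: "g \<in> borel_measurable borel" "\<And>r. 0 \<le> g r"
    and N: "orlicz_norm \<beta> {0..T - h} g \<le> ennreal (C * h powr \<eta>)"
  shows "(\<integral>\<^sup>+r\<in>{0..T - h}. ennreal (g r) \<partial>lborel)
    \<le> ennreal (((1 + fst (mean_consts \<beta> p)) * T + snd (mean_consts \<beta> p)) * C * T powr (1 / p) * h powr (\<eta> - 1 / p))"
proof -
  let ?A = "fst (mean_consts \<beta> p)" and ?B = "snd (mean_consts \<beta> p)"
  have AB: "1 \<le> ?A" "1 \<le> ?B" by (intro mean_consts \<beta> p)+
  have "(\<integral>\<^sup>+r\<in>{0..T - h}. ennreal (g r) \<partial>lborel)
      \<le> ennreal ((1 + 1 powr (1 - p) * ?A) * T + 1 powr (1 - p) * ?B) * orlicz_norm \<beta> {0..T - h} g"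
    using h T by (intro mean_consts(3)[OF \<beta> p _ _ _ _ _ g]) (auto intro!: ennreal_leI)
  also have "\<dots> \<le> ennreal ((1 + ?A) * T + ?B) * ennreal (C * h powr \<eta>)"
    by (simp, intro mult_left_mono N) simp
  also have "\<dots> = ennreal (((1 + ?A) * T + ?B) * (C * h powr \<eta>))"
    using AB T C by (intro ennreal_mult[symmetric]) (auto intro!: add_nonneg_nonneg mult_nonneg_nonneg)
  also have "\<dots> \<le> ennreal (((1 + ?A) * T + ?B) * C * T powr (1 / p) * h powr (\<eta> - 1 / p))"
  proof (rule ennreal_leI)
    have "h powr \<eta> = h powr (1 / p) * h powr (\<eta> - 1 / p)"
      by (simp add: powr_add[symmetric])
    also have "\<dots> \<le> T powr (1 / p) * h powr (\<eta> - 1 / p)"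
      using h T p by (intro mult_right_mono powr_mono2) auto
    finally have "((1 + ?A) * T + ?B) * C * h powr \<eta> \<le> ((1 + ?A) * T + ?B) * C * (T powr (1 / p) * h powr (\<eta> - 1 / p))"
      using AB T C by (intro mult_left_mono) (auto intro!: add_nonneg_nonneg mult_nonneg_nonneg)
    then show "((1 + ?A) * T + ?B) * (C * h powr \<eta>) \<le> ((1 + ?A) * T + ?B) * C * T powr (1 / p) * h powr (\<eta> - 1 / p)"
      by (simp add: mult.assoc)
  qed
  finally show ?thesis .
qed

lemma closure_of_almost_all:
  fixes G :: "real set"
  assumes ae: "AE s in lborel. s \<in> {0..T} \<longrightarrow> s \<in> G" and T: "0 < T"
  shows "{0..T} \<subseteq> closure G"
proof
  fix x assume x: "x \<in> {0..T}"
  show "x \<in> closure G"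
    unfolding closure_approachable
  proof (intro allI impI)
    fix e :: real assume e: "0 < e"
    obtain y where "max 0 (x - e) < y" "y < min T (x + e)" "y \<in> {0..T} \<longrightarrow> y \<in> G"
      by (rule mono_AE_point[OF ae, of "max 0 (x - e)" "min T (x + e)"]) (use x e T in auto)
    then show "\<exists>y\<in>G. dist y x < e"
      by (intro bexI[of _ y]) (auto simp: dist_real_def)
  qed
qed

lemma hoelder_uniformly_continuous:
  assumes \<kappa>: "0 < \<kappa>" and C: "0 \<le> C" and le: "\<And>x y. x \<in> G \<Longrightarrow> y \<in> G \<Longrightarrow> dist (f x) (f y) \<le> C * dist x y powr \<kappa>"
  shows "uniformly_continuous_on G f"
  unfolding uniformly_continuous_on_def
proof (intro allI impI)
  fix e :: real assume e: "0 < e"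
  define d where "d = (e / (C + 1)) powr (1 / \<kappa>)"
  have d: "0 < d" using e C by (simp add: d_def)
  have "dist (f y) (f x) < e" if xy: "x \<in> G" "y \<in> G" "dist y x < d" for x y
  proof -
    have "dist y x powr \<kappa> \<le> d powr \<kappa>"
      using xy(3) \<kappa> by (intro powr_mono2) auto
    also have "d powr \<kappa> = e / (C + 1)" using e C \<kappa> by (simp add: d_def powr_powr)
    finally have "C * dist y x powr \<kappa> \<le> C * (e / (C + 1))"
      using C by (intro mult_left_mono)
    also have "\<dots> < e" using C e by (simp add: field_simps)
    finally show ?thesis using le[OF xy(2,1)] by simp
  qed
  then show "\<exists>d>0. \<forall>x\<in>G. \<forall>x'\<in>G. dist x' x < d \<longrightarrow> dist (f x') (f x) < e"
    using d by blast
qed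

text \<open>On a set of full measure the path is Hoelder continuous, hence each coordinate is
  uniformly continuous there and extends to the closure, which is the whole interval.\<close>

lemma continuous_version:
  fixes f :: "real \<Rightarrow> nat \<Rightarrow> real"
  assumes G: "AE s in lborel. s \<in> {0..T} \<longrightarrow> s \<in> G" "G \<subseteq> {0..T}" and T: "0 < T" and \<kappa>: "0 < \<kappa>" and C: "0 \<le> C"
    and bound: "\<And>s t. s \<in> G \<Longrightarrow> t \<in> G \<Longrightarrow> s < t \<Longrightarrow> vec_norm m (f t - f s) \<le> C * (t - s) powr \<kappa>"
  obtains g where "vec_continuous_on m {0..T} g" "L0_1_eq T m g f" "g \<in> L0_1 T m"
proof -
  have "\<exists>g. continuous_on {0..T} g \<and> (\<forall>t\<in>G. g t = f t i)" if i: "i < m" for i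
  proof -
    have le: "\<bar>f t i - f s i\<bar> \<le> C * \<bar>t - s\<bar> powr \<kappa>" if "s \<in> G" "t \<in> G" for s t
    proof -
      have *: "\<bar>f v i - f u i\<bar> \<le> C * (v - u) powr \<kappa>" if "u \<in> G" "v \<in> G" "u < v" for u v
        using vec_norm_component[OF i, of "f v - f u"] bound[OF that] by simp
      show ?thesis
        using *[of s t] *[of t s] that C by (cases s t rule: linorder_cases) (auto simp: abs_minus_commute)
    qed
    have "uniformly_continuous_on G (\<lambda>t. f t i)"
      using le by (intro hoelder_uniformly_continuous[OF \<kappa> C]) (simp add: dist_real_def abs_minus_commute)
    from uniformly_continuous_on_extension_on_closure[OF this]
    obtain g where g: "uniformly_continuous_on (closure G) g" "\<And>t. t \<in> G \<Longrightarrow> f t i = g t"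
      by metis
    have "continuous_on {0..T} g"
      by (rule continuous_on_subset[OF uniformly_continuous_imp_continuous[OF g(1)] closure_of_almost_all[OF G(1) T]])
    then show ?thesis using g(2) by (intro exI[of _ g]) auto
  qed
  then obtain h where h: "\<And>i. i < m \<Longrightarrow> continuous_on {0..T} (h i)" "\<And>i t. i < m \<Longrightarrow> t \<in> G \<Longrightarrow> h i t = f t i"
    by metis
  show thesis
  proof (rule that[of "\<lambda>t i. h i t"])
    show "vec_continuous_on m {0..T} (\<lambda>t i. h i t)" using h(1) by (simp add: vec_continuous_on_def)
    show "(\<lambda>t i. h i t) \<in> L0_1 T m"
      using h(1) by (auto simp: L0_1_def vec_measurable_on_def intro: borel_measurable_continuous_on_restrict)
    show "L0_1_eq T m (\<lambda>t i. h i t) f"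
      unfolding L0_1_eq_def using G(1) by eventually_elim (auto simp: vec_eq_def h(2))
  qed
qed

definition admissible_compare_consts :: "real \<Rightarrow> real \<Rightarrow> real \<times> real \<Rightarrow> bool" where
  "admissible_compare_consts \<beta>' \<beta> c \<longleftrightarrow> 1 \<le> fst c \<and> 1 \<le> snd c \<and>
    (\<forall>D d g. D \<in> sets borel \<and> emeasure lborel D \<le> ennreal d \<and> 0 \<le> d \<and> g \<in> borel_measurable borel \<and> (\<forall>r. 0 \<le> g r)
      \<longrightarrow> orlicz_norm \<beta>' D g \<le> ennreal (fst c * d + snd c) * orlicz_norm \<beta> D g)"

definition compare_consts :: "real \<Rightarrow> real \<Rightarrow> real \<times> real" where
  "compare_consts \<beta>' \<beta> = (SOME c. admissible_compare_consts \<beta>' \<beta> c)"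

lemma admissible_compare_consts:
  assumes "0 < \<beta>'" "\<beta>' \<le> \<beta>"
  shows "admissible_compare_consts \<beta>' \<beta> (compare_consts \<beta>' \<beta>)"
  unfolding compare_consts_def
proof (rule someI_ex, rule orlicz_norm_compare[OF assms], goal_cases)
  case (1 A B)
  have "admissible_compare_consts \<beta>' \<beta> (A, B)"
    unfolding admissible_compare_consts_def fst_conv snd_conv by (intro conjI allI impI 1) auto
  then show ?case ..
qed

definition compare_factor :: "real \<Rightarrow> real \<Rightarrow> real \<Rightarrow> real" where
  "compare_factor \<beta>' \<beta> T = fst (compare_consts \<beta>' \<beta>) * T + snd (compare_consts \<beta>' \<beta>)"

lemma compare_factor:
  assumes "0 < \<beta>'" "\<beta>' \<le> \<beta>" "0 \<le> T"
  shows "1 \<le> compare_factor \<beta>' \<beta> T"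
    "\<lbrakk>D \<in> sets borel; emeasure lborel D \<le> ennreal T; g \<in> borel_measurable borel; \<And>r. 0 \<le> g r\<rbrakk>
      \<Longrightarrow> orlicz_norm \<beta>' D g \<le> ennreal (compare_factor \<beta>' \<beta> T) * orlicz_norm \<beta> D g"
proof -
  note * = admissible_compare_consts[OF assms(1,2), unfolded admissible_compare_consts_def]
  have "1 \<le> snd (compare_consts \<beta>' \<beta>)" "0 \<le> fst (compare_consts \<beta>' \<beta>) * T" using * assms(3) by auto
  then show "1 \<le> compare_factor \<beta>' \<beta> T" unfolding compare_factor_def by linarith
  show "orlicz_norm \<beta>' D g \<le> ennreal (compare_factor \<beta>' \<beta> T) * orlicz_norm \<beta> D g"
    if "D \<in> sets borel" "emeasure lborel D \<le> ennreal T" "g \<in> borel_measurable borel" "\<And>r. 0 \<le> g r"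
    unfolding compare_factor_def using * that assms(3) by (simp del: ennreal_plus)
qed

subsection \<open>Bounds for the sewn path\<close>

definition sum_const :: "ennreal \<Rightarrow> real" where
  "sum_const q = 2 * 2 powr (1 / enn2real q)"

context sewn
begin

abbreviation K2 :: ennreal where "K2 \<equiv> besov2_norm T m \<alpha> \<beta>1 q1 X"

abbreviation D :: "real \<Rightarrow> real \<Rightarrow> nat \<Rightarrow> real" where "D \<equiv> delta1 (clip1 T m I)"

lemma K2_finite: "K2 < \<infinity>"
  using X by (auto simp: sewing_domain_def besov2_def)

lemma measurable_D [measurable (raw)]:
  assumes "f \<in> borel_measurable N" "g \<in> borel_measurable N"
  shows "(\<lambda>x. D (f x) (g x) i) \<in> borel_measurable N"
  unfolding delta1_def by (intro borel_measurable_diff measurable_I assms)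

lemma D_path: "(\<lambda>r. D (r + a) (r + b)) \<in> measurable_paths" "(\<lambda>r. D r (r + b)) \<in> measurable_paths"
  and X_path: "(\<lambda>r. clip2 T m X r (r + b)) \<in> measurable_paths"
  unfolding measurable_paths_def by auto

lemma D_eq: "D s t = clip2 T m X s t + E s t"
  by (simp add: E_def delta1_def fun_eq_iff)

lemma modulus2_D: "modulus2 T m \<beta> (delta1 I) \<tau> = modulus2 T m \<beta> D \<tau>"
  by (rule modulus2_cong_AE) (auto simp: delta1_def clip1_def)

lemma modulus2_X_power:
  assumes "0 < \<tau>" "\<tau> \<le> 3 * T / 4"
  shows "modulus2 T m \<beta>1 X \<tau> \<le> ennreal (embedding_const \<alpha> q1 * \<tau> powr \<alpha>) * K2"
  unfolding besov2_norm_def using \<alpha> assms by (intro Lq_log_norm_embedding T q mono_modulus2) auto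

text \<open>The increment over \<open>h\<close> splits into two over \<open>h / 2\<close>; this avoids the modulus of \<open>X\<close> near
  \<open>\<tau> = T\<close>, which the norm does not control pointwise.\<close>

lemma modulus2_doubling:
  fixes c :: ennreal
  assumes \<beta>: "0 < \<beta>" and step: "\<And>h. 0 < h \<Longrightarrow> h \<le> \<tau> / 2 \<Longrightarrow> h \<le> T / 2 \<Longrightarrow> path_norm m \<beta> (T - h) (\<lambda>r. D r (r + h)) \<le> c"
  shows "modulus2 T m \<beta> (delta1 I) \<tau> \<le> 2 * c"
  unfolding modulus2_D
proof (rule modulus2_leI)
  fix h assume h: "0 \<le> h" "h \<le> \<tau>" "h < T"
  interpret seminorm_on "path_norm m \<beta> l" measurable_paths for l
    by (rule path_norm_seminorm[OF \<beta>])
  show "path_norm m \<beta> (T - h) (\<lambda>r. D r (r + h)) \<le> 2 * c"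
  proof (cases "h = 0")
    case True
    have "(\<lambda>r. D r (r + h)) = 0" by (simp add: True delta1_def fun_eq_iff)
    then show ?thesis by (simp add: zero)
  next
    case False
    then have h2: "0 < h / 2" "h / 2 \<le> \<tau> / 2" "h / 2 \<le> T / 2" using h by auto
    have "(\<lambda>r. D r (r + h)) = (\<lambda>r. D r (r + h / 2)) + (\<lambda>r. D (r + h / 2) (r + h))"
      by (simp add: fun_eq_iff delta1_def)
    then have "path_norm m \<beta> (T - h) (\<lambda>r. D r (r + h))
        \<le> path_norm m \<beta> (T - h) (\<lambda>r. D r (r + h / 2)) + path_norm m \<beta> (T - h) (\<lambda>r. D (r + h / 2) (r + h))"
      using triangle[OF D_path(2) D_path(1)] by simp
    also have "\<dots> \<le> path_norm m \<beta> (T - h / 2) (\<lambda>r. D r (r + h / 2)) + path_norm m \<beta> (T - h / 2) (\<lambda>r. D r (r + h / 2))"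
    proof (rule add_mono)
      show "path_norm m \<beta> (T - h) (\<lambda>r. D r (r + h / 2)) \<le> path_norm m \<beta> (T - h / 2) (\<lambda>r. D r (r + h / 2))"
        using path_norm_shift[OF \<beta> D_path(2)[of "h / 2"], of 0 "T - h" "T - h / 2"] h by simp
      have "(\<lambda>r. D (r + h / 2) (r + h)) = (\<lambda>r. (\<lambda>r. D r (r + h / 2)) (h / 2 + r))"
        by (simp add: fun_eq_iff add.commute)
      then show "path_norm m \<beta> (T - h) (\<lambda>r. D (r + h / 2) (r + h)) \<le> path_norm m \<beta> (T - h / 2) (\<lambda>r. D r (r + h / 2))"
        using path_norm_shift[OF \<beta> D_path(2)[of "h / 2"], of "h / 2" "T - h" "T - h / 2"] h by simp
    qed
    also have "\<dots> \<le> c + c" by (intro add_mono step h2)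
    finally show ?thesis by (simp add: mult_2)
  qed
qed

text \<open>The common pattern of the seminorm bounds. Doubling evaluates the modulus of
  \<open>X\<close> at \<open>\<tau> / 2\<close>, where it is bounded pointwise by its norm on the
  whole range of \<open>\<tau>\<close>; so its exponent can be raised from \<open>q1\<close> to the
  maximum. The surplus power \<open>e\<close> makes the other term integrable for every
  exponent.\<close>

lemma besov_seminorm_bound:
  assumes \<beta>: "0 < \<beta>" and a: "0 \<le> a" and c: "0 \<le> c" and e: "0 < e"
    and step: "\<And>h. 0 < h \<Longrightarrow> h \<le> T / 2 \<Longrightarrow> path_norm m \<beta> (T - h) (\<lambda>r. D r (r + h))
      \<le> ennreal a * modulus2 T m \<beta>1 X h + ennreal (c * h powr (\<alpha> + e)) * k"
  shows "besov_seminorm T m \<alpha> \<beta> (max q1 q2) I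
    \<le> ennreal (2 * sum_const (max q1 q2)) * (ennreal (a * embedding_const \<alpha> q1) * K2 + ennreal (c * power_const e (max q1 q2) * T powr e) * k)"
proof -
  let ?q = "max q1 q2"
  have q': "0 < ?q" using q by (simp add: max_def)
  define F where "F = modulus2 T m \<beta>1 X"
  have mF: "mono F" unfolding F_def by (rule mono_modulus2)
  note [measurable] = mono_ennreal_borel_measurable[OF mF]
  have [measurable]: "modulus2 T m \<beta> (delta1 I) \<in> borel_measurable borel"
    by (rule mono_ennreal_borel_measurable[OF mono_modulus2])
  have ec: "1 \<le> embedding_const \<alpha> q1" using \<alpha> by (intro embedding_const_ge_1) simp
  define G where "G \<tau> = ennreal (\<tau> powr (- \<alpha>)) * F (\<tau> / 2)" for \<tau>
  have [measurable]: "G \<in> borel_measurable borel" unfolding G_def by measurable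
  have G1: "Lq_log_norm T ?q G \<le> ennreal (embedding_const \<alpha> q1) * K2"
  proof (rule Lq_log_norm_increase_exponent[OF q(1)])
    have "Lq_log_norm T q1 G \<le> Lq_log_norm T q1 (\<lambda>\<tau>. ennreal (\<tau> powr (- \<alpha>)) * F \<tau>)"
    proof (rule Lq_log_norm_mono[OF q(1)])
      show "G \<tau> \<le> ennreal (\<tau> powr (- \<alpha>)) * F \<tau>" if "0 < \<tau>" for \<tau>
        unfolding G_def using that by (intro mult_left_mono monoD[OF mF]) auto
    qed measurable
    also have "\<dots> = K2" by (simp add: F_def besov2_norm_def)
    also have "K2 = ennreal 1 * K2" by simp
    also have "\<dots> \<le> ennreal (embedding_const \<alpha> q1) * K2"
      by (intro mult_right_mono ennreal_leI ec) simp
    finally show "Lq_log_norm T q1 G \<le> ennreal (embedding_const \<alpha> q1) * K2" .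
    fix \<tau> assume \<tau>: "0 < \<tau>" "\<tau> \<le> T"
    have "G \<tau> \<le> ennreal (\<tau> powr (- \<alpha>)) * (ennreal (embedding_const \<alpha> q1 * (\<tau> / 2) powr \<alpha>) * K2)"
      unfolding G_def F_def using \<tau> by (intro mult_left_mono modulus2_X_power) auto
    also have "\<dots> = ennreal (\<tau> powr (- \<alpha>) * (embedding_const \<alpha> q1 * (\<tau> / 2) powr \<alpha>)) * K2"
      using ec by (simp add: ennreal_mult mult.assoc)
    also have "\<dots> \<le> ennreal (embedding_const \<alpha> q1) * K2"
    proof (intro mult_right_mono ennreal_leI)
      have "(\<tau> / 2) powr \<alpha> \<le> \<tau> powr \<alpha>" using \<tau> \<alpha> by (intro powr_mono2) auto
      then have "\<tau> powr (- \<alpha>) * (embedding_const \<alpha> q1 * (\<tau> / 2) powr \<alpha>) \<le> \<tau> powr (- \<alpha>) * (embedding_const \<alpha> q1 * \<tau> powr \<alpha>)"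
        using ec by (intro mult_left_mono) auto
      also have "\<dots> = embedding_const \<alpha> q1" using \<tau> by (simp add: powr_minus)
      finally show "\<tau> powr (- \<alpha>) * (embedding_const \<alpha> q1 * (\<tau> / 2) powr \<alpha>) \<le> embedding_const \<alpha> q1" .
    qed simp
    finally show "G \<tau> \<le> ennreal (embedding_const \<alpha> q1) * K2" .
  qed simp_all
  define B where "B = ennreal c * k"
  have le: "ennreal (\<tau> powr (- \<alpha>)) * modulus2 T m \<beta> (delta1 I) \<tau>
      \<le> 2 * (ennreal a * G \<tau> + B * ennreal (\<tau> powr e))" if \<tau>: "0 < \<tau>" "\<tau> \<le> T" for \<tau>
  proof -
    have "modulus2 T m \<beta> (delta1 I) \<tau> \<le> 2 * (ennreal a * F (\<tau> / 2) + ennreal (c * \<tau> powr (\<alpha> + e)) * k)"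
    proof (rule modulus2_doubling[OF \<beta>])
      fix h assume h: "0 < h" "h \<le> \<tau> / 2" "h \<le> T / 2"
      have "path_norm m \<beta> (T - h) (\<lambda>r. D r (r + h)) \<le> ennreal a * F h + ennreal (c * h powr (\<alpha> + e)) * k"
        unfolding F_def using h by (intro step)
      also have "\<dots> \<le> ennreal a * F (\<tau> / 2) + ennreal (c * \<tau> powr (\<alpha> + e)) * k"
        using h \<alpha> e c by (intro add_mono mult_left_mono mult_right_mono ennreal_leI monoD[OF mF] powr_mono2) auto
      finally show "path_norm m \<beta> (T - h) (\<lambda>r. D r (r + h)) \<le> ennreal a * F (\<tau> / 2) + ennreal (c * \<tau> powr (\<alpha> + e)) * k" .
    qed
    then have "ennreal (\<tau> powr (- \<alpha>)) * modulus2 T m \<beta> (delta1 I) \<tau>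
        \<le> ennreal (\<tau> powr (- \<alpha>)) * (2 * (ennreal a * F (\<tau> / 2) + ennreal (c * \<tau> powr (\<alpha> + e)) * k))"
      by (intro mult_left_mono) auto
    also have "\<dots> = 2 * (ennreal a * G \<tau> + (ennreal (\<tau> powr (- \<alpha>)) * ennreal (c * \<tau> powr (\<alpha> + e))) * k)"
      by (simp add: G_def ring_distribs mult_ac)
    also have "ennreal (\<tau> powr (- \<alpha>)) * ennreal (c * \<tau> powr (\<alpha> + e)) = ennreal (c * \<tau> powr e)"
      using \<tau> c by (simp add: ennreal_mult[symmetric] powr_add powr_minus)
    also have "\<dots> * k = B * ennreal (\<tau> powr e)"
      using c by (simp add: B_def ennreal_mult mult_ac)
    finally show ?thesis .
  qed
  have "besov_seminorm T m \<alpha> \<beta> ?q I \<le> Lq_log_norm T ?q (\<lambda>\<tau>. 2 * (ennreal a * G \<tau> + B * ennreal (\<tau> powr e)))"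
    unfolding besov_seminorm_def besov2_norm_def by (intro Lq_log_norm_mono q' le) simp_all
  also have "\<dots> \<le> 2 * Lq_log_norm T ?q (\<lambda>\<tau>. ennreal a * G \<tau> + B * ennreal (\<tau> powr e))"
    by (intro Lq_log_norm_cmult_le q') simp
  also have "\<dots> \<le> 2 * (ennreal (sum_const (max q1 q2)) * (Lq_log_norm T ?q (\<lambda>\<tau>. ennreal a * G \<tau>) + Lq_log_norm T ?q (\<lambda>\<tau>. B * ennreal (\<tau> powr e))))"
    unfolding sum_const_def by (intro mult_left_mono Lq_log_norm_add_le q') simp_all
  also have "\<dots> \<le> 2 * (ennreal (sum_const (max q1 q2)) * (ennreal a * (ennreal (embedding_const \<alpha> q1) * K2) + B * ennreal (power_const e ?q * T powr e)))"
  proof (intro mult_left_mono add_mono)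
    have "Lq_log_norm T ?q (\<lambda>\<tau>. ennreal a * G \<tau>) \<le> ennreal a * Lq_log_norm T ?q G"
      by (intro Lq_log_norm_cmult_le q') simp
    also have "\<dots> \<le> ennreal a * (ennreal (embedding_const \<alpha> q1) * K2)"
      by (intro mult_left_mono G1) simp
    finally show "Lq_log_norm T ?q (\<lambda>\<tau>. ennreal a * G \<tau>) \<le> ennreal a * (ennreal (embedding_const \<alpha> q1) * K2)" .
    have "Lq_log_norm T ?q (\<lambda>\<tau>. B * ennreal (\<tau> powr e)) \<le> B * Lq_log_norm T ?q (\<lambda>\<tau>. ennreal (\<tau> powr e))"
      by (intro Lq_log_norm_cmult_le q') simp
    also have "\<dots> \<le> B * ennreal (power_const e ?q * T powr e)"
      by (intro mult_left_mono Lq_log_norm_powr_le q' e T) simp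
    finally show "Lq_log_norm T ?q (\<lambda>\<tau>. B * ennreal (\<tau> powr e)) \<le> B * ennreal (power_const e ?q * T powr e)" .
  qed simp_all
  also have "\<dots> = ennreal (2 * sum_const (max q1 q2)) * (ennreal (a * embedding_const \<alpha> q1) * K2 + ennreal (c * power_const e ?q * T powr e) * k)"
  proof -
    have pc: "0 \<le> power_const e ?q" by (simp add: power_const_def)
    have s: "0 \<le> sum_const (max q1 q2)" by (simp add: sum_const_def)
    have "ennreal (c * power_const e ?q * T powr e) = ennreal c * ennreal (power_const e ?q * T powr e)"
      using pc c by (simp add: ennreal_mult mult.assoc)
    moreover have "ennreal (2 * sum_const (max q1 q2)) = 2 * ennreal (sum_const (max q1 q2))"
      using s by (simp add: ennreal_mult)
    moreover have "ennreal (a * embedding_const \<alpha> q1) = ennreal a * ennreal (embedding_const \<alpha> q1)"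
      using a ec by (simp add: ennreal_mult)
    ultimately show ?thesis by (simp add: B_def mult_ac)
  qed
  finally show ?thesis .
qed

lemma path_norm_D_compare:
  assumes \<beta>': "0 < \<beta>" "\<beta> \<le> \<beta>1" "\<beta> \<le> \<beta>2" and h: "0 \<le> h" "h \<le> T"
  shows "path_norm m \<beta> (T - h) (\<lambda>r. D r (r + h))
    \<le> ennreal (compare_factor \<beta> \<beta>1 T) * modulus2 T m \<beta>1 X h + ennreal (compare_factor \<beta> \<beta>2 T) * S h"
proof -
  interpret seminorm_on "path_norm m \<beta> l" measurable_paths for l
    by (rule path_norm_seminorm[OF \<beta>'(1)])
  have "(\<lambda>r. D r (r + h)) = (\<lambda>r. clip2 T m X r (r + h)) + (\<lambda>r. E r (r + h))"
    by (simp add: fun_eq_iff D_eq)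
  then have "path_norm m \<beta> (T - h) (\<lambda>r. D r (r + h))
      \<le> path_norm m \<beta> (T - h) (\<lambda>r. clip2 T m X r (r + h)) + path_norm m \<beta> (T - h) (\<lambda>r. E r (r + h))"
    using triangle[OF X_path E_path'] by simp
  also have "\<dots> \<le> ennreal (compare_factor \<beta> \<beta>1 T) * path_norm m \<beta>1 (T - h) (\<lambda>r. clip2 T m X r (r + h))
      + ennreal (compare_factor \<beta> \<beta>2 T) * path_norm m \<beta>2 (T - h) (\<lambda>r. E r (r + h))"
    unfolding path_norm_def using \<beta>' h T
    by (intro add_mono compare_factor(2) measurable_paths_vec_norm X_path E_path') (auto intro!: ennreal_leI)
  also have "\<dots> \<le> ennreal (compare_factor \<beta> \<beta>1 T) * modulus2 T m \<beta>1 (clip2 T m X) h + ennreal (compare_factor \<beta> \<beta>2 T) * S h"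
    using h by (intro add_mono mult_left_mono path_norm_le_modulus2 E_bound) auto
  finally show ?thesis by (simp only: modulus2_clip)
qed

lemma besov_seminorm_sewn:
  fixes \<beta> c :: real
  defines "\<beta> \<equiv> min \<beta>1 \<beta>2"
    and "c \<equiv> 2 * sum_const (max q1 q2) * max (compare_factor (min \<beta>1 \<beta>2) \<beta>1 T * embedding_const \<alpha> q1)
      (compare_factor (min \<beta>1 \<beta>2) \<beta>2 T * sewn_const \<gamma> q2 * power_const (\<gamma> - \<alpha>) (max q1 q2) * T powr (\<gamma> - \<alpha>))"
  shows "besov_seminorm T m \<alpha> \<beta> (max q1 q2) I \<le> ennreal c * (K2 + K3)"
proof -
  have b: "0 < \<beta>" "\<beta> \<le> \<beta>1" "\<beta> \<le> \<beta>2" using \<beta> by (auto simp: \<beta>_def)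
  have cf: "1 \<le> compare_factor \<beta> \<beta>1 T" "1 \<le> compare_factor \<beta> \<beta>2 T"
    using b T by (auto intro: compare_factor(1))
  have sc: "0 < sewn_const \<gamma> q2" by (rule sewn_const_pos[OF \<gamma>])
  let ?x = "compare_factor \<beta> \<beta>1 T * embedding_const \<alpha> q1"
  let ?y = "compare_factor \<beta> \<beta>2 T * sewn_const \<gamma> q2 * power_const (\<gamma> - \<alpha>) (max q1 q2) * T powr (\<gamma> - \<alpha>)"
  have "besov_seminorm T m \<alpha> \<beta> (max q1 q2) I
    \<le> ennreal (2 * sum_const (max q1 q2)) * (ennreal ?x * K2 + ennreal ?y * K3)"
  proof (rule besov_seminorm_bound[OF b(1)])
    fix h assume h: "0 < h" "h \<le> T / 2"
    have "path_norm m \<beta> (T - h) (\<lambda>r. D r (r + h))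
        \<le> ennreal (compare_factor \<beta> \<beta>1 T) * modulus2 T m \<beta>1 X h + ennreal (compare_factor \<beta> \<beta>2 T) * S h"
      using h T by (intro path_norm_D_compare b) auto
    also have "\<dots> \<le> ennreal (compare_factor \<beta> \<beta>1 T) * modulus2 T m \<beta>1 X h
        + ennreal (compare_factor \<beta> \<beta>2 T) * (ennreal (sewn_const \<gamma> q2 * h powr \<gamma>) * K3)"
      using h T by (intro add_left_mono mult_left_mono S_power) auto
    also have "ennreal (compare_factor \<beta> \<beta>2 T) * (ennreal (sewn_const \<gamma> q2 * h powr \<gamma>) * K3)
        = ennreal (compare_factor \<beta> \<beta>2 T * sewn_const \<gamma> q2 * h powr (\<alpha> + (\<gamma> - \<alpha>))) * K3"
      using cf sc by (simp add: ennreal_mult mult.assoc)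
    finally show "path_norm m \<beta> (T - h) (\<lambda>r. D r (r + h)) \<le> ennreal (compare_factor \<beta> \<beta>1 T) * modulus2 T m \<beta>1 X h
        + ennreal (compare_factor \<beta> \<beta>2 T * sewn_const \<gamma> q2 * h powr (\<alpha> + (\<gamma> - \<alpha>))) * K3" .
  qed (use cf sc \<alpha> \<gamma> in auto)
  also have "\<dots> \<le> ennreal (2 * sum_const (max q1 q2)) * (ennreal (max ?x ?y) * K2 + ennreal (max ?x ?y) * K3)"
    by (intro mult_left_mono add_mono mult_right_mono ennreal_leI) auto
  also have "\<dots> = ennreal c * (K2 + K3)"
  proof -
    have "0 \<le> ?x" using cf embedding_const_ge_1[of \<alpha> q1] \<alpha> by simp
    then have "ennreal c = ennreal (2 * sum_const (max q1 q2)) * ennreal (max ?x ?y)"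
      unfolding c_def \<beta>_def[symmetric] by (intro ennreal_mult) (auto simp: sum_const_def)
    then show ?thesis by (simp add: ring_distribs mult.assoc)
  qed
  finally show ?thesis .
qed

lemma vec_norm_cocycle:
  "vec_norm m (D s t) \<le> vec_norm m (D s u) + vec_norm m (D u t)"
  "vec_norm m (D s u) \<le> vec_norm m (D s t) + vec_norm m (D u t)"
  "vec_norm m (D u t) \<le> vec_norm m (D s t) + vec_norm m (D s u)"
proof -
  have "D s t = D s u + D u t" "D s u = D s t - D u t" "D u t = D s t - D s u"
    by (simp_all add: delta1_def fun_eq_iff)
  then show "vec_norm m (D s t) \<le> vec_norm m (D s u) + vec_norm m (D u t)"
    "vec_norm m (D s u) \<le> vec_norm m (D s t) + vec_norm m (D u t)"
    "vec_norm m (D u t) \<le> vec_norm m (D s t) + vec_norm m (D s u)"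
    by (metis vec_norm_triangle vec_norm_diff_triangle)+
qed

text \<open>Increments of a path are exactly additive, so the averaging argument applies with
  \<open>M = 0\<close>. The choice \<open>p = 2 / \<alpha>\<close> leaves half of the exponent
  \<open>\<alpha>\<close> as Hoelder exponent between good points.\<close>

lemma continuous_sewn:
  obtains J where "vec_continuous_on m {0..T} J" "L0_1_eq T m J I" "J \<in> L0_1 T m"
proof -
  define \<beta> where "\<beta> = min \<beta>1 \<beta>2"
  have b: "0 < \<beta>" "\<beta> \<le> \<beta>1" "\<beta> \<le> \<beta>2" using \<beta> by (auto simp: \<beta>_def)
  define p where "p = 2 / \<alpha>"
  have p: "1 \<le> p" "\<alpha> - 1 / p = \<alpha> / 2" using \<alpha> by (auto simp: p_def field_simps)
  define a c where "a = compare_factor \<beta> \<beta>1 T * embedding_const \<alpha> q1" and "c = compare_factor \<beta> \<beta>2 T * sewn_const \<gamma> q2 * T powr (\<gamma> - \<alpha>)"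
  have cf: "1 \<le> compare_factor \<beta> \<beta>1 T" "1 \<le> compare_factor \<beta> \<beta>2 T"
    using b T by (auto intro: compare_factor(1))
  have sc: "0 < sewn_const \<gamma> q2" by (rule sewn_const_pos[OF \<gamma>])
  have ec: "1 \<le> embedding_const \<alpha> q1" using \<alpha> by (intro embedding_const_ge_1) simp
  have ac: "0 \<le> a" "0 \<le> c" using cf ec sc by (auto simp: a_def c_def)
  define C where "C = enn2real (ennreal a * K2 + ennreal c * K3)"
  have C: "ennreal a * K2 + ennreal c * K3 = ennreal C" "0 \<le> C"
    using K2_finite K3_finite by (auto simp: C_def ennreal_mult_less_top)
  have N: "path_norm m \<beta> (T - h) (\<lambda>r. D r (r + h)) \<le> ennreal (C * \<epsilon> powr \<alpha>)"
    if h: "0 \<le> h" "h \<le> \<epsilon>" "0 < \<epsilon>" "\<epsilon> \<le> 3 * T / 4" for h \<epsilon>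
  proof -
    have "path_norm m \<beta> (T - h) (\<lambda>r. D r (r + h))
        \<le> ennreal (compare_factor \<beta> \<beta>1 T) * modulus2 T m \<beta>1 X h + ennreal (compare_factor \<beta> \<beta>2 T) * S h"
      using h T by (intro path_norm_D_compare b) auto
    also have "\<dots> \<le> ennreal (compare_factor \<beta> \<beta>1 T) * modulus2 T m \<beta>1 X \<epsilon> + ennreal (compare_factor \<beta> \<beta>2 T) * S \<epsilon>"
      using h by (intro add_mono mult_left_mono monoD[OF mono_S] monoD[OF mono_modulus2]) auto
    also have "\<dots> \<le> ennreal (compare_factor \<beta> \<beta>1 T) * (ennreal (embedding_const \<alpha> q1 * \<epsilon> powr \<alpha>) * K2)
        + ennreal (compare_factor \<beta> \<beta>2 T) * (ennreal (sewn_const \<gamma> q2 * \<epsilon> powr \<gamma>) * K3)"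
      using h by (intro add_mono mult_left_mono S_power modulus2_X_power) auto
    also have "\<dots> \<le> ennreal (compare_factor \<beta> \<beta>1 T) * (ennreal (embedding_const \<alpha> q1 * \<epsilon> powr \<alpha>) * K2)
        + ennreal (compare_factor \<beta> \<beta>2 T) * (ennreal (sewn_const \<gamma> q2 * (T powr (\<gamma> - \<alpha>) * \<epsilon> powr \<alpha>)) * K3)"
    proof (intro add_left_mono mult_left_mono mult_right_mono ennreal_leI)
      have "\<epsilon> powr \<gamma> = \<epsilon> powr (\<gamma> - \<alpha>) * \<epsilon> powr \<alpha>" by (simp add: powr_add[symmetric])
      also have "\<dots> \<le> T powr (\<gamma> - \<alpha>) * \<epsilon> powr \<alpha>"
        using h T \<alpha> \<gamma> by (intro mult_right_mono powr_mono2) auto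
      finally show "\<epsilon> powr \<gamma> \<le> T powr (\<gamma> - \<alpha>) * \<epsilon> powr \<alpha>" .
    qed (use sc in simp_all)
    also have "\<dots> = (ennreal a * K2 + ennreal c * K3) * ennreal (\<epsilon> powr \<alpha>)"
      using cf ec sc by (simp add: a_def c_def ennreal_mult ring_distribs mult_ac)
    also have "\<dots> = ennreal (C * \<epsilon> powr \<alpha>)"
      using C by (simp add: ennreal_mult)
    finally show ?thesis .
  qed
  have Dm: "(\<lambda>r. vec_norm m (D r (r + h))) \<in> borel_measurable borel" for h by measurable
  interpret mean_bounded T "\<alpha> - 1 / p" 0 "mean_factor \<beta> p T * C" "\<lambda>s t. vec_norm m (D s t)"
  proof
    show "0 < T" by (rule T)
    show "0 < \<alpha> - 1 / p" using p \<alpha> by simp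
    show "0 \<le> mean_factor \<beta> p T * C" using mean_factor_ge_1[OF b(1) p(1) T] C by simp
    have "(\<lambda>x. vec_norm m (D (fst x) (snd x))) \<in> borel_measurable (borel \<Otimes>\<^sub>M borel)" by measurable
    then show "(\<lambda>(s, t). vec_norm m (D s t)) \<in> borel_measurable (borel \<Otimes>\<^sub>M borel)"
      by (simp add: split_beta')
    show "(\<integral>\<^sup>+r\<in>{a..a + \<epsilon> - h}. ennreal (vec_norm m (D r (r + h))) \<partial>lborel) \<le> ennreal (mean_factor \<beta> p T * C * \<epsilon> powr (1 + (\<alpha> - 1 / p)))"
      if "0 < \<epsilon>" "\<epsilon> \<le> 3 * T / 4" "0 \<le> h" "h \<le> \<epsilon>" "0 \<le> a" "a + \<epsilon> \<le> T" for \<epsilon> h a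
      using that by (intro orlicz_mean_window[OF b(1) p(1) _ _ _ _ _ _ C(2) Dm] N[unfolded path_norm_def]) auto
    let ?L = "((1 + fst (mean_consts \<beta> p)) * T + snd (mean_consts \<beta> p)) * C * T powr (1 / p)"
    have "(\<integral>\<^sup>+r\<in>{0..T - h}. ennreal (vec_norm m (D r (r + h))) \<partial>lborel) \<le> ennreal (?L * h powr (\<alpha> - 1 / p))"
      if "0 < h \<and> h \<le> T / 2" for h
      using that T by (intro orlicz_mean_global[OF b(1) p(1) T _ _ C(2) Dm] N[unfolded path_norm_def]) auto
    moreover have "0 \<le> ?L"
      using mean_consts(1,2)[OF b(1) p(1)] T C by simp
    ultimately show "\<exists>L'\<ge>0. \<forall>h. 0 < h \<and> h \<le> T / 2 \<longrightarrow>
        (\<integral>\<^sup>+r\<in>{0..T - h}. ennreal (vec_norm m (D r (r + h))) \<partial>lborel) \<le> ennreal (L' * h powr (\<alpha> - 1 / p))"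
      by blast
  qed (use vec_norm_cocycle in auto)
  have good: "good \<subseteq> {0..T}" using goodD(1,2) by fastforce
  obtain J where "vec_continuous_on m {0..T} J" "L0_1_eq T m J (clip1 T m I)" "J \<in> L0_1 T m"
  proof (rule continuous_version[OF AE_good good T])
    show "0 < \<alpha> - 1 / p" using p \<alpha> by simp
    show "0 \<le> (16 * decay + 33) * (mean_factor \<beta> p T * C + 0)"
    proof -
      have "1 \<le> decay" by (rule decay_ge_1)
      then show ?thesis using mean_factor_ge_1[OF b(1) p(1) T] C by simp
    qed
    fix s t assume st: "s \<in> good" "t \<in> good" "s < t"
    have "clip1 T m I t - clip1 T m I s = D s t" by (simp add: delta1_def fun_eq_iff)
    then show "vec_norm m (clip1 T m I t - clip1 T m I s) \<le> (16 * decay + 33) * (mean_factor \<beta> p T * C + 0) * (t - s) powr (\<alpha> - 1 / p)"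
      using good_bound[OF st] by simp
  qed
  moreover from this have "L0_1_eq T m J I"
    unfolding L0_1_eq_def by (auto elim!: eventually_mono simp: vec_eq_def clip1_def)
  ultimately show thesis using that by blast
qed

end

subsection \<open>Hoelder bounds for the remainder\<close>

definition admissible_interpolation_const :: "real \<Rightarrow> real \<Rightarrow> real \<Rightarrow> bool" where
  "admissible_interpolation_const \<beta>2 \<beta>1 A \<longleftrightarrow> 1 \<le> A \<and>
    (\<forall>D d g s \<mu>. D \<in> sets borel \<and> emeasure lborel D \<le> ennreal d \<and> 0 \<le> d \<and> g \<in> borel_measurable borel \<and> (\<forall>r. 0 \<le> g r) \<and>
        0 < s \<and> (AE r in lborel. r \<in> D \<longrightarrow> g r \<le> s) \<and> 0 < \<mu> \<and> orlicz_norm \<beta>2 D g \<le> ennreal \<mu>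
      \<longrightarrow> orlicz_norm \<beta>1 D g \<le> ennreal ((A * d + 1) * (2 * \<mu> powr (\<beta>2 / \<beta>1) * s powr (1 - \<beta>2 / \<beta>1))))"

definition interpolation_const :: "real \<Rightarrow> real \<Rightarrow> real" where
  "interpolation_const \<beta>2 \<beta>1 = (SOME A. admissible_interpolation_const \<beta>2 \<beta>1 A)"

lemma admissible_interpolation_const:
  assumes "0 < \<beta>2" "\<beta>2 < \<beta>1"
  shows "admissible_interpolation_const \<beta>2 \<beta>1 (interpolation_const \<beta>2 \<beta>1)"
  unfolding interpolation_const_def
proof (rule someI_ex, rule orlicz_norm_interpolation[OF assms], goal_cases)
  case (1 A)
  have "admissible_interpolation_const \<beta>2 \<beta>1 A"
    unfolding admissible_interpolation_const_def by (intro conjI allI impI 1) simp_all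
  then show ?case ..
qed

lemma interpolation_const:
  assumes "0 < \<beta>2" "\<beta>2 < \<beta>1"
  shows "1 \<le> interpolation_const \<beta>2 \<beta>1"
    "\<lbrakk>D \<in> sets borel; emeasure lborel D \<le> ennreal d; 0 \<le> d; g \<in> borel_measurable borel; \<And>r. 0 \<le> g r;
        0 < s; AE r in lborel. r \<in> D \<longrightarrow> g r \<le> s; 0 < \<mu>; orlicz_norm \<beta>2 D g \<le> ennreal \<mu>\<rbrakk>
      \<Longrightarrow> orlicz_norm \<beta>1 D g \<le> ennreal ((interpolation_const \<beta>2 \<beta>1 * d + 1) * (2 * \<mu> powr (\<beta>2 / \<beta>1) * s powr (1 - \<beta>2 / \<beta>1)))"
  using admissible_interpolation_const[OF assms] unfolding admissible_interpolation_const_def by (simp_all del: ennreal_plus)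

text \<open>The first factor is the constant of \<open>good_bound\<close> with \<open>decay\<close>
  written out for the exponent \<open>\<gamma> - 1 / p\<close>. The second bounds
  \<open>L + M\<close>: the mean factor and \<open>sewn_const\<close> multiply the norm of
  \<open>delta2 X\<close>, and the \<open>1\<close> belongs to \<open>M\<close>.\<close>

definition hoelder_const :: "real \<Rightarrow> real \<Rightarrow> real \<Rightarrow> ennreal \<Rightarrow> real \<Rightarrow> real" where
  "hoelder_const \<gamma> \<beta>2 p q2 T =
     (16 * (1 / (1 - 2 powr (- (\<gamma> - 1 / p)))) + 33) * (mean_factor \<beta>2 p T * sewn_const \<gamma> q2 + 1)"

lemma hoelder_const_pos:
  assumes "1 < \<gamma>" "0 < \<beta>2" "1 \<le> p" "0 < T"
  shows "0 < hoelder_const \<gamma> \<beta>2 p q2 T"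
proof -
  have "1 / p \<le> 1" using assms by simp
  then have "2 powr (- (\<gamma> - 1 / p)) < (2 :: real) powr 0" using assms(1) by (intro powr_less_mono) linarith+
  then have "0 < 1 / (1 - 2 powr (- (\<gamma> - 1 / p)))" by simp
  moreover have "0 < mean_factor \<beta>2 p T * sewn_const \<gamma> q2"
    using mean_factor_ge_1[OF assms(2-4)] sewn_const_pos[OF assms(1), of q2] by simp
  ultimately show ?thesis unfolding hoelder_const_def by (intro mult_pos_pos) linarith+
qed

text \<open>\<open>T\<close> enters only through \<open>mean_factor\<close>, which is affine in
  \<open>T\<close> with a positive slope.\<close>

lemma hoelder_const_mono:
  assumes "1 < \<gamma>" "0 < \<beta>2" "1 \<le> p" "T \<le> T'"
  shows "hoelder_const \<gamma> \<beta>2 p q2 T \<le> hoelder_const \<gamma> \<beta>2 p q2 T'"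
proof -
  have "1 / p \<le> 1" using assms by simp
  then have "2 powr (- (\<gamma> - 1 / p)) < (2 :: real) powr 0" using assms(1) by (intro powr_less_mono) linarith+
  then have "0 \<le> 16 * (1 / (1 - 2 powr (- (\<gamma> - 1 / p)))) + 33" by simp
  moreover have "mean_factor \<beta>2 p T * sewn_const \<gamma> q2 \<le> mean_factor \<beta>2 p T' * sewn_const \<gamma> q2"
    using sewn_const_pos[OF assms(1), of q2] by (intro mult_right_mono mean_factor_mono assms) auto
  ultimately show ?thesis unfolding hoelder_const_def by (intro mult_left_mono add_right_mono)
qed

definition interpolated_const :: "real \<Rightarrow> real \<Rightarrow> real \<Rightarrow> real \<Rightarrow> ennreal \<Rightarrow> real \<Rightarrow> real" where
  "interpolated_const \<gamma> \<beta>1 \<beta>2 p q2 T = (interpolation_const \<beta>2 \<beta>1 * T + 1) *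
     (2 * sewn_const \<gamma> q2 powr (\<beta>2 / \<beta>1) * hoelder_const \<gamma> \<beta>2 p q2 T powr (1 - \<beta>2 / \<beta>1))"

lemma interpolated_const_mono:
  assumes "1 < \<gamma>" "0 < \<beta>2" "\<beta>2 < \<beta>1" "1 \<le> p" "0 < T" "T \<le> T'"
  shows "interpolated_const \<gamma> \<beta>1 \<beta>2 p q2 T \<le> interpolated_const \<gamma> \<beta>1 \<beta>2 p q2 T'"
  unfolding interpolated_const_def
  using assms interpolation_const(1)[OF assms(2,3)] hoelder_const_pos[OF assms(1,2,4,5), of q2]
  by (intro mult_mono mult_left_mono powr_mono2 hoelder_const_mono add_right_mono) (auto simp: field_simps)

lemma mult_powr_le:
  fixes x y d :: real
  assumes "0 \<le> x" "0 \<le> y" "x \<le> d" "y \<le> d" "0 \<le> \<rho>" "\<rho> \<le> 1"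
  shows "x powr \<rho> * y powr (1 - \<rho>) \<le> d"
proof -
  have "x powr \<rho> * y powr (1 - \<rho>) \<le> d powr \<rho> * d powr (1 - \<rho>)"
    using assms by (intro mult_mono powr_mono2) auto
  also have "\<dots> = d" using assms by (simp add: powr_add[symmetric])
  finally show ?thesis .
qed

locale pointwise_sewn = sewn +
  fixes \<rho> M p :: real
  assumes \<rho>: "0 < \<rho>" "\<rho> \<le> 1 / 2" and M: "0 < M" and p: "1 \<le> p"
    and bound: "pointwise_bound T m \<rho> M (\<gamma> - 1 / p) X"
begin

definition \<kappa> :: real where "\<kappa> = \<gamma> - 1 / p"

definition k3 :: real where "k3 = enn2real K3"

lemma k3: "K3 = ennreal k3" "0 \<le> k3"
  using K3_finite by (auto simp: k3_def)

lemma kappa: "0 < \<kappa>"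
proof -
  have "1 / p \<le> 1" using p by simp
  then show ?thesis using \<gamma> by (simp add: \<kappa>_def)
qed

text \<open>The first form provides the defect in the almost triangle inequalities. The second
  retains a positive power of the shorter leg, so the defect is small as soon as one leg is short;
  the continuous extension to pairs rests on this and on \<open>\<rho> > 0\<close>.\<close>

lemma delta_X_bound:
  assumes "0 \<le> s" "s \<le> u" "u \<le> t" "t \<le> T"
  shows "vec_norm m (delta2 X s u t) \<le> M * (t - s) powr \<kappa>"
    "vec_norm m (delta2 X s u t) \<le> M * T powr ((1 - \<rho>) * \<kappa>) * min (u - s) (t - u) powr (\<rho> * \<kappa>)"
proof -
  define x y where "x = min (u - s) (t - u)" and "y = max (u - s) (t - u)"
  have xy: "0 \<le> x" "0 \<le> y" "x \<le> t - s" "y \<le> t - s" "y \<le> T" using assms by (auto simp: x_def y_def)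
  have *: "vec_norm m (delta2 X s u t) \<le> M * (x powr \<rho> * y powr (1 - \<rho>)) powr \<kappa>"
    using bound assms by (auto simp: pointwise_bound_def triangle3_def x_def y_def \<kappa>_def)
  also have "\<dots> \<le> M * (t - s) powr \<kappa>"
    using M xy \<rho> kappa by (intro mult_left_mono powr_mono2 mult_powr_le) auto
  finally show "vec_norm m (delta2 X s u t) \<le> M * (t - s) powr \<kappa>" .
  note *
  also have "(x powr \<rho> * y powr (1 - \<rho>)) powr \<kappa> = x powr (\<rho> * \<kappa>) * y powr ((1 - \<rho>) * \<kappa>)"
    by (simp add: powr_mult powr_powr)
  also have "M * \<dots> \<le> M * (x powr (\<rho> * \<kappa>) * T powr ((1 - \<rho>) * \<kappa>))"
    using M xy \<rho> kappa by (intro mult_left_mono powr_mono2) auto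
  finally show "vec_norm m (delta2 X s u t) \<le> M * T powr ((1 - \<rho>) * \<kappa>) * min (u - s) (t - u) powr (\<rho> * \<kappa>)"
    by (simp add: x_def mult_ac)
qed

text \<open>At three equal times \<open>delta2 X\<close> is \<open>- X\<close>, and the pointwise
  bound is \<open>0\<close> there.\<close>

lemma X_diagonal:
  assumes "0 \<le> s" "s \<le> T" "i < m"
  shows "X s s i = 0"
proof -
  have "vec_norm m (delta2 X s s s) \<le> 0"
    using delta_X_bound(1)[of s s s] assms by simp
  then have "vec_norm m (delta2 X s s s) = 0"
    by (intro antisym) auto
  then show ?thesis using assms by (simp add: vec_norm_eq_0_iff delta2_def)
qed

lemma E_diagonal: "E s s = 0"
  using X_diagonal by (auto simp: E_def clip2_def fun_eq_iff)

lemma E_cocycle: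
  assumes "0 \<le> s" "s \<le> u" "u \<le> t" "t \<le> T" "i < m"
  shows "E s t i = E s u i + E u t i - delta2 X s u t i"
  using assms by (simp add: E_def clip2_def delta2_def)

lemma E_bound':
  assumes "0 \<le> h" "h \<le> \<epsilon>" "0 < \<epsilon>" "\<epsilon> \<le> 3 * T / 4"
  shows "path_norm m \<beta>2 (T - h) (\<lambda>r. E r (r + h)) \<le> ennreal (sewn_const \<gamma> q2 * k3 * \<epsilon> powr \<gamma>)"
proof -
  have "path_norm m \<beta>2 (T - h) (\<lambda>r. E r (r + h)) \<le> S h" using assms by (intro E_bound) auto
  also have "S h \<le> S \<epsilon>" using assms by (intro monoD[OF mono_S])
  also have "S \<epsilon> \<le> ennreal (sewn_const \<gamma> q2 * \<epsilon> powr \<gamma>) * K3" using assms by (intro S_power)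
  also have "\<dots> = ennreal (sewn_const \<gamma> q2 * k3 * \<epsilon> powr \<gamma>)"
    using sewn_const_pos[OF \<gamma>, of q2] k3 by (simp add: ennreal_mult[symmetric] mult_ac)
  finally show ?thesis .
qed

text \<open>Increments of a path have no defect, so that of the remainder is
  \<open>- delta2 X\<close>. The three almost triangle inequalities result from solving one and the
  same relation for each of its terms.\<close>

sublocale mb: mean_bounded T \<kappa> M "mean_factor \<beta>2 p T * (sewn_const \<gamma> q2 * k3)" "\<lambda>s t. vec_norm m (E s t)"
proof
  have c: "0 \<le> sewn_const \<gamma> q2 * k3"
    using sewn_const_pos[OF \<gamma>, of q2] k3 by simp
  have Em: "(\<lambda>r. vec_norm m (E r (r + h))) \<in> borel_measurable borel" for h by measurable
  show "0 < T" "0 < \<kappa>" by (rule T kappa)+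
  show "0 \<le> M" using M by simp
  show "0 \<le> mean_factor \<beta>2 p T * (sewn_const \<gamma> q2 * k3)"
    using mean_factor_ge_1[OF \<beta>(2) p T] c by simp
  have "(\<lambda>x. vec_norm m (E (fst x) (snd x))) \<in> borel_measurable (borel \<Otimes>\<^sub>M borel)" by measurable
  then show "(\<lambda>(s, t). vec_norm m (E s t)) \<in> borel_measurable (borel \<Otimes>\<^sub>M borel)"
    by (simp add: split_beta')
  show "vec_norm m (E s t) \<le> vec_norm m (E s u) + vec_norm m (E u t) + M * (t - s) powr \<kappa>"
    and "vec_norm m (E s u) \<le> vec_norm m (E s t) + vec_norm m (E u t) + M * (t - s) powr \<kappa>"
    and "vec_norm m (E u t) \<le> vec_norm m (E s t) + vec_norm m (E s u) + M * (t - s) powr \<kappa>"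
    if st: "0 \<le> s" "s \<le> u" "u \<le> t" "t \<le> T" for s u t
  proof -
    note co = E_cocycle[OF st] and b = delta_X_bound(1)[OF st]
    have "vec_norm m (E s t) = vec_norm m ((E s u + E u t) - delta2 X s u t)"
      by (rule vec_norm_cong) (simp add: co)
    also have "\<dots> \<le> vec_norm m (E s u) + vec_norm m (E u t) + vec_norm m (delta2 X s u t)"
      by (intro order_trans[OF vec_norm_diff_triangle] add_right_mono vec_norm_triangle)
    finally show "vec_norm m (E s t) \<le> vec_norm m (E s u) + vec_norm m (E u t) + M * (t - s) powr \<kappa>"
      using b by simp
    have "vec_norm m (E s u) = vec_norm m ((E s t - E u t) + delta2 X s u t)"
      by (rule vec_norm_cong) (simp add: co)
    also have "\<dots> \<le> vec_norm m (E s t) + vec_norm m (E u t) + vec_norm m (delta2 X s u t)"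
      by (intro order_trans[OF vec_norm_triangle] add_right_mono vec_norm_diff_triangle)
    finally show "vec_norm m (E s u) \<le> vec_norm m (E s t) + vec_norm m (E u t) + M * (t - s) powr \<kappa>"
      using b by simp
    have "vec_norm m (E u t) = vec_norm m ((E s t - E s u) + delta2 X s u t)"
      by (rule vec_norm_cong) (simp add: co)
    also have "\<dots> \<le> vec_norm m (E s t) + vec_norm m (E s u) + vec_norm m (delta2 X s u t)"
      by (intro order_trans[OF vec_norm_triangle] add_right_mono vec_norm_diff_triangle)
    finally show "vec_norm m (E u t) \<le> vec_norm m (E s t) + vec_norm m (E s u) + M * (t - s) powr \<kappa>"
      using b by simp
  qed
  show "(\<integral>\<^sup>+r\<in>{a..a + \<epsilon> - h}. ennreal (vec_norm m (E r (r + h))) \<partial>lborel)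
      \<le> ennreal (mean_factor \<beta>2 p T * (sewn_const \<gamma> q2 * k3) * \<epsilon> powr (1 + \<kappa>))"
    if "0 < \<epsilon>" "\<epsilon> \<le> 3 * T / 4" "0 \<le> h" "h \<le> \<epsilon>" "0 \<le> a" "a + \<epsilon> \<le> T" for \<epsilon> h a
    unfolding \<kappa>_def using that
    by (intro orlicz_mean_window[OF \<beta>(2) p _ _ _ _ _ _ c Em] E_bound'[unfolded path_norm_def]) auto
  let ?L = "((1 + fst (mean_consts \<beta>2 p)) * T + snd (mean_consts \<beta>2 p)) * (sewn_const \<gamma> q2 * k3) * T powr (1 / p)"
  have "(\<integral>\<^sup>+r\<in>{0..T - h}. ennreal (vec_norm m (E r (r + h))) \<partial>lborel) \<le> ennreal (?L * h powr \<kappa>)"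
    if "0 < h \<and> h \<le> T / 2" for h
    unfolding \<kappa>_def using that T
    by (intro orlicz_mean_global[OF \<beta>(2) p T _ _ c Em] E_bound'[unfolded path_norm_def]) auto
  moreover have "0 \<le> ?L"
    using mean_consts(1,2)[OF \<beta>(2) p] T c by simp
  ultimately show "\<exists>L'\<ge>0. \<forall>h. 0 < h \<and> h \<le> T / 2 \<longrightarrow>
      (\<integral>\<^sup>+r\<in>{0..T - h}. ennreal (vec_norm m (E r (r + h))) \<partial>lborel) \<le> ennreal (L' * h powr \<kappa>)"
    by blast
qed simp

definition C :: real where "C = hoelder_const \<gamma> \<beta>2 p q2 T * (k3 + M)"

lemma C_pos: "0 < C"
  using hoelder_const_pos[OF \<gamma> \<beta>(2) p T, of q2] k3 M by (simp add: C_def)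

lemma E_good:
  assumes "s \<in> mb.good" "t \<in> mb.good" "s \<le> t"
  shows "vec_norm m (E s t) \<le> C * (t - s) powr \<kappa>"
proof (cases "s = t")
  case False
  then have "vec_norm m (E s t) \<le> (16 * mb.decay + 33) * (mean_factor \<beta>2 p T * (sewn_const \<gamma> q2 * k3) + M) * (t - s) powr \<kappa>"
    using assms by (intro mb.good_bound) auto
  also have "\<dots> \<le> (16 * mb.decay + 33) * ((mean_factor \<beta>2 p T * sewn_const \<gamma> q2 + 1) * (k3 + M)) * (t - s) powr \<kappa>"
  proof (intro mult_right_mono mult_left_mono)
    have "0 \<le> mean_factor \<beta>2 p T * sewn_const \<gamma> q2"
      using mean_factor_ge_1[OF \<beta>(2) p T] sewn_const_pos[OF \<gamma>, of q2] by simp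
    then have "0 \<le> mean_factor \<beta>2 p T * sewn_const \<gamma> q2 * M" using M by simp
    then show "mean_factor \<beta>2 p T * (sewn_const \<gamma> q2 * k3) + M \<le> (mean_factor \<beta>2 p T * sewn_const \<gamma> q2 + 1) * (k3 + M)"
      using k3 by (simp add: algebra_simps)
    show "0 \<le> 16 * mb.decay + 33" using mb.decay_ge_1 by simp
  qed simp
  also have "\<dots> = C * (t - s) powr \<kappa>"
    unfolding C_def hoelder_const_def mb.decay_def unfolding \<kappa>_def by (simp only: mult.assoc)
  finally show ?thesis .
qed (simp add: E_diagonal)

end

lemma AE_translate:
  fixes c T h :: real
  assumes "AE s in lborel. s \<in> {0..T} \<longrightarrow> P s" "0 \<le> h"
  shows "AE r in lborel. r \<in> {0..T - h} \<longrightarrow> P r \<and> P (r + h)"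
proof -
  from AE_lborel_affine_unit[OF _ assms(1), of 1 h]
  have "AE r in lborel. h + 1 * r \<in> {0..T} \<longrightarrow> P (h + 1 * r)" by simp
  with assms(1) show ?thesis
    by eventually_elim (use assms(2) in \<open>auto simp: add.commute\<close>)
qed

text \<open>Off the diagonal the two times are approximated closely enough to keep their order; on
  the diagonal one generic point approximates both.\<close>

lemma closure_of_almost_all_pairs:
  fixes G :: "real set"
  assumes ae: "AE s in lborel. s \<in> {0..T} \<longrightarrow> s \<in> G" and T: "0 < T"
  shows "triangle2 T \<subseteq> closure {(s, t). s \<in> G \<and> t \<in> G \<and> s \<le> t}"
proof
  fix x assume "x \<in> triangle2 T"
  then obtain s t where x: "x = (s, t)" and st: "0 \<le> s" "s \<le> t" "t \<le> T" by (auto simp: triangle2_def)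
  show "x \<in> closure {(s, t). s \<in> G \<and> t \<in> G \<and> s \<le> t}"
    unfolding closure_approachable
  proof (intro allI impI)
    fix e :: real assume e: "0 < e"
    have pick: "\<exists>y. y \<in> G \<and> \<bar>y - u\<bar> < d" if u: "0 \<le> u" "u \<le> T" "0 < d" for u d
    proof -
      obtain y where "max 0 (u - d) < y" "y < min T (u + d)" "y \<in> {0..T} \<longrightarrow> y \<in> G"
        by (rule mono_AE_point[OF ae, of "max 0 (u - d)" "min T (u + d)"]) (use u T in auto)
      then show ?thesis by (intro exI[of _ y]) auto
    qed
    have "\<exists>s' t'. s' \<in> G \<and> t' \<in> G \<and> s' \<le> t' \<and> \<bar>s' - s\<bar> < e / 2 \<and> \<bar>t' - t\<bar> < e / 2"
    proof (cases "s = t")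
      case True
      obtain y where "y \<in> G \<and> \<bar>y - s\<bar> < e / 2" using pick[of s "e / 2"] st e by auto
      then show ?thesis using True by blast
    next
      case False
      define d where "d = min (e / 2) ((t - s) / 2)"
      have d: "0 < d" using False st e by (simp add: d_def)
      have d': "d \<le> e / 2" "d \<le> (t - s) / 2" unfolding d_def by (rule min.cobounded1 min.cobounded2)+
      obtain s' t' where st': "s' \<in> G" "\<bar>s' - s\<bar> < d" "t' \<in> G" "\<bar>t' - t\<bar> < d"
        using pick[of s d] pick[of t d] st d by auto
      then have "s' < s + d" "t - d < t'" by auto
      then have "s' \<le> t'" using d' by (simp add: field_simps)
      moreover have "\<bar>s' - s\<bar> < e / 2" "\<bar>t' - t\<bar> < e / 2" using st' d'(1) by (auto intro: less_le_trans)
      ultimately have "s' \<le> t'" "\<bar>s' - s\<bar> < e / 2" "\<bar>t' - t\<bar> < e / 2" .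
      then show ?thesis using st' by blast
    qed
    then obtain s' t' where st': "s' \<in> G" "t' \<in> G" "s' \<le> t'" "\<bar>s' - s\<bar> < e / 2" "\<bar>t' - t\<bar> < e / 2" by blast
    have "dist (s', t') x \<le> dist s' s + dist t' t"
      unfolding x dist_prod_def by (simp add: sqrt_sum_squares_le_sum)
    also have "\<dots> < e" using st' by (simp add: dist_real_def)
    finally show "\<exists>y\<in>{(s, t). s \<in> G \<and> t \<in> G \<and> s \<le> t}. dist y x < e"
      using st' by (intro bexI[of _ "(s', t')"]) auto
  qed
qed

section \<open>The continuous version of the remainder and the interpolated bound\<close>

context pointwise_sewn
begin

definition good_pairs :: "(real \<times> real) set" where
  "good_pairs = {(s, t). s \<in> mb.good \<and> t \<in> mb.good \<and> s \<le> t}"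

lemma powr_split:
  assumes "0 \<le> x" "x \<le> d" "x \<le> T"
  shows "x powr \<kappa> \<le> T powr ((1 - \<rho>) * \<kappa>) * d powr (\<rho> * \<kappa>)"
proof -
  have "x powr \<kappa> = x powr ((1 - \<rho>) * \<kappa>) * x powr (\<rho> * \<kappa>)"
    by (simp add: powr_add[symmetric] algebra_simps)
  also have "\<dots> \<le> T powr ((1 - \<rho>) * \<kappa>) * d powr (\<rho> * \<kappa>)"
    using assms \<rho> kappa by (intro mult_mono powr_mono2) auto
  finally show ?thesis .
qed

text \<open>Enlarging the interval at its left and at its right end changes \<open>E\<close> by a
  short increment and a defect each. The increments are small by the bound between good points, the
  defects because one leg is at most \<open>d\<close>.\<close>

lemma E_modulus_nested:
  assumes G: "s1 \<in> mb.good" "s \<in> mb.good" "t \<in> mb.good" "t1 \<in> mb.good"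
    and le: "s1 \<le> s" "s \<le> t" "t \<le> t1" and d: "s - s1 \<le> d" "t1 - t \<le> d" and i: "i < m"
  shows "\<bar>E s1 t1 i - E s t i\<bar> \<le> 2 * (C + M) * T powr ((1 - \<rho>) * \<kappa>) * d powr (\<rho> * \<kappa>)"
proof -
  let ?B = "T powr ((1 - \<rho>) * \<kappa>) * d powr (\<rho> * \<kappa>)"
  have T1: "0 \<le> s1" "t1 \<le> T" using mb.goodD(1)[OF G(1)] mb.goodD(2)[OF G(4)] by auto
  have E: "\<bar>E u v i\<bar> \<le> C * ?B" if "u \<in> mb.good" "v \<in> mb.good" "u \<le> v" "v - u \<le> d" for u v
  proof -
    have "\<bar>E u v i\<bar> \<le> C * (v - u) powr \<kappa>"
      using vec_norm_component[OF i, of "E u v"] E_good[OF that(1-3)] by linarith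
    also have "\<dots> \<le> C * ?B"
      using C_pos that mb.goodD(1)[OF that(1)] mb.goodD(2)[OF that(2)] by (intro mult_left_mono powr_split) auto
    finally show ?thesis .
  qed
  have X: "\<bar>delta2 X u v w i\<bar> \<le> M * ?B" if "0 \<le> u" "u \<le> v" "v \<le> w" "w \<le> T" "min (v - u) (w - v) \<le> d" for u v w
  proof -
    have "\<bar>delta2 X u v w i\<bar> \<le> M * T powr ((1 - \<rho>) * \<kappa>) * min (v - u) (w - v) powr (\<rho> * \<kappa>)"
      using vec_norm_component[OF i, of "delta2 X u v w"] delta_X_bound(2)[OF that(1-4)] by linarith
    also have "\<dots> \<le> M * T powr ((1 - \<rho>) * \<kappa>) * d powr (\<rho> * \<kappa>)"
      using that M \<rho> kappa by (intro mult_left_mono powr_mono2) auto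
    finally show ?thesis by (simp add: mult.assoc)
  qed
  have e1: "E s1 t1 i = E s1 s i + E s t1 i - delta2 X s1 s t1 i"
    using le T1 i by (intro E_cocycle) auto
  have e2: "E s t1 i = E s t i + E t t1 i - delta2 X s t t1 i"
    using le T1 i by (intro E_cocycle) auto
  have "\<bar>E s1 s i\<bar> \<le> C * ?B" "\<bar>E t t1 i\<bar> \<le> C * ?B" using G le d by (auto intro: E)
  moreover have "\<bar>delta2 X s1 s t1 i\<bar> \<le> M * ?B" "\<bar>delta2 X s t t1 i\<bar> \<le> M * ?B"
    using le T1 d by (auto intro!: X)
  moreover have "2 * (C + M) * T powr ((1 - \<rho>) * \<kappa>) * d powr (\<rho> * \<kappa>) = C * ?B + C * ?B + M * ?B + M * ?B"
    by (simp add: algebra_simps)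
  ultimately show ?thesis using e1 e2 by linarith
qed

text \<open>Two intervals need not be nested, so both are compared with the interval they span,
  whose endpoints are again good. This doubles the constant.\<close>

lemma E_modulus:
  assumes "x \<in> good_pairs" "y \<in> good_pairs" and i: "i < m"
  shows "dist (E (fst x) (snd x) i) (E (fst y) (snd y) i) \<le> 4 * (C + M) * T powr ((1 - \<rho>) * \<kappa>) * dist x y powr (\<rho> * \<kappa>)"
proof -
  obtain s t s' t' where xy: "x = (s, t)" "y = (s', t')" by (cases x, cases y) auto
  have G: "s \<in> mb.good" "t \<in> mb.good" "s \<le> t" "s' \<in> mb.good" "t' \<in> mb.good" "s' \<le> t'"
    using assms by (auto simp: xy good_pairs_def)
  have d: "\<bar>s - s'\<bar> \<le> dist x y" "\<bar>t - t'\<bar> \<le> dist x y"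
    using dist_fst_le[of x y] dist_snd_le[of x y] by (auto simp: xy dist_real_def)
  have G1: "min s s' \<in> mb.good" "max t t' \<in> mb.good" using G by (auto simp: min_def max_def)
  let ?B = "2 * (C + M) * T powr ((1 - \<rho>) * \<kappa>) * dist x y powr (\<rho> * \<kappa>)"
  have "\<bar>E (min s s') (max t t') i - E s t i\<bar> \<le> ?B" "\<bar>E (min s s') (max t t') i - E s' t' i\<bar> \<le> ?B"
    using d by (intro E_modulus_nested G G1 i; auto)+
  then have "\<bar>E s t i - E s' t' i\<bar> \<le> ?B + ?B" by linarith
  then show ?thesis by (simp add: xy dist_real_def algebra_simps)
qed

text \<open>Uniform continuity extends the remainder from ordered pairs of good points to the closed
  triangle. The Hoelder bound is preserved because both of its sides are continuous on the
  closure.\<close>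

lemma remainder_version:
  obtains R where "vec_continuous_on m (triangle2 T) (\<lambda>(s, t). R s t)" "L0_2_eq T m R (sub2 (delta1 I) X)"
    "hoelder2_norm T m (\<gamma> - 1 / p) R \<le> ennreal C"
proof -
  have dense: "triangle2 T \<subseteq> closure good_pairs"
    unfolding good_pairs_def by (rule closure_of_almost_all_pairs[OF mb.AE_good T])
  have "\<exists>g. continuous_on (closure good_pairs) g \<and> (\<forall>x\<in>good_pairs. g x = E (fst x) (snd x) i)" if i: "i < m" for i
  proof -
    have "uniformly_continuous_on good_pairs (\<lambda>x. E (fst x) (snd x) i)"
    proof (rule hoelder_uniformly_continuous)
      show "0 < \<rho> * \<kappa>" using \<rho> kappa by simp
      show "0 \<le> 4 * (C + M) * T powr ((1 - \<rho>) * \<kappa>)" using C_pos M by simp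
    qed (rule E_modulus[OF _ _ i])
    from uniformly_continuous_on_extension_on_closure[OF this]
    obtain g where g: "uniformly_continuous_on (closure good_pairs) g" "\<And>x. x \<in> good_pairs \<Longrightarrow> E (fst x) (snd x) i = g x"
      by metis
    then show ?thesis using uniformly_continuous_imp_continuous[OF g(1)] by auto
  qed
  then obtain g where g: "\<And>i. i < m \<Longrightarrow> continuous_on (closure good_pairs) (g i)"
      "\<And>i x. i < m \<Longrightarrow> x \<in> good_pairs \<Longrightarrow> g i x = E (fst x) (snd x) i"
    by metis
  define R where "R s t i = g i (s, t)" for s t i
  show thesis
  proof (rule that)
    show "vec_continuous_on m (triangle2 T) (\<lambda>(s, t). R s t)"
      unfolding vec_continuous_on_def
    proof (intro allI impI)
      fix i assume "i < m"
      then show "continuous_on (triangle2 T) (\<lambda>x. (\<lambda>(s, t). R s t) x i)"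
        using continuous_on_subset[OF g(1) dense] by (simp add: R_def split_beta')
    qed
    show "L0_2_eq T m R (sub2 (delta1 I) X)"
      unfolding L0_2_eq_def
    proof
      fix h assume h: "h \<in> {0..T}"
      have "AE r in lborel. r \<in> {0..T - h} \<longrightarrow> r \<in> mb.good \<and> r + h \<in> mb.good"
        using h by (intro AE_translate mb.AE_good) auto
      then show "AE r in lborel. r \<in> {0..T - h} \<longrightarrow> vec_eq m (R r (r + h)) (sub2 (delta1 I) X r (r + h))"
        by eventually_elim (use h in \<open>auto simp: vec_eq_def R_def g(2) good_pairs_def remainder_eq\<close>)
    qed
    have R: "vec_norm m (\<lambda>i. g i x) - C * \<bar>snd x - fst x\<bar> powr \<kappa> \<le> 0" if "x \<in> closure good_pairs" for x
    proof (rule continuous_le_on_closure[OF _ that])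
      show "continuous_on (closure good_pairs) (\<lambda>x. vec_norm m (\<lambda>i. g i x) - C * \<bar>snd x - fst x\<bar> powr \<kappa>)"
        unfolding vec_norm_def L2_set_def
        using kappa by (intro continuous_intros continuous_on_powr' g(1)) auto
      fix y assume y: "y \<in> good_pairs"
      then have "vec_norm m (\<lambda>i. g i y) = vec_norm m (E (fst y) (snd y))"
        by (intro vec_norm_cong) (simp add: g(2))
      also have "\<dots> \<le> C * (snd y - fst y) powr \<kappa>"
        using y by (intro E_good) (auto simp: good_pairs_def)
      also have "snd y - fst y = \<bar>snd y - fst y\<bar>" using y by (auto simp: good_pairs_def)
      finally show "vec_norm m (\<lambda>i. g i y) - C * \<bar>snd y - fst y\<bar> powr \<kappa> \<le> 0" by simp
    qed
    show "hoelder2_norm T m (\<gamma> - 1 / p) R \<le> ennreal C"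
      unfolding hoelder2_norm_def
    proof (intro SUP_least ennreal_leI)
      fix h r assume hr: "h \<in> {0<..T}" "r \<in> {0..T - h}"
      then have "(r, r + h) \<in> closure good_pairs" using dense by (auto simp: triangle2_def)
      from R[OF this] have "vec_norm m (R r (r + h)) \<le> C * h powr \<kappa>"
        using hr by (simp add: R_def[abs_def])
      then have "vec_norm m (R r (r + h)) * h powr (- \<kappa>) \<le> C * h powr \<kappa> * h powr (- \<kappa>)"
        by (intro mult_right_mono) auto
      also have "\<dots> = C" using hr by (simp add: powr_minus)
      finally show "vec_norm m (R r (r + h)) * h powr (- (\<gamma> - 1 / p)) \<le> C" by (simp add: \<kappa>_def)
    qed
  qed
qed

text \<open>The exponent is \<open>\<gamma> * \<theta> + (\<gamma> - 1 / p) * (1 - \<theta>)\<close>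
  with \<open>\<theta> = \<beta>2 / \<beta>1\<close>, so part of the loss \<open>1 / p\<close> in
  the supremum bound is recovered. Enlarging \<open>k3\<close> to \<open>k3 + M\<close> in the norm
  bound lets the two powers of this quantity recombine to its first power.\<close>

lemma path_norm_interpolated:
  assumes \<beta>': "\<beta>2 < \<beta>1" and h: "0 < h" "h \<le> T / 2"
  shows "path_norm m \<beta>1 (T - h) (\<lambda>r. E r (r + h))
    \<le> ennreal (interpolated_const \<gamma> \<beta>1 \<beta>2 p q2 T * h powr (\<alpha> + (\<gamma> - 1 / p - \<alpha> + \<beta>2 / (p * \<beta>1)))) * (K3 + ennreal M)"
proof -
  let ?\<theta> = "\<beta>2 / \<beta>1" and ?c = "sewn_const \<gamma> q2" and ?H = "hoelder_const \<gamma> \<beta>2 p q2 T" and ?A = "interpolation_const \<beta>2 \<beta>1"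
  have A: "1 \<le> ?A" by (rule interpolation_const(1)[OF \<beta>(2) \<beta>'])
  have c: "0 < ?c" by (rule sewn_const_pos[OF \<gamma>])
  have H: "0 < ?H" by (rule hoelder_const_pos[OF \<gamma> \<beta>(2) p T])
  define k where "k = k3 + M"
  have k: "0 < k" using k3 M by (simp add: k_def)
  have C: "C = ?H * k" by (simp add: C_def k_def)
  have ae: "AE r in lborel. r \<in> {0..T - h} \<longrightarrow> r \<in> mb.good \<and> r + h \<in> mb.good"
    using h by (intro AE_translate mb.AE_good) auto
  have "path_norm m \<beta>1 (T - h) (\<lambda>r. E r (r + h))
      \<le> ennreal ((?A * T + 1) * (2 * (?c * k * h powr \<gamma>) powr ?\<theta> * (?H * k * h powr \<kappa>) powr (1 - ?\<theta>)))"
    unfolding path_norm_def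
  proof (rule interpolation_const(2)[OF \<beta>(2) \<beta>'])
    show "emeasure lborel {0..T - h} \<le> ennreal T" using h T by (simp add: ennreal_leI)
    show "AE r in lborel. r \<in> {0..T - h} \<longrightarrow> vec_norm m (E r (r + h)) \<le> ?H * k * h powr \<kappa>"
      using ae
    proof eventually_elim
      case (elim r)
      then show ?case using E_good[of r "r + h"] h by (simp add: C)
    qed
    have "orlicz_norm \<beta>2 {0..T - h} (\<lambda>r. vec_norm m (E r (r + h))) \<le> ennreal (?c * k3 * h powr \<gamma>)"
      using E_bound'[of h h] h by (simp add: path_norm_def)
    also have "\<dots> \<le> ennreal (?c * k * h powr \<gamma>)"
      using c M by (intro ennreal_leI mult_right_mono mult_left_mono) (auto simp: k_def)
    finally show "orlicz_norm \<beta>2 {0..T - h} (\<lambda>r. vec_norm m (E r (r + h))) \<le> ennreal (?c * k * h powr \<gamma>)" .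
    show "(\<lambda>r. vec_norm m (E r (r + h))) \<in> borel_measurable borel" by measurable
  qed (use c H k h T in auto)
  also have "(?A * T + 1) * (2 * (?c * k * h powr \<gamma>) powr ?\<theta> * (?H * k * h powr \<kappa>) powr (1 - ?\<theta>))
      = interpolated_const \<gamma> \<beta>1 \<beta>2 p q2 T * h powr (\<alpha> + (\<gamma> - 1 / p - \<alpha> + \<beta>2 / (p * \<beta>1))) * k"
  proof -
    have "(?c * k * h powr \<gamma>) powr ?\<theta> * (?H * k * h powr \<kappa>) powr (1 - ?\<theta>)
        = ?c powr ?\<theta> * ?H powr (1 - ?\<theta>) * (k powr ?\<theta> * k powr (1 - ?\<theta>)) * (h powr (\<gamma> * ?\<theta>) * h powr (\<kappa> * (1 - ?\<theta>)))"
      using c H k by (simp add: powr_mult powr_powr)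
    also have "k powr ?\<theta> * k powr (1 - ?\<theta>) = k" using k by (simp add: powr_add[symmetric])
    also have "h powr (\<gamma> * ?\<theta>) * h powr (\<kappa> * (1 - ?\<theta>)) = h powr (\<alpha> + (\<gamma> - 1 / p - \<alpha> + \<beta>2 / (p * \<beta>1)))"
    proof -
      have "\<gamma> * ?\<theta> + \<kappa> * (1 - ?\<theta>) = \<alpha> + (\<gamma> - 1 / p - \<alpha> + \<beta>2 / (p * \<beta>1))"
        by (simp add: \<kappa>_def algebra_simps)
      then show ?thesis by (simp only: powr_add[symmetric])
    qed
    finally show ?thesis by (simp add: interpolated_const_def mult_ac)
  qed
  also have "ennreal (interpolated_const \<gamma> \<beta>1 \<beta>2 p q2 T * h powr (\<alpha> + (\<gamma> - 1 / p - \<alpha> + \<beta>2 / (p * \<beta>1))) * k)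
      = ennreal (interpolated_const \<gamma> \<beta>1 \<beta>2 p q2 T * h powr (\<alpha> + (\<gamma> - 1 / p - \<alpha> + \<beta>2 / (p * \<beta>1)))) * (K3 + ennreal M)"
  proof -
    have "0 \<le> interpolated_const \<gamma> \<beta>1 \<beta>2 p q2 T"
      using A T c H by (simp add: interpolated_const_def)
    moreover have "K3 + ennreal M = ennreal k" using k3 M by (simp add: k_def ennreal_plus)
    ultimately show ?thesis using k by (simp only: ennreal_mult[symmetric] mult_nonneg_nonneg powr_ge_zero less_imp_le)
  qed
  finally show ?thesis .
qed

lemma besov_seminorm_interpolated:
  fixes e :: real
  defines "e \<equiv> \<gamma> - 1 / p - \<alpha> + \<beta>2 / (p * \<beta>1)"
  assumes \<beta>': "\<beta>2 < \<beta>1" and e: "1 / p < \<gamma> - \<alpha>"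
  shows "besov_seminorm T m \<alpha> \<beta>1 (max q1 q2) I
    \<le> ennreal (2 * sum_const (max q1 q2) * max (embedding_const \<alpha> q1) (interpolated_const \<gamma> \<beta>1 \<beta>2 p q2 T * power_const e (max q1 q2)))
      * (K2 + ennreal (T powr e) * (K3 + ennreal M))"
proof -
  let ?c = "interpolated_const \<gamma> \<beta>1 \<beta>2 p q2 T"
  have e0: "0 < e" using e \<beta> p by (simp add: e_def add_pos_nonneg)
  have c: "0 \<le> ?c"
    using interpolation_const(1)[OF \<beta>(2) \<beta>'] T by (simp add: interpolated_const_def)
  have ec: "1 \<le> embedding_const \<alpha> q1" using \<alpha> by (intro embedding_const_ge_1) simp
  have pc: "0 \<le> power_const e (max q1 q2)" by (simp add: power_const_def)
  interpret seminorm_on "path_norm m \<beta>1 l" measurable_paths for l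
    by (rule path_norm_seminorm[OF \<beta>(1)])
  have "besov_seminorm T m \<alpha> \<beta>1 (max q1 q2) I
    \<le> ennreal (2 * sum_const (max q1 q2)) * (ennreal (1 * embedding_const \<alpha> q1) * K2 + ennreal (?c * power_const e (max q1 q2) * T powr e) * (K3 + ennreal M))"
  proof (rule besov_seminorm_bound[OF \<beta>(1) _ c e0])
    fix h assume h: "0 < h" "h \<le> T / 2"
    have "(\<lambda>r. D r (r + h)) = (\<lambda>r. clip2 T m X r (r + h)) + (\<lambda>r. E r (r + h))"
      by (simp add: fun_eq_iff D_eq)
    then have "path_norm m \<beta>1 (T - h) (\<lambda>r. D r (r + h))
        \<le> path_norm m \<beta>1 (T - h) (\<lambda>r. clip2 T m X r (r + h)) + path_norm m \<beta>1 (T - h) (\<lambda>r. E r (r + h))"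
      using triangle[OF X_path E_path'] by simp
    also have "\<dots> \<le> modulus2 T m \<beta>1 (clip2 T m X) h + ennreal (?c * h powr (\<alpha> + e)) * (K3 + ennreal M)"
      unfolding e_def using h by (intro add_mono path_norm_le_modulus2 path_norm_interpolated \<beta>') auto
    finally show "path_norm m \<beta>1 (T - h) (\<lambda>r. D r (r + h))
        \<le> ennreal 1 * modulus2 T m \<beta>1 X h + ennreal (?c * h powr (\<alpha> + e)) * (K3 + ennreal M)"
      by (simp add: modulus2_clip)
  qed simp
  also have "ennreal (1 * embedding_const \<alpha> q1) * K2 + ennreal (?c * power_const e (max q1 q2) * T powr e) * (K3 + ennreal M)
      = ennreal (embedding_const \<alpha> q1) * K2 + ennreal (?c * power_const e (max q1 q2)) * (ennreal (T powr e) * (K3 + ennreal M))"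
    using c pc by (simp add: ennreal_mult mult.assoc)
  also have "ennreal (2 * sum_const (max q1 q2)) * \<dots>
      \<le> ennreal (2 * sum_const (max q1 q2)) * (ennreal (max (embedding_const \<alpha> q1) (?c * power_const e (max q1 q2))) * K2
        + ennreal (max (embedding_const \<alpha> q1) (?c * power_const e (max q1 q2))) * (ennreal (T powr e) * (K3 + ennreal M)))"
    by (intro mult_left_mono add_mono mult_right_mono ennreal_leI) auto
  also have "\<dots> = ennreal (2 * sum_const (max q1 q2) * max (embedding_const \<alpha> q1) (?c * power_const e (max q1 q2)))
      * (K2 + ennreal (T powr e) * (K3 + ennreal M))"
  proof -
    have "ennreal (2 * sum_const (max q1 q2) * max (embedding_const \<alpha> q1) (?c * power_const e (max q1 q2)))
        = ennreal (2 * sum_const (max q1 q2)) * ennreal (max (embedding_const \<alpha> q1) (?c * power_const e (max q1 q2)))"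
      using ec by (intro ennreal_mult) (auto simp: sum_const_def)
    then show ?thesis by (simp only: distrib_left mult.assoc)
  qed
  finally show ?thesis .
qed

end

subsection \<open>Uniqueness\<close>

lemma continuous_eq_on_AE:
  fixes f :: "real \<Rightarrow> real"
  assumes f: "continuous_on {0..T} f" and T: "0 < T" and ae: "AE r in lborel. r \<in> {0..T} \<longrightarrow> f r = c" and t: "t \<in> {0..T}"
  shows "f t = c"
proof -
  define G where "G = {r \<in> {0..T}. f r = c}"
  have G: "AE r in lborel. r \<in> {0..T} \<longrightarrow> r \<in> G" using ae by eventually_elim (auto simp: G_def)
  have "closure G \<subseteq> {0..T}" by (rule closure_minimal) (auto simp: G_def)
  then have cl: "closure G = {0..T}" by (rule antisym[OF _ closure_of_almost_all[OF G T]])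
  show ?thesis
    by (rule continuous_constant_on_closure[of G f c t]) (use f t cl in \<open>auto simp: G_def\<close>)
qed

context sewing_parameters
begin

text \<open>Two candidates are compared through one Riemann sum, which cancels in the difference.
  The exponent \<open>\<infinity>\<close> is used because it gives a bound at each single increment
  \<open>h\<close>.\<close>

lemma path_norm_riemann_sum_diff:
  assumes X: "X \<in> L0_2 T m" and I: "I \<in> L0_1 T m" and J: "J \<in> L0_1 T m" and p: "unit_partition K p" and h: "0 < h" "h < T"
  shows "path_norm m \<beta>2 (T - h) (\<lambda>r. delta1 (clip1 T m I) r (r + h) - delta1 (clip1 T m J) r (r + h))
    \<le> ennreal (h powr \<gamma>) * (besov2_norm T m \<gamma> \<beta>2 \<infinity> (sub2 (delta1 I) (riemann_sum K p X))
        + besov2_norm T m \<gamma> \<beta>2 \<infinity> (sub2 (delta1 J) (riemann_sum K p X)))"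
proof -
  interpret seminorm_on "path_norm m \<beta>2 l" measurable_paths for l
    by (rule path_norm_seminorm[OF \<beta>(2)])
  note [measurable] = clip1_measurable[OF I] clip1_measurable[OF J] clip2_measurable'[OF X]
  define Y where "Y I r = sub2 (delta1 (clip1 T m I)) (riemann_sum K p (clip2 T m X)) r (r + h)" for I r
  have Ym: "Y I \<in> measurable_paths" if [measurable]: "\<And>i. (\<lambda>t. clip1 T m I t i) \<in> borel_measurable borel" for I
  proof -
    have "(\<lambda>r. clip1 T m I (r + h) i) \<in> borel_measurable borel" for i
      by (rule measurable_compose[OF _ that]) measurable
    then show ?thesis
      unfolding measurable_paths_def Y_def sub2_def delta1_def riemann_sum_def by measurable
  qed
  have Yle: "path_norm m \<beta>2 (T - h) (Y I) \<le> ennreal (h powr \<gamma>) * besov2_norm T m \<gamma> \<beta>2 \<infinity> (sub2 (delta1 I) (riemann_sum K p X))" for I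
  proof -
    have "path_norm m \<beta>2 (T - h) (Y I) = path_norm m \<beta>2 (T - h) (\<lambda>r. sub2 (delta1 I) (riemann_sum K p X) r (r + h))"
    proof (rule path_norm_cong_AE, intro AE_I2 impI allI)
      fix r j assume r: "r \<in> {0..T - h}" and j: "j < m"
      have "(\<Sum>i<K. clip2 T m X (r + p i * h) (r + p (Suc i) * h) j) = (\<Sum>i<K. X (r + p i * h) (r + p (Suc i) * h) j)"
      proof (intro sum.cong refl)
        fix i assume "i \<in> {..<K}"
        then have i: "i \<le> K" "Suc i \<le> K" "p i < p (Suc i)" using p by (auto simp: unit_partition_def)
        have "0 \<le> p i * h" "p i * h \<le> p (Suc i) * h" "p (Suc i) * h \<le> 1 * h"
          using unit_partition_bounds[OF p i(1)] unit_partition_bounds[OF p i(2)] i(3) h by (auto intro: mult_right_mono)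
        then show "clip2 T m X (r + p i * h) (r + p (Suc i) * h) j = X (r + p i * h) (r + p (Suc i) * h) j"
          using r j by (simp add: clip2_def)
      qed
      then show "Y I r j = sub2 (delta1 I) (riemann_sum K p X) r (r + h) j"
        using r j h by (simp add: Y_def sub2_def delta1_def riemann_sum_def clip1_def)
    qed
    also have "\<dots> \<le> modulus2 T m \<beta>2 (sub2 (delta1 I) (riemann_sum K p X)) h"
      using h by (intro path_norm_le_modulus2) auto
    also have "\<dots> \<le> ennreal (h powr \<gamma>) * besov2_norm T m \<gamma> \<beta>2 \<infinity> (sub2 (delta1 I) (riemann_sum K p X))"
      unfolding besov2_norm_def using \<gamma> h by (intro Lq_log_norm_top_pointwise mono_modulus2) auto
    finally show ?thesis .
  qed
  have "(\<lambda>r. delta1 (clip1 T m I) r (r + h) - delta1 (clip1 T m J) r (r + h)) = Y I - Y J"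
    by (simp add: fun_eq_iff Y_def sub2_def)
  then have "path_norm m \<beta>2 (T - h) (\<lambda>r. delta1 (clip1 T m I) r (r + h) - delta1 (clip1 T m J) r (r + h))
      \<le> path_norm m \<beta>2 (T - h) (Y I) + path_norm m \<beta>2 (T - h) (Y J)"
    using triangle_diff[OF Ym Ym] clip1_measurable[OF I] clip1_measurable[OF J] by simp
  also have "\<dots> \<le> ennreal (h powr \<gamma>) * besov2_norm T m \<gamma> \<beta>2 \<infinity> (sub2 (delta1 I) (riemann_sum K p X))
      + ennreal (h powr \<gamma>) * besov2_norm T m \<gamma> \<beta>2 \<infinity> (sub2 (delta1 J) (riemann_sum K p X))"
    by (intro add_mono Yle)
  finally show ?thesis by (simp only: distrib_left)
qed

lemma continuous_L0_1: "vec_continuous_on m {0..T} I \<Longrightarrow> I \<in> L0_1 T m"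
  by (auto simp: L0_1_def vec_continuous_on_def vec_measurable_on_def intro: borel_measurable_continuous_on_restrict)

text \<open>Vanishing of the compared norms identifies the increments over \<open>h\<close> at
  almost every starting point. Continuity extends this to the starting point \<open>0\<close>, where
  the two paths agree.\<close>

lemma sewing_limit_unique:
  assumes X: "X \<in> L0_2 T m" and cont: "vec_continuous_on m {0..T} I" "vec_continuous_on m {0..T} J"
    and init: "vec_eq m (I 0) (J 0)" and lim: "sewing_limit T m \<gamma> \<beta>2 q2 X I" "sewing_limit T m \<gamma> \<beta>2 q2 X J"
    and t: "t \<in> {0..T}"
  shows "vec_eq m (I t) (J t)"
  unfolding vec_eq_def
proof (intro allI impI)
  fix i assume i: "i < m"
  have IJ: "I \<in> L0_1 T m" "J \<in> L0_1 T m" using cont by (auto intro: continuous_L0_1)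
  define p where "p N j = real j / real (Suc N)" for N j
  have p: "unit_partition (Suc N) (p N)" for N
    by (auto simp: unit_partition_def p_def divide_strict_right_mono)
  have "partition_mesh (Suc N) (p N) = inverse (real (Suc N))" for N
  proof -
    have "(\<lambda>j. p N (Suc j) - p N j) ` {..<Suc N} = {inverse (real (Suc N))}"
      by (auto simp: p_def field_simps)
    then show ?thesis by (simp add: partition_mesh_def)
  qed
  then have mesh: "(\<lambda>N. partition_mesh (Suc N) (p N)) \<longlonglongrightarrow> 0"
    using LIMSEQ_inverse_real_of_nat by simp
  \<comment> \<open>The exponent \<open>r = \<infinity>\<close> satisfies both conditions of the
    limit statement for every \<open>q2\<close> and \<open>\<gamma>\<close>.\<close>
  have conv: "(\<lambda>N. besov2_norm T m \<gamma> \<beta>2 \<infinity> (sub2 (delta1 Z) (riemann_sum (Suc N) (p N) X))) \<longlonglongrightarrow> 0"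
    if "sewing_limit T m \<gamma> \<beta>2 q2 X Z" for Z
    using that[unfolded sewing_limit_def, rule_format, of "Suc" p \<infinity>] p mesh by simp
  have inc: "I h i - J h i = I 0 i - J 0 i" if h: "0 < h" "h < T" for h
  proof -
    let ?Z = "\<lambda>r. delta1 (clip1 T m I) r (r + h) - delta1 (clip1 T m J) r (r + h)"
    have "(\<lambda>N. ennreal (h powr \<gamma>) * (besov2_norm T m \<gamma> \<beta>2 \<infinity> (sub2 (delta1 I) (riemann_sum (Suc N) (p N) X))
        + besov2_norm T m \<gamma> \<beta>2 \<infinity> (sub2 (delta1 J) (riemann_sum (Suc N) (p N) X)))) \<longlonglongrightarrow> ennreal (h powr \<gamma>) * (0 + 0)"
      by (intro ennreal_tendsto_cmult tendsto_add conv lim) simp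
    then have "path_norm m \<beta>2 (T - h) ?Z \<le> ennreal (h powr \<gamma>) * (0 + 0)"
      by (rule LIMSEQ_le_const) (intro exI[of _ 0] allI impI path_norm_riemann_sum_diff X IJ p h)
    then have 0: "path_norm m \<beta>2 (T - h) ?Z = 0" by simp
    have "(\<lambda>r. clip1 T m Z (r + h) j) \<in> borel_measurable borel" if "Z \<in> L0_1 T m" for Z j
      by (rule measurable_compose[OF _ clip1_measurable[OF that]]) measurable
    with IJ clip1_measurable[OF IJ(1)] clip1_measurable[OF IJ(2)] have "?Z \<in> measurable_paths"
      unfolding measurable_paths_def delta1_def by simp
    from path_norm_eq_0D[OF \<beta>(2) this 0]
    have ae: "AE r in lborel. r \<in> {0..T - h} \<longrightarrow> (I (r + h) i - I r i) - (J (r + h) i - J r i) = 0"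
      by eventually_elim (use i h in \<open>auto simp: delta1_def clip1_def\<close>)
    have cI: "continuous_on {0..T} (\<lambda>t. I t i)" "continuous_on {0..T} (\<lambda>t. J t i)"
      using cont i by (auto simp: vec_continuous_on_def)
    have sh: "continuous_on {0..T - h} (\<lambda>r. Z (r + h))" "continuous_on {0..T - h} Z" if "continuous_on {0..T} Z" for Z :: "real \<Rightarrow> real"
    proof -
      show "continuous_on {0..T - h} (\<lambda>r. Z (r + h))"
        by (rule continuous_on_compose2[OF that]) (use h in \<open>auto intro!: continuous_intros\<close>)
      show "continuous_on {0..T - h} Z"
        by (rule continuous_on_subset[OF that]) (use h in auto)
    qed
    have "(I (0 + h) i - I 0 i) - (J (0 + h) i - J 0 i) = 0"
    proof (rule continuous_eq_on_AE[OF _ _ ae])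
      show "continuous_on {0..T - h} (\<lambda>r. (I (r + h) i - I r i) - (J (r + h) i - J r i))"
        by (intro continuous_on_diff sh(1)[OF cI(1)] sh(1)[OF cI(2)] sh(2)[OF cI(1)] sh(2)[OF cI(2)])
    qed (use h in auto)
    then show ?thesis by simp
  qed
  have "I t i - J t i = 0"
  proof (rule continuous_eq_on_AE[OF _ T _ t, where f = "\<lambda>t. I t i - J t i"])
    show "continuous_on {0..T} (\<lambda>t. I t i - J t i)"
      using cont i by (auto simp: vec_continuous_on_def intro: continuous_on_diff)
    show "AE r in lborel. r \<in> {0..T} \<longrightarrow> I r i - J r i = 0"
      using AE_lborel_singleton[of 0] AE_lborel_singleton[of T]
    proof eventually_elim
      case (elim r)
      then show ?case using inc[of r] init i by (auto simp: vec_eq_def)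
    qed
  qed
  then show "I t i = J t i" by simp
qed

end

section \<open>Constants as functions of the parameters and assembly of the statement\<close>

definition seminorm_const :: "real \<Rightarrow> real \<Rightarrow> real \<Rightarrow> real \<Rightarrow> ennreal \<Rightarrow> ennreal \<Rightarrow> real \<Rightarrow> real" where
  "seminorm_const \<alpha> \<gamma> \<beta>1 \<beta>2 q1 q2 T = 2 * sum_const (max q1 q2) * max (compare_factor (min \<beta>1 \<beta>2) \<beta>1 T * embedding_const \<alpha> q1)
     (compare_factor (min \<beta>1 \<beta>2) \<beta>2 T * sewn_const \<gamma> q2 * power_const (\<gamma> - \<alpha>) (max q1 q2) * T powr (\<gamma> - \<alpha>))"

definition refined_const :: "real \<Rightarrow> real \<Rightarrow> real \<Rightarrow> real \<Rightarrow> real \<Rightarrow> ennreal \<Rightarrow> ennreal \<Rightarrow> real \<Rightarrow> real" where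
  "refined_const \<alpha> \<gamma> \<beta>1 \<beta>2 p q1 q2 T = 2 * sum_const (max q1 q2) *
     max (embedding_const \<alpha> q1) (interpolated_const \<gamma> \<beta>1 \<beta>2 p q2 T * power_const (\<gamma> - 1 / p - \<alpha> + \<beta>2 / (p * \<beta>1)) (max q1 q2))"

lemma refined_const_mono:
  assumes "1 < \<gamma>" "0 < \<beta>2" "\<beta>2 < \<beta>1" "1 \<le> p" "0 < T" "T \<le> T'"
  shows "refined_const \<alpha> \<gamma> \<beta>1 \<beta>2 p q1 q2 T \<le> refined_const \<alpha> \<gamma> \<beta>1 \<beta>2 p q1 q2 T'"
  unfolding refined_const_def
  by (intro mult_left_mono max.mono mult_right_mono interpolated_const_mono assms order_refl)
    (simp_all add: power_const_def sum_const_def)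

context sewing_parameters
begin

lemma sewn_self: "X \<in> sewing_domain T m \<alpha> \<gamma> \<beta>1 \<beta>2 q1 q2 \<Longrightarrow> sewn T m \<alpha> \<gamma> \<beta>1 \<beta>2 q1 q2 X (sew T (clip2 T m X))"
  by (intro sewn_sew sew_L0_1) (simp_all add: L0_1_eq_def vec_eq_def)

lemma sewn_continuous:
  assumes X: "X \<in> sewing_domain T m \<alpha> \<gamma> \<beta>1 \<beta>2 q1 q2"
  obtains I where "vec_continuous_on m {0..T} I" "L0_1_eq T m I (sew T (clip2 T m X))" "sewn T m \<alpha> \<gamma> \<beta>1 \<beta>2 q1 q2 X I"
proof -
  interpret sewn T m \<alpha> \<gamma> \<beta>1 \<beta>2 q1 q2 X "sew T (clip2 T m X)" by (rule sewn_self[OF X])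
  obtain I where "vec_continuous_on m {0..T} I" "L0_1_eq T m I (sew T (clip2 T m X))" "I \<in> L0_1 T m"
    by (rule continuous_sewn)
  then show thesis by (intro that sewn_sew X)
qed

text \<open>The prescribed initial value is reached by adding a constant vector to a continuous
  version, which leaves all increments, and so the limit and the remainder, unchanged.\<close>

lemma sewing_existence:
  assumes X: "X \<in> sewing_domain T m \<alpha> \<gamma> \<beta>1 \<beta>2 q1 q2"
  obtains I where "vec_continuous_on m {0..T} I" "vec_eq m (I 0) \<Theta>" "sewing_limit T m \<gamma> \<beta>2 q2 X I"
    "besov2_norm T m \<gamma> \<beta>2 q2 (sub2 (delta1 I) X) \<le> ennreal (hardy_const \<gamma> q2) * besov3_norm T m \<gamma> \<beta>2 q2 (delta2 X)"
proof -
  obtain J where J: "vec_continuous_on m {0..T} J" "sewn T m \<alpha> \<gamma> \<beta>1 \<beta>2 q1 q2 X J" by (rule sewn_continuous[OF X])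
  interpret sewn T m \<alpha> \<gamma> \<beta>1 \<beta>2 q1 q2 X J by fact
  define I where "I t i = J t i - J 0 i + \<Theta> i" for t i
  have d: "delta1 I = delta1 J" by (simp add: delta1_def I_def fun_eq_iff)
  show thesis
  proof (rule that)
    show "vec_continuous_on m {0..T} I"
      using J(1) unfolding vec_continuous_on_def I_def
      by (intro allI impI continuous_on_add continuous_on_diff continuous_on_const) auto
    show "vec_eq m (I 0) \<Theta>" by (simp add: vec_eq_def I_def)
    show "sewing_limit T m \<gamma> \<beta>2 q2 X I" using sewing_limit unfolding sewing_limit_def d .
    show "besov2_norm T m \<gamma> \<beta>2 q2 (sub2 (delta1 I) X) \<le> ennreal (hardy_const \<gamma> q2) * besov3_norm T m \<gamma> \<beta>2 q2 (delta2 X)"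
      unfolding d by (rule besov_remainder[unfolded K3_def])
  qed
qed

text \<open>As \<open>\<alpha> < 1\<close>, the first entry of the maximum forces
  \<open>p \<ge> 1\<close>, which the mean bound asks for. The second entry makes
  \<open>\<gamma> - 1 / p - \<alpha>\<close> positive, so the interpolated remainder has a surplus
  power over \<open>\<alpha>\<close>.\<close>

lemma sewing_refined:
  assumes sewn: "sewn T m \<alpha> \<gamma> \<beta>1 \<beta>2 q1 q2 X I"
    and \<rho>: "0 < \<rho>" "\<rho> \<le> 1 / 2" and M: "0 < M" and bound: "pointwise_bound T m \<rho> M (\<gamma> - 1 / p) X"
    and b: "\<beta>2 < \<beta>1" and large: "max (1 / \<alpha>) (1 / (\<gamma> - \<alpha>)) < p"
  shows "1 \<le> p"
    "\<exists>R. vec_continuous_on m (triangle2 T) (\<lambda>(s, t). R s t) \<and> L0_2_eq T m R (sub2 (delta1 I) X) \<and>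
       hoelder2_norm T m (\<gamma> - 1 / p) R
         \<le> ennreal (hoelder_const \<gamma> \<beta>2 p q2 T) * (besov3_norm T m \<gamma> \<beta>2 q2 (delta2 X) + ennreal M)"
    "besov_seminorm T m \<alpha> \<beta>1 (max q1 q2) I
       \<le> ennreal (refined_const \<alpha> \<gamma> \<beta>1 \<beta>2 p q1 q2 T) *
         (besov2_norm T m \<alpha> \<beta>1 q1 X
           + ennreal (T powr (\<gamma> - 1 / p - \<alpha> + \<beta>2 / (p * \<beta>1))) * (besov3_norm T m \<gamma> \<beta>2 q2 (delta2 X) + ennreal M))"
proof -
  have "1 \<le> 1 / \<alpha>" using \<alpha> by simp
  then show p1: "1 \<le> p" using large by simp
  interpret sewn T m \<alpha> \<gamma> \<beta>1 \<beta>2 q1 q2 X I by fact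
  interpret pointwise_sewn T m \<alpha> \<gamma> \<beta>1 \<beta>2 q1 q2 X I \<rho> M p
    by unfold_locales (use \<rho> M bound p1 in auto)
  obtain R where R: "vec_continuous_on m (triangle2 T) (\<lambda>(s, t). R s t)" "L0_2_eq T m R (sub2 (delta1 I) X)"
    "hoelder2_norm T m (\<gamma> - 1 / p) R \<le> ennreal C"
    by (rule remainder_version)
  have "ennreal C = ennreal (hoelder_const \<gamma> \<beta>2 p q2 T) * (besov3_norm T m \<gamma> \<beta>2 q2 (delta2 X) + ennreal M)"
    using k3[unfolded K3_def] M hoelder_const_pos[OF \<gamma> \<beta>(2) p1 T, of q2] by (simp add: C_def ennreal_mult ennreal_plus)
  with R show "\<exists>R. vec_continuous_on m (triangle2 T) (\<lambda>(s, t). R s t) \<and> L0_2_eq T m R (sub2 (delta1 I) X) \<and>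
       hoelder2_norm T m (\<gamma> - 1 / p) R
         \<le> ennreal (hoelder_const \<gamma> \<beta>2 p q2 T) * (besov3_norm T m \<gamma> \<beta>2 q2 (delta2 X) + ennreal M)"
    by (intro exI[of _ R]) simp
  have "0 < \<gamma> - \<alpha>" "1 / (\<gamma> - \<alpha>) < p" using \<alpha> \<gamma> large by auto
  then have "1 < p * (\<gamma> - \<alpha>)" by (simp only: pos_divide_less_eq)
  then have "1 / p < \<gamma> - \<alpha>"
    using p1 by (simp add: pos_divide_less_eq mult.commute)
  then show "besov_seminorm T m \<alpha> \<beta>1 (max q1 q2) I
       \<le> ennreal (refined_const \<alpha> \<gamma> \<beta>1 \<beta>2 p q1 q2 T) *
         (besov2_norm T m \<alpha> \<beta>1 q1 X
           + ennreal (T powr (\<gamma> - 1 / p - \<alpha> + \<beta>2 / (p * \<beta>1))) * (besov3_norm T m \<gamma> \<beta>2 q2 (delta2 X) + ennreal M))"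
    unfolding refined_const_def by (rule besov_seminorm_interpolated[unfolded K3_def, OF b])
qed

end

theorem theorem4p11:
  "\<exists>(C1 :: real \<Rightarrow> ennreal \<Rightarrow> real)
     (C2 :: real \<Rightarrow> real \<Rightarrow> real \<Rightarrow> real \<Rightarrow> real \<Rightarrow> ennreal \<Rightarrow> ennreal \<Rightarrow> real \<Rightarrow> real)
     (C3 :: real \<Rightarrow> real \<Rightarrow> real \<Rightarrow> ennreal \<Rightarrow> real \<Rightarrow> real \<Rightarrow> real)
     (C4 :: real \<Rightarrow> real \<Rightarrow> real \<Rightarrow> real \<Rightarrow> real \<Rightarrow> ennreal \<Rightarrow> ennreal \<Rightarrow> real \<Rightarrow> real \<Rightarrow> real).
     (\<forall>\<gamma> \<beta>2 p q2 \<rho>. mono_on {0<..} (C3 \<gamma> \<beta>2 p q2 \<rho>)) \<and>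
     (\<forall>\<alpha> \<gamma> \<beta>1 \<beta>2 p q1 q2 \<rho>. mono_on {0<..} (C4 \<alpha> \<gamma> \<beta>1 \<beta>2 p q1 q2 \<rho>)) \<and>
     (\<forall>(T::real) (m::nat) (\<alpha>::real) (\<gamma>::real) (\<beta>1::real) (\<beta>2::real) (q1::ennreal) (q2::ennreal).
        0 < T \<longrightarrow> 0 < m \<longrightarrow> 0 < \<alpha> \<longrightarrow> \<alpha> < 1 \<longrightarrow> 1 < \<gamma> \<longrightarrow> 0 < \<beta>1 \<longrightarrow> 0 < \<beta>2 \<longrightarrow> 0 < q1 \<longrightarrow> 0 < q2 \<longrightarrow>
        (\<exists>J. linear_on_classes T m (sewing_domain T m \<alpha> \<gamma> \<beta>1 \<beta>2 q1 q2) J \<and>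
          (\<forall>\<Xi>\<in>sewing_domain T m \<alpha> \<gamma> \<beta>1 \<beta>2 q1 q2.
             sewing_limit T m \<gamma> \<beta>2 q2 \<Xi> (J \<Xi>) \<and>
             besov2_norm T m \<gamma> \<beta>2 q2 (sub2 (delta1 (J \<Xi>)) \<Xi>)
               \<le> ennreal (C1 \<gamma> q2) * besov3_norm T m \<gamma> \<beta>2 q2 (delta2 \<Xi>) \<and>
             (\<forall>\<rho> M p. 0 < \<rho> \<longrightarrow> \<rho> \<le> 1 / 2 \<longrightarrow> 0 < M \<longrightarrow> 1 / \<gamma> < p \<longrightarrow>
                pointwise_bound T m \<rho> M (\<gamma> - 1 / p) \<Xi> \<longrightarrow>
                (\<exists>I. vec_continuous_on m {0..T} I \<and> L0_1_eq T m I (J \<Xi>) \<and>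
                   besov_seminorm T m \<alpha> (min \<beta>1 \<beta>2) (max q1 q2) I
                     \<le> ennreal (C2 \<alpha> \<gamma> \<beta>1 \<beta>2 p q1 q2 T) *
                        (besov2_norm T m \<alpha> \<beta>1 q1 \<Xi> + besov3_norm T m \<gamma> \<beta>2 q2 (delta2 \<Xi>) + ennreal M) \<and>
                   (\<beta>2 < \<beta>1 \<longrightarrow> max (1 / \<alpha>) (1 / (\<gamma> - \<alpha>)) < p \<longrightarrow>
                      (\<exists>R. vec_continuous_on m (triangle2 T) (\<lambda>(s, t). R s t) \<and>
                           L0_2_eq T m R (sub2 (delta1 I) \<Xi>) \<and>
                           hoelder2_norm T m (\<gamma> - 1 / p) R
                             \<le> ennreal (C3 \<gamma> \<beta>2 p q2 \<rho> T) *
                                (besov3_norm T m \<gamma> \<beta>2 q2 (delta2 \<Xi>) + ennreal M)) \<and>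
                      besov_seminorm T m \<alpha> \<beta>1 (max q1 q2) I
                        \<le> ennreal (C4 \<alpha> \<gamma> \<beta>1 \<beta>2 p q1 q2 \<rho> T) *
                           (besov2_norm T m \<alpha> \<beta>1 q1 \<Xi>
                            + ennreal (T powr (\<gamma> - 1 / p - \<alpha> + \<beta>2 / (p * \<beta>1))) *
                              (besov3_norm T m \<gamma> \<beta>2 q2 (delta2 \<Xi>) + ennreal M)
                            + ennreal (T powr (- (1 / p)) * M)))) \<and>
                (\<forall>\<Theta> :: nat \<Rightarrow> real.
                   let sews = (\<lambda>I. vec_continuous_on m {0..T} I \<and> vec_eq m (I 0) \<Theta> \<and>
                         sewing_limit T m \<gamma> \<beta>2 q2 \<Xi> I \<and>
                         besov2_norm T m \<gamma> \<beta>2 q2 (sub2 (delta1 I) \<Xi>)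
                           \<le> ennreal (C1 \<gamma> q2) * besov3_norm T m \<gamma> \<beta>2 q2 (delta2 \<Xi>))
                   in (\<exists>I. sews I) \<and>
                      (\<forall>I I'. sews I \<longrightarrow> sews I' \<longrightarrow> (\<forall>t\<in>{0..T}. vec_eq m (I t) (I' t))))))))"
proof -
  \<comment> \<open>Monotonicity in \<open>T\<close> is demanded for all parameter values, hence the value \<open>0\<close> outside the
    range of the estimates.\<close>
  let ?C3 = "\<lambda>\<gamma> \<beta>2 p q2 (\<rho> :: real) T. if 1 < \<gamma> \<and> 0 < \<beta>2 \<and> 1 \<le> p then hoelder_const \<gamma> \<beta>2 p q2 T else 0"
  let ?C4 = "\<lambda>\<alpha> \<gamma> \<beta>1 \<beta>2 p q1 q2 (\<rho> :: real) T.
    if 1 < \<gamma> \<and> 0 < \<beta>2 \<and> \<beta>2 < \<beta>1 \<and> 1 \<le> p then refined_const \<alpha> \<gamma> \<beta>1 \<beta>2 p q1 q2 T else 0"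
  show ?thesis
  proof (rule exI[of _ hardy_const], rule exI[of _ "\<lambda>\<alpha> \<gamma> \<beta>1 \<beta>2 p q1 q2 T. seminorm_const \<alpha> \<gamma> \<beta>1 \<beta>2 q1 q2 T"],
      rule exI[of _ ?C3], rule exI[of _ ?C4], intro conjI allI impI, goal_cases)
    case 1
    show ?case by (auto intro!: mono_onI hoelder_const_mono)
  next
    case 2
    show ?case by (auto intro!: mono_onI refined_const_mono)
  next
    case (3 T m \<alpha> \<gamma> \<beta>1 \<beta>2 q1 q2)
    then interpret sewing_parameters T m \<alpha> \<gamma> \<beta>1 \<beta>2 q1 q2 by unfold_locales
    show ?case
    proof (rule exI[of _ "\<lambda>X. sew T (clip2 T m X)"], intro conjI sew_linear ballI allI impI, goal_cases)
      case (1 X)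
      then show ?case by (rule sewn.sewing_limit[OF sewn_self])
    next
      case (2 X)
      interpret sewn T m \<alpha> \<gamma> \<beta>1 \<beta>2 q1 q2 X "sew T (clip2 T m X)" by (rule sewn_self[OF 2])
      show ?case by (rule besov_remainder[unfolded K3_def])
    next
      case (3 X \<rho> M p)
      \<comment> \<open>One continuous version is fixed here and serves all the bounds, as the
        statement asks for a single path.\<close>
      obtain I where I: "vec_continuous_on m {0..T} I" "L0_1_eq T m I (sew T (clip2 T m X))" "sewn T m \<alpha> \<gamma> \<beta>1 \<beta>2 q1 q2 X I"
        by (rule sewn_continuous[OF 3(1)])
      show ?case
      proof (intro exI[of _ I] conjI I(1,2) impI, goal_cases)
        case 1
        interpret sewn T m \<alpha> \<gamma> \<beta>1 \<beta>2 q1 q2 X I by (rule I(3))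
        show ?case
          by (rule order_trans[OF besov_seminorm_sewn[unfolded K3_def, folded seminorm_const_def]], rule mult_left_mono) auto
      next
        case 2
        note refined = sewing_refined[OF I(3) 3(2-4,6) 2]
        show ?case using refined(1,2) 2(1) \<gamma> \<beta> by simp
      next
        case 4: 3
        note refined = sewing_refined[OF I(3) 3(2-4,6) 4]
        have "?C4 \<alpha> \<gamma> \<beta>1 \<beta>2 p q1 q2 \<rho> T = refined_const \<alpha> \<gamma> \<beta>1 \<beta>2 p q1 q2 T" using refined(1) 4(1) \<gamma> \<beta> by simp
        then show ?case by (simp only:) (rule order_trans[OF refined(3)], rule mult_left_mono, auto)
      qed
    next
      case (4 X \<rho> M p \<Theta>)
      obtain J where "vec_continuous_on m {0..T} J" "vec_eq m (J 0) \<Theta>" "sewing_limit T m \<gamma> \<beta>2 q2 X J"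
        "besov2_norm T m \<gamma> \<beta>2 q2 (sub2 (delta1 J) X) \<le> ennreal (hardy_const \<gamma> q2) * besov3_norm T m \<gamma> \<beta>2 q2 (delta2 X)"
        by (rule sewing_existence[OF 4(1)])
      moreover have "vec_eq m (J t) (J' t)"
        if "vec_continuous_on m {0..T} J" "vec_eq m (J 0) \<Theta>" "sewing_limit T m \<gamma> \<beta>2 q2 X J"
          "vec_continuous_on m {0..T} J'" "vec_eq m (J' 0) \<Theta>" "sewing_limit T m \<gamma> \<beta>2 q2 X J'" "t \<in> {0..T}" for J J' t
      proof (rule sewing_limit_unique[OF _ that(1,4) _ that(3,6,7)])
        show "X \<in> L0_2 T m" using 4(1) by (simp add: sewing_domain_def besov2_def)
        show "vec_eq m (J 0) (J' 0)" using that(2,5) by (simp add: vec_eq_def)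
      qed
      ultimately show ?case
        unfolding Let_def by blast
    qed
  qed
qed

end
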